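(* Assume $\alpha'(0)=\alpha''(0)=0$. Let $u_0,\bar u_0\in\check H^2(\Omega)$ and $f\in W^{1,1}(0,T;L^2(\Omega))$ be such that the solution $u$ of the variable-exponent fractional diffusion-wave problem $$\int_0^t k(t-s)\,\partial_s^2u(\boldsymbol x,s)\,ds-\kappa A u(\boldsymbol x,t)=f(\boldsymbol x,t)\ \text{ in }\Omega\times(0,T],\qquad k(t)=\frac{t^{1-\alpha(t)}}{\Gamma(2-\alpha(t))},$$ $$u(\cdot,0)=u_0,\quad \partial_tu(\cdot,0)=\bar u_0,\qquad u=0\text{ on }\partial\Omega\times[0,T],$$ satisfies, for some constant $Q_0$, $\|\partial_t^{n+1}u(t)\|_{\check H^{2m}}\le Q_0t^{\alpha_0-(n+1)}$ for $t\in(0,T]$, $n=1,2$, $m=0,1$. Let $U^0=u_0$ and let $U^1,\dots,U^N$ (with zero boundary values on $\partial\Omega$) satisfy, for $1\le n\le N$, $$\delta_tU^n+\frac1\tau\Big[w_0U^{n-\frac12}-\sum_{k=1}^{n-1}(w_{k-1}-w_k)U^{n-k-\frac12}-w_{n-1}U^0\Big]-\kappa I_{\bar\alpha}^{n-1/2}(AU)=\bar F^n.$$ Then there is a constant $Q>0$, independent of $\tau$, $N$ and $m$, such that $$\|u(t_m)-U^m\|\le Q\,\tau^2,\qquad 1\le m\le N.$$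
   Context: Standing setting: $T>0$, $\kappa>0$, $1\le d\le 3$; $\Omega\subset\mathbb R^d$ is a simply-connected bounded domain with piecewise smooth boundary with convex corners; $A$ is the Laplacian with zero Dirichlet boundary condition, with eigenpairs $-A\phi_i=\lambda_i\phi_i$; $\check H^s(\Omega):=\{q\in L^2(\Omega):\|q\|_{\check H^s}^2:=\sum_i\lambda_i^s(q,\phi_i)^2<\infty\}$, so $\check H^0=L^2(\Omega)$ and $\check H^2(\Omega)=H^2(\Omega)\cap H_0^1(\Omega)$; $\|\cdot\|$ is the $L^2(\Omega)$ norm. $\alpha:[0,T]\to(1,2)$ is three times differentiable with $|\alpha'(t)|+|\alpha''(t)|+|\alpha'''(t)|\le L$ for some $L>0$; $\alpha_0:=\alpha(0)$, $\bar\alpha:=\alpha_0-1\in(0,1)$. $\beta_\mu(t):=t^{\mu-1}/\Gamma(\mu)$. The solution $u$ is the unique one in $W^{2,p}(0,T;L^2(\Omega))\cap L^p(0,T;\check H^2(\Omega))$ with $1<p<\frac1{2-\alpha_0}$. Define $$g(t):=\int_0^1\frac{(tz)^{\alpha(0)-\alpha(tz)}}{\Gamma(\alpha(0)-1)\Gamma(2-\alpha(tz))}(1-z)^{\alpha(0)-2}z^{1-\alpha(0)}\,dz,\qquad g(0)=1$$ (so $g$ is the time convolution of $\beta_{\alpha_0-1}$ and $k$), and $$\bar f(t):=\int_0^t\beta_{\bar\alpha}(t-s)f(s)\,ds+g(t)\bar u_0,\qquad \bar F^n:=\frac1\tau\int_{t_{n-1}}^{t_n}\bar f(t)\,dt.$$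 Time grid: $N$ is a positive integer, $\tau=T/N$, $t_n=n\tau$; $\delta_tv^n=(v^n-v^{n-1})/\tau$ and $v^{n-1/2}=(v^n+v^{n-1})/2$ for $1\le n\le N$. Weights: $w_k=g(t_{k+1})-g(t_k)$ for $k\ge0$. The averaged product-integration rule is $$I_{\bar\alpha}^{n-1/2}(\varphi)=\omega_{n,1}\varphi^1+\sum_{j=2}^n\omega_{n,j}\varphi^{j-1/2},\qquad \omega_{n,j}=\frac1\tau\int_{t_{n-1}}^{t_n}\int_{t_{j-1}}^{\min(t,t_j)}\beta_{\bar\alpha}(t-s)\,ds\,dt,\quad 1\le j\le n,$$ and $I_{\bar\alpha}^{n-1/2}(AU)$ means this with $\varphi^j=AU^j$. *)

theory Defs
  imports "HOL-Analysis.Analysis"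
begin

text \<open>
  The Hilbert space \<open>L\<^sup>2(\<real>\<^sup>d)\<close> of square-integrable functions modulo equality almost everywhere. It is
  built as a type so that the Bochner integral and the derivatives of \<open>L\<^sup>2\<close>-valued functions of time are
  the ones of the library; this requires completeness and separability, which are proved below.
\<close>

definition square_integrable :: "('a::euclidean_space \<Rightarrow> real) \<Rightarrow> bool" where
  "square_integrable f \<longleftrightarrow> f \<in> borel_measurable lebesgue \<and> integrable lebesgue (\<lambda>x. (f x)\<^sup>2)"

lemma square_integrable_prod:
  assumes "square_integrable f" "square_integrable g"
  shows "integrable lebesgue (\<lambda>x. f x * g x)"
proof -
  have [measurable]: "f \<in> borel_measurable lebesgue" "g \<in> borel_measurable lebesgue"
    using assms by (auto simp: square_integrable_def)
  have i: "integrable lebesgue (\<lambda>x. (f x)\<^sup>2 + (g x)\<^sup>2)"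
    using assms by (auto simp: square_integrable_def)
  show ?thesis
  proof (rule Bochner_Integration.integrable_bound[OF i])
    show "AE x in lebesgue. norm (f x * g x) \<le> norm ((f x)\<^sup>2 + (g x)\<^sup>2)"
    proof (rule AE_I2)
      fix x
      have "2 * (\<bar>f x\<bar> * \<bar>g x\<bar>) \<le> (f x)\<^sup>2 + (g x)\<^sup>2"
        using sum_squares_bound[of "\<bar>f x\<bar>" "\<bar>g x\<bar>"] by (simp add: mult.assoc)
      moreover have "0 \<le> \<bar>f x\<bar> * \<bar>g x\<bar>" by simp
      ultimately have "\<bar>f x\<bar> * \<bar>g x\<bar> \<le> (f x)\<^sup>2 + (g x)\<^sup>2" by linarith
      then show "norm (f x * g x) \<le> norm ((f x)\<^sup>2 + (g x)\<^sup>2)"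
        by (simp add: abs_mult)
    qed
  qed measurable
qed

lemma square_integrable_add:
  assumes "square_integrable f" "square_integrable g"
  shows "square_integrable (\<lambda>x. f x + g x)"
proof -
  have "integrable lebesgue (\<lambda>x. (f x)\<^sup>2 + (g x)\<^sup>2 + 2 * (f x * g x))"
    using assms square_integrable_prod[OF assms] by (auto simp: square_integrable_def)
  then show ?thesis
    using assms by (auto simp: square_integrable_def power2_sum mult.assoc)
qed

lemma square_integrable_scale:
  assumes "square_integrable f"
  shows "square_integrable (\<lambda>x. c * f x)"
  using assms by (auto simp: square_integrable_def power_mult_distrib)

lemma square_integrable_zero: "square_integrable (\<lambda>x. 0)"
  by (simp add: square_integrable_def)

lemma square_integrable_uminus:
  assumes "square_integrable f"
  shows "square_integrable (\<lambda>x. - f x)"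
  using square_integrable_scale[OF assms, of "-1"] by simp

lemma square_integrable_bound:
  assumes g: "square_integrable g" and f: "f \<in> borel_measurable lebesgue" and le: "\<And>x. \<bar>f x\<bar> \<le> \<bar>g x\<bar>"
  shows "square_integrable f"
proof -
  have "integrable lebesgue (\<lambda>x. (g x)\<^sup>2)" using g by (simp add: square_integrable_def)
  then have "integrable lebesgue (\<lambda>x. (f x)\<^sup>2)"
  proof (rule Bochner_Integration.integrable_bound)
    show "AE x in lebesgue. norm ((f x)\<^sup>2) \<le> norm ((g x)\<^sup>2)"
      using le by (intro AE_I2) (simp add: abs_le_square_iff)
  qed (use f in measurable)
  then show ?thesis using f by (simp add: square_integrable_def)
qed

lemma square_integrable_diff:
  assumes "square_integrable f" "square_integrable g"
  shows "square_integrable (\<lambda>x. f x - g x)"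
  using square_integrable_add[OF assms(1) square_integrable_uminus[OF assms(2)]] by simp

quotient_type (overloaded) 'a L2 = "'a::euclidean_space \<Rightarrow> real" / partial:
  "\<lambda>f g. square_integrable f \<and> square_integrable g \<and> (AE x in lebesgue. f x = g x)"
  morphisms rep_L2 to_L2
proof (rule part_equivpI)
  show "\<exists>f::'a \<Rightarrow> real. square_integrable f \<and> square_integrable f \<and> (AE x in lebesgue. f x = f x)"
    using square_integrable_zero by auto
  show "symp (\<lambda>f g::'a \<Rightarrow> real. square_integrable f \<and> square_integrable g \<and> (AE x in lebesgue. f x = g x))"
    by (auto intro!: sympI)
  show "transp (\<lambda>f g::'a \<Rightarrow> real. square_integrable f \<and> square_integrable g \<and> (AE x in lebesgue. f x = g x))"
    by (intro transpI) (auto elim: AE_mp)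
qed

instantiation L2 :: (euclidean_space) real_vector
begin

lift_definition zero_L2 :: "'a L2" is "\<lambda>x. 0"
  by (simp add: square_integrable_zero)

lift_definition plus_L2 :: "'a L2 \<Rightarrow> 'a L2 \<Rightarrow> 'a L2" is "\<lambda>f g x. f x + g x"
  by (auto intro: square_integrable_add)

lift_definition minus_L2 :: "'a L2 \<Rightarrow> 'a L2 \<Rightarrow> 'a L2" is "\<lambda>f g x. f x - g x"
  by (auto intro: square_integrable_diff)

lift_definition uminus_L2 :: "'a L2 \<Rightarrow> 'a L2" is "\<lambda>f x. - f x"
  by (auto intro: square_integrable_uminus)

lift_definition scaleR_L2 :: "real \<Rightarrow> 'a L2 \<Rightarrow> 'a L2" is "\<lambda>c f x. c * f x"
  by (auto intro: square_integrable_scale)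

instance
proof
  fix f g h :: "'a L2" and a b :: real
  show "f + g + h = f + (g + h)"
    by transfer (auto intro!: square_integrable_add simp: algebra_simps)
  show "f + g = g + f"
    by transfer (auto intro!: square_integrable_add simp: algebra_simps)
  show "0 + f = f" by transfer auto
  show "- f + f = 0" by transfer (auto simp: square_integrable_zero)
  show "f - g = f + - g"
    by transfer (auto intro: square_integrable_diff)
  show "a *\<^sub>R (f + g) = a *\<^sub>R f + a *\<^sub>R g"
    by transfer (auto intro!: square_integrable_add square_integrable_scale simp: distrib_left)
  show "(a + b) *\<^sub>R f = a *\<^sub>R f + b *\<^sub>R f"
    by transfer (auto intro!: square_integrable_add square_integrable_scale
        simp: distrib_right square_integrable_add square_integrable_scale)
  show "a *\<^sub>R b *\<^sub>R f = (a * b) *\<^sub>R f"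
    by transfer (auto intro!: square_integrable_scale simp: mult.assoc)
  show "1 *\<^sub>R f = f" by transfer auto
qed

end

instantiation L2 :: (euclidean_space) real_inner
begin

lift_definition inner_L2 :: "'a L2 \<Rightarrow> 'a L2 \<Rightarrow> real" is "\<lambda>f g. LINT x|lebesgue. f x * g x"
  by (rule integral_cong_AE) (auto simp: square_integrable_def)

definition norm_L2 :: "'a L2 \<Rightarrow> real" where "norm_L2 f = sqrt (inner f f)"

definition sgn_L2 :: "'a L2 \<Rightarrow> 'a L2" where "sgn_L2 f = f /\<^sub>R norm f"

definition dist_L2 :: "'a L2 \<Rightarrow> 'a L2 \<Rightarrow> real" where "dist_L2 f g = norm (f - g)"

definition uniformity_L2 :: "('a L2 \<times> 'a L2) filter" where
  "uniformity_L2 = (INF e\<in>{0<..}. principal {(x, y). dist x y < e})"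

definition open_L2 :: "'a L2 set \<Rightarrow> bool" where
  "open_L2 U \<longleftrightarrow> (\<forall>x\<in>U. eventually (\<lambda>(x', y). x' = x \<longrightarrow> y \<in> U) uniformity)"

instance
proof
  fix f g h :: "'a L2" and a :: real
  show "inner f g = inner g f" by transfer (simp add: mult.commute)
  show "inner (f + g) h = inner f h + inner g h"
    by transfer (simp add: distrib_right square_integrable_prod)
  show "inner (a *\<^sub>R f) g = a * inner f g"
    by transfer (simp add: mult.assoc)
  show "0 \<le> inner f f" by transfer simp
  show "inner f f = 0 \<longleftrightarrow> f = 0"
  proof transfer
    fix f :: "'a \<Rightarrow> real"
    assume "square_integrable f \<and> square_integrable f \<and> (AE x in lebesgue. f x = f x)"
    then have f: "square_integrable f" by simp
    have "(LINT x|lebesgue. f x * f x) = 0 \<longleftrightarrow> (AE x in lebesgue. f x * f x = 0)"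
      by (rule integral_nonneg_eq_0_iff_AE) (auto intro: square_integrable_prod f)
    then show "((LINT x|lebesgue. f x * f x) = 0) =
        (square_integrable f \<and> square_integrable (\<lambda>x::'a. 0) \<and> (AE x in lebesgue. f x = 0))"
      using f by (simp add: square_integrable_zero)
  qed
  show "norm f = sqrt (inner f f)" by (rule norm_L2_def)
  show "sgn f = f /\<^sub>R norm f" by (rule sgn_L2_def)
  show "dist f g = norm (f - g)" by (rule dist_L2_def)
  show "(uniformity :: ('a L2 \<times> 'a L2) filter) = (INF e\<in>{0<..}. principal {(x, y). dist x y < e})"
    by (rule uniformity_L2_def)
next
  fix U :: "'a L2 set"
  show "open U \<longleftrightarrow> (\<forall>x\<in>U. eventually (\<lambda>(x', y). x' = x \<longrightarrow> y \<in> U) uniformity)"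
    by (rule open_L2_def)
qed

end

lemma to_L2_eq_iff:
  assumes "square_integrable f" "square_integrable g"
  shows "to_L2 f = to_L2 g \<longleftrightarrow> (AE x in lebesgue. f x = g x)"
  using assms Quotient_L2 unfolding Quotient_def by fastforce

lemma square_integrable_rep_L2: "square_integrable (rep_L2 q)"
  using Quotient3_rep_reflp[OF Quotient3_L2] by auto

lemma to_L2_rep_L2: "to_L2 (rep_L2 q) = q"
  by (rule Quotient3_abs_rep[OF Quotient3_L2])

lemma rep_L2_to_L2:
  assumes "square_integrable f"
  shows "AE x in lebesgue. rep_L2 (to_L2 f) x = f x"
  using to_L2_eq_iff[OF square_integrable_rep_L2 assms] to_L2_rep_L2[of "to_L2 f"] by simp

lemma inner_to_L2:
  assumes "square_integrable f" "square_integrable g"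
  shows "inner (to_L2 f) (to_L2 g) = (LINT x|lebesgue. f x * g x)"
  using assms by (simp add: inner_L2.abs_eq)

lemma to_L2_add:
  assumes "square_integrable f" "square_integrable g"
  shows "to_L2 f + to_L2 g = to_L2 (\<lambda>x. f x + g x)"
  using assms by (simp add: plus_L2.abs_eq)

lemma to_L2_diff:
  assumes "square_integrable f" "square_integrable g"
  shows "to_L2 f - to_L2 g = to_L2 (\<lambda>x. f x - g x)"
  using assms by (simp add: minus_L2.abs_eq)

lemma to_L2_scale:
  assumes "square_integrable f"
  shows "c *\<^sub>R to_L2 f = to_L2 (\<lambda>x. c * f x)"
  using assms by (simp add: scaleR_L2.abs_eq)

lemma norm_to_L2_diff:
  assumes "square_integrable f" "square_integrable g"
  shows "(norm (to_L2 f - to_L2 g))\<^sup>2 = (LINT x|lebesgue. (f x - g x)\<^sup>2)"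
  unfolding power2_norm_eq_inner to_L2_diff[OF assms]
  using square_integrable_diff[OF assms] by (simp add: inner_to_L2 power2_eq_square)

lemma norm_rep_L2_diff:
  "(norm (p - q))\<^sup>2 = (LINT x|lebesgue. (rep_L2 p x - rep_L2 q x)\<^sup>2)"
  using norm_to_L2_diff[OF square_integrable_rep_L2 square_integrable_rep_L2, of p q]
  by (simp add: to_L2_rep_L2)

lemma integrable_rep_L2_diff: "integrable lebesgue (\<lambda>x. (rep_L2 p x - rep_L2 q x)\<^sup>2)"
  using square_integrable_diff[OF square_integrable_rep_L2 square_integrable_rep_L2, of p q]
  by (simp add: square_integrable_def)

lemma nn_integral_rep_L2_diff:
  "(\<integral>\<^sup>+x. ennreal ((rep_L2 p x - rep_L2 q x)\<^sup>2) \<partial>lebesgue) = ennreal ((norm (p - q))\<^sup>2)"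
  unfolding norm_rep_L2_diff by (rule nn_integral_eq_integral[OF integrable_rep_L2_diff]) simp

lemma measurable_rep_L2 [measurable]: "rep_L2 q \<in> borel_measurable lebesgue"
  using square_integrable_rep_L2[of q] by (simp add: square_integrable_def)

lemma fast_Cauchy_L2_AE_convergent:
  fixes X :: "nat \<Rightarrow> 'a::euclidean_space L2"
  assumes "\<And>n. norm (X (Suc n) - X n) \<le> (1/2) ^ n"
  shows "AE x in lebesgue. convergent (\<lambda>n. rep_L2 (X n) x)"
proof -
  let ?d = "\<lambda>n x. rep_L2 (X (Suc n)) x - rep_L2 (X n) x"
  have "(\<integral>\<^sup>+x. (\<Sum>n. ennreal ((3/2) ^ n * (?d n x)\<^sup>2)) \<partial>lebesgue)
      = (\<Sum>n. \<integral>\<^sup>+x. ennreal ((3/2) ^ n * (?d n x)\<^sup>2) \<partial>lebesgue)"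
    by (rule nn_integral_suminf) measurable
  also have "\<dots> = (\<Sum>n. ennreal ((3/2) ^ n * (norm (X (Suc n) - X n))\<^sup>2))"
    by (simp add: ennreal_mult nn_integral_cmult nn_integral_rep_L2_diff)
  also have "\<dots> \<le> (\<Sum>n. ennreal ((3/8) ^ n))"
  proof (intro suminf_le ennreal_leI)
    fix n
    have "(norm (X (Suc n) - X n))\<^sup>2 \<le> ((1/2) ^ n)\<^sup>2"
      using assms by (intro power_mono) auto
    also have "\<dots> = (1/4::real) ^ n"
      by (simp flip: power_mult_distrib power_mult add: mult.commute[of n 2] power_mult power2_eq_square)
    finally have "(3/2) ^ n * (norm (X (Suc n) - X n))\<^sup>2 \<le> (3/2) ^ n * (1/4::real) ^ n"
      by (intro mult_left_mono) auto
    also have "\<dots> = (3/8) ^ n" by (simp flip: power_mult_distrib)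
    finally show "(3/2) ^ n * (norm (X (Suc n) - X n))\<^sup>2 \<le> (3/8) ^ n" .
  qed auto
  also have "\<dots> = ennreal (\<Sum>n. (3/8) ^ n)"
    by (rule suminf_ennreal2) (auto intro: summable_geometric)
  also have "\<dots> < \<infinity>" by simp
  finally have fin: "(\<integral>\<^sup>+x. (\<Sum>n. ennreal ((3/2) ^ n * (?d n x)\<^sup>2)) \<partial>lebesgue) \<noteq> \<infinity>"
    by simp
  have "AE x in lebesgue. (\<Sum>n. ennreal ((3/2) ^ n * (?d n x)\<^sup>2)) \<noteq> \<infinity>"
    by (rule nn_integral_PInf_AE[OF _ fin]) measurable
  then show ?thesis
  proof eventually_elim
    case (elim x)
    have s: "summable (\<lambda>n. (3/2) ^ n * (?d n x)\<^sup>2)"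
      by (rule summable_suminf_not_top) (use elim in \<open>auto simp: infinity_ennreal_def\<close>)
    have "summable (\<lambda>n. (2/3) ^ n + (3/2) ^ n * (?d n x)\<^sup>2)"
      by (intro summable_add s summable_geometric) simp
    then have "summable (\<lambda>n. ?d n x)"
    proof (rule summable_comparison_test'[where N=0])
      fix n :: nat
      have "2 * ((2/3) ^ n * ((3/2) ^ n * \<bar>?d n x\<bar>)) \<le> (2/3) ^ n * (1 + ((3/2) ^ n * \<bar>?d n x\<bar>)\<^sup>2)"
        using sum_squares_bound[of 1 "(3/2) ^ n * \<bar>?d n x\<bar>"] by (simp add: mult.left_commute[of 2])
      also have "\<dots> = (2/3) ^ n + (2/3) ^ n * (3/2) ^ n * (3/2) ^ n * (?d n x)\<^sup>2"
        by (simp add: power_mult_distrib power2_eq_square algebra_simps)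
      also have "(2/3::real) ^ n * (3/2) ^ n = 1" by (simp flip: power_mult_distrib)
      finally have "2 * \<bar>?d n x\<bar> \<le> (2/3) ^ n + (3/2) ^ n * (?d n x)\<^sup>2"
        by (simp flip: power_mult_distrib mult.assoc)
      moreover have "\<bar>a\<bar> \<le> r" if "2 * \<bar>a\<bar> \<le> r" for a r :: real using that by linarith
      ultimately show "norm (?d n x) \<le> (2/3) ^ n + (3/2) ^ n * (?d n x)\<^sup>2"
        unfolding real_norm_def by blast
    qed
    then have "convergent (\<lambda>n. \<Sum>k<n. ?d k x)" by (simp add: summable_iff_convergent)
    then have "convergent (\<lambda>n. rep_L2 (X n) x - rep_L2 (X 0) x)"
      using sum_lessThan_telescope[of "\<lambda>k. rep_L2 (X k) x"] by simp
    then have "convergent (\<lambda>n. (rep_L2 (X n) x - rep_L2 (X 0) x) + rep_L2 (X 0) x)"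
      by (intro convergent_add convergent_const)
    then show ?case by simp
  qed
qed

lemma fast_Cauchy_L2_convergent:
  fixes X :: "nat \<Rightarrow> 'a::euclidean_space L2"
  assumes C: "Cauchy X" and fast: "\<And>n. norm (X (Suc n) - X n) \<le> (1/2) ^ n"
  shows "convergent X"
proof -
  define f where "f x = lim (\<lambda>n. rep_L2 (X n) x)" for x
  have [measurable]: "f \<in> borel_measurable lebesgue"
    unfolding f_def by measurable
  have conv: "AE x in lebesgue. (\<lambda>n. rep_L2 (X n) x) \<longlonglongrightarrow> f x"
    using fast_Cauchy_L2_AE_convergent[OF fast] by (simp add: f_def convergent_LIMSEQ_iff)
  have Fatou: "(\<integral>\<^sup>+x. ennreal ((f x - rep_L2 (X m) x)\<^sup>2) \<partial>lebesgue) \<le> ennreal (e\<^sup>2)"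
    if e: "\<And>n. n \<ge> m \<Longrightarrow> norm (X n - X m) \<le> e" for m e
  proof -
    have "(\<integral>\<^sup>+x. ennreal ((f x - rep_L2 (X m) x)\<^sup>2) \<partial>lebesgue)
        = (\<integral>\<^sup>+x. liminf (\<lambda>n. ennreal ((rep_L2 (X n) x - rep_L2 (X m) x)\<^sup>2)) \<partial>lebesgue)"
    proof (rule nn_integral_cong_AE, use conv in eventually_elim)
      case (elim x)
      then have "(\<lambda>n. ennreal ((rep_L2 (X n) x - rep_L2 (X m) x)\<^sup>2)) \<longlonglongrightarrow> ennreal ((f x - rep_L2 (X m) x)\<^sup>2)"
        by (intro tendsto_intros)
      then show ?case by (intro lim_imp_Liminf[symmetric]) auto
    qed
    also have "\<dots> \<le> liminf (\<lambda>n. \<integral>\<^sup>+x. ennreal ((rep_L2 (X n) x - rep_L2 (X m) x)\<^sup>2) \<partial>lebesgue)"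
      by (rule nn_integral_liminf) measurable
    also have "\<dots> = liminf (\<lambda>n. ennreal ((norm (X n - X m))\<^sup>2))"
      by (simp add: nn_integral_rep_L2_diff)
    also have "\<dots> \<le> liminf (\<lambda>n. ennreal (e\<^sup>2))"
      using e by (intro Liminf_mono) (auto simp: eventually_sequentially intro!: exI[of _ m] ennreal_leI power_mono)
    also have "\<dots> = ennreal (e\<^sup>2)" by (simp add: Liminf_const)
    finally show ?thesis .
  qed
  have sq: "square_integrable (\<lambda>x. f x - rep_L2 (X m) x)"
    if e: "\<And>n. n \<ge> m \<Longrightarrow> norm (X n - X m) \<le> e" for m e
  proof -
    have "(\<integral>\<^sup>+x. ennreal (norm ((f x - rep_L2 (X m) x)\<^sup>2)) \<partial>lebesgue) < \<infinity>"
      using le_less_trans[OF Fatou[OF e]] by simp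
    then show ?thesis unfolding square_integrable_def
      by (auto intro!: integrableI_bounded)
  qed
  obtain M where "\<And>n. n \<ge> M \<Longrightarrow> norm (X n - X M) \<le> 1"
    using CauchyD[OF C, of 1] by (metis less_imp_le order_refl zero_less_one)
  then have f: "square_integrable f"
    using square_integrable_add[OF sq[of M 1] square_integrable_rep_L2[of "X M"]] by simp
  have "X \<longlonglongrightarrow> to_L2 f"
  proof (rule LIMSEQ_I)
    fix r :: real assume "r > 0"
    then obtain M where M: "\<And>n m. n \<ge> M \<Longrightarrow> m \<ge> M \<Longrightarrow> norm (X n - X m) \<le> r / 2"
      using CauchyD[OF C, of "r/2"] by (metis less_imp_le half_gt_zero)
    have "norm (X n - to_L2 f) < r" if n: "n \<ge> M" for n
    proof -
      have e: "\<And>k. k \<ge> n \<Longrightarrow> norm (X k - X n) \<le> r / 2" using M n by simp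
      have "ennreal ((norm (to_L2 f - X n))\<^sup>2) = (\<integral>\<^sup>+x. ennreal ((f x - rep_L2 (X n) x)\<^sup>2) \<partial>lebesgue)"
        using norm_to_L2_diff[OF f square_integrable_rep_L2, of "X n"] sq[OF e]
        by (simp add: to_L2_rep_L2 nn_integral_eq_integral square_integrable_def)
      also have "\<dots> \<le> ennreal ((r/2)\<^sup>2)" by (rule Fatou[OF e])
      finally have "(norm (to_L2 f - X n))\<^sup>2 \<le> (r/2)\<^sup>2" by (simp add: ennreal_le_iff)
      then have "norm (to_L2 f - X n) \<le> r/2"
        by (rule power2_le_imp_le) (use \<open>r > 0\<close> in simp)
      then show ?thesis using \<open>r > 0\<close> by (simp add: norm_minus_commute)
    qed
    then show "\<exists>no. \<forall>n\<ge>no. norm (X n - to_L2 f) < r" by blast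
  qed
  then show ?thesis by (auto simp: convergent_def)
qed

instance L2 :: (euclidean_space) complete_space
proof
  fix X :: "nat \<Rightarrow> 'a L2" assume C: "Cauchy X"
  have "\<exists>r. strict_mono r \<and> (\<forall>n. \<forall>k\<ge>r n. \<forall>l\<ge>r n. norm (X k - X l) \<le> (1/2) ^ n)"
  proof -
    have "\<exists>M. \<forall>k\<ge>M. \<forall>l\<ge>M. norm (X k - X l) \<le> (1/2) ^ n" for n :: nat
      using CauchyD[OF C, of "(1/2) ^ n"] by (meson less_imp_le zero_less_divide_1_iff zero_less_numeral zero_less_power)
    then obtain M where M: "\<And>n k l. k \<ge> M n \<Longrightarrow> l \<ge> M n \<Longrightarrow> norm (X k - X l) \<le> (1/2) ^ n"
      by metis
    define r where "r n = n + (\<Sum>i\<le>n. M i)" for n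
    have "strict_mono r" by (rule strict_monoI_Suc) (simp add: r_def)
    moreover
    have "M n \<le> r n" for n
      unfolding r_def by (rule trans_le_add2) (rule member_le_sum, auto)
    then have "norm (X k - X l) \<le> (1/2) ^ n" if "r n \<le> k" "r n \<le> l" for n k l
      using M[of n k l] that order_trans[of "M n" "r n"] by blast
    ultimately show ?thesis by blast
  qed
  then obtain r where r: "strict_mono r"
      "\<And>n k l. k \<ge> r n \<Longrightarrow> l \<ge> r n \<Longrightarrow> norm (X k - X l) \<le> (1/2) ^ n"
    by blast
  have "convergent (X \<circ> r)"
  proof (rule fast_Cauchy_L2_convergent)
    show "Cauchy (X \<circ> r)" by (rule Cauchy_subseq_Cauchy[OF C r(1)])
    show "norm ((X \<circ> r) (Suc n) - (X \<circ> r) n) \<le> (1/2) ^ n" for n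
      using r(2)[of n "r (Suc n)" "r n"] strict_mono_less_eq[OF r(1), of n "Suc n"] by simp
  qed
  then show "convergent X"
    using Cauchy_converges_subseq[OF C r(1)] unfolding convergent_def by blast
qed

instance L2 :: (euclidean_space) banach ..

lemma second_countableI_dense:
  fixes D :: "'b::metric_space set"
  assumes D: "countable D" and dense: "closure D = UNIV"
  shows "\<exists>B::'b set set. countable B \<and> open = generate_topology B"
proof -
  let ?B = "(\<lambda>(x, n). ball x (1 / Suc n)) ` (D \<times> (UNIV :: nat set))"
  have "countable ?B" using D by auto
  moreover have "topological_basis ?B"
  proof (rule topological_basisI)
    fix U :: "'b set" and x assume U: "open U" "x \<in> U"
    then obtain e where e: "e > 0" "ball x e \<subseteq> U" by (auto simp: open_contains_ball)
    obtain n where n: "1 / Suc n < e / 2" using nat_approx_posE[of "e/2"] e by auto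
    have "x \<in> closure D" using dense by simp
    then obtain y where y: "y \<in> D" "dist y x < 1 / Suc n"
      unfolding closure_approachable using of_nat_0_less_iff zero_less_divide_1_iff by blast
    have "ball y (1 / Suc n) \<subseteq> ball x e"
    proof
      fix z assume "z \<in> ball y (1 / Suc n)"
      then show "z \<in> ball x e"
        using y n dist_triangle[of x z y] by (auto simp: dist_commute)
    qed
    then show "\<exists>B'\<in>?B. x \<in> B' \<and> B' \<subseteq> U"
      using y e by (intro bexI[of _ "ball y (1 / Suc n)"]) auto
  qed auto
  ultimately show ?thesis using topological_basis_imp_subbasis by blast
qed

lemma subspace_closure_span:
  fixes B :: "'b::real_normed_vector set"
  shows "subspace (closure (span B))"
proof (rule subspaceI)
  show "0 \<in> closure (span B)" using closure_subset span_zero by blast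
  show "x + y \<in> closure (span B)" if x: "x \<in> closure (span B)" and y: "y \<in> closure (span B)" for x y
  proof -
    obtain f g where "\<And>n::nat. f n \<in> span B" "f \<longlonglongrightarrow> x" "\<And>n::nat. g n \<in> span B" "g \<longlonglongrightarrow> y"
      using x y unfolding closure_sequential by blast
    then show ?thesis unfolding closure_sequential
      by (intro exI[of _ "\<lambda>n. f n + g n"]) (auto intro: span_add tendsto_add)
  qed
  show "c *\<^sub>R x \<in> closure (span B)" if x: "x \<in> closure (span B)" for c x
  proof -
    obtain f where "\<And>n::nat. f n \<in> span B" "f \<longlonglongrightarrow> x"
      using x unfolding closure_sequential by blast
    then show ?thesis unfolding closure_sequential
      by (intro exI[of _ "\<lambda>n. c *\<^sub>R f n"]) (auto intro: span_scale tendsto_scaleR tendsto_const)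
  qed
qed

lemma countable_dense_span:
  fixes B :: "'b::real_normed_vector set"
  assumes "countable B"
  shows "\<exists>D. countable D \<and> span B \<subseteq> closure D"
proof -
  define S :: "(rat \<times> 'b) list \<Rightarrow> 'b" where "S l = (\<Sum>(r, b)\<leftarrow>l. of_rat r *\<^sub>R b)" for l
  define D where "D = S ` lists (UNIV \<times> B)"
  have "countable D" unfolding D_def using assms by (intro countable_image countable_lists) auto
  moreover have "x \<in> closure D" if "x \<in> span B" for x
    using that
  proof (induction rule: span_induct_alt)
    case base
    have "S [] \<in> D" unfolding D_def by blast
    then show ?case using closure_subset[of D] by (auto simp: S_def)
  next
    case (step c b y)
    show ?case unfolding closure_approachable
    proof (intro allI impI)
      fix e :: real assume e: "e > 0"
      obtain z where z: "z \<in> D" "dist z y < e / 2"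
        using step e unfolding closure_approachable by (meson half_gt_zero)
      then obtain l where l: "l \<in> lists (UNIV \<times> B)" "z = S l" by (auto simp: D_def)
      have "0 < e / 2 / (norm b + 1)" using e by (simp add: add_nonneg_pos)
      then obtain r :: rat where r: "c < of_rat r" "of_rat r < c + e / 2 / (norm b + 1)"
        using of_rat_dense[of c "c + e / 2 / (norm b + 1)"] by auto
      have "norm (of_rat r *\<^sub>R b - c *\<^sub>R b) = (of_rat r - c) * norm b"
        using r by (simp flip: scaleR_left_diff_distrib)
      also have "\<dots> \<le> e / 2 / (norm b + 1) * norm b" using r by (intro mult_right_mono) auto
      also have "\<dots> \<le> e / 2 / (norm b + 1) * (norm b + 1)" using e by (intro mult_left_mono) (auto simp: add_nonneg_pos)
      also have "\<dots> = e / 2"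
      proof -
        have "norm b + 1 \<noteq> 0" using norm_ge_zero[of b] by linarith
        then show ?thesis by (metis nonzero_eq_divide_eq)
      qed
      finally have "dist (of_rat r *\<^sub>R b + z) (c *\<^sub>R b + y) < e"
        using z dist_triangle_add[of "of_rat r *\<^sub>R b" z "c *\<^sub>R b" y] by (simp add: dist_norm)
      moreover have "of_rat r *\<^sub>R b + z \<in> D"
      proof -
        have "S ((r, b) # l) \<in> D" unfolding D_def using l step by (intro imageI) auto
        then show ?thesis using l by (simp add: S_def)
      qed
      ultimately show "\<exists>d\<in>D. dist d (c *\<^sub>R b + y) < e" by blast
    qed
  qed
  ultimately show ?thesis by blast
qed

lemma square_integrable_indicator:
  assumes "A \<in> lmeasurable"
  shows "square_integrable (indicator A)"
  using assms unfolding square_integrable_def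
  by (auto simp: fmeasurable_def power2_eq_square simp flip: indicator_inter_arith)

lemma to_L2_tendsto:
  fixes f :: "'a::euclidean_space \<Rightarrow> real"
  assumes X: "\<And>n. square_integrable (X n)" and f: "square_integrable f"
    and lim: "\<And>x. (\<lambda>n. X n x) \<longlonglongrightarrow> f x" and bound: "\<And>n x. \<bar>X n x\<bar> \<le> \<bar>f x\<bar>"
  shows "(\<lambda>n. to_L2 (X n)) \<longlonglongrightarrow> to_L2 f"
proof -
  have [measurable]: "f \<in> borel_measurable lebesgue" "\<And>n. X n \<in> borel_measurable lebesgue"
    using X f by (auto simp: square_integrable_def)
  have "(\<lambda>n. LINT x|lebesgue. (X n x - f x)\<^sup>2) \<longlonglongrightarrow> (LINT x::'a|lebesgue. 0)"
  proof (rule integral_dominated_convergence)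
    show "integrable lebesgue (\<lambda>x. 4 * (f x)\<^sup>2)" using f by (simp add: square_integrable_def)
    have "(\<lambda>n. (X n x - f x)\<^sup>2) \<longlonglongrightarrow> (f x - f x)\<^sup>2" for x by (intro tendsto_intros lim)
    then show "AE x in lebesgue. (\<lambda>n. (X n x - f x)\<^sup>2) \<longlonglongrightarrow> 0" by simp
    show "AE x in lebesgue. norm ((X n x - f x)\<^sup>2) \<le> 4 * (f x)\<^sup>2" for n
    proof (rule AE_I2)
      fix x
      have "\<bar>X n x - f x\<bar> \<le> 2 * \<bar>f x\<bar>" using bound[of n x] by linarith
      then have "\<bar>X n x - f x\<bar>\<^sup>2 \<le> (2 * \<bar>f x\<bar>)\<^sup>2" by (intro power_mono) auto
      then show "norm ((X n x - f x)\<^sup>2) \<le> 4 * (f x)\<^sup>2" by (simp add: power_mult_distrib)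
    qed
  qed measurable
  then have "(\<lambda>n. (norm (to_L2 (X n) - to_L2 f))\<^sup>2) \<longlonglongrightarrow> 0"
    by (simp add: norm_to_L2_diff X f)
  then have "(\<lambda>n. sqrt ((norm (to_L2 (X n) - to_L2 f))\<^sup>2)) \<longlonglongrightarrow> sqrt 0"
    by (rule tendsto_real_sqrt)
  then have "(\<lambda>n. norm (to_L2 (X n) - to_L2 f)) \<longlonglongrightarrow> 0" by simp
  then have "(\<lambda>n. to_L2 (X n) - to_L2 f) \<longlonglongrightarrow> 0" by (rule tendsto_norm_zero_cancel)
  then show ?thesis by (rule LIM_zero_cancel)
qed

lemma lmeasurable_approx_countable:
  "\<exists>C::'a::euclidean_space set set. countable C \<and> C \<subseteq> lmeasurable \<and>
     (\<forall>A\<in>lmeasurable. \<forall>e>0. \<exists>c\<in>C. measure lebesgue (sym_diff A c) < e)"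
proof -
  obtain B :: "'a set set" where B: "countable B" "topological_basis B"
    using ex_countable_basis by blast
  define C where "C = {\<Union>F |F. finite F \<and> F \<subseteq> B \<and> \<Union>F \<in> lmeasurable}"
  have "C \<subseteq> Union ` {F. finite F \<and> F \<subseteq> B}" by (auto simp: C_def)
  moreover have "countable {F. finite F \<and> F \<subseteq> B}"
    using B(1) by (rule countable_Collect_finite_subset)
  ultimately have "countable C" by (rule countable_subset[OF _ countable_image])
  moreover have "C \<subseteq> lmeasurable" by (auto simp: C_def)
  moreover have "\<exists>c\<in>C. measure lebesgue (sym_diff A c) < e"
    if A: "A \<in> lmeasurable" and e: "e > 0" for A :: "'a set" and e :: real
  proof -
    obtain T where T: "open T" "A \<subseteq> T" "T - A \<in> lmeasurable" "measure lebesgue (T - A) < e / 2"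
    proof -
      obtain T where "open T" "A \<subseteq> T" and TA: "T - A \<in> lmeasurable" "emeasure lebesgue (T - A) < ennreal (e/2)"
        using sets_lebesgue_outer_open[of A "e/2"] A e by (auto simp: fmeasurableD)
      moreover have "measure lebesgue (T - A) < e / 2"
        using TA(2) unfolding emeasure_eq_measure2[OF TA(1)] by (subst (asm) ennreal_less_iff) auto
      ultimately show ?thesis using that by blast
    qed
    have Tm: "T \<in> lmeasurable"
      using fmeasurable.Un[OF A T(3)] T(2) by (simp add: Un_absorb1)
    obtain F where F: "F \<subseteq> B" "\<Union>F = T"
      using B(2) T(1) unfolding topological_basis_def by blast
    have cF: "countable F" using F(1) B(1) by (rule countable_subset)
    have openF: "open U" if "U \<in> F" for U using that F(1) topological_basis_open[OF B(2)] by blast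
    show ?thesis
    proof (cases "F = {}")
      case True
      then have "A = {}" using F T by auto
      moreover have "{} \<in> C" unfolding C_def by (auto intro!: exI[of _ "{}"])
      ultimately show ?thesis using e by (intro bexI[of _ "{}"]) auto
    next
      case False
      define c where "c n = (\<Union>i\<le>n. from_nat_into F i)" for n
      have inF: "from_nat_into F i \<in> F" for i using False by (rule from_nat_into)
      then have "from_nat_into F i \<subseteq> T" for i using Union_upper[of _ F] unfolding F(2) by simp
      then have cT: "c n \<subseteq> T" for n unfolding c_def by (rule UN_least)
      have "open (c n)" for n unfolding c_def by (intro open_UN ballI openF inF)
      then have cm: "c n \<in> lmeasurable" for n
        using fmeasurableI2[OF Tm cT] by (simp add: borel_open)
      have un: "(\<Union>n. c n) = T"
      proof -
        have "(\<Union>n. c n) = (\<Union>i. from_nat_into F i)" by (auto simp: c_def)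
        then show ?thesis using range_from_nat_into[OF False cF] F(2) by simp
      qed
      have "(\<lambda>n. measure lebesgue (c n)) \<longlonglongrightarrow> measure lebesgue (\<Union>n. c n)"
      proof (rule Lim_measure_incseq)
        show "range c \<subseteq> sets lebesgue" using cm by auto
        show "incseq c" unfolding incseq_def c_def by (intro allI impI UN_mono) auto
        show "emeasure lebesgue (\<Union>n. c n) \<noteq> \<infinity>" unfolding un emeasure_eq_measure2[OF Tm] by simp
      qed
      then have "\<forall>\<^sub>F n in sequentially. \<bar>measure lebesgue (c n) - measure lebesgue T\<bar> < e / 2"
        unfolding un tendsto_iff dist_real_def using half_gt_zero[OF e] by blast
      then obtain n where n: "\<bar>measure lebesgue (c n) - measure lebesgue T\<bar> < e / 2"
        by (auto simp: eventually_sequentially)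
      have "sym_diff A (c n) \<subseteq> (T - A) \<union> (T - c n)" using cT[of n] T(2) by auto
      then have "measure lebesgue (sym_diff A (c n)) \<le> measure lebesgue ((T - A) \<union> (T - c n))"
        using A cm T(3) Tm by (intro measure_mono_fmeasurable fmeasurable.Un fmeasurable.Diff) auto
      also have "\<dots> \<le> measure lebesgue (T - A) + measure lebesgue (T - c n)"
        using T(3) Tm cm by (intro measure_Un_le) auto
      also have "measure lebesgue (T - c n) = measure lebesgue T - measure lebesgue (c n)"
        using Tm cm cT by (intro measurable_measure_Diff) auto
      finally have "measure lebesgue (sym_diff A (c n)) < e" using T(4) n by linarith
      moreover have "c n \<in> C" unfolding C_def
      proof (intro CollectI exI[of _ "from_nat_into F ` {..n}"] conjI)
        show "c n = \<Union> (from_nat_into F ` {..n})" by (simp add: c_def)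
        then show "\<Union> (from_nat_into F ` {..n}) \<in> lmeasurable" using cm[of n] by simp
      qed (use inF F(1) in auto)
      ultimately show ?thesis by blast
    qed
  qed
  ultimately show ?thesis by blast
qed

lemma L2_countable_dense: "\<exists>D::'a::euclidean_space L2 set. countable D \<and> closure D = UNIV"
proof -
  obtain C :: "'a set set" where C: "countable C" "C \<subseteq> lmeasurable"
    "\<And>A e. A \<in> lmeasurable \<Longrightarrow> e > 0 \<Longrightarrow> \<exists>c\<in>C. measure lebesgue (sym_diff A c) < e"
    using lmeasurable_approx_countable[where 'a='a] by metis
  define V :: "'a L2 set" where "V = closure (span ((\<lambda>c. to_L2 (indicator c)) ` C))"
  have sub: "subspace V" unfolding V_def by (rule subspace_closure_span)
  have clV: "closed V" by (simp add: V_def)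
  have ind: "to_L2 (indicator A) \<in> V" if A: "A \<in> lmeasurable" for A :: "'a set"
    unfolding V_def closure_approachable
  proof (intro allI impI)
    fix e :: real assume "e > 0"
    then obtain c where c: "c \<in> C" "measure lebesgue (sym_diff A c) < e\<^sup>2"
      using C(3)[OF A, of "e\<^sup>2"] by auto
    have cm: "c \<in> lmeasurable" using c C by blast
    have "(norm (to_L2 (indicator c) - to_L2 (indicator A)))\<^sup>2
        = (LINT x|lebesgue. (indicator c x - indicator A x)\<^sup>2)"
      by (intro norm_to_L2_diff square_integrable_indicator A cm)
    also have "(\<lambda>x. (indicator c x - indicator A x)\<^sup>2) = (indicator (sym_diff A c) :: 'a \<Rightarrow> real)"
      by (auto simp: indicator_def)
    also have "(LINT x|lebesgue. indicator (sym_diff A c) x) = measure lebesgue (sym_diff A c)"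
      by simp
    finally have "(norm (to_L2 (indicator c) - to_L2 (indicator A)))\<^sup>2 < e\<^sup>2" using c by simp
    then have "dist (to_L2 (indicator c)) (to_L2 (indicator A)) < e"
      using \<open>e > 0\<close> by (simp add: dist_norm power2_less_imp_less)
    then show "\<exists>y\<in>span ((\<lambda>c. to_L2 (indicator c)) ` C). dist y (to_L2 (indicator A)) < e"
      using c(1) by (blast intro: span_base)
  qed
  have nonneg: "square_integrable u \<longrightarrow> to_L2 u \<in> V"
    if "u \<in> borel_measurable lebesgue" "\<And>x. 0 \<le> u x" for u :: "'a \<Rightarrow> real"
    using that
  proof (induction rule: borel_measurable_induct_real)
    case (set A)
    show ?case
    proof
      assume "square_integrable (indicator A :: 'a \<Rightarrow> real)"
      then have "integrable lebesgue (indicator A :: 'a \<Rightarrow> real)"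
        by (simp add: square_integrable_def power2_eq_square flip: indicator_inter_arith)
      then have "A \<in> lmeasurable" using set by (simp add: integrable_indicator_iff fmeasurable_def)
      then show "to_L2 (indicator A) \<in> V" by (rule ind)
    qed
  next
    case (mult u c)
    show ?case
    proof (cases "c = 0")
      case True
      have "to_L2 (\<lambda>x. 0) \<in> V" using subspace_0[OF sub] by (simp add: zero_L2_def)
      then show ?thesis using True by simp
    next
      case False
      show ?thesis
      proof
        assume "square_integrable (\<lambda>x. c * u x)"
        from square_integrable_scale[OF this, of "1/c"] False
        have u: "square_integrable u" by simp
        then show "to_L2 (\<lambda>x. c * u x) \<in> V"
          using mult subspace_scale[OF sub] to_L2_scale[OF u, of c] by metis
      qed
    qed
  next
    case (add u v)
    show ?case
    proof
      assume uv: "square_integrable (\<lambda>x. v x + u x)"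
      have u: "square_integrable u"
        by (rule square_integrable_bound[OF uv]) (use add in \<open>simp_all add: abs_of_nonneg\<close>)
      have v: "square_integrable v"
        by (rule square_integrable_bound[OF uv]) (use add in \<open>simp_all add: abs_of_nonneg\<close>)
      show "to_L2 (\<lambda>x. v x + u x) \<in> V"
        using add u v subspace_add[OF sub] to_L2_add[OF v u] by metis
    qed
  next
    case (seq U)
    show ?case
    proof
      assume u: "square_integrable u"
      have le: "U i x \<le> u x" for i x
        using incseq_le[of "\<lambda>i. U i x" "u x"] seq
        by (auto simp: incseq_def le_fun_def)
      have abs: "\<bar>U i x\<bar> \<le> \<bar>u x\<bar>" for i x using le[of i x] seq(2)[of i x] by linarith
      have U: "square_integrable (U i)" for i
        by (rule square_integrable_bound[OF u seq(1) abs])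
      have "(\<lambda>i. to_L2 (U i)) \<longlonglongrightarrow> to_L2 u"
      proof (rule to_L2_tendsto[OF U u])
        show "\<bar>U n x\<bar> \<le> \<bar>u x\<bar>" for n x by (rule abs)
        show "(\<lambda>i. U i x) \<longlonglongrightarrow> u x" for x using seq(4)[of x] by simp
      qed
      moreover have "\<And>i. to_L2 (U i) \<in> V" using seq U by blast
      ultimately show "to_L2 u \<in> V" using closed_sequentially[OF clV] by metis
    qed
  qed
  have "q \<in> V" for q :: "'a L2"
  proof -
    let ?f = "rep_L2 q"
    have p: "square_integrable (\<lambda>x. max (?f x) 0)"
      by (rule square_integrable_bound[OF square_integrable_rep_L2[of q]]) auto
    have n: "square_integrable (\<lambda>x. max (- ?f x) 0)"
      by (rule square_integrable_bound[OF square_integrable_rep_L2[of q]]) auto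
    have "to_L2 (\<lambda>x. max (?f x) 0) - to_L2 (\<lambda>x. max (- ?f x) 0) \<in> V"
      by (intro subspace_diff[OF sub] nonneg[rule_format] p n) auto
    also have "to_L2 (\<lambda>x. max (?f x) 0) - to_L2 (\<lambda>x. max (- ?f x) 0) = to_L2 (\<lambda>x. max (?f x) 0 - max (- ?f x) 0)"
      by (rule to_L2_diff[OF p n])
    also have "(\<lambda>x. max (?f x) 0 - max (- ?f x) 0) = ?f" by (auto simp: max_def)
    finally show ?thesis by (simp add: to_L2_rep_L2)
  qed
  then have V: "V = UNIV" by blast
  obtain D where D: "countable D" "span ((\<lambda>c. to_L2 (indicator c)) ` C) \<subseteq> closure D"
    using countable_dense_span[OF countable_image[OF C(1)]] by blast
  have "V \<subseteq> closure D" unfolding V_def using D(2) by (rule closure_minimal) simp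
  then show ?thesis using D V by blast
qed

instance L2 :: (euclidean_space) second_countable_topology
proof
  show "\<exists>B::'a L2 set set. countable B \<and> open = generate_topology B"
    using L2_countable_dense second_countableI_dense by blast
qed

subsection \<open>Spaces of functions on a domain\<close>

text \<open>
  \<open>L\<^sup>2(\<Omega>)\<close>, identified with its image in \<open>L\<^sup>2(\<real>\<^sup>d)\<close> under extension by zero, which preserves the norm and
  the inner product.
\<close>

definition L2_on :: "'a::euclidean_space set \<Rightarrow> 'a L2 set" where
  "L2_on \<Omega> = {q. AE x in lebesgue. x \<notin> \<Omega> \<longrightarrow> rep_L2 q x = 0}"

fun Ck_on :: "nat \<Rightarrow> 'a::euclidean_space set \<Rightarrow> ('a \<Rightarrow> real) \<Rightarrow> bool" where
  "Ck_on 0 S v \<longleftrightarrow> continuous_on S v"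
| "Ck_on (Suc k) S v \<longleftrightarrow>
     (\<exists>G. (\<forall>x\<in>S. GDERIV v x :> G x) \<and> (\<forall>b\<in>Basis. Ck_on k S (\<lambda>x. G x \<bullet> b)))"

definition smooth_on :: "'a::euclidean_space set \<Rightarrow> ('a \<Rightarrow> real) \<Rightarrow> bool" where
  "smooth_on S v \<longleftrightarrow> (\<forall>k. Ck_on k S v)"

definition test_functions :: "'a::euclidean_space set \<Rightarrow> ('a \<Rightarrow> real) set" where
  "test_functions \<Omega> = {v. smooth_on UNIV v \<and> (\<exists>K. compact K \<and> K \<subseteq> \<Omega> \<and> (\<forall>x. x \<notin> K \<longrightarrow> v x = 0))}"

definition partial_deriv :: "'a::euclidean_space \<Rightarrow> ('a \<Rightarrow> real) \<Rightarrow> 'a \<Rightarrow> real" where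
  "partial_deriv b v x = frechet_derivative v (at x) b"

definition has_weak_gradient ::
    "'a::euclidean_space set \<Rightarrow> 'a L2 \<Rightarrow> ('a \<Rightarrow> 'a L2) \<Rightarrow> bool" where
  "has_weak_gradient \<Omega> q D \<longleftrightarrow> q \<in> L2_on \<Omega> \<and>
     (\<forall>b\<in>Basis. D b \<in> L2_on \<Omega> \<and>
        (\<forall>v\<in>test_functions \<Omega>. q \<bullet> to_L2 (partial_deriv b v) = - (D b \<bullet> to_L2 v)))"

text \<open>\<open>H\<^sup>1\<^sub>0(\<Omega>)\<close>: the closure of the test functions in the norm of \<open>H\<^sup>1(\<Omega>)\<close>.\<close>

definition H1_zero :: "'a::euclidean_space set \<Rightarrow> 'a L2 set" where
  "H1_zero \<Omega> = {q. \<exists>D. has_weak_gradient \<Omega> q D \<and>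
     (\<exists>v::nat \<Rightarrow> 'a \<Rightarrow> real. (\<forall>n. v n \<in> test_functions \<Omega>) \<and>
        (\<lambda>n. to_L2 (v n)) \<longlonglongrightarrow> q \<and>
        (\<forall>b\<in>Basis. (\<lambda>n. to_L2 (partial_deriv b (v n))) \<longlonglongrightarrow> D b))}"

subsection \<open>The Dirichlet Laplacian and the spaces defined by its eigenpairs\<close>

definition has_weak_laplacian :: "'a::euclidean_space set \<Rightarrow> 'a L2 \<Rightarrow> 'a L2 \<Rightarrow> bool" where
  "has_weak_laplacian \<Omega> q w \<longleftrightarrow> w \<in> L2_on \<Omega> \<and>
     (\<exists>D. has_weak_gradient \<Omega> q D \<and>
       (\<forall>v\<in>test_functions \<Omega>.
          (\<Sum>b\<in>Basis. D b \<bullet> to_L2 (partial_deriv b v)) = - (w \<bullet> to_L2 v)))"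

text \<open>
  The Laplacian with zero Dirichlet condition as an unbounded operator in \<open>L\<^sup>2(\<Omega>)\<close>. Its domain is
  \<open>{q \<in> H\<^sup>1\<^sub>0(\<Omega>). \<Delta>q \<in> L\<^sup>2(\<Omega>)}\<close>, which is \<open>H\<^sup>2(\<Omega>) \<inter> H\<^sup>1\<^sub>0(\<Omega>)\<close> when elliptic regularity holds on \<open>\<Omega>\<close>.
\<close>

definition dirichlet_dom :: "'a::euclidean_space set \<Rightarrow> 'a L2 set" where
  "dirichlet_dom \<Omega> = {q \<in> H1_zero \<Omega>. \<exists>w. has_weak_laplacian \<Omega> q w}"

definition dirichlet_laplacian :: "'a::euclidean_space set \<Rightarrow> 'a L2 \<Rightarrow> 'a L2" where
  "dirichlet_laplacian \<Omega> q = (THE w. has_weak_laplacian \<Omega> q w)"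

text \<open>An orthonormal basis of \<open>L\<^sup>2(\<Omega>)\<close> of eigenfunctions; eigenvalues are repeated by multiplicity.\<close>

definition dirichlet_eigensystem ::
    "'a::euclidean_space set \<Rightarrow> (nat \<Rightarrow> real) \<Rightarrow> (nat \<Rightarrow> 'a L2) \<Rightarrow> bool" where
  "dirichlet_eigensystem \<Omega> lam \<phi> \<longleftrightarrow>
     (\<forall>i. 0 < lam i \<and> \<phi> i \<in> dirichlet_dom \<Omega> \<and> - dirichlet_laplacian \<Omega> (\<phi> i) = lam i *\<^sub>R \<phi> i) \<and>
     (\<forall>i j. \<phi> i \<bullet> \<phi> j = (if i = j then 1 else 0)) \<and>
     closure (span (range \<phi>)) = L2_on \<Omega>"

definition Hcheck ::
    "'a::euclidean_space set \<Rightarrow> (nat \<Rightarrow> real) \<Rightarrow> (nat \<Rightarrow> 'a L2) \<Rightarrow> real \<Rightarrow> 'a L2 set" where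
  "Hcheck \<Omega> lam \<phi> s = {q \<in> L2_on \<Omega>. summable (\<lambda>i. lam i powr s * (q \<bullet> \<phi> i)\<^sup>2)}"

definition Hcheck_norm ::
    "(nat \<Rightarrow> real) \<Rightarrow> (nat \<Rightarrow> 'a::euclidean_space L2) \<Rightarrow> real \<Rightarrow> 'a L2 \<Rightarrow> real" where
  "Hcheck_norm lam \<phi> s q = sqrt (\<Sum>i. lam i powr s * (q \<bullet> \<phi> i)\<^sup>2)"

subsection \<open>Domains with piecewise smooth boundary and convex corners\<close>

definition tangent_cone :: "'a::euclidean_space set \<Rightarrow> 'a \<Rightarrow> 'a set" where
  "tangent_cone \<Omega> x = {w. \<exists>(y::nat \<Rightarrow> 'a) (r::nat \<Rightarrow> real). (\<forall>n. y n \<in> \<Omega> \<and> 0 < r n) \<and>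
     r \<longlonglongrightarrow> 0 \<and> (\<lambda>n. (y n - x) /\<^sub>R r n) \<longlonglongrightarrow> w}"

text \<open>
  Locally \<open>\<Omega>\<close> is the sublevel set \<open>{h < 0}\<close> of a continuous selection \<open>h\<close> of finitely many smooth functions
  that all increase in a common direction \<open>v\<close>. So the boundary is a Lipschitz graph made of pieces of
  smooth hypersurfaces, and smooth pieces may also join tangentially. Convexity of the tangent cone at each
  boundary point rules out reentrant corners and edges.
\<close>

definition piecewise_smooth_convex_corners :: "'a::euclidean_space set \<Rightarrow> bool" where
  "piecewise_smooth_convex_corners \<Omega> \<longleftrightarrow>
     (\<forall>x\<in>frontier \<Omega>. convex (tangent_cone \<Omega> x) \<and>
       (\<exists>W G h v. open W \<and> x \<in> W \<and> finite G \<and>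
          (\<forall>\<gamma>\<in>G. smooth_on W \<gamma> \<and> (\<forall>y\<in>W. 0 < frechet_derivative \<gamma> (at y) v)) \<and>
          continuous_on W h \<and> (\<forall>y\<in>W. \<exists>\<gamma>\<in>G. h y = \<gamma> y) \<and>
          \<Omega> \<inter> W = {y \<in> W. h y < 0}))"

definition admissible_domain :: "'a::euclidean_space set \<Rightarrow> bool" where
  "admissible_domain \<Omega> \<longleftrightarrow> \<Omega> \<noteq> {} \<and> open \<Omega> \<and> connected \<Omega> \<and> bounded \<Omega> \<and> simply_connected \<Omega> \<and>
     piecewise_smooth_convex_corners \<Omega>"

subsection \<open>Vector-valued functions of time\<close>

text \<open>
  \<open>L\<^sup>p(0,T;X)\<close> for a subspace \<open>X\<close> of \<open>L\<^sup>2\<close> carrying the norm \<open>nrm\<close>. Measurability is that of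
  \<open>L\<^sup>2\<close>-valued functions: the spaces \<open>X\<close> used here are separable Hilbert spaces continuously embedded in
  \<open>L\<^sup>2\<close>, for which this is the same as strong measurability in \<open>X\<close>.
\<close>

definition bochner_Lp ::
    "real \<Rightarrow> real \<Rightarrow> 'a::euclidean_space L2 set \<Rightarrow> ('a L2 \<Rightarrow> real) \<Rightarrow> (real \<Rightarrow> 'a L2) set" where
  "bochner_Lp p T X nrm = {v. v \<in> borel_measurable (lebesgue_on {0<..<T}) \<and>
     (AE t in lebesgue_on {0<..<T}. v t \<in> X) \<and>
     integrable (lebesgue_on {0<..<T}) (\<lambda>t. nrm (v t) powr p)}"

definition weak_time_deriv ::
    "real \<Rightarrow> (real \<Rightarrow> 'a::euclidean_space L2) \<Rightarrow> (real \<Rightarrow> 'a L2) \<Rightarrow> bool" where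
  "weak_time_deriv T v w \<longleftrightarrow> (\<forall>\<eta>\<in>test_functions {0<..<T}.
     (LINT t|lebesgue_on {0<..<T}. deriv \<eta> t *\<^sub>R v t) = - (LINT t|lebesgue_on {0<..<T}. \<eta> t *\<^sub>R w t))"

text \<open>\<open>dv 0\<close> belongs to \<open>W\<^sup>m\<^sup>,\<^sup>p(0,T;L\<^sup>2(\<Omega>))\<close> and has the weak derivatives \<open>dv 1, \<dots>, dv m\<close>.\<close>

definition bochner_sobolev ::
    "nat \<Rightarrow> real \<Rightarrow> real \<Rightarrow> 'a::euclidean_space set \<Rightarrow> (nat \<Rightarrow> real \<Rightarrow> 'a L2) \<Rightarrow> bool" where
  "bochner_sobolev m p T \<Omega> dv \<longleftrightarrow>
     (\<forall>j\<le>m. dv j \<in> bochner_Lp p T (L2_on \<Omega>) norm) \<and> (\<forall>j<m. weak_time_deriv T (dv j) (dv (Suc j)))"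

subsection \<open>The variable-exponent fractional diffusion-wave problem\<close>

definition beta_kernel :: "real \<Rightarrow> real \<Rightarrow> real" where
  "beta_kernel \<mu> t = t powr (\<mu> - 1) / Gamma \<mu>"

definition k_kernel :: "(real \<Rightarrow> real) \<Rightarrow> real \<Rightarrow> real" where
  "k_kernel \<alpha> t = t powr (1 - \<alpha> t) / Gamma (2 - \<alpha> t)"

definition g_kernel :: "(real \<Rightarrow> real) \<Rightarrow> real \<Rightarrow> real" where
  "g_kernel \<alpha> t = (if t = 0 then 1 else
     LINT z|lebesgue_on {0..1}. (t * z) powr (\<alpha> 0 - \<alpha> (t * z)) / (Gamma (\<alpha> 0 - 1) * Gamma (2 - \<alpha> (t * z)))
       * (1 - z) powr (\<alpha> 0 - 2) * z powr (1 - \<alpha> 0))"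

text \<open>
  \<open>du j\<close> is the \<open>j\<close>-th time derivative of the solution \<open>u = du 0\<close>. As \<open>u\<close> is of class \<open>W\<^sup>2\<^sup>,\<^sup>p\<close> in time,
  \<open>u\<close> and its first derivative are taken to be the continuous representatives, which gives the initial
  conditions a meaning, and the equation holds in \<open>L\<^sup>2(\<Omega>)\<close> for almost every time.
\<close>

definition diffusion_wave_solution ::
    "'a::euclidean_space set \<Rightarrow> (nat \<Rightarrow> real) \<Rightarrow> (nat \<Rightarrow> 'a L2) \<Rightarrow> real \<Rightarrow> real \<Rightarrow> (real \<Rightarrow> real) \<Rightarrow> real \<Rightarrow>
     (real \<Rightarrow> 'a L2) \<Rightarrow> 'a L2 \<Rightarrow> 'a L2 \<Rightarrow> (nat \<Rightarrow> real \<Rightarrow> 'a L2) \<Rightarrow> bool" where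
  "diffusion_wave_solution \<Omega> lam \<phi> T \<kappa> \<alpha> p f u0 ubar0 du \<longleftrightarrow>
     bochner_sobolev 2 p T \<Omega> du \<and>
     du 0 \<in> bochner_Lp p T (Hcheck \<Omega> lam \<phi> 2) (Hcheck_norm lam \<phi> 2) \<and>
     continuous_on {0..T} (du 0) \<and> continuous_on {0..T} (du 1) \<and>
     du 0 0 = u0 \<and> du 1 0 = ubar0 \<and>
     (AE t in lebesgue_on {0<..<T}.
        (LINT s|lebesgue_on {0..t}. k_kernel \<alpha> (t - s) *\<^sub>R du 2 s)
          - \<kappa> *\<^sub>R dirichlet_laplacian \<Omega> (du 0 t) = f t)"

subsection \<open>The averaged product-integration scheme\<close>

definition fbar :: "(real \<Rightarrow> real) \<Rightarrow> (real \<Rightarrow> 'a::euclidean_space L2) \<Rightarrow> 'a L2 \<Rightarrow> real \<Rightarrow> 'a L2" where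
  "fbar \<alpha> f ubar0 t =
     (LINT s|lebesgue_on {0..t}. beta_kernel (\<alpha> 0 - 1) (t - s) *\<^sub>R f s) + g_kernel \<alpha> t *\<^sub>R ubar0"

definition Fbar ::
    "(real \<Rightarrow> real) \<Rightarrow> (real \<Rightarrow> 'a::euclidean_space L2) \<Rightarrow> 'a L2 \<Rightarrow> real \<Rightarrow> nat \<Rightarrow> 'a L2" where
  "Fbar \<alpha> f ubar0 \<tau> n =
     (1 / \<tau>) *\<^sub>R (LINT t|lebesgue_on {real (n - 1) * \<tau>..real n * \<tau>}. fbar \<alpha> f ubar0 t)"

definition delta_t :: "real \<Rightarrow> (nat \<Rightarrow> 'a::euclidean_space L2) \<Rightarrow> nat \<Rightarrow> 'a L2" where
  "delta_t \<tau> v n = (1 / \<tau>) *\<^sub>R (v n - v (n - 1))"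

text \<open>\<open>half_avg v n\<close> is \<open>v\<close> at the half-integer index \<open>n - 1/2\<close>.\<close>

definition half_avg :: "(nat \<Rightarrow> 'a::euclidean_space L2) \<Rightarrow> nat \<Rightarrow> 'a L2" where
  "half_avg v n = (1 / 2) *\<^sub>R (v n + v (n - 1))"

definition w_weight :: "(real \<Rightarrow> real) \<Rightarrow> real \<Rightarrow> nat \<Rightarrow> real" where
  "w_weight \<alpha> \<tau> k = g_kernel \<alpha> (real (Suc k) * \<tau>) - g_kernel \<alpha> (real k * \<tau>)"

definition omega_weight :: "real \<Rightarrow> real \<Rightarrow> nat \<Rightarrow> nat \<Rightarrow> real" where
  "omega_weight abar \<tau> n j = (1 / \<tau>) *
     (LINT t|lebesgue_on {real (n - 1) * \<tau>..real n * \<tau>}.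
        LINT s|lebesgue_on {real (j - 1) * \<tau>..min t (real j * \<tau>)}. beta_kernel abar (t - s))"

definition PI_rule :: "real \<Rightarrow> real \<Rightarrow> nat \<Rightarrow> (nat \<Rightarrow> 'a::euclidean_space L2) \<Rightarrow> 'a L2" where
  "PI_rule abar \<tau> n \<psi> =
     omega_weight abar \<tau> n 1 *\<^sub>R \<psi> 1 + (\<Sum>j = 2..n. omega_weight abar \<tau> n j *\<^sub>R half_avg \<psi> j)"

definition numerical_solution ::
    "'a::euclidean_space set \<Rightarrow> real \<Rightarrow> (real \<Rightarrow> real) \<Rightarrow> (real \<Rightarrow> 'a L2) \<Rightarrow> 'a L2 \<Rightarrow> 'a L2 \<Rightarrow>
     real \<Rightarrow> nat \<Rightarrow> (nat \<Rightarrow> 'a L2) \<Rightarrow> bool" where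
  "numerical_solution \<Omega> \<kappa> \<alpha> f u0 ubar0 \<tau> N U \<longleftrightarrow>
     U 0 = u0 \<and>
     (\<forall>n\<in>{1..N}. U n \<in> dirichlet_dom \<Omega> \<and>
        delta_t \<tau> U n
          + (1 / \<tau>) *\<^sub>R (w_weight \<alpha> \<tau> 0 *\<^sub>R half_avg U n
              - (\<Sum>k = 1..n - 1. (w_weight \<alpha> \<tau> (k - 1) - w_weight \<alpha> \<tau> k) *\<^sub>R half_avg U (n - k))
              - w_weight \<alpha> \<tau> (n - 1) *\<^sub>R U 0)
          - \<kappa> *\<^sub>R PI_rule (\<alpha> 0 - 1) \<tau> n (\<lambda>j. dirichlet_laplacian \<Omega> (U j))
        = Fbar \<alpha> f ubar0 \<tau> n)"

end

theory Submission
  imports Defs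
begin

text \<open>
  Expansion in the eigenfunctions reduces the theorem to scalar problems with a parameter \<open>\<mu> = \<kappa> \<lambda>\<^sub>i\<close>. Convolving the
  equation with \<open>1 * \<beta>\<close> turns it into \<open>g * y' + \<mu> \<gamma> * y = \<integral> fbar\<close> with \<open>\<gamma>(t) = t\<^bsup>\<alpha>(0)-1\<^esup> / \<Gamma>(\<alpha>(0))\<close>, and
  summation by parts shows that the summed scheme discretises the same identity, with trapezoidal weights for \<open>g\<close>
  and exact cell integrals for \<open>\<gamma>\<close>.

  Stability: the error equation is tested with the averaged errors. The weights \<open>\<omega>\<close> form a positive semidefinite
  Toeplitz form, since their symmetrisation is a convex decreasing nonnegative sequence, that is, a nonnegative
  combination of Fejer kernels. The coefficient of the leading difference is \<open>(g(0) + g(\<tau>)) / 2 \<ge> 1 / 2\<close>.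

  Consistency: \<open>\<alpha>'(0) = \<alpha>''(0) = 0\<close> makes \<open>g\<close> of class \<open>C\<^bsup>1,1\<^esup>\<close>, and the increments of the residual sum up to
  \<open>O(\<tau>\<^sup>2) (1 + \<mu>) (\<bar>y'(0)\<bar> + \<integral> \<bar>y''\<bar>)\<close>. These bounds are square summable over the modes by the Cauchy-Schwarz inequality
  with the weight \<open>t\<^bsup>\<alpha>(0)-2\<^esup>\<close>.
\<close>

subsection \<open>Convex Toeplitz forms\<close>

text \<open>The obstacle is the singularity at the start: u'' may grow like t to the power alpha(0)
  - 2, integrable but unbounded, so the local error near t = 0 need not be O(tau^2) step by step.
  For this reason no pointwise bound is sought. Stability is stated for the l^1 sum of the residual
  increments, and consistency uses only the total variation of u', which is finite. Convolution with
  beta matters because it trades the singular kernel k for one that is regular up to t = 0. The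
  parameter \<mu> enters stability through a nonnegative term alone, so the stability constant is
  uniform over the modes. It enters consistency linearly; this costs two space derivatives, paid for
  by the regularity in the stronger norm and by the smoothness of the initial velocity. The first
  cell is special: the product rule takes the value at index 1 instead of an average. The test
  sequence must start with the same value, since otherwise the quadratic form would pair two
  different sequences.\<close>

lemma card_common_window:
  fixes n j p m :: nat
  assumes "n < m" "j < m"
  shows "card {q. q < m + p \<and> (n \<le> q \<and> q < n + p) \<and> (j \<le> q \<and> q < j + p)} = p - ((n - j) + (j - n))"
proof (cases "n \<le> j")
  case True
  then have "{q. q < m + p \<and> (n \<le> q \<and> q < n + p) \<and> (j \<le> q \<and> q < j + p)} = {j..<n + p}"
    using assms by auto
  then show ?thesis using True by simp
next
  case False
  then have "{q. q < m + p \<and> (n \<le> q \<and> q < n + p) \<and> (j \<le> q \<and> q < j + p)} = {n..<j + p}"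
    using assms by auto
  then show ?thesis using False by simp
qed

text \<open>With truncated subtraction \<open>(n - j) + (j - n)\<close> is the distance of
  \<open>n\<close> and \<open>j\<close>, and \<open>p - ...\<close> is a hat function of it. The hat
  matrix is the Gram matrix of the windows of length \<open>p\<close> starting at \<open>n\<close>
  and at \<open>j\<close>, hence positive semidefinite.\<close>

lemma Fejer_matrix_nonneg:
  fixes x :: "nat \<Rightarrow> real"
  shows "0 \<le> (\<Sum>n<m. \<Sum>j<m. real (p - ((n - j) + (j - n))) * x n * x j)"
proof -
  define I :: "nat \<Rightarrow> nat \<Rightarrow> real" where "I n q = of_bool (n \<le> q \<and> q < n + p)" for n q
  have I: "real (p - ((n - j) + (j - n))) = (\<Sum>q<m + p. I n q * I j q)" if "n < m" "j < m" for n j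
  proof -
    have "(\<Sum>q<m + p. I n q * I j q) = (\<Sum>q\<in>{..<m+p}. of_bool (q \<in> {q. q < m + p \<and> (n \<le> q \<and> q < n + p) \<and> (j \<le> q \<and> q < j + p)}))"
      by (intro sum.cong) (auto simp: I_def)
    also have "\<dots> = real (card {q. q < m + p \<and> (n \<le> q \<and> q < n + p) \<and> (j \<le> q \<and> q < j + p)})"
      by (subst sum_of_bool_eq) (auto intro!: arg_cong[of _ _ card])
    finally show ?thesis using card_common_window[OF that, of p] by simp
  qed
  have "(\<Sum>n<m. \<Sum>j<m. real (p - ((n - j) + (j - n))) * x n * x j)
      = (\<Sum>n<m. \<Sum>j<m. \<Sum>q<m + p. (I n q * x n) * (I j q * x j))"
    by (intro sum.cong refl) (simp add: I sum_distrib_left sum_distrib_right mult_ac)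
  also have "\<dots> = (\<Sum>n<m. \<Sum>q<m + p. \<Sum>j<m. (I n q * x n) * (I j q * x j))"
    by (intro sum.cong refl sum.swap)
  also have "\<dots> = (\<Sum>q<m + p. \<Sum>n<m. \<Sum>j<m. (I n q * x n) * (I j q * x j))"
    by (rule sum.swap)
  also have "\<dots> = (\<Sum>q<m + p. (\<Sum>n<m. I n q * x n)\<^sup>2)"
    by (simp add: power2_eq_square sum_product)
  also have "\<dots> \<ge> 0" by (intro sum_nonneg) auto
  finally show ?thesis .
qed

text \<open>Two summations by parts. Stopping at \<open>M\<close> keeps the sum finite, at the price
  of a constant and one more hat.\<close>

lemma convex_sequence_expansion:
  fixes b :: "nat \<Rightarrow> real"
  assumes "k \<le> M"
  shows "b k = (\<Sum>p<M. (b p - 2 * b (Suc p) + b (Suc (Suc p))) * real (Suc p - k))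
    + b M + real (M - k) * (b M - b (Suc M))"
  using assms
proof (induction M)
  case 0
  then show ?case by simp
next
  case (Suc M)
  show ?case
  proof (cases "k = Suc M")
    case True
    have "(\<Sum>p<M. (b p - 2 * b (Suc p) + b (Suc (Suc p))) * real (Suc p - Suc M)) = 0"
      by (intro sum.neutral) auto
    then show ?thesis using True by simp
  next
    case False
    then have "k \<le> M" using Suc by simp
    then show ?thesis using Suc.IH by (simp add: Suc_diff_le algebra_simps)
  qed
qed

text \<open>Expanding at \<open>M = m\<close>, which no distance exceeds, splits the form into Fejer
  forms weighted by second differences, a rank-one square weighted by \<open>b m\<close>, and a last
  Fejer form weighted by the decrease of \<open>b\<close>. The three hypotheses are the signs of
  these weights.\<close>

lemma convex_Toeplitz_nonneg:
  fixes b x :: "nat \<Rightarrow> real"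
  assumes nn: "\<And>k. 0 \<le> b k" and decr: "\<And>k. b (Suc k) \<le> b k"
    and conv: "\<And>k. 2 * b (Suc k) \<le> b k + b (Suc (Suc k))"
  shows "0 \<le> (\<Sum>n<m. \<Sum>j<m. b ((n - j) + (j - n)) * x n * x j)"
proof -
  define F where "F p = (\<Sum>n<m. \<Sum>j<m. real (p - ((n - j) + (j - n))) * x n * x j)" for p
  have F: "0 \<le> F p" for p unfolding F_def by (rule Fejer_matrix_nonneg)
  define c where "c p = b p - 2 * b (Suc p) + b (Suc (Suc p))" for p
  have sq: "(\<Sum>n<m. x n * (\<Sum>j<m. x j)) = (\<Sum>n<m. x n)\<^sup>2"
    by (simp add: power2_eq_square sum_distrib_right)
  have c: "0 \<le> c p" for p using conv[of p] by (simp add: c_def)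
  have "(\<Sum>n<m. \<Sum>j<m. b ((n - j) + (j - n)) * x n * x j)
     = (\<Sum>n<m. \<Sum>j<m. (\<Sum>p<m. c p * (real (Suc p - ((n - j) + (j - n))) * x n * x j))
         + b m * (x n * x j) + (b m - b (Suc m)) * (real (m - ((n - j) + (j - n))) * x n * x j))"
  proof (intro sum.cong refl)
    fix n j assume "n \<in> {..<m}" "j \<in> {..<m}"
    then have "(n - j) + (j - n) \<le> m" by auto
    from convex_sequence_expansion[OF this, of b]
    have "b ((n - j) + (j - n)) * (x n * x j) = ((\<Sum>p<m. c p * real (Suc p - ((n - j) + (j - n))))
        + b m + real (m - ((n - j) + (j - n))) * (b m - b (Suc m))) * (x n * x j)"
      unfolding c_def by (simp only:)
    then show "b ((n - j) + (j - n)) * x n * x j = (\<Sum>p<m. c p * (real (Suc p - ((n - j) + (j - n))) * x n * x j))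
         + b m * (x n * x j) + (b m - b (Suc m)) * (real (m - ((n - j) + (j - n))) * x n * x j)"
      by (simp only: distrib_right sum_distrib_right) (simp only: mult_ac)
  qed
  also have "\<dots> = (\<Sum>n<m. \<Sum>j<m. \<Sum>p<m. c p * (real (Suc p - ((n - j) + (j - n))) * x n * x j))
     + b m * (\<Sum>n<m. x n)\<^sup>2 + (b m - b (Suc m)) * F m"
    by (simp add: sum.distrib F_def sum_distrib_left[symmetric] sq)
  also have "(\<Sum>n<m. \<Sum>j<m. \<Sum>p<m. c p * (real (Suc p - ((n - j) + (j - n))) * x n * x j))
     = (\<Sum>n<m. \<Sum>p<m. \<Sum>j<m. c p * (real (Suc p - ((n - j) + (j - n))) * x n * x j))"
    by (intro sum.cong refl sum.swap)
  also have "\<dots> = (\<Sum>p<m. \<Sum>n<m. \<Sum>j<m. c p * (real (Suc p - ((n - j) + (j - n))) * x n * x j))"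
    by (rule sum.swap)
  also have "\<dots> = (\<Sum>p<m. c p * F (Suc p))" by (simp add: F_def sum_distrib_left)
  also have "0 \<le> (\<Sum>p<m. c p * F (Suc p)) + b m * (\<Sum>n<m. x n)\<^sup>2 + (b m - b (Suc m)) * F m"
    using c F nn[of m] decr[of m] by (intro add_nonneg_nonneg sum_nonneg mult_nonneg_nonneg) auto
  finally show ?thesis .
qed

lemma sum_symmetric_lower_triangle:
  fixes f :: "nat \<Rightarrow> nat \<Rightarrow> real"
  assumes "\<And>n j. f n j = f j n"
  shows "(\<Sum>n<m. \<Sum>j<m. f n j) = 2 * (\<Sum>n<m. \<Sum>j<n. f n j) + (\<Sum>n<m. f n n)"
proof (induction m)
  case (Suc m)
  have "(\<Sum>n<m. f n m) = (\<Sum>j<m. f m j)" by (intro sum.cong assms refl)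
  then have "(\<Sum>n<Suc m. \<Sum>j<Suc m. f n j) = (\<Sum>n<m. \<Sum>j<m. f n j) + 2 * (\<Sum>j<m. f m j) + f m m"
    by (simp add: sum.distrib)
  then show ?case using Suc by simp
qed simp

text \<open>The diagonal entry is halved, as for a causal kernel tested against itself.\<close>

lemma convex_causal_Toeplitz_nonneg:
  fixes a x :: "nat \<Rightarrow> real"
  assumes nn: "\<And>k. 0 \<le> a k" and decr: "\<And>k. a (Suc (Suc k)) \<le> a (Suc k)"
    and decr0: "a 1 \<le> 2 * a 0" and conv0: "2 * a 1 \<le> 2 * a 0 + a 2"
    and conv: "\<And>k. 2 * a (Suc (Suc k)) \<le> a (Suc k) + a (Suc (Suc (Suc k)))"
  shows "0 \<le> (\<Sum>n<m. (\<Sum>j\<le>n. a (n - j) * x j) * x n)"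
proof -
  define b where "b k = (if k = 0 then 2 * a 0 else a k)" for k
  have "0 \<le> (\<Sum>n<m. \<Sum>j<m. b ((n - j) + (j - n)) * x n * x j)"
  proof (rule convex_Toeplitz_nonneg)
    show "0 \<le> b k" for k using nn[of k] by (auto simp: b_def)
    show "b (Suc k) \<le> b k" for k using decr[of "k - 1"] decr0 by (cases k) (auto simp: b_def)
    show "2 * b (Suc k) \<le> b k + b (Suc (Suc k))" for k
      using conv[of "k - 1"] conv0 by (cases k) (auto simp: b_def numeral_2_eq_2)
  qed
  also have "\<dots> = 2 * (\<Sum>n<m. \<Sum>j<n. b ((n - j) + (j - n)) * x n * x j) + (\<Sum>n<m. b 0 * x n * x n)"
    by (subst sum_symmetric_lower_triangle) (simp_all add: add.commute mult_ac)
  also have "\<dots> = 2 * (\<Sum>n<m. (\<Sum>j\<le>n. a (n - j) * x j) * x n)"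
  proof -
    have "(\<Sum>j\<le>n. a (n - j) * x j) * x n = (\<Sum>j<n. b ((n - j) + (j - n)) * x n * x j) + b 0 / 2 * x n * x n" for n
    proof -
      have "(\<Sum>j<n. b ((n - j) + (j - n)) * x n * x j) = (\<Sum>j<n. a (n - j) * x j) * x n"
        unfolding sum_distrib_right by (intro sum.cong) (auto simp: b_def)
      moreover have "(\<Sum>j\<le>n. a (n - j) * x j) = (\<Sum>j<n. a (n - j) * x j) + a 0 * x n"
        by (simp add: lessThan_Suc_atMost[symmetric])
      ultimately show ?thesis by (simp add: b_def algebra_simps)
    qed
    then show ?thesis by (simp add: sum.distrib sum_distrib_left)
  qed
  finally show ?thesis by simp
qed

section \<open>Second differences of powers\<close>

lemma DERIV_powr_second_difference:
  fixes q x :: real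
  assumes "1 < x"
  shows "((\<lambda>x. (x + 1) powr q - 2 * x powr q + (x - 1) powr q) has_real_derivative
      q * ((x + 1) powr (q - 1) - 2 * x powr (q - 1) + (x - 1) powr (q - 1))) (at x)"
  using assms by (auto intro!: derivative_eq_intros simp: algebra_simps)

text \<open>The factor \<open>r * (r - 1)\<close> lets one statement serve all exponents: the second
  derivative of \<open>r * (r - 1) * x powr r\<close> is a square times a nonnegative power. Below,
  \<open>r\<close> runs through \<open>q\<close>, \<open>q - 1\<close> and \<open>q - 2\<close>,
  where the factor is positive, negative and positive.\<close>

lemma powr_second_difference_sign:
  fixes r x :: real
  assumes x: "1 < x"
  shows "0 \<le> r * (r - 1) * ((x + 1) powr r - 2 * x powr r + (x - 1) powr r)"
proof -
  have "convex_on {0<..} (\<lambda>x. r * (r - 1) * x powr r)"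
  proof (rule f''_ge0_imp_convex)
    show "((\<lambda>x. r * (r - 1) * x powr r) has_real_derivative r * (r - 1) * (r * x powr (r - 1))) (at x)"
      if "x \<in> {0<..}" for x using that by (auto intro!: derivative_eq_intros)
    show "((\<lambda>x. r * (r - 1) * (r * x powr (r - 1))) has_real_derivative
        r * (r - 1) * (r * ((r - 1) * x powr (r - 2)))) (at x)" if "x \<in> {0<..}" for x
      using that by (auto intro!: derivative_eq_intros)
    show "0 \<le> r * (r - 1) * (r * ((r - 1) * x powr (r - 2)))" for x
    proof -
      have "r * (r - 1) * (r * ((r - 1) * x powr (r - 2))) = (r * (r - 1))\<^sup>2 * x powr (r - 2)"
        unfolding power2_eq_square by (simp only: mult_ac)
      then show ?thesis by (simp only:) simp
    qed
  qed (rule convex_real_interval)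
  then have "r * (r - 1) * ((1 - 1/2) *\<^sub>R (x - 1) + (1/2) *\<^sub>R (x + 1)) powr r
     \<le> (1 - 1/2) * (r * (r - 1) * (x - 1) powr r) + (1/2) * (r * (r - 1) * (x + 1) powr r)"
    by (rule convex_onD) (use x in auto)
  moreover have "(1 - 1/2) *\<^sub>R (x - 1) + (1/2) *\<^sub>R (x + 1) = x" by (simp add: field_simps)
  ultimately show ?thesis by (simp add: algebra_simps)
qed

lemma nonneg_of_mult:
  fixes a b :: real
  assumes "0 \<le> a * b" "0 < a"
  shows "0 \<le> b"
  using assms by (auto simp: zero_le_mult_iff)

text \<open>The second derivative of \<open>\<phi>\<close> is q (q - 1) times the second difference
  of the power q - 2, whose sign is known. For \<open>x = 2\<close> the left node is 1, where
  \<open>\<phi>\<close> is continuous but the derivative formula stops; hence the shift by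
  \<open>e\<close> and the limit from the right.\<close>

lemma powr_second_difference_convex:
  fixes q x :: real
  assumes q: "1 < q" "q < 2" and x: "2 \<le> x"
  defines "\<phi> \<equiv> \<lambda>x. (x + 1) powr q - 2 * x powr q + (x - 1) powr q"
  shows "2 * \<phi> x \<le> \<phi> (x - 1) + \<phi> (x + 1)"
proof -
  have cvx: "convex_on {1<..} \<phi>"
  proof (rule f''_ge0_imp_convex)
    let ?d = "\<lambda>r (x::real). (x + 1) powr r - 2 * x powr r + (x - 1) powr r"
    show "(\<phi> has_real_derivative q * ?d (q - 1) x) (at x)" if "x \<in> {1<..}" for x
      unfolding \<phi>_def using that by (intro DERIV_powr_second_difference) auto
    show "((\<lambda>x. q * ?d (q - 1) x) has_real_derivative q * ((q - 1) * ?d (q - 2) x)) (at x)" if "x \<in> {1<..}" for x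
      using DERIV_cmult[OF DERIV_powr_second_difference[of x "q - 1"], of q] that
      by (simp only: greaterThan_iff diff_diff_eq one_add_one)
    show "0 \<le> q * ((q - 1) * ?d (q - 2) x)" if "x \<in> {1<..}" for x
    proof -
      have "0 \<le> (q - 2) * (q - 2 - 1) * ?d (q - 2) x"
        using powr_second_difference_sign[of x "q - 2"] that by simp
      moreover have "0 < (q - 2) * (q - 2 - 1)" using q by (intro mult_neg_neg) auto
      ultimately have "0 \<le> ?d (q - 2) x" by (rule nonneg_of_mult)
      then show ?thesis using q by simp
    qed
  qed (rule convex_real_interval)
  have mid: "2 * \<phi> (2 * x / 2 + e) \<le> \<phi> (x - 1 + e) + \<phi> (x + 1 + e)" if "0 < e" for e
  proof -
    have "\<phi> ((1 - 1/2) *\<^sub>R (x - 1 + e) + (1/2) *\<^sub>R (x + 1 + e)) \<le> (1 - 1/2) * \<phi> (x - 1 + e) + (1/2) * \<phi> (x + 1 + e)"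
      by (rule convex_onD[OF cvx]) (use x that in auto)
    moreover have "(1 - 1/2) *\<^sub>R (x - 1 + e) + (1/2) *\<^sub>R (x + 1 + e) = x + e" by (simp add: field_simps)
    ultimately show ?thesis by simp
  qed
  have lim: "((\<lambda>e. \<phi> (y + e)) \<longlongrightarrow> \<phi> y) (at_right 0)" if "1 \<le> y" for y
  proof -
    have "continuous_on {0..} (\<lambda>e. \<phi> (y + e))"
      unfolding \<phi>_def using q that by (intro continuous_intros continuous_on_powr') auto
    then have "((\<lambda>e. \<phi> (y + e)) \<longlongrightarrow> \<phi> (y + 0)) (at 0 within {0..})"
      unfolding continuous_on by (rule bspec) simp
    then have "((\<lambda>e. \<phi> (y + e)) \<longlongrightarrow> \<phi> (y + 0)) (at_right 0)" by (rule tendsto_within_subset) auto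
    then show ?thesis by simp
  qed
  have l1: "((\<lambda>e. 2 * \<phi> (x + e)) \<longlongrightarrow> 2 * \<phi> x) (at_right 0)" using x by (intro tendsto_mult_left lim) auto
  have l2: "((\<lambda>e. \<phi> (x - 1 + e) + \<phi> (x + 1 + e)) \<longlongrightarrow> \<phi> (x - 1) + \<phi> (x + 1)) (at_right 0)"
    using x by (intro tendsto_add lim) auto
  have l3: "\<forall>\<^sub>F e in at_right 0. 2 * \<phi> (x + e) \<le> \<phi> (x - 1 + e) + \<phi> (x + 1 + e)"
    using eventually_at_right_less[of 0] by eventually_elim (use mid in simp)
  show ?thesis by (rule tendsto_le[OF trivial_limit_at_right_real l2 l1 l3])
qed

text \<open>The derivative is a positive multiple of the second difference of the concave power q -
  1.\<close>

lemma powr_second_difference_decreasing: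
  fixes q x :: real
  assumes q: "1 < q" "q < 2" and x: "1 \<le> x"
  defines "\<phi> \<equiv> \<lambda>x. (x + 1) powr q - 2 * x powr q + (x - 1) powr q"
  shows "\<phi> (x + 1) \<le> \<phi> x"
proof -
  let ?d = "\<lambda>r (x::real). (x + 1) powr r - 2 * x powr r + (x - 1) powr r"
  have "continuous_on {x..x + 1} \<phi>"
    unfolding \<phi>_def using q x by (intro continuous_intros continuous_on_powr') auto
  moreover have "\<exists>D. (\<phi> has_real_derivative D) (at y) \<and> D \<le> 0" if "x < y" "y < x + 1" for y
  proof (intro exI conjI)
    show "(\<phi> has_real_derivative q * ?d (q - 1) y) (at y)"
      unfolding \<phi>_def using that x by (intro DERIV_powr_second_difference) auto
    have "0 \<le> (q - 1) * (q - 1 - 1) * ?d (q - 1) y"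
      using powr_second_difference_sign[of y "q - 1"] that x by simp
    moreover have "(q - 1) * (q - 1 - 1) < 0" using q by (intro mult_pos_neg) auto
    ultimately have "?d (q - 1) y \<le> 0"
      using nonneg_of_mult[of "- ((q - 1) * (q - 1 - 1))" "- ?d (q - 1) y"] by (simp only: minus_mult_minus minus_mult_left[symmetric] minus_minus mult_minus_left mult_minus_right neg_0_less_iff_less neg_0_le_iff_le)
    then show "q * ?d (q - 1) y \<le> 0" using q by (simp add: mult_nonneg_nonpos)
  qed
  ultimately show ?thesis
    using DERIV_nonpos_imp_decreasing_open[of x "x + 1" \<phi>] by auto
qed

text \<open>This is the convexity condition at the diagonal,
  \<open>2 * a 1 \<le> 2 * a 0 + a 2\<close>, for the weights of the rule. Equality holds at
  \<open>q = 2\<close>, and \<open>3 powr q - 4 * 2 powr q\<close> decreases up to there; the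
  numerical input is 3^9 < 2^16.\<close>

lemma two_three_powr_bound:
  fixes q :: real
  assumes q: "1 < q" "q < 2"
  shows "4 * 2 powr q \<le> 7 + 3 powr q"
proof -
  let ?f = "\<lambda>q::real. 3 powr q - 4 * 2 powr q"
  have "?f 2 \<le> ?f q"
  proof (rule DERIV_nonpos_imp_nonincreasing[of q 2 ?f])
    fix x :: real assume x: "q \<le> x" "x \<le> 2"
    have "(?f has_real_derivative 3 powr x * ln 3 - 4 * (2 powr x * ln 2)) (at x)"
      by (auto intro!: derivative_eq_intros)
    moreover have "3 powr x * ln 3 - 4 * (2 powr x * ln 2) \<le> 0"
    proof -
      have "3 powr x = 2 powr x * (3/2) powr x" by (simp flip: powr_mult)
      also have "(3/2) powr x \<le> (3/2::real) powr 2" using x by (intro powr_mono) auto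
      also have "(3/2::real) powr 2 = 9/4" by (simp add: power2_eq_square)
      finally have "3 powr x \<le> 2 powr x * (9/4)" by simp
      then have "3 powr x * ln 3 \<le> 2 powr x * (9/4) * ln 3" by (intro mult_right_mono) auto
      also have "\<dots> = 2 powr x / 4 * (9 * ln 3)" by simp
      also have "9 * ln (3::real) \<le> 16 * ln 2"
        using ln_realpow[of "3::real" 9] ln_realpow[of "2::real" 16] ln_le_cancel_iff[of "3^9::real" "2^16"] by simp
      then have "2 powr x / 4 * (9 * ln 3) \<le> 2 powr x / 4 * (16 * ln (2::real))" by (intro mult_left_mono) auto
      finally show ?thesis by (simp add: mult_ac)
    qed
    ultimately show "\<exists>y. (?f has_real_derivative y) (at x) \<and> y \<le> 0" by blast
  qed (use q in auto)
  then show ?thesis by (simp add: power2_eq_square)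
qed

text \<open>The weights \<open>\<tau> \<omega>\<^bsub>n,n-k\<^esub>\<close> divided by \<open>\<tau>\<^sup>q / \<Gamma>(q + 1)\<close>, where \<open>q = \<alpha>(0)\<close>.\<close>

definition pi_weight :: "real \<Rightarrow> nat \<Rightarrow> real" where
  "pi_weight q k = (if k = 0 then 1 else (real k + 1) powr q - 2 * real k powr q + (real k - 1) powr q)"

lemma pi_weight_form_nonneg:
  assumes q: "1 < q" "q < 2"
  shows "0 \<le> (\<Sum>n<m. (\<Sum>j\<le>n. pi_weight q (n - j) * x j) * x n)"
proof (rule convex_causal_Toeplitz_nonneg)
  have two: "(2::real) powr q \<le> 4" using q powr_mono[of q 2 "2::real"] by simp
  have two': "2 \<le> (2::real) powr q" using q powr_mono[of 1 q "2::real"] by simp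
  show "2 * pi_weight q 1 \<le> 2 * pi_weight q 0 + pi_weight q 2"
    using two_three_powr_bound[OF q] by (simp add: pi_weight_def)
  show "pi_weight q 1 \<le> 2 * pi_weight q 0" using two by (simp add: pi_weight_def)
  show "pi_weight q (Suc (Suc k)) \<le> pi_weight q (Suc k)" for k
    using powr_second_difference_decreasing[OF q, of "real (Suc k)"] by (simp add: pi_weight_def algebra_simps)
  show "2 * pi_weight q (Suc (Suc k)) \<le> pi_weight q (Suc k) + pi_weight q (Suc (Suc (Suc k)))" for k
    using powr_second_difference_convex[OF q, of "real (Suc (Suc k))"] by (simp add: pi_weight_def algebra_simps)
  show "0 \<le> pi_weight q k" for k
  proof -
    consider "k = 0" | "k = 1" | "1 < k" by linarith
    then show ?thesis
    proof cases
      case 2 then show ?thesis using two' by (simp add: pi_weight_def)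
    next
      case 3
      have "0 < q * (q - 1)" using q by simp
      then show ?thesis using powr_second_difference_sign[of "real k" q] 3
        by (auto simp: pi_weight_def zero_le_mult_iff)
    qed (simp add: pi_weight_def)
  qed
qed

subsection \<open>Stability of the averaged scheme\<close>

text \<open>The induction bounds the whole right-hand side, which grows by the factor
  \<open>1 + b\<close> per step. The sum is strictly causal, so \<open>b\<close> may be of any
  size.\<close>

lemma discrete_Gronwall:
  fixes E :: "nat \<Rightarrow> real"
  assumes le: "\<And>m. m \<le> N \<Longrightarrow> E m \<le> a + b * (\<Sum>n<m. E n)" and b: "0 \<le> b" and m: "m \<le> N"
  shows "E m \<le> a * (1 + b) ^ m"
proof -
  have "a + b * (\<Sum>n<m. E n) \<le> a * (1 + b) ^ m" using m
  proof (induction m)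
    case (Suc m)
    have "a + b * (\<Sum>n<Suc m. E n) = (a + b * (\<Sum>n<m. E n)) + b * E m" by (simp add: algebra_simps)
    also have "\<dots> \<le> (1 + b) * (a + b * (\<Sum>n<m. E n))"
      using mult_left_mono[OF le[of m] b] Suc by (simp add: algebra_simps)
    also have "\<dots> \<le> (1 + b) * (a * (1 + b) ^ m)" using Suc b by (intro mult_left_mono) auto
    finally show ?case by (simp add: algebra_simps)
  qed simp
  then show ?thesis using le[OF m] by linarith
qed

text \<open>The energy controls values of \<open>e\<close>, not increments. Summation by parts moves
  the difference to the kernel; when \<open>D\<close> is itself a difference, second differences
  appear.\<close>

lemma Abel_causal_sum:
  fixes D e :: "nat \<Rightarrow> real"
  shows "(\<Sum>j\<le>p. D (p - j) * (e (Suc j) - e j))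
     = D 0 * e (Suc p) - D p * e 0 + (\<Sum>j<p. (D (p - j) - D (p - Suc j)) * e (Suc j))"
proof -
  have "(\<Sum>j\<le>p. D (p - j) * e j) = D p * e 0 + (\<Sum>j<p. D (p - Suc j) * e (Suc j))"
    by (simp add: sum.atMost_shift)
  moreover have "(\<Sum>j\<le>p. D (p - j) * e (Suc j)) = D 0 * e (Suc p) + (\<Sum>j<p. D (p - j) * e (Suc j))"
    by (simp add: lessThan_Suc_atMost[symmetric])
  ultimately show ?thesis by (simp add: algebra_simps sum_subtractf)
qed

text \<open>From the second step on the products are differences of squares and telescope. In the
  first step \<open>eb 0 = e 1\<close> gives a full square instead of half of it, whence the extra
  term with \<open>e 1\<close>.\<close>

lemma averaged_energy_identity:
  fixes e eb :: "nat \<Rightarrow> real"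
  assumes "e 0 = 0" "eb 0 = e 1" "\<And>j. eb (Suc j) = (e (Suc (Suc j)) + e (Suc j)) / 2"
  shows "(\<Sum>n<Suc m. (e (Suc n) - e n) * eb n) = ((e (Suc m))\<^sup>2 + (e 1)\<^sup>2) / 2"
proof (induction m)
  case 0
  then show ?case using assms by (simp add: power2_eq_square)
next
  case (Suc m)
  have "(e (Suc (Suc m)) - e (Suc m)) * eb (Suc m) = ((e (Suc (Suc m)))\<^sup>2 - (e (Suc m))\<^sup>2) / 2"
    unfolding assms(3) by (simp add: power2_eq_square field_simps)
  then show ?case using Suc by (subst sum.lessThan_Suc) (simp add: field_simps)
qed

text \<open>
  Energy estimate obtained by testing with \<open>eb\<close>. Only the strictly causal part of the \<open>gh\<close>-terms is moved to
  the right-hand side, so that Gronwall's inequality needs no restriction on the step size.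
\<close>

lemma averaged_scheme_stability:
  fixes e eb \<rho> gh a :: "nat \<Rightarrow> real" and \<mu> \<delta> \<delta>' :: real
  assumes e0: "e 0 = 0" and eb0: "eb 0 = e 1"
    and eb: "\<And>j. eb (Suc j) = (e (Suc (Suc j)) + e (Suc j)) / 2"
    and half: "1 / 2 \<le> gh 0"
    and d1: "\<And>k. Suc k < N \<Longrightarrow> \<bar>gh (Suc k) - gh k\<bar> \<le> \<delta>"
    and d2: "\<And>k. Suc (Suc k) < N \<Longrightarrow> \<bar>(gh (Suc (Suc k)) - gh (Suc k)) - (gh (Suc k) - gh k)\<bar> \<le> \<delta>'"
    and \<delta>': "0 \<le> \<delta>'" "real N * \<delta>' \<le> \<delta>"
    and eq: "\<And>n. n < N \<Longrightarrow> gh 0 * (e (Suc n) - e n)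
        + (\<Sum>j<n. (gh (n - j) - gh (n - Suc j)) * (e (Suc j) - e j))
        + \<mu> * (\<Sum>j\<le>n. a (n - j) * eb j) = \<rho> n"
    and \<mu>: "0 \<le> \<mu>" and psd: "\<And>m. 0 \<le> (\<Sum>n<m. (\<Sum>j\<le>n. a (n - j) * eb j) * eb n)"
    and m: "m \<le> N"
  shows "\<bar>e m\<bar> \<le> 4 * exp (8 * \<delta> * real N) * (\<Sum>n<N. \<bar>\<rho> n\<bar>)"
proof -
  have \<delta>: "0 \<le> \<delta>" using \<delta>' mult_nonneg_nonneg[of "real N" \<delta>'] by linarith
  \<comment> \<open>The running maximum is monotone in time, so the whole history can be bounded by
    its current value.\<close>
  define E where "E n = Max ((\<lambda>j. \<bar>e j\<bar>) ` {..n})" for n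
  define S where "S n = (\<Sum>j<n. (gh (n - j) - gh (n - Suc j)) * (e (Suc j) - e j))" for n
  have E_ge: "\<bar>e j\<bar> \<le> E n" if "j \<le> n" for j n unfolding E_def using that by (intro Max_ge) auto
  have E_nn: "0 \<le> E n" for n using E_ge[of 0 n] by simp
  \<comment> \<open>One \<open>\<delta>\<close> is the boundary term of the summation by parts; the
    other collects at most \<open>N\<close> second differences of size
    \<open>\<delta>'\<close>.\<close>
  have S_le: "\<bar>S n\<bar> \<le> 2 * \<delta> * E n" if n: "n < N" for n
  proof (cases n)
    case 0
    then show ?thesis using \<delta> E_nn[of 0] by (simp add: S_def)
  next
    case (Suc p)
    define D where "D k = gh (Suc k) - gh k" for k
    have "S n = (\<Sum>j\<le>p. D (p - j) * (e (Suc j) - e j))"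
      unfolding S_def Suc lessThan_Suc_atMost D_def by (intro sum.cong) (auto simp: Suc_diff_le)
    also have "\<dots> = D 0 * e (Suc p) + (\<Sum>j<p. (D (p - j) - D (p - Suc j)) * e (Suc j))"
      unfolding Abel_causal_sum by (simp add: e0)
    also have "\<bar>\<dots>\<bar> \<le> \<bar>D 0 * e (Suc p)\<bar> + (\<Sum>j<p. \<bar>(D (p - j) - D (p - Suc j)) * e (Suc j)\<bar>)"
      by (intro order_trans[OF abs_triangle_ineq] add_mono sum_abs) auto
    also have "\<dots> \<le> \<delta> * E n + (\<Sum>j<p. \<delta>' * E n)"
    proof (intro add_mono sum_mono)
      show "\<bar>D 0 * e (Suc p)\<bar> \<le> \<delta> * E n"
        unfolding abs_mult D_def using d1[of 0] E_ge[of n n] n Suc \<delta> by (intro mult_mono) auto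
      fix j assume j: "j \<in> {..<p}"
      then have 1: "p - j = Suc (p - Suc j)" by auto
      have "\<bar>D (p - j) - D (p - Suc j)\<bar> \<le> \<delta>'"
        unfolding D_def 1 using n Suc j by (intro d2) auto
      then show "\<bar>(D (p - j) - D (p - Suc j)) * e (Suc j)\<bar> \<le> \<delta>' * E n"
        unfolding abs_mult using E_ge[of "Suc j" n] Suc j \<delta>' by (intro mult_mono) auto
    qed
    also have "\<dots> = \<delta> * E n + (real p * \<delta>') * E n" by simp
    also have "\<dots> \<le> \<delta> * E n + \<delta> * E n"
    proof -
      have "real p * \<delta>' \<le> real N * \<delta>'" using n Suc \<delta>' by (intro mult_right_mono) auto
      then show ?thesis using \<delta>' E_nn[of n] by (intro add_left_mono mult_right_mono) auto
    qed
    finally show ?thesis by simp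
  qed
  have E_mono: "E k \<le> E n" if "k \<le> n" for k n
    unfolding E_def using that by (intro Max_mono image_mono) auto
  define R where "R = (\<Sum>n<N. \<bar>\<rho> n\<bar>)"
  have step: "E M \<le> 4 * R + 8 * \<delta> * (\<Sum>n<M. E n)" if M: "M \<le> N" for M
  proof -
    have "E M \<in> (\<lambda>j. \<bar>e j\<bar>) ` {..M}" unfolding E_def by (intro Max_in) auto
    \<comment> \<open>Testing stops at the index where the running maximum is attained. The energy
      then contains the square of \<open>E M\<close>, and one factor can be cancelled.\<close>
    then obtain k where k: "k \<le> M" "E M = \<bar>e k\<bar>" by auto
    show ?thesis
    proof (cases k)
      case 0
      then have "E M = 0" using k e0 by simp
      moreover have "0 \<le> R" unfolding R_def by (intro sum_nonneg) auto
      moreover have "0 \<le> \<delta> * (\<Sum>n<M. E n)" using \<delta> E_nn by (intro mult_nonneg_nonneg sum_nonneg) auto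
      ultimately show ?thesis by simp
    next
      case (Suc k')
      have eb_le: "\<bar>eb n\<bar> \<le> E M" if "n < k" for n
      proof (cases n)
        case 0
        then show ?thesis using eb0 E_ge[of 1 M] k that by auto
      next
        case (Suc n')
        have "\<bar>e (Suc (Suc n'))\<bar> \<le> E M" "\<bar>e (Suc n')\<bar> \<le> E M"
          using E_ge[of "Suc (Suc n')" M] E_ge[of "Suc n'" M] that k(1) Suc by auto
        then show ?thesis unfolding Suc eb by (simp add: abs_le_iff)
      qed
      \<comment> \<open>The surplus square of \<open>e 1\<close> from the first cell is nonnegative
        and is dropped.\<close>
      have "gh 0 * (e k)\<^sup>2 / 2 \<le> gh 0 * (((e k)\<^sup>2 + (e 1)\<^sup>2) / 2)" using half by (simp add: field_simps)
      also have "\<dots> = (\<Sum>n<k. gh 0 * (e (Suc n) - e n) * eb n)"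
        unfolding Suc by (simp only: mult.assoc sum_distrib_left[symmetric] averaged_energy_identity[OF e0 eb0 eb])
      also have "\<dots> = (\<Sum>n<k. (\<rho> n - S n) * eb n) - \<mu> * (\<Sum>n<k. (\<Sum>j\<le>n. a (n - j) * eb j) * eb n)"
        unfolding sum_distrib_left sum_subtractf[symmetric]
      proof (intro sum.cong refl)
        fix n assume "n \<in> {..<k}"
        then have *: "gh 0 * (e (Suc n) - e n) = \<rho> n - S n - \<mu> * (\<Sum>j\<le>n. a (n - j) * eb j)"
          using eq[of n] k M unfolding S_def by simp
        show "gh 0 * (e (Suc n) - e n) * eb n = (\<rho> n - S n) * eb n - \<mu> * ((\<Sum>j\<le>n. a (n - j) * eb j) * eb n)"
          unfolding * by (simp add: algebra_simps)
      qed
      also have "\<dots> \<le> (\<Sum>n<k. (\<rho> n - S n) * eb n)" using mult_nonneg_nonneg[OF \<mu> psd[of k]] by simp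
      also have "\<dots> \<le> (\<Sum>n<k. (\<bar>\<rho> n\<bar> + 2 * \<delta> * E n) * E M)"
      proof (intro sum_mono)
        fix n assume n: "n \<in> {..<k}"
        have "(\<rho> n - S n) * eb n \<le> \<bar>\<rho> n - S n\<bar> * \<bar>eb n\<bar>" by (simp flip: abs_mult)
        also have "\<dots> \<le> (\<bar>\<rho> n\<bar> + 2 * \<delta> * E n) * E M"
          using S_le[of n] eb_le[of n] n k M \<delta> E_nn by (intro mult_mono) auto
        finally show "(\<rho> n - S n) * eb n \<le> (\<bar>\<rho> n\<bar> + 2 * \<delta> * E n) * E M" .
      qed
      also have "\<dots> = ((\<Sum>n<k. \<bar>\<rho> n\<bar>) + 2 * \<delta> * (\<Sum>n<k. E n)) * E M"
        by (simp add: sum.distrib sum_distrib_left sum_distrib_right distrib_right)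
      also have "\<dots> \<le> (R + 2 * \<delta> * (\<Sum>n<M. E n)) * E M"
        unfolding R_def using k M \<delta> E_nn
        by (intro mult_right_mono add_mono mult_left_mono sum_mono2) auto
      finally have "gh 0 * (e k)\<^sup>2 / 2 \<le> (R + 2 * \<delta> * (\<Sum>n<M. E n)) * E M" .
      moreover have "1 / 2 * (e k)\<^sup>2 / 2 \<le> gh 0 * (e k)\<^sup>2 / 2"
        using half by (intro divide_right_mono mult_right_mono) auto
      moreover have "(e k)\<^sup>2 = E M * E M" unfolding k(2) by (simp add: power2_eq_square)
      \<comment> \<open>The factor 4 undoes the one half of the energy and the lower bound one half
        for \<open>gh 0\<close>.\<close>
      ultimately have *: "E M * E M \<le> (4 * R + 8 * \<delta> * (\<Sum>n<M. E n)) * E M" by (simp add: algebra_simps)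
      show ?thesis
      proof (cases "E M = 0")
        case True
        have "0 \<le> R" unfolding R_def by (intro sum_nonneg) auto
        moreover have "0 \<le> \<delta> * (\<Sum>n<M. E n)" using \<delta> E_nn by (intro mult_nonneg_nonneg sum_nonneg) auto
        ultimately show ?thesis using True by simp
      next
        case False
        then show ?thesis using * E_nn[of M] by (metis less_eq_real_def mult_le_cancel_right_pos)
      qed
    qed
  qed
  have R: "0 \<le> R" unfolding R_def by (intro sum_nonneg) auto
  have "\<bar>e m\<bar> \<le> E m" by (rule E_ge) simp
  also have "\<dots> \<le> 4 * R * (1 + 8 * \<delta>) ^ m"
    using discrete_Gronwall[of N E "4 * R" "8 * \<delta>" m] step \<delta> m by auto
  also have "\<dots> \<le> 4 * R * exp (8 * \<delta> * real N)"
  proof (rule mult_left_mono)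
    have "(1 + 8 * \<delta>) ^ m \<le> exp (8 * \<delta>) ^ m" using \<delta> by (intro power_mono exp_ge_add_one_self) auto
    also have "\<dots> = exp (8 * \<delta> * real m)" by (simp add: exp_of_nat_mult[symmetric] mult.commute)
    also have "\<dots> \<le> exp (8 * \<delta> * real N)" using m \<delta> by (simp add: mult_left_mono)
    finally show "(1 + 8 * \<delta>) ^ m \<le> exp (8 * \<delta> * real N)" .
  qed (use R in simp)
  finally show ?thesis by (simp add: R_def mult_ac)
qed

text \<open>Young's inequality for sequences in l^1, by exchanging the sums.\<close>

lemma sum_causal_convolution_le:
  fixes q Z :: "nat \<Rightarrow> real"
  assumes "\<And>k. k < N \<Longrightarrow> 0 \<le> q k" "\<And>j. j < N \<Longrightarrow> 0 \<le> Z j"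
  shows "(\<Sum>n<N. \<Sum>j\<le>n. q (n - j) * Z j) \<le> (\<Sum>k<N. q k) * (\<Sum>j<N. Z j)"
proof -
  have "(\<Sum>n<N. \<Sum>j\<le>n. q (n - j) * Z j) = (\<Sum>n<N. \<Sum>j<N. if j \<le> n then q (n - j) * Z j else 0)"
    by (intro sum.cong refl sum.mono_neutral_cong_left) auto
  also have "\<dots> = (\<Sum>j<N. \<Sum>n<N. if j \<le> n then q (n - j) * Z j else 0)" by (rule sum.swap)
  also have "\<dots> \<le> (\<Sum>j<N. (\<Sum>k<N. q k) * Z j)"
  proof (intro sum_mono)
    fix j assume "j \<in> {..<N}"
    have "(\<Sum>n<N. if j \<le> n then q (n - j) * Z j else 0) = (\<Sum>n\<in>{j..<N}. q (n - j) * Z j)"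
      by (intro sum.mono_neutral_cong_right) auto
    also have "\<dots> = (\<Sum>k\<in>{..<N - j}. q k * Z j)"
      by (rule sum.reindex_bij_witness[of _ "\<lambda>k. k + j" "\<lambda>n. n - j"]) auto
    also have "\<dots> \<le> (\<Sum>k<N. q k * Z j)"
      using \<open>j \<in> {..<N}\<close> by (intro sum_mono2 mult_nonneg_nonneg assms) auto
    finally show "(\<Sum>n<N. if j \<le> n then q (n - j) * Z j else 0) \<le> (\<Sum>k<N. q k) * Z j"
      by (simp add: sum_distrib_right)
  qed
  finally show ?thesis by (simp add: sum_distrib_left)
qed

text \<open>The increment in \<open>n\<close> acts on the lag index of \<open>F\<close>. The newest
  cell enters with lag 0, where there is nothing to subtract, so its full size is charged to
  \<open>q 0\<close>.\<close>

lemma variation_causal_sum: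
  fixes F :: "nat \<Rightarrow> nat \<Rightarrow> real"
  assumes q: "\<And>k. k < N \<Longrightarrow> 0 \<le> q k" and Z: "\<And>j. j < N \<Longrightarrow> 0 \<le> Z j"
    and F0: "\<And>j. j < N \<Longrightarrow> \<bar>F 0 j\<bar> \<le> q 0 * Z j"
    and F: "\<And>k j. Suc k + j < N \<Longrightarrow> \<bar>F (Suc k) j - F k j\<bar> \<le> q (Suc k) * Z j"
  shows "(\<Sum>n<N. \<bar>(\<Sum>j<Suc n. F (n - j) j) - (\<Sum>j<n. F (n - Suc j) j)\<bar>) \<le> (\<Sum>k<N. q k) * (\<Sum>j<N. Z j)"
proof -
  have "\<bar>(\<Sum>j<Suc n. F (n - j) j) - (\<Sum>j<n. F (n - Suc j) j)\<bar> \<le> (\<Sum>j\<le>n. q (n - j) * Z j)" if n: "n < N" for n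
  proof -
    have "(\<Sum>j<Suc n. F (n - j) j) - (\<Sum>j<n. F (n - Suc j) j)
        = F 0 n + (\<Sum>j<n. F (n - j) j - F (n - Suc j) j)"
      by (simp add: sum_subtractf)
    also have "\<bar>\<dots>\<bar> \<le> \<bar>F 0 n\<bar> + (\<Sum>j<n. \<bar>F (n - j) j - F (n - Suc j) j\<bar>)"
      by (intro order_trans[OF abs_triangle_ineq] add_mono sum_abs) auto
    also have "\<dots> \<le> q 0 * Z n + (\<Sum>j<n. q (n - j) * Z j)"
    proof (intro add_mono sum_mono)
      fix j assume "j \<in> {..<n}"
      then have 1: "n - j = Suc (n - Suc j)" by auto
      show "\<bar>F (n - j) j - F (n - Suc j) j\<bar> \<le> q (n - j) * Z j"
        unfolding 1 using n \<open>j \<in> {..<n}\<close> by (intro F) auto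
    qed (use F0 n in auto)
    also have "\<dots> = (\<Sum>j\<le>n. q (n - j) * Z j)" by (simp add: lessThan_Suc_atMost[symmetric])
    finally show ?thesis .
  qed
  then have "(\<Sum>n<N. \<bar>(\<Sum>j<Suc n. F (n - j) j) - (\<Sum>j<n. F (n - Suc j) j)\<bar>) \<le> (\<Sum>n<N. \<Sum>j\<le>n. q (n - j) * Z j)"
    by (intro sum_mono) auto
  also have "\<dots> \<le> (\<Sum>k<N. q k) * (\<Sum>j<N. Z j)" by (rule sum_causal_convolution_le[OF q Z])
  finally show ?thesis .
qed

text \<open>Complementary to the previous estimate: for products the increment is moved onto
  \<open>b\<close>, so smallness of \<open>D\<close> is enough and no differences of
  \<open>D\<close> occur. In the applications \<open>b\<close> samples \<open>y1\<close>, whose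
  variation is finite.\<close>

lemma variation_causal_product_sum:
  fixes D b :: "nat \<Rightarrow> real"
  shows "(\<Sum>n<N. \<bar>(\<Sum>j<Suc n. D (n - j) * b j) - (\<Sum>j<n. D (n - Suc j) * b j)\<bar>)
     \<le> (\<Sum>k<N. \<bar>D k\<bar>) * (\<bar>b 0\<bar> + (\<Sum>j<N. \<bar>b (Suc j) - b j\<bar>))"
proof -
  \<comment> \<open>The first value counts as a jump from zero.\<close>
  define c where "c j = (case j of 0 \<Rightarrow> \<bar>b 0\<bar> | Suc i \<Rightarrow> \<bar>b (Suc i) - b i\<bar>)" for j
  have c: "0 \<le> c j" for j by (auto simp: c_def split: nat.split)
  have "\<bar>(\<Sum>j<Suc n. D (n - j) * b j) - (\<Sum>j<n. D (n - Suc j) * b j)\<bar> \<le> (\<Sum>j\<le>n. \<bar>D (n - j)\<bar> * c j)" for n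
  proof -
    have "(\<Sum>j<Suc n. D (n - j) * b j) = D n * b 0 + (\<Sum>j<n. D (n - Suc j) * b (Suc j))"
      by (simp only: sum.lessThan_Suc_shift) simp
    then have "(\<Sum>j<Suc n. D (n - j) * b j) - (\<Sum>j<n. D (n - Suc j) * b j)
        = D n * b 0 + (\<Sum>j<n. D (n - Suc j) * (b (Suc j) - b j))"
      by (simp add: sum_subtractf algebra_simps)
    also have "\<bar>\<dots>\<bar> \<le> \<bar>D n * b 0\<bar> + (\<Sum>j<n. \<bar>D (n - Suc j) * (b (Suc j) - b j)\<bar>)"
      by (intro order_trans[OF abs_triangle_ineq] add_mono sum_abs) auto
    also have "\<dots> = (\<Sum>j\<le>n. \<bar>D (n - j)\<bar> * c j)"
      by (simp add: sum.atMost_shift c_def abs_mult)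
    finally show ?thesis .
  qed
  then have "(\<Sum>n<N. \<bar>(\<Sum>j<Suc n. D (n - j) * b j) - (\<Sum>j<n. D (n - Suc j) * b j)\<bar>)
      \<le> (\<Sum>n<N. \<Sum>j\<le>n. \<bar>D (n - j)\<bar> * c j)"
    by (intro sum_mono) auto
  also have "\<dots> \<le> (\<Sum>k<N. \<bar>D k\<bar>) * (\<Sum>j<N. c j)"
    by (rule sum_causal_convolution_le) (auto simp: c)
  also have "(\<Sum>j<N. c j) \<le> \<bar>b 0\<bar> + (\<Sum>j<N. \<bar>b (Suc j) - b j\<bar>)"
  proof -
    have "(\<Sum>j<N. c j) \<le> (\<Sum>j<Suc N. c j)" using c by simp
    also have "\<dots> = \<bar>b 0\<bar> + (\<Sum>j<N. \<bar>b (Suc j) - b j\<bar>)"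
      by (simp only: sum.lessThan_Suc_shift) (simp add: c_def)
    finally show ?thesis .
  qed
  finally show ?thesis by (simp add: mult_left_mono sum_nonneg)
qed

subsection \<open>Truncation errors\<close>

lemma integral_shift_origin:
  fixes f :: "real \<Rightarrow> real"
  assumes "continuous_on {a..a + h} f"
  shows "integral {a..a + h} f = integral {0..h} (\<lambda>x. f (a + x))"
  using integral_shift[of 0 a h f] assms by (simp add: o_def add.commute)

lemma integral_cells:
  fixes f :: "real \<Rightarrow> real"
  assumes \<tau>: "0 \<le> \<tau>" and f: "continuous_on {0..real m * \<tau>} f"
  shows "integral {0..real m * \<tau>} f = (\<Sum>j<m. integral {0..\<tau>} (\<lambda>x. f (real j * \<tau> + x)))"
  using f
proof (induction m)
  case (Suc m)
  have le: "real m * \<tau> \<le> real (Suc m) * \<tau>" using \<tau> by (intro mult_right_mono) auto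
  have s: "real (Suc m) * \<tau> = real m * \<tau> + \<tau>" by (simp add: algebra_simps)
  have c1: "continuous_on {0..real m * \<tau>} f" using le by (intro continuous_on_subset[OF Suc.prems]) auto
  have c2: "continuous_on {real m * \<tau>..real m * \<tau> + \<tau>} f"
    unfolding s[symmetric] using \<tau> by (intro continuous_on_subset[OF Suc.prems]) auto
  have "integral {0..real (Suc m) * \<tau>} f = integral {0..real m * \<tau>} f + integral {real m * \<tau>..real (Suc m) * \<tau>} f"
    using \<tau> le Suc.prems by (intro Henstock_Kurzweil_Integration.integral_combine[symmetric] integrable_continuous_interval) auto
  then show ?case using Suc.IH[OF c1] integral_shift_origin[OF c2] by (simp only: s sum.lessThan_Suc)
qed simp

lemma integral_reflect_origin:
  fixes f :: "real \<Rightarrow> real"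
  assumes "continuous_on {0..h} f"
  shows "integral {0..h} (\<lambda>x. f (h - x)) = integral {0..h} f"
proof -
  have "integral {0..h} (\<lambda>x. f (h - x)) = integral {- h..0} (\<lambda>x. f (h + x))"
    using Henstock_Kurzweil_Integration.integral_reflect_real[of 0 "-h" "\<lambda>x. f (h + x)"] by simp
  also have "\<dots> = integral {0..h} f"
    using integral_shift[of "-h" h 0 f] assms by (simp add: o_def add.commute)
  finally show ?thesis .
qed

lemma abs_integral_le:
  fixes f :: "real \<Rightarrow> real"
  assumes "0 \<le> h" "continuous_on {0..h} f" "\<And>x. 0 \<le> x \<Longrightarrow> x \<le> h \<Longrightarrow> \<bar>f x\<bar> \<le> B"
  shows "\<bar>integral {0..h} f\<bar> \<le> B * h"
  using integral_bound[of 0 h f B] assms by auto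

text \<open>The derivative is measured only through \<open>V\<close>, a majorant of its variation.
  This admits a second derivative that is integrable but unbounded near 0; the error bounds will
  contain nothing of \<open>y\<close> but \<open>y1 0\<close> and \<open>V T\<close>.\<close>

context
  fixes \<tau> T :: real and N :: nat and y y1 V :: "real \<Rightarrow> real"
  assumes \<tau>: "0 < \<tau>" and T: "real N * \<tau> = T"
    and y: "\<And>s. s \<in> {0..T} \<Longrightarrow> (y has_real_derivative y1 s) (at s within {0..T})"
    and y1: "continuous_on {0..T} y1"
    and V: "\<And>r s. 0 \<le> r \<Longrightarrow> r \<le> s \<Longrightarrow> s \<le> T \<Longrightarrow> \<bar>y1 s - y1 r\<bar> \<le> V s - V r"
    and V0: "V 0 = 0"
begin

lemma cell_bounds:
  assumes "j < N" "0 \<le> x" "x \<le> \<tau>"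
  shows "0 \<le> real j * \<tau> + x" "real j * \<tau> + x \<le> T" "real j * \<tau> + x \<le> real (Suc j) * \<tau>" "real (Suc j) * \<tau> \<le> T"
    "0 \<le> real (Suc j) * \<tau> - x" "real (Suc j) * \<tau> - x \<le> T" "real j * \<tau> \<le> T" "0 \<le> real j * \<tau>"
    "real j * \<tau> \<le> real (Suc j) * \<tau> - x"
proof -
  have "real (Suc j) * \<tau> \<le> real N * \<tau>" using assms \<tau> by (intro mult_right_mono) auto
  then have 1: "real j * \<tau> + \<tau> \<le> T" using T by (simp add: algebra_simps)
  have 2: "0 \<le> real j * \<tau>" using \<tau> by simp
  have s: "real (Suc j) * \<tau> = real j * \<tau> + \<tau>" by (simp add: distrib_right)
  show "0 \<le> real j * \<tau> + x" "real j * \<tau> + x \<le> T" "real j * \<tau> + x \<le> real (Suc j) * \<tau>" "real (Suc j) * \<tau> \<le> T"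
    "0 \<le> real (Suc j) * \<tau> - x" "real (Suc j) * \<tau> - x \<le> T" "real j * \<tau> \<le> T" "0 \<le> real j * \<tau>"
    "real j * \<tau> \<le> real (Suc j) * \<tau> - x"
    using 1 2 assms(2,3) by (simp_all only: s)
qed

lemma y_continuous: "continuous_on {0..T} y"
  using y by (meson DERIV_continuous_on)

lemma cell_increment:
  assumes "j < N"
  shows "y (real (Suc j) * \<tau>) - y (real j * \<tau>) = integral {0..\<tau>} (\<lambda>x. y1 (real j * \<tau> + x))"
proof -
  have sub: "{real j * \<tau>..real (Suc j) * \<tau>} \<subseteq> {0..T}"
    using cell_bounds[OF assms, of 0] \<tau> by auto
  have le: "real j * \<tau> \<le> real (Suc j) * \<tau>" using cell_bounds[OF assms, of 0] \<tau> by simp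
  have "(y1 has_integral y (real (Suc j) * \<tau>) - y (real j * \<tau>)) {real j * \<tau>..real (Suc j) * \<tau>}"
  proof (rule fundamental_theorem_of_calculus[OF le])
    fix x assume "x \<in> {real j * \<tau>..real (Suc j) * \<tau>}"
    then have "(y has_real_derivative y1 x) (at x within {real j * \<tau>..real (Suc j) * \<tau>})"
      using y[of x] sub by (auto intro: DERIV_subset)
    then show "(y has_vector_derivative y1 x) (at x within {real j * \<tau>..real (Suc j) * \<tau>})"
      by (simp add: has_real_derivative_iff_has_vector_derivative)
  qed
  then have "y (real (Suc j) * \<tau>) - y (real j * \<tau>) = integral {real j * \<tau>..real j * \<tau> + \<tau>} y1"
    by (simp add: integral_unique algebra_simps)
  also have "\<dots> = integral {0..\<tau>} (\<lambda>x. y1 (real j * \<tau> + x))"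
  proof (intro integral_shift_origin continuous_on_subset[OF y1])
    show "{real j * \<tau>..real j * \<tau> + \<tau>} \<subseteq> {0..T}" using sub by (simp add: distrib_right add.commute)
  qed
  finally show ?thesis .
qed

lemma cell_Taylor:
  assumes j: "j < N" and x: "0 \<le> x" "x \<le> \<tau>"
  shows "\<bar>y (real j * \<tau> + x) - y (real j * \<tau>) - y1 (real j * \<tau>) * x\<bar> \<le> \<tau> * (V (real (Suc j) * \<tau>) - V (real j * \<tau>))"
proof -
  let ?a = "real j * \<tau>" and ?B = "V (real (Suc j) * \<tau>) - V (real j * \<tau>)"
  have B: "\<bar>y1 s - y1 ?a\<bar> \<le> ?B" if "?a \<le> s" "s \<le> ?a + x" for s
  proof -
    have "s \<le> real (Suc j) * \<tau>" using that cell_bounds[OF j x] by simp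
    then have "\<bar>y1 s - y1 ?a\<bar> \<le> V s - V ?a" "0 \<le> V (real (Suc j) * \<tau>) - V s"
      using V[of ?a s] V[of s "real (Suc j) * \<tau>"] that cell_bounds[OF j x] by auto
    then show ?thesis by linarith
  qed
  have "norm ((y (?a + x) - y1 ?a * (?a + x)) - (y ?a - y1 ?a * ?a)) \<le> ?B * norm ((?a + x) - ?a)"
  proof (rule field_differentiable_bound[where S = "{?a..?a + x}" and f' = "\<lambda>s. y1 s - y1 ?a"])
    fix s assume s: "s \<in> {?a..?a + x}"
    have "{?a..?a + x} \<subseteq> {0..T}" using cell_bounds[OF j x] by auto
    with s have "(y has_real_derivative y1 s) (at s within {?a..?a + x})"
      using y[of s] by (auto intro: DERIV_subset)
    then show "((\<lambda>s. y s - y1 ?a * s) has_field_derivative y1 s - y1 ?a) (at s within {?a..?a + x})"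
      by (auto intro!: derivative_eq_intros)
    show "norm (y1 s - y1 ?a) \<le> ?B" using B s by simp
  qed (use x in auto)
  then have "\<bar>y (?a + x) - y ?a - y1 ?a * x\<bar> \<le> ?B * x" using x by (simp add: algebra_simps)
  also have "\<dots> \<le> ?B * \<tau>" using x B[of ?a] by (intro mult_left_mono) auto
  finally show ?thesis by (simp add: mult.commute)
qed

lemma sum_V_increments: "(\<Sum>j<N. V (real (Suc j) * \<tau>) - V (real j * \<tau>)) = V T"
  using sum_lessThan_telescope[of "\<lambda>j. V (real j * \<tau>)" N] T V0 by simp

lemma V_increment_nonneg: "j < N \<Longrightarrow> 0 \<le> V (real (Suc j) * \<tau>) - V (real j * \<tau>)"
  using V[of "real j * \<tau>" "real (Suc j) * \<tau>"] cell_bounds[of j 0] \<tau> by auto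

lemma sum_y1_increments: "(\<Sum>j<N. \<bar>y1 (real (Suc j) * \<tau>) - y1 (real j * \<tau>)\<bar>) \<le> V T"
proof -
  have "(\<Sum>j<N. \<bar>y1 (real (Suc j) * \<tau>) - y1 (real j * \<tau>)\<bar>) \<le> (\<Sum>j<N. V (real (Suc j) * \<tau>) - V (real j * \<tau>))"
    using cell_bounds[of _ 0] \<tau> by (intro sum_mono V) auto
  then show ?thesis by (simp only: sum_V_increments)
qed

lemma cell_continuous:
  assumes "continuous_on {0..T} h" "j < N"
  shows "continuous_on {0..\<tau>} (\<lambda>x. h (real j * \<tau> + x))" "continuous_on {0..\<tau>} (\<lambda>x. h (real (Suc j) * \<tau> - x))"
proof -
  show "continuous_on {0..\<tau>} (\<lambda>x. h (real j * \<tau> + x))"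
    using cell_bounds[OF assms(2), of 0] cell_bounds[OF assms(2), of \<tau>] \<tau>
    by (intro continuous_on_compose2[OF assms(1)] continuous_intros) auto
  show "continuous_on {0..\<tau>} (\<lambda>x. h (real (Suc j) * \<tau> - x))"
    using cell_bounds[OF assms(2), of 0] cell_bounds[OF assms(2), of \<tau>] \<tau>
    by (intro continuous_on_compose2[OF assms(1)] continuous_intros) auto
qed

text \<open>On cell \<open>j\<close> the kernel argument depends only on the lag
  \<open>m - Suc j\<close>. The scheme has the same Toeplitz structure, which makes a comparison
  cell by cell possible.\<close>

lemma convolution_cells:
  fixes a b :: "real \<Rightarrow> real"
  assumes a: "continuous_on {0..T} a" and b: "continuous_on {0..T} b" and m: "m \<le> N"
  shows "integral {0..real m * \<tau>} (\<lambda>s. a (real m * \<tau> - s) * b s)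
    = (\<Sum>j<m. integral {0..\<tau>} (\<lambda>x. a (real (Suc (m - Suc j)) * \<tau> - x) * b (real j * \<tau> + x)))"
proof -
  have mT: "real m * \<tau> \<le> T" unfolding T[symmetric] using m \<tau> by (intro mult_right_mono) auto
  have "continuous_on {0..real m * \<tau>} (\<lambda>s. a (real m * \<tau> - s) * b s)"
    using mT by (intro continuous_intros continuous_on_compose2[OF a] continuous_on_subset[OF b]) auto
  then have "integral {0..real m * \<tau>} (\<lambda>s. a (real m * \<tau> - s) * b s)
      = (\<Sum>j<m. integral {0..\<tau>} (\<lambda>x. a (real m * \<tau> - (real j * \<tau> + x)) * b (real j * \<tau> + x)))"
    using \<tau> by (intro integral_cells) auto
  also have "\<dots> = (\<Sum>j<m. integral {0..\<tau>} (\<lambda>x. a (real (Suc (m - Suc j)) * \<tau> - x) * b (real j * \<tau> + x)))"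
  proof (intro sum.cong refl)
    fix j assume "j \<in> {..<m}"
    then have "real (Suc (m - Suc j)) * \<tau> = real m * \<tau> - real j * \<tau>"
      by (simp add: Suc_diff_Suc of_nat_diff algebra_simps)
    then have "real m * \<tau> - (real j * \<tau> + x) = real (Suc (m - Suc j)) * \<tau> - x" for x by linarith
    then show "integral {0..\<tau>} (\<lambda>x. a (real m * \<tau> - (real j * \<tau> + x)) * b (real j * \<tau> + x)) =
        integral {0..\<tau>} (\<lambda>x. a (real (Suc (m - Suc j)) * \<tau> - x) * b (real j * \<tau> + x))"
      by (simp only:)
  qed
  finally show ?thesis .
qed

text \<open>
  The stability estimate needs the increments of the residual \<open>E\<close>. In both truncation lemmas \<open>y1\<close> is split into
  its value at the left end of a cell and a remainder bounded by the variation of \<open>y1\<close> over the cell.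
\<close>

lemma truncation_smooth_kernel:
  fixes g :: "real \<Rightarrow> real"
  assumes C: "0 \<le> C"
    and g1: "\<And>a b. a \<in> {0..T} \<Longrightarrow> b \<in> {0..T} \<Longrightarrow> \<bar>g a - g b\<bar> \<le> C * \<bar>a - b\<bar>"
    and g2: "\<And>a b c. 0 \<le> a \<Longrightarrow> 0 \<le> b \<Longrightarrow> 0 \<le> c \<Longrightarrow> a + b + c \<le> T \<Longrightarrow>
       \<bar>g (a + b + c) - g (a + b) - g (a + c) + g a\<bar> \<le> C * b * c"
  defines "gh \<equiv> \<lambda>k. (g (real k * \<tau>) + g (real (Suc k) * \<tau>)) / 2"
  defines "E \<equiv> \<lambda>m. integral {0..real m * \<tau>} (\<lambda>s. g (real m * \<tau> - s) * y1 s)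
      - (\<Sum>j<m. gh (m - Suc j) * (y (real (Suc j) * \<tau>) - y (real j * \<tau>)))"
  shows "(\<Sum>n<N. \<bar>E (Suc n) - E n\<bar>) \<le> C * (1 + 2 * T) * \<tau>\<^sup>2 * (\<bar>y1 0\<bar> + V T)"
proof -
  have gc: "continuous_on {0..T} g"
    by (rule lipschitz_on_continuous_on[of C]) (auto simp: lipschitz_on_def dist_real_def C intro!: g1)
  define p where "p k x = g (real (Suc k) * \<tau> - x) - gh k" for k x
  have pc: "continuous_on {0..\<tau>} (p k)" if "k < N" for k
    unfolding p_def using that by (intro continuous_intros cell_continuous gc)
  \<comment> \<open>\<open>D k\<close> is the error of the trapezoidal rule for \<open>g\<close> on
    one cell. It multiplies the derivative frozen at the left end, while \<open>F\<close> takes the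
    remainder.\<close>
  define D where "D k = integral {0..\<tau>} (p k)" for k
  define F where "F k j = integral {0..\<tau>} (\<lambda>x. p k x * (y1 (real j * \<tau> + x) - y1 (real j * \<tau>)))" for k j
  define Z where "Z j = V (real (Suc j) * \<tau>) - V (real j * \<tau>)" for j
  have Z: "0 \<le> Z j" if "j < N" for j using V_increment_nonneg[OF that] by (simp add: Z_def)
  have y1Z: "\<bar>y1 (real j * \<tau> + x) - y1 (real j * \<tau>)\<bar> \<le> Z j" if "j < N" "0 \<le> x" "x \<le> \<tau>" for j x
    unfolding Z_def using V[of "real j * \<tau>" "real j * \<tau> + x"] V[of "real j * \<tau> + x" "real (Suc j) * \<tau>"]
      cell_bounds[OF that] that by auto
  have E: "E m = (\<Sum>j<m. D (m - Suc j) * y1 (real j * \<tau>)) + (\<Sum>j<m. F (m - Suc j) j)" if m: "m \<le> N" for m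
  proof -
    have "E m = (\<Sum>j<m. integral {0..\<tau>} (\<lambda>x. g (real (Suc (m - Suc j)) * \<tau> - x) * y1 (real j * \<tau> + x))
          - gh (m - Suc j) * integral {0..\<tau>} (\<lambda>x. y1 (real j * \<tau> + x)))"
      unfolding E_def convolution_cells[OF gc y1 m] sum_subtractf[symmetric]
      using m by (intro sum.cong refl, subst cell_increment) auto
    also have "\<dots> = (\<Sum>j<m. D (m - Suc j) * y1 (real j * \<tau>) + F (m - Suc j) j)"
    proof (intro sum.cong refl)
      fix j assume j: "j \<in> {..<m}"
      define k where "k = m - Suc j"
      have jk: "j < N" "k < N" using j m by (auto simp: k_def)
      have i1: "(\<lambda>x. g (real (Suc k) * \<tau> - x) * y1 (real j * \<tau> + x)) integrable_on {0..\<tau>}"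
        by (intro integrable_continuous_interval continuous_intros cell_continuous gc y1 jk)
      have i2: "(\<lambda>x. gh k * y1 (real j * \<tau> + x)) integrable_on {0..\<tau>}"
        by (intro integrable_continuous_interval continuous_intros cell_continuous y1 jk)
      have i3: "(\<lambda>x. p k x * y1 (real j * \<tau>)) integrable_on {0..\<tau>}"
        using pc[OF jk(2)] by (intro integrable_continuous_interval continuous_intros)
      have i4: "(\<lambda>x. p k x * (y1 (real j * \<tau> + x) - y1 (real j * \<tau>))) integrable_on {0..\<tau>}"
        using pc[OF jk(2)] by (intro integrable_continuous_interval continuous_intros cell_continuous y1 jk)
      have "integral {0..\<tau>} (\<lambda>x. g (real (Suc k) * \<tau> - x) * y1 (real j * \<tau> + x)) - gh k * integral {0..\<tau>} (\<lambda>x. y1 (real j * \<tau> + x))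
          = integral {0..\<tau>} (\<lambda>x. p k x * y1 (real j * \<tau> + x))"
        unfolding integral_mult_right[symmetric] Henstock_Kurzweil_Integration.integral_diff[OF i1 i2, symmetric]
        by (simp add: p_def left_diff_distrib)
      also have "\<dots> = integral {0..\<tau>} (\<lambda>x. p k x * y1 (real j * \<tau>) + p k x * (y1 (real j * \<tau> + x) - y1 (real j * \<tau>)))"
        by (simp add: algebra_simps)
      also have "\<dots> = D k * y1 (real j * \<tau>) + F k j"
        unfolding Henstock_Kurzweil_Integration.integral_add[OF i3 i4] D_def F_def by simp
      finally show "integral {0..\<tau>} (\<lambda>x. g (real (Suc (m - Suc j)) * \<tau> - x) * y1 (real j * \<tau> + x))
          - gh (m - Suc j) * integral {0..\<tau>} (\<lambda>x. y1 (real j * \<tau> + x)) = D (m - Suc j) * y1 (real j * \<tau>) + F (m - Suc j) j"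
        unfolding k_def .
    qed
    finally show ?thesis by (simp add: sum.distrib)
  qed
  \<comment> \<open>Averaging the integrand with its reflection turns the trapezoidal error into a
    mixed second difference of \<open>g\<close> with increments x and tau - x.\<close>
  have D: "\<bar>D k\<bar> \<le> C * \<tau> ^ 3" if k: "k < N" for k
  proof -
    let ?a = "real k * \<tau>"
    have s: "real (Suc k) * \<tau> = ?a + \<tau>" by (simp add: algebra_simps)
    have c1: "continuous_on {0..\<tau>} (\<lambda>x. g (?a + x))" by (intro cell_continuous gc k)
    have c2: "continuous_on {0..\<tau>} (\<lambda>x. g (?a + (\<tau> - x)))"
      using cell_continuous(2)[OF gc k] unfolding s by (simp add: algebra_simps)
    have "integral {0..\<tau>} (\<lambda>x. g (?a + (\<tau> - x))) = integral {0..\<tau>} (\<lambda>x. g (?a + x))"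
      by (rule integral_reflect_origin[OF c1])
    then have "D k = integral {0..\<tau>} (\<lambda>x. (g (?a + x) + g (?a + (\<tau> - x))) / 2 - gh k)"
      unfolding D_def p_def s using c1 c2
      by (subst (1 2) Henstock_Kurzweil_Integration.integral_diff)
        (auto intro!: integrable_continuous_interval continuous_intros
          simp: Henstock_Kurzweil_Integration.integral_add integrable_continuous_interval add_diff_eq[symmetric])
    also have "\<bar>\<dots>\<bar> \<le> (C * \<tau>\<^sup>2) * \<tau>"
    proof (intro abs_integral_le)
      show "continuous_on {0..\<tau>} (\<lambda>x. (g (?a + x) + g (?a + (\<tau> - x))) / 2 - gh k)"
        by (intro continuous_intros c1 c2) simp
      fix x assume x: "0 \<le> x" "x \<le> \<tau>"
      have "\<bar>g (?a + x + (\<tau> - x)) - g (?a + x) - g (?a + (\<tau> - x)) + g ?a\<bar> \<le> C * x * (\<tau> - x)"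
        using x cell_bounds[OF k, of \<tau>] by (intro g2) (auto simp: algebra_simps)
      also have "\<dots> = C * (x * (\<tau> - x))" by simp
      also have "\<dots> \<le> C * (\<tau> * \<tau>)" using x C by (intro mult_left_mono mult_mono) auto
      finally have "\<bar>g (?a + \<tau>) - g (?a + x) - g (?a + (\<tau> - x)) + g ?a\<bar> \<le> C * \<tau>\<^sup>2"
        by (simp add: power2_eq_square)
      then show "\<bar>(g (?a + x) + g (?a + (\<tau> - x))) / 2 - gh k\<bar> \<le> C * \<tau>\<^sup>2"
        unfolding gh_def s by (simp add: abs_le_iff) (auto simp: field_simps)
    qed (use \<tau> in auto)
    finally show ?thesis by (simp add: power3_eq_cube power2_eq_square mult_ac)
  qed
  have p0: "\<bar>p 0 x\<bar> \<le> C * \<tau>" if "0 < N" "0 \<le> x" "x \<le> \<tau>" for x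
  proof -
    have "\<bar>g (\<tau> - x) - g 0\<bar> \<le> C * \<bar>\<tau> - x - 0\<bar>" "\<bar>g (\<tau> - x) - g \<tau>\<bar> \<le> C * \<bar>\<tau> - x - \<tau>\<bar>"
      using g1[of "\<tau> - x" 0] g1[of "\<tau> - x" \<tau>] cell_bounds[OF that] by simp_all
    moreover have "C * \<bar>\<tau> - x - 0\<bar> \<le> C * \<tau>" "C * \<bar>\<tau> - x - \<tau>\<bar> \<le> C * \<tau>"
      using that C by (auto intro!: mult_left_mono)
    ultimately show ?thesis unfolding p_def gh_def by (auto simp: abs_le_iff field_simps)
  qed
  \<comment> \<open>The increment of \<open>g\<close> over one step, taken at \<open>x\<close>, is
    compared with the mean of its values at the two ends of the cell. Each comparison is a mixed
    second difference.\<close>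
  have p1: "\<bar>p (Suc k) x - p k x\<bar> \<le> C * \<tau>\<^sup>2" if k: "Suc k < N" and x: "0 \<le> x" "x \<le> \<tau>" for k x
  proof -
    let ?a = "real k * \<tau>"
    have s: "real (Suc k) * \<tau> = ?a + \<tau>" "real (Suc (Suc k)) * \<tau> = ?a + 2 * \<tau>" by (simp_all add: algebra_simps)
    have b: "?a + 2 * \<tau> \<le> T" "0 \<le> ?a" using cell_bounds[OF k, of \<tau>] \<tau> s by auto
    have "\<bar>g ((?a + \<tau> - x) + \<tau> + x) - g ((?a + \<tau> - x) + \<tau>) - g ((?a + \<tau> - x) + x) + g (?a + \<tau> - x)\<bar> \<le> C * \<tau> * x"
      by (rule g2; use b x \<tau> in linarith)
    then have 1: "\<bar>(g (?a + 2 * \<tau>) - g (?a + \<tau>)) - (g (?a + 2 * \<tau> - x) - g (?a + \<tau> - x))\<bar> \<le> C * \<tau> * x"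
      by (simp add: algebra_simps)
    have "\<bar>g (?a + \<tau> + (\<tau> - x)) - g (?a + \<tau>) - g (?a + (\<tau> - x)) + g ?a\<bar> \<le> C * \<tau> * (\<tau> - x)"
      using b x \<tau> by (intro g2) auto
    then have 2: "\<bar>(g (?a + 2 * \<tau> - x) - g (?a + \<tau> - x)) - (g (?a + \<tau>) - g ?a)\<bar> \<le> C * \<tau> * (\<tau> - x)"
      by (simp add: algebra_simps)
    have half_diff: "\<bar>u / 2 - v / 2\<bar> \<le> c / 2 + d / 2" if "\<bar>u\<bar> \<le> c" "\<bar>v\<bar> \<le> d" for u v c d :: real
      using that by linarith
    have "p (Suc k) x - p k x = ((g (?a + 2 * \<tau> - x) - g (?a + \<tau> - x)) - (g (?a + \<tau>) - g ?a)) / 2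
        - ((g (?a + 2 * \<tau>) - g (?a + \<tau>)) - (g (?a + 2 * \<tau> - x) - g (?a + \<tau> - x))) / 2"
      unfolding p_def gh_def s by (simp add: field_simps)
    then have "\<bar>p (Suc k) x - p k x\<bar> \<le> C * \<tau> * (\<tau> - x) / 2 + C * \<tau> * x / 2"
      using half_diff[OF 2 1] by (simp only:)
    also have "\<dots> = C * \<tau>\<^sup>2 / 2" by (simp add: power2_eq_square field_simps)
    also have "\<dots> \<le> C * \<tau>\<^sup>2" using C by simp
    finally show ?thesis .
  qed
  \<comment> \<open>Lag 0 is worse by one power of the step, but there is only one such lag; the
    other lags, fewer than \<open>N\<close>, have size tau^3. Together they are O(tau^2).\<close>
  define q where "q k = (case k of 0 \<Rightarrow> C * \<tau>\<^sup>2 | Suc _ \<Rightarrow> C * \<tau> ^ 3)" for k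
  have vF: "(\<Sum>n<N. \<bar>(\<Sum>j<Suc n. F (n - j) j) - (\<Sum>j<n. F (n - Suc j) j)\<bar>) \<le> (\<Sum>k<N. q k) * (\<Sum>j<N. Z j)"
  proof (rule variation_causal_sum)
    show "0 \<le> q k" for k using C \<tau> by (auto simp: q_def split: nat.split)
    show "0 \<le> Z j" if "j < N" for j by (rule Z[OF that])
    show "\<bar>F 0 j\<bar> \<le> q 0 * Z j" if j: "j < N" for j
    proof -
      have "\<bar>F 0 j\<bar> \<le> (C * \<tau> * Z j) * \<tau>" unfolding F_def
      proof (intro abs_integral_le)
        show "continuous_on {0..\<tau>} (\<lambda>x. p 0 x * (y1 (real j * \<tau> + x) - y1 (real j * \<tau>)))"
          using j by (intro continuous_intros pc cell_continuous y1) auto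
        show "\<bar>p 0 x * (y1 (real j * \<tau> + x) - y1 (real j * \<tau>))\<bar> \<le> C * \<tau> * Z j" if "0 \<le> x" "x \<le> \<tau>" for x
          unfolding abs_mult using p0[of x] y1Z[OF j that] j that C \<tau> by (intro mult_mono) auto
      qed (use \<tau> in auto)
      then show ?thesis by (simp add: q_def power2_eq_square mult_ac)
    qed
    show "\<bar>F (Suc k) j - F k j\<bar> \<le> q (Suc k) * Z j" if kj: "Suc k + j < N" for k j
    proof -
      have j: "j < N" and k: "k < N" "Suc k < N" using kj by auto
      have c: "continuous_on {0..\<tau>} (\<lambda>x. p l x * (y1 (real j * \<tau> + x) - y1 (real j * \<tau>)))" if "l < N" for l
        using j that by (intro continuous_intros pc cell_continuous y1) auto
      have "F (Suc k) j - F k j = integral {0..\<tau>} (\<lambda>x. (p (Suc k) x - p k x) * (y1 (real j * \<tau> + x) - y1 (real j * \<tau>)))"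
        unfolding F_def left_diff_distrib
        by (intro Henstock_Kurzweil_Integration.integral_diff[symmetric] integrable_continuous_interval c k)
      also have "\<bar>\<dots>\<bar> \<le> (C * \<tau>\<^sup>2 * Z j) * \<tau>"
      proof (intro abs_integral_le)
        show "continuous_on {0..\<tau>} (\<lambda>x. (p (Suc k) x - p k x) * (y1 (real j * \<tau> + x) - y1 (real j * \<tau>)))"
          using j k by (intro continuous_intros pc cell_continuous y1) auto
        show "\<bar>(p (Suc k) x - p k x) * (y1 (real j * \<tau> + x) - y1 (real j * \<tau>))\<bar> \<le> C * \<tau>\<^sup>2 * Z j" if "0 \<le> x" "x \<le> \<tau>" for x
          unfolding abs_mult using p1[OF k(2) that] y1Z[OF j that] C by (intro mult_mono) auto
      qed (use \<tau> in auto)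
      finally show ?thesis by (simp add: q_def power2_eq_square power3_eq_cube mult_ac)
    qed
  qed
  have N3: "real N * (C * \<tau> ^ 3) = C * T * \<tau>\<^sup>2"
    unfolding T[symmetric] by (simp add: power2_eq_square power3_eq_cube)
  have "(\<Sum>k<N. q k) \<le> C * \<tau>\<^sup>2 + real N * (C * \<tau> ^ 3)"
  proof (cases N)
    case (Suc M)
    then have "(\<Sum>k<N. q k) = C * \<tau>\<^sup>2 + real M * (C * \<tau> ^ 3)"
      by (simp only: sum.lessThan_Suc_shift) (simp add: q_def)
    moreover have "real M * (C * \<tau> ^ 3) \<le> real N * (C * \<tau> ^ 3)" using Suc C \<tau> by (intro mult_right_mono) auto
    ultimately show ?thesis by simp
  qed (use C in simp)
  then have sq: "(\<Sum>k<N. q k) \<le> C * (1 + T) * \<tau>\<^sup>2" unfolding N3 by (simp add: algebra_simps)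
  have sZ: "(\<Sum>j<N. Z j) = V T" unfolding Z_def by (rule sum_V_increments)
  have VT: "0 \<le> V T" unfolding sZ[symmetric] by (intro sum_nonneg Z) auto
  have T0: "0 \<le> T" using T \<tau> by (metis mult_nonneg_nonneg of_nat_0_le_iff less_imp_le)
  have vD: "(\<Sum>n<N. \<bar>(\<Sum>j<Suc n. D (n - j) * y1 (real j * \<tau>)) - (\<Sum>j<n. D (n - Suc j) * y1 (real j * \<tau>))\<bar>)
     \<le> C * T * \<tau>\<^sup>2 * (\<bar>y1 0\<bar> + V T)"
  proof -
    have "(\<Sum>n<N. \<bar>(\<Sum>j<Suc n. D (n - j) * y1 (real j * \<tau>)) - (\<Sum>j<n. D (n - Suc j) * y1 (real j * \<tau>))\<bar>)
      \<le> (\<Sum>k<N. \<bar>D k\<bar>) * (\<bar>y1 (real 0 * \<tau>)\<bar> + (\<Sum>j<N. \<bar>y1 (real (Suc j) * \<tau>) - y1 (real j * \<tau>)\<bar>))"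
      by (rule variation_causal_product_sum)
    also have "\<dots> \<le> (\<Sum>k<N. C * \<tau> ^ 3) * (\<bar>y1 0\<bar> + V T)"
      using C \<tau> by (intro mult_mono sum_mono D add_mono sum_y1_increments) (auto intro!: sum_nonneg add_nonneg_nonneg)
    finally show ?thesis using N3 by simp
  qed
  have "(\<Sum>n<N. \<bar>E (Suc n) - E n\<bar>)
     \<le> (\<Sum>n<N. \<bar>(\<Sum>j<Suc n. D (n - j) * y1 (real j * \<tau>)) - (\<Sum>j<n. D (n - Suc j) * y1 (real j * \<tau>))\<bar>
        + \<bar>(\<Sum>j<Suc n. F (n - j) j) - (\<Sum>j<n. F (n - Suc j) j)\<bar>)"
  proof (intro sum_mono)
    fix n assume "n \<in> {..<N}"
    then have "E (Suc n) - E n = ((\<Sum>j<Suc n. D (n - j) * y1 (real j * \<tau>)) - (\<Sum>j<n. D (n - Suc j) * y1 (real j * \<tau>)))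
       + ((\<Sum>j<Suc n. F (n - j) j) - (\<Sum>j<n. F (n - Suc j) j))"
      using E[of n] E[of "Suc n"] by simp
    then show "\<bar>E (Suc n) - E n\<bar> \<le> \<bar>(\<Sum>j<Suc n. D (n - j) * y1 (real j * \<tau>)) - (\<Sum>j<n. D (n - Suc j) * y1 (real j * \<tau>))\<bar>
        + \<bar>(\<Sum>j<Suc n. F (n - j) j) - (\<Sum>j<n. F (n - Suc j) j)\<bar>"
      by (simp only: abs_triangle_ineq)
  qed
  also have "\<dots> \<le> C * T * \<tau>\<^sup>2 * (\<bar>y1 0\<bar> + V T) + (C * (1 + T) * \<tau>\<^sup>2) * V T"
    unfolding sum.distrib using order_trans[OF vF mult_right_mono[OF sq]] sZ VT vD by (intro add_mono) auto
  also have "\<dots> \<le> C * T * \<tau>\<^sup>2 * (\<bar>y1 0\<bar> + V T) + (C * (1 + T) * \<tau>\<^sup>2) * (\<bar>y1 0\<bar> + V T)"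
    using C T0 by (intro add_left_mono mult_left_mono) auto
  also have "\<dots> = C * (1 + 2 * T) * \<tau>\<^sup>2 * (\<bar>y1 0\<bar> + V T)" by (simp add: algebra_simps)
  finally show ?thesis .
qed

text \<open>
  The cell moments \<open>P k\<close> of the kernel are not \<open>O(\<tau>\<^sup>3)\<close> near \<open>k = 0\<close>, but they are bounded by increments of
  \<open>\<gamma>\<close>, whose sum telescopes. This is where the full second order is saved.
\<close>

lemma truncation_monotone_kernel:
  fixes \<gamma> :: "real \<Rightarrow> real"
  assumes \<gamma>c: "continuous_on {0..T} \<gamma>" and \<gamma>m: "mono_on {0..T} \<gamma>" and \<gamma>0: "\<gamma> 0 = 0"
    and yb0: "yb 0 = y \<tau>" and yb: "\<And>j. yb (Suc j) = (y (real (Suc (Suc j)) * \<tau>) + y (real (Suc j) * \<tau>)) / 2"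
  defines "E \<equiv> \<lambda>m. integral {0..real m * \<tau>} (\<lambda>s. \<gamma> (real m * \<tau> - s) * y s)
      - (\<Sum>j<m. integral {0..\<tau>} (\<lambda>x. \<gamma> (real (Suc (m - Suc j)) * \<tau> - x)) * yb j)"
  shows "(\<Sum>n<N. \<bar>E (Suc n) - E n\<bar>) \<le> 3 * \<gamma> T * \<tau>\<^sup>2 * (\<bar>y1 0\<bar> + V T)"
proof -
  have yc: "continuous_on {0..T} y" by (rule y_continuous)
  have T0: "0 \<le> T" using T \<tau> by (metis mult_nonneg_nonneg of_nat_0_le_iff less_imp_le)
  have \<gamma>_mono: "\<gamma> a \<le> \<gamma> b" if "0 \<le> a" "a \<le> b" "b \<le> T" for a b
    using \<gamma>m that by (intro mono_onD[OF \<gamma>m]) auto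
  have \<gamma>_nn: "0 \<le> \<gamma> a" if "0 \<le> a" "a \<le> T" for a using \<gamma>_mono[of 0 a] that \<gamma>0 by simp
  define p where "p k x = \<gamma> (real (Suc k) * \<tau> - x)" for k x
  have pc: "continuous_on {0..\<tau>} (p k)" if "k < N" for k
    unfolding p_def using that by (intro cell_continuous \<gamma>c)
  \<comment> \<open>The linear part is centred at the midpoint because \<open>yb j\<close>, for
    \<open>j > 0\<close>, approximates the midpoint value, and because a constant kernel has no
    moment against \<open>x - \<tau> / 2\<close>.\<close>
  define \<xi> where "\<xi> j x = y (real j * \<tau> + x) - yb j - y1 (real j * \<tau>) * (x - \<tau> / 2)" for j x
  have \<xi>c: "continuous_on {0..\<tau>} (\<xi> j)" if "j < N" for j
    unfolding \<xi>_def using that by (intro continuous_intros cell_continuous yc)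
  define P where "P k = integral {0..\<tau>} (\<lambda>x. p k x * (x - \<tau> / 2))" for k
  define I where "I k = integral {0..\<tau>} (p k)" for k
  define F where "F k j = integral {0..\<tau>} (\<lambda>x. p k x * \<xi> j x)" for k j
  \<comment> \<open>In the first cell \<open>yb 0\<close> is the value at the right end, which
    misses the midpoint value by a term of first order. The extra summand charges this to a single
    cell.\<close>
  define Z where "Z j = 2 * \<tau> * (V (real (Suc j) * \<tau>) - V (real j * \<tau>)) + (if j = 0 then \<tau> * \<bar>y1 0\<bar> else 0)" for j
  have Z: "0 \<le> Z j" if "j < N" for j using V_increment_nonneg[OF that] \<tau> by (simp add: Z_def)
  have \<xi>Z: "\<bar>\<xi> j x\<bar> \<le> Z j" if j: "j < N" and x: "0 \<le> x" "x \<le> \<tau>" for j x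
  proof -
    let ?B = "\<tau> * (V (real (Suc j) * \<tau>) - V (real j * \<tau>))"
    have s: "real (Suc j) * \<tau> = real j * \<tau> + \<tau>" by (simp add: distrib_right)
    have B: "0 \<le> ?B" using V_increment_nonneg[OF j] \<tau> by simp
    have 1: "\<bar>y (real j * \<tau> + x) - y (real j * \<tau>) - y1 (real j * \<tau>) * x\<bar> \<le> ?B" by (rule cell_Taylor[OF j x])
    have 2: "\<bar>y (real j * \<tau> + \<tau>) - y (real j * \<tau>) - y1 (real j * \<tau>) * \<tau>\<bar> \<le> ?B"
      using cell_Taylor[OF j, of \<tau>] \<tau> by simp
    show ?thesis
    proof (cases j)
      case 0
      have "\<xi> j x = (y (real j * \<tau> + x) - y (real j * \<tau>) - y1 (real j * \<tau>) * x)
          - (y (real j * \<tau> + \<tau>) - y (real j * \<tau>) - y1 (real j * \<tau>) * \<tau>) - y1 0 * \<tau> / 2"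
        unfolding \<xi>_def using 0 yb0 by (simp add: algebra_simps)
      moreover have "\<bar>y1 0 * \<tau> / 2\<bar> \<le> \<tau> * \<bar>y1 0\<bar>" using \<tau> by (simp add: abs_mult)
      moreover have "Z j = 2 * ?B + \<tau> * \<bar>y1 0\<bar>" using 0 by (simp add: Z_def)
      ultimately show ?thesis using 1 2 by linarith
    next
      case (Suc i)
      have "yb j = (y (real j * \<tau> + \<tau>) + y (real j * \<tau>)) / 2" unfolding s[symmetric] unfolding Suc by (rule yb)
      then have "\<xi> j x = (y (real j * \<tau> + x) - y (real j * \<tau>) - y1 (real j * \<tau>) * x)
          - (y (real j * \<tau> + \<tau>) - y (real j * \<tau>) - y1 (real j * \<tau>) * \<tau>) / 2"
        unfolding \<xi>_def by (simp add: field_simps)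
      moreover have "Z j = 2 * ?B" using Suc by (simp add: Z_def)
      moreover have "\<bar>u - v / 2\<bar> \<le> 2 * b" if "\<bar>u\<bar> \<le> b" "\<bar>v\<bar> \<le> b" "0 \<le> b" for u v b :: real
        using that by linarith
      ultimately show ?thesis using 1 2 B by simp
    qed
  qed
  have E: "E m = (\<Sum>j<m. P (m - Suc j) * y1 (real j * \<tau>)) + (\<Sum>j<m. F (m - Suc j) j)" if m: "m \<le> N" for m
  proof -
    have "E m = (\<Sum>j<m. integral {0..\<tau>} (\<lambda>x. p (m - Suc j) x * y (real j * \<tau> + x)) - I (m - Suc j) * yb j)"
      unfolding E_def convolution_cells[OF \<gamma>c yc m] sum_subtractf[symmetric] p_def I_def ..
    also have "\<dots> = (\<Sum>j<m. P (m - Suc j) * y1 (real j * \<tau>) + F (m - Suc j) j)"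
    proof (intro sum.cong refl)
      fix j assume j: "j \<in> {..<m}"
      define k where "k = m - Suc j"
      have jk: "j < N" "k < N" using j m by (auto simp: k_def)
      have i1: "(\<lambda>x. p k x * y (real j * \<tau> + x)) integrable_on {0..\<tau>}"
        by (intro integrable_continuous_interval continuous_intros cell_continuous pc yc jk)
      have i2: "(\<lambda>x. p k x * yb j) integrable_on {0..\<tau>}"
        by (intro integrable_continuous_interval continuous_intros pc jk)
      have i3: "(\<lambda>x. p k x * (x - \<tau> / 2) * y1 (real j * \<tau>)) integrable_on {0..\<tau>}"
        by (intro integrable_continuous_interval continuous_intros pc jk) auto
      have i4: "(\<lambda>x. p k x * \<xi> j x) integrable_on {0..\<tau>}"
        by (intro integrable_continuous_interval continuous_intros \<xi>c pc jk)
      have "integral {0..\<tau>} (\<lambda>x. p k x * y (real j * \<tau> + x)) - I k * yb j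
          = integral {0..\<tau>} (\<lambda>x. p k x * (x - \<tau> / 2) * y1 (real j * \<tau>) + p k x * \<xi> j x)"
        unfolding I_def integral_mult_left[symmetric] Henstock_Kurzweil_Integration.integral_diff[OF i1 i2, symmetric]
        by (simp add: \<xi>_def algebra_simps)
      also have "\<dots> = P k * y1 (real j * \<tau>) + F k j"
        unfolding Henstock_Kurzweil_Integration.integral_add[OF i3 i4] P_def F_def by simp
      finally show "integral {0..\<tau>} (\<lambda>x. p (m - Suc j) x * y (real j * \<tau> + x)) - I (m - Suc j) * yb j
          = P (m - Suc j) * y1 (real j * \<tau>) + F (m - Suc j) j"
        unfolding k_def .
    qed
    finally show ?thesis by (simp add: sum.distrib)
  qed
  \<comment> \<open>The centred factor has mean zero, so the kernel may be replaced by its increase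
    within the cell.\<close>
  have P: "\<bar>P k\<bar> \<le> \<tau>\<^sup>2 * (\<gamma> (real (Suc k) * \<tau>) - \<gamma> (real k * \<tau>))" if k: "k < N" for k
  proof -
    let ?d = "\<gamma> (real (Suc k) * \<tau>) - \<gamma> (real k * \<tau>)"
    have "integral {0..\<tau>} (\<lambda>x. x - \<tau> / 2) = 0"
    proof -
      have "((\<lambda>x. x - \<tau> / 2) has_integral ((\<tau>\<^sup>2 / 2 - \<tau> / 2 * \<tau>) - (0\<^sup>2 / 2 - \<tau> / 2 * 0))) {0..\<tau>}"
        using \<tau> by (intro fundamental_theorem_of_calculus)
          (auto intro!: derivative_eq_intros simp flip: has_real_derivative_iff_has_vector_derivative)
      then show ?thesis by (simp add: integral_unique power2_eq_square)
    qed
    then have "P k = P k - \<gamma> (real k * \<tau>) * integral {0..\<tau>} (\<lambda>x. x - \<tau> / 2)" by simp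
    also have "\<dots> = integral {0..\<tau>} (\<lambda>x. (p k x - \<gamma> (real k * \<tau>)) * (x - \<tau> / 2))"
    proof -
      have "(\<lambda>x. p k x * (x - \<tau> / 2)) integrable_on {0..\<tau>}" "(\<lambda>x. \<gamma> (real k * \<tau>) * (x - \<tau> / 2)) integrable_on {0..\<tau>}"
        by (intro integrable_continuous_interval continuous_intros pc k; simp)+
      then show ?thesis
        unfolding P_def integral_mult_right[symmetric] left_diff_distrib
        by (rule Henstock_Kurzweil_Integration.integral_diff[symmetric])
    qed
    also have "\<bar>\<dots>\<bar> \<le> (?d * \<tau>) * \<tau>"
    proof (rule abs_integral_le)
      show "continuous_on {0..\<tau>} (\<lambda>x. (p k x - \<gamma> (real k * \<tau>)) * (x - \<tau> / 2))"
        by (intro continuous_intros pc k) auto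
      fix x assume x: "0 \<le> x" "x \<le> \<tau>"
      have "\<bar>p k x - \<gamma> (real k * \<tau>)\<bar> \<le> ?d"
      proof -
        have "\<gamma> (real (Suc k) * \<tau> - x) \<le> \<gamma> (real (Suc k) * \<tau>)"
          by (rule \<gamma>_mono; use cell_bounds[OF k x] x in linarith)
        moreover have "\<gamma> (real k * \<tau>) \<le> \<gamma> (real (Suc k) * \<tau> - x)"
          by (rule \<gamma>_mono; use cell_bounds[OF k x] in linarith)
        ultimately show ?thesis unfolding p_def by linarith
      qed
      moreover have "\<bar>x - \<tau> / 2\<bar> \<le> \<tau>" using x by (auto simp: abs_le_iff)
      ultimately show "\<bar>(p k x - \<gamma> (real k * \<tau>)) * (x - \<tau> / 2)\<bar> \<le> ?d * \<tau>"
        unfolding abs_mult by (intro mult_mono) auto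
    qed (use \<tau> in auto)
    finally show ?thesis by (simp add: power2_eq_square mult_ac)
  qed
  \<comment> \<open>Monotonicity makes the cell integrals \<open>I\<close> grow with the lag, so
    their increments are nonnegative weights. They telescope to the last integral, which is at most
    \<open>\<gamma> T * \<tau>\<close>.\<close>
  define q where "q k = I k - (case k of 0 \<Rightarrow> 0 | Suc l \<Rightarrow> I l)" for k
  have dp: "0 \<le> p (Suc k) x - p k x" if k: "Suc k < N" and x: "0 \<le> x" "x \<le> \<tau>" for k x
  proof -
    have "\<gamma> (real (Suc k) * \<tau> - x) \<le> \<gamma> (real (Suc (Suc k)) * \<tau> - x)"
      by (rule \<gamma>_mono; use cell_bounds[OF k x] cell_bounds[OF Suc_lessD[OF k] x] x in linarith)
    then show ?thesis unfolding p_def by linarith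
  qed
  have p_nn: "0 \<le> p k x" if "k < N" "0 \<le> x" "x \<le> \<tau>" for k x
    unfolding p_def using cell_bounds[OF that] by (intro \<gamma>_nn)
  have qS: "q (Suc k) = integral {0..\<tau>} (\<lambda>x. p (Suc k) x - p k x)" if "Suc k < N" for k
    unfolding q_def I_def using that
    by (simp, intro Henstock_Kurzweil_Integration.integral_diff[symmetric] integrable_continuous_interval pc) auto
  have vF: "(\<Sum>n<N. \<bar>(\<Sum>j<Suc n. F (n - j) j) - (\<Sum>j<n. F (n - Suc j) j)\<bar>) \<le> (\<Sum>k<N. q k) * (\<Sum>j<N. Z j)"
  proof (rule variation_causal_sum)
    show "0 \<le> q k" if k: "k < N" for k
    proof (cases k)
      case 0
      then show ?thesis using k p_nn pc[of 0]
        by (auto simp: q_def I_def intro!: Henstock_Kurzweil_Integration.integral_nonneg integrable_continuous_interval)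
    next
      case (Suc l)
      then have l: "Suc l < N" "l < N" using k by auto
      show ?thesis unfolding Suc qS[OF l(1)]
        by (intro Henstock_Kurzweil_Integration.integral_nonneg integrable_continuous_interval continuous_intros pc l)
          (use dp[OF l(1)] in auto)
    qed
    show "0 \<le> Z j" if "j < N" for j by (rule Z[OF that])
    have le: "\<bar>integral {0..\<tau>} (\<lambda>x. r x * \<xi> j x)\<bar> \<le> integral {0..\<tau>} r * Z j"
      if j: "j < N" and r: "continuous_on {0..\<tau>} r" "\<And>x. 0 \<le> x \<Longrightarrow> x \<le> \<tau> \<Longrightarrow> 0 \<le> r x" for r j
    proof -
      have "norm (integral {0..\<tau>} (\<lambda>x. r x * \<xi> j x)) \<le> integral {0..\<tau>} (\<lambda>x. r x * Z j)"
      proof (rule integral_norm_bound_integral)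
        show "(\<lambda>x. r x * \<xi> j x) integrable_on {0..\<tau>}" "(\<lambda>x. r x * Z j) integrable_on {0..\<tau>}"
          by (intro integrable_continuous_interval continuous_intros r(1) \<xi>c j)+
        fix x assume "x \<in> {0..\<tau>}"
        then show "norm (r x * \<xi> j x) \<le> r x * Z j"
          using \<xi>Z[OF j, of x] r(2)[of x] by (simp add: abs_mult mult_left_mono)
      qed
      then show ?thesis by simp
    qed
    show "\<bar>F 0 j\<bar> \<le> q 0 * Z j" if j: "j < N" for j
      unfolding F_def q_def I_def using le[OF j pc[of 0]] p_nn[of 0] j by simp
    show "\<bar>F (Suc k) j - F k j\<bar> \<le> q (Suc k) * Z j" if kj: "Suc k + j < N" for k j
    proof -
      have j: "j < N" and k: "k < N" "Suc k < N" using kj by auto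
      have "F (Suc k) j - F k j = integral {0..\<tau>} (\<lambda>x. (p (Suc k) x - p k x) * \<xi> j x)"
        unfolding F_def left_diff_distrib
        by (intro Henstock_Kurzweil_Integration.integral_diff[symmetric] integrable_continuous_interval continuous_intros pc \<xi>c k j)
      then show ?thesis unfolding qS[OF k(2)]
        using le[OF j, of "\<lambda>x. p (Suc k) x - p k x"] dp[OF k(2)] pc k by (simp add: continuous_on_diff)
    qed
  qed
  have sq: "(\<Sum>k<N. q k) \<le> \<gamma> T * \<tau>"
  proof (cases N)
    case 0
    then show ?thesis using \<gamma>_nn[of T] T0 \<tau> by simp
  next
    case (Suc M)
    have tele: "(\<Sum>k<Suc n. q k) = I n" for n
      by (induction n) (simp_all add: q_def)
    have M: "M < N" using Suc by simp
    have "\<bar>I M\<bar> \<le> \<gamma> T * \<tau>" unfolding I_def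
    proof (rule abs_integral_le)
      show "\<bar>p M x\<bar> \<le> \<gamma> T" if "0 \<le> x" "x \<le> \<tau>" for x
        using p_nn[OF M that] \<gamma>_mono[of "real (Suc M) * \<tau> - x" T] cell_bounds[OF M that] by (simp add: p_def)
    qed (use \<tau> pc[OF M] in auto)
    then show ?thesis unfolding Suc tele by simp
  qed
  have sZ: "(\<Sum>j<N. Z j) \<le> 2 * \<tau> * (\<bar>y1 0\<bar> + V T)"
  proof -
    have "(\<Sum>j<N. Z j) = 2 * \<tau> * V T + (\<Sum>j<N. if j = 0 then \<tau> * \<bar>y1 0\<bar> else 0)"
      unfolding Z_def sum.distrib sum_distrib_left[symmetric] sum_V_increments ..
    also have "(\<Sum>j<N. if j = 0 then \<tau> * \<bar>y1 0\<bar> else 0) \<le> 2 * \<tau> * \<bar>y1 0\<bar>"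
      using \<tau> by (cases N) (auto simp: sum.delta)
    finally show ?thesis by (simp add: algebra_simps)
  qed
  have VT: "0 \<le> V T" unfolding sum_V_increments[symmetric] using V_increment_nonneg by (intro sum_nonneg) auto
  have \<gamma>T: "0 \<le> \<gamma> T" using \<gamma>_nn[of T] T0 by simp
  have vP: "(\<Sum>n<N. \<bar>(\<Sum>j<Suc n. P (n - j) * y1 (real j * \<tau>)) - (\<Sum>j<n. P (n - Suc j) * y1 (real j * \<tau>))\<bar>)
     \<le> \<gamma> T * \<tau>\<^sup>2 * (\<bar>y1 0\<bar> + V T)"
  proof -
    have "(\<Sum>n<N. \<bar>(\<Sum>j<Suc n. P (n - j) * y1 (real j * \<tau>)) - (\<Sum>j<n. P (n - Suc j) * y1 (real j * \<tau>))\<bar>)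
      \<le> (\<Sum>k<N. \<bar>P k\<bar>) * (\<bar>y1 (real 0 * \<tau>)\<bar> + (\<Sum>j<N. \<bar>y1 (real (Suc j) * \<tau>) - y1 (real j * \<tau>)\<bar>))"
      by (rule variation_causal_product_sum)
    also have "\<dots> \<le> (\<gamma> T * \<tau>\<^sup>2) * (\<bar>y1 0\<bar> + V T)"
    proof (intro mult_mono add_mono sum_y1_increments)
      have "(\<Sum>k<N. \<bar>P k\<bar>) \<le> (\<Sum>k<N. \<tau>\<^sup>2 * (\<gamma> (real (Suc k) * \<tau>) - \<gamma> (real k * \<tau>)))"
        by (intro sum_mono P) auto
      also have "\<dots> = \<gamma> T * \<tau>\<^sup>2"
        unfolding sum_distrib_left[symmetric] sum_lessThan_telescope[of "\<lambda>k. \<gamma> (real k * \<tau>)"] using T \<gamma>0 by simp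
      finally show "(\<Sum>k<N. \<bar>P k\<bar>) \<le> \<gamma> T * \<tau>\<^sup>2" .
    qed (use \<gamma>T in \<open>auto intro!: sum_nonneg add_nonneg_nonneg\<close>)
    finally show ?thesis .
  qed
  have "(\<Sum>n<N. \<bar>E (Suc n) - E n\<bar>)
     \<le> (\<Sum>n<N. \<bar>(\<Sum>j<Suc n. P (n - j) * y1 (real j * \<tau>)) - (\<Sum>j<n. P (n - Suc j) * y1 (real j * \<tau>))\<bar>
        + \<bar>(\<Sum>j<Suc n. F (n - j) j) - (\<Sum>j<n. F (n - Suc j) j)\<bar>)"
  proof (intro sum_mono)
    fix n assume "n \<in> {..<N}"
    then have "E (Suc n) - E n = ((\<Sum>j<Suc n. P (n - j) * y1 (real j * \<tau>)) - (\<Sum>j<n. P (n - Suc j) * y1 (real j * \<tau>)))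
       + ((\<Sum>j<Suc n. F (n - j) j) - (\<Sum>j<n. F (n - Suc j) j))"
      using E[of n] E[of "Suc n"] by simp
    then show "\<bar>E (Suc n) - E n\<bar> \<le> \<bar>(\<Sum>j<Suc n. P (n - j) * y1 (real j * \<tau>)) - (\<Sum>j<n. P (n - Suc j) * y1 (real j * \<tau>))\<bar>
        + \<bar>(\<Sum>j<Suc n. F (n - j) j) - (\<Sum>j<n. F (n - Suc j) j)\<bar>"
      by (simp only: abs_triangle_ineq)
  qed
  also have "\<dots> \<le> \<gamma> T * \<tau>\<^sup>2 * (\<bar>y1 0\<bar> + V T) + (\<gamma> T * \<tau>) * (2 * \<tau> * (\<bar>y1 0\<bar> + V T))"
  proof -
    have "(\<Sum>k<N. q k) * (\<Sum>j<N. Z j) \<le> (\<gamma> T * \<tau>) * (2 * \<tau> * (\<bar>y1 0\<bar> + V T))"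
      using sq sZ \<gamma>T \<tau> by (intro mult_mono) (auto intro!: sum_nonneg Z)
    then show ?thesis unfolding sum.distrib using vF vP by linarith
  qed
  also have "\<dots> = 3 * \<gamma> T * \<tau>\<^sup>2 * (\<bar>y1 0\<bar> + V T)" by (simp add: power2_eq_square algebra_simps)
  finally show ?thesis .
qed

end

section \<open>Error bound for a single mode\<close>

lemma integral_powr_cell:
  fixes q \<tau> :: real
  assumes q: "1 < q" and \<tau>: "0 < \<tau>"
  shows "integral {0..\<tau>} (\<lambda>x. (real (Suc k) * \<tau> - x) powr (q - 1) / Gamma q)
    = \<tau> powr q / Gamma (q + 1) * (real (Suc k) powr q - real k powr q)"
proof -
  define G where "G x = - ((real (Suc k) * \<tau> - x) powr q / Gamma (q + 1))" for x
  have Gq: "Gamma (q + 1) = q * Gamma q" using q by (intro Gamma_plus1) (auto elim!: nonpos_Ints_cases)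
  have \<Gamma>: "Gamma (q + 1) \<noteq> 0" using q by (intro less_imp_neq[THEN not_sym] Gamma_real_pos) auto
  have pm: "(real n * \<tau>) powr q = real n powr q * \<tau> powr q" for n
    by (rule powr_mult)
  have pos: "0 < real (Suc k) * \<tau> - x" if "x < \<tau>" for x
  proof -
    have "\<tau> \<le> real (Suc k) * \<tau>" using \<tau> by simp
    then show ?thesis using that by linarith
  qed
  have "((\<lambda>x. (real (Suc k) * \<tau> - x) powr (q - 1) / Gamma q) has_integral (G \<tau> - G 0)) {0..\<tau>}"
  proof (rule fundamental_theorem_of_calculus_interior)
    have "0 \<le> real (Suc k) * \<tau> - x" if "x \<le> \<tau>" for x using pos[of x] pos[of "x - 1"] that \<tau>
      by (cases "x = \<tau>") auto
    then show "continuous_on {0..\<tau>} G" unfolding G_def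
      using q \<Gamma> by (intro continuous_on_minus continuous_on_divide continuous_on_powr' continuous_on_diff continuous_on_const continuous_on_id) auto
    fix x assume "x \<in> {0<..<\<tau>}"
    then have p: "0 < real (Suc k) * \<tau> - x" using pos[of x] by simp
    have "(G has_real_derivative q * (real (Suc k) * \<tau> - x) powr (q - 1) / Gamma (q + 1)) (at x)"
      unfolding G_def using p \<Gamma> by (auto intro!: derivative_eq_intros)
    then show "(G has_vector_derivative (real (Suc k) * \<tau> - x) powr (q - 1) / Gamma q) (at x)"
      using q by (simp add: Gq has_real_derivative_iff_has_vector_derivative[symmetric])
  qed (use \<tau> in simp)
  then have "integral {0..\<tau>} (\<lambda>x. (real (Suc k) * \<tau> - x) powr (q - 1) / Gamma q) = G \<tau> - G 0"
    by (rule integral_unique)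
  also have "\<dots> = \<tau> powr q / Gamma (q + 1) * (real (Suc k) powr q - real k powr q)"
  proof -
    have "real (Suc k) * \<tau> - \<tau> = real k * \<tau>" by (simp add: algebra_simps)
    then have "G \<tau> - G 0 = (real (Suc k) * \<tau>) powr q / Gamma (q + 1) - (real k * \<tau>) powr q / Gamma (q + 1)"
      unfolding G_def by simp
    then show ?thesis unfolding pm by (simp add: algebra_simps diff_divide_distrib)
  qed
  finally show ?thesis .
qed

lemma pi_weight_difference:
  "pi_weight q k = (real (Suc k) powr q - real k powr q) - (if k = 0 then 0 else real k powr q - real (k - 1) powr q)"
  by (cases k) (auto simp: pi_weight_def)

text \<open>The scheme is given in incremental form, driven by increments of the same
  \<open>\<Phi>\<close> as in the integrated equation. Subtraction cancels \<open>\<Phi>\<close>,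
  and the error equation is driven by increments of the two truncation errors alone.
  \<open>\<mu>\<close> stays out of the exponential and enters linearly.\<close>

lemma averaged_scheme_error:
  fixes y y1 V g :: "real \<Rightarrow> real" and Y Yb \<Phi> :: "nat \<Rightarrow> real"
  assumes \<tau>: "0 < \<tau>" and T: "real N * \<tau> = T" and N: "0 < N"
    and y: "\<And>s. s \<in> {0..T} \<Longrightarrow> (y has_real_derivative y1 s) (at s within {0..T})"
    and y1: "continuous_on {0..T} y1"
    and V: "\<And>r s. 0 \<le> r \<Longrightarrow> r \<le> s \<Longrightarrow> s \<le> T \<Longrightarrow> \<bar>y1 s - y1 r\<bar> \<le> V s - V r"
    and V0: "V 0 = 0"
    and C: "0 \<le> C"
    and g1: "\<And>a b. a \<in> {0..T} \<Longrightarrow> b \<in> {0..T} \<Longrightarrow> \<bar>g a - g b\<bar> \<le> C * \<bar>a - b\<bar>"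
    and g2: "\<And>a b c. 0 \<le> a \<Longrightarrow> 0 \<le> b \<Longrightarrow> 0 \<le> c \<Longrightarrow> a + b + c \<le> T \<Longrightarrow>
       \<bar>g (a + b + c) - g (a + b) - g (a + c) + g a\<bar> \<le> C * b * c"
    and g0: "g 0 = 1" and g_nn: "\<And>a. a \<in> {0..T} \<Longrightarrow> 0 \<le> g a"
    and q: "1 < q" "q < 2" and \<mu>: "0 \<le> \<mu>"
  defines "gh \<equiv> \<lambda>k. (g (real k * \<tau>) + g (real (Suc k) * \<tau>)) / 2"
    and "\<gamma> \<equiv> \<lambda>x. x powr (q - 1) / Gamma q"
  assumes Y0: "Y 0 = y 0" and Yb0: "Yb 0 = Y 1" and Yb: "\<And>j. Yb (Suc j) = (Y (Suc (Suc j)) + Y (Suc j)) / 2"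
    and scheme: "\<And>n. n < N \<Longrightarrow> gh 0 * (Y (Suc n) - Y n)
        + (\<Sum>j<n. (gh (n - j) - gh (n - Suc j)) * (Y (Suc j) - Y j))
        + \<mu> * (\<tau> powr q / Gamma (q + 1)) * (\<Sum>j\<le>n. pi_weight q (n - j) * Yb j) = \<Phi> (Suc n) - \<Phi> n"
    and exact: "\<And>m. m \<le> N \<Longrightarrow> integral {0..real m * \<tau>} (\<lambda>s. g (real m * \<tau> - s) * y1 s)
        + \<mu> * integral {0..real m * \<tau>} (\<lambda>s. \<gamma> (real m * \<tau> - s) * y s) = \<Phi> m"
    and m: "m \<le> N"
  shows "\<bar>y (real m * \<tau>) - Y m\<bar> \<le> 4 * exp (8 * (C * (1 + T)) * T)
     * ((C * (1 + 2 * T) + 3 * \<mu> * \<gamma> T) * \<tau>\<^sup>2 * (\<bar>y1 0\<bar> + V T))"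
proof -
  note ctx = \<tau> T y y1 V V0
  have T0: "0 \<le> T" using T \<tau> by (metis mult_nonneg_nonneg of_nat_0_le_iff less_imp_le)
  have le_T: "real k * \<tau> \<le> T" if "k \<le> N" for k unfolding T[symmetric] using that \<tau> by (intro mult_right_mono) auto
  have ge_0: "0 \<le> real k * \<tau>" for k using \<tau> by simp
  have in_T: "real k * \<tau> \<in> {0..T}" if "k \<le> N" for k using le_T[OF that] ge_0[of k] by simp
  define c where "c = \<tau> powr q / Gamma (q + 1)"
  have c: "0 \<le> c" using q by (simp add: c_def Gamma_real_nonneg)
  \<comment> \<open>Case 0 copies what the product rule does in the first cell, so that the errors
    \<open>eb\<close> inherit the same recursion.\<close>
  define yb where "yb j = (case j of 0 \<Rightarrow> y \<tau> | Suc i \<Rightarrow> (y (real (Suc (Suc i)) * \<tau>) + y (real (Suc i) * \<tau>)) / 2)" for j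
  define e where "e j = y (real j * \<tau>) - Y j" for j
  define eb where "eb j = yb j - Yb j" for j
  define E1 where "E1 m = integral {0..real m * \<tau>} (\<lambda>s. g (real m * \<tau> - s) * y1 s)
      - (\<Sum>j<m. gh (m - Suc j) * (y (real (Suc j) * \<tau>) - y (real j * \<tau>)))" for m
  define E2 where "E2 m = integral {0..real m * \<tau>} (\<lambda>s. \<gamma> (real m * \<tau> - s) * y s)
      - (\<Sum>j<m. integral {0..\<tau>} (\<lambda>x. \<gamma> (real (Suc (m - Suc j)) * \<tau> - x)) * yb j)" for m
  define \<rho> where "\<rho> n = - (E1 (Suc n) - E1 n) - \<mu> * (E2 (Suc n) - E2 n)" for n
  have v1: "(\<Sum>n<N. \<bar>E1 (Suc n) - E1 n\<bar>) \<le> C * (1 + 2 * T) * \<tau>\<^sup>2 * (\<bar>y1 0\<bar> + V T)"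
    unfolding E1_def gh_def by (rule truncation_smooth_kernel[OF ctx C g1 g2])
  have v2: "(\<Sum>n<N. \<bar>E2 (Suc n) - E2 n\<bar>) \<le> 3 * \<gamma> T * \<tau>\<^sup>2 * (\<bar>y1 0\<bar> + V T)"
    unfolding E2_def
  proof (rule truncation_monotone_kernel[OF ctx])
    have "Gamma q \<noteq> 0" using q by (intro less_imp_neq[THEN not_sym] Gamma_real_pos) auto
    then show "continuous_on {0..T} \<gamma>" unfolding \<gamma>_def using q
      by (intro continuous_on_divide continuous_on_powr' continuous_on_const continuous_on_id) auto
    show "mono_on {0..T} \<gamma>" unfolding \<gamma>_def using q
      by (intro mono_onI divide_right_mono powr_mono2) (auto simp: Gamma_real_nonneg)
    show "\<gamma> 0 = 0" by (simp add: \<gamma>_def)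
  qed (auto simp: yb_def)
  have \<gamma>_int: "integral {0..\<tau>} (\<lambda>x. \<gamma> (real (Suc k) * \<tau> - x)) = c * (real (Suc k) powr q - real k powr q)" for k
    unfolding \<gamma>_def c_def by (rule integral_powr_cell[OF q(1) \<tau>])
  have gsum: "(\<Sum>j<Suc n. gh (Suc n - Suc j) * x j) - (\<Sum>j<n. gh (n - Suc j) * x j)
      = gh 0 * x n + (\<Sum>j<n. (gh (n - j) - gh (n - Suc j)) * x j)" for n and x :: "nat \<Rightarrow> real"
    by (simp add: left_diff_distrib sum_subtractf)
  define Gk where "Gk k = real (Suc k) powr q - real k powr q" for k
  \<comment> \<open>The exact cell integrals of \<open>\<gamma>\<close> are first differences of
    powers; one more difference in the time index produces the second differences
    \<open>pi_weight\<close>.\<close>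
  have \<gamma>sum: "(\<Sum>j<Suc n. Gk (Suc n - Suc j) * x j) - (\<Sum>j<n. Gk (n - Suc j) * x j)
      = (\<Sum>j\<le>n. pi_weight q (n - j) * x j)" for n and x :: "nat \<Rightarrow> real"
  proof -
    have "(\<Sum>j\<le>n. pi_weight q (n - j) * x j) = pi_weight q 0 * x n + (\<Sum>j<n. pi_weight q (n - j) * x j)"
      by (simp add: lessThan_Suc_atMost[symmetric])
    also have "(\<Sum>j<n. pi_weight q (n - j) * x j) = (\<Sum>j<n. (Gk (n - j) - Gk (n - Suc j)) * x j)"
      unfolding Gk_def by (intro sum.cong refl) (simp add: pi_weight_difference Suc_diff_Suc)
    finally have "(\<Sum>j\<le>n. pi_weight q (n - j) * x j) = x n + ((\<Sum>j<n. Gk (n - j) * x j) - (\<Sum>j<n. Gk (n - Suc j) * x j))"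
      by (simp add: pi_weight_def[of q 0] left_diff_distrib sum_subtractf)
    moreover have "Gk 0 = 1" by (simp add: Gk_def)
    ultimately show ?thesis by simp
  qed
  have bound: "\<bar>e m\<bar> \<le> 4 * exp (8 * (C * (1 + T) * \<tau>) * real N) * (\<Sum>n<N. \<bar>\<rho> n\<bar>)"
  proof (rule averaged_scheme_stability[where gh = gh and a = "\<lambda>k. c * pi_weight q k" and \<mu> = \<mu> and \<delta>' = "C * \<tau>\<^sup>2" and eb = eb])
    show "e 0 = 0" "eb 0 = e 1" by (simp_all add: e_def eb_def yb_def Yb0 Y0)
    show "eb (Suc j) = (e (Suc (Suc j)) + e (Suc j)) / 2" for j
      by (simp add: e_def eb_def yb_def Yb diff_divide_distrib add_divide_distrib)
    show "m \<le> N" "0 \<le> \<mu>" "0 \<le> C * \<tau>\<^sup>2" using m \<mu> C by auto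
    \<comment> \<open>The two summands of \<open>1 + T\<close> serve two purposes: the 1 covers
      first differences of \<open>gh\<close>, and the \<open>T\<close> covers \<open>N\<close>
      second differences.\<close>
    show "real N * (C * \<tau>\<^sup>2) \<le> C * (1 + T) * \<tau>"
    proof -
      have "real N * (C * \<tau>\<^sup>2) = C * T * \<tau>" unfolding T[symmetric] by (simp add: power2_eq_square)
      also have "\<dots> \<le> C * (1 + T) * \<tau>" using C \<tau> by (intro mult_right_mono mult_left_mono) auto
      finally show ?thesis .
    qed
    show "0 \<le> (\<Sum>n<M. (\<Sum>j\<le>n. c * pi_weight q (n - j) * eb j) * eb n)" for M
    proof -
      have "(\<Sum>n<M. (\<Sum>j\<le>n. c * pi_weight q (n - j) * eb j) * eb n)
          = c * (\<Sum>n<M. (\<Sum>j\<le>n. pi_weight q (n - j) * eb j) * eb n)"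
        by (simp only: sum_distrib_left sum_distrib_right mult.assoc)
      also have "\<dots> \<ge> 0" by (intro mult_nonneg_nonneg c pi_weight_form_nonneg q)
      finally show ?thesis .
    qed
    show "\<bar>gh (Suc k) - gh k\<bar> \<le> C * (1 + T) * \<tau>" if k: "Suc k < N" for k
    proof -
      have s: "real (Suc (Suc k)) * \<tau> - real k * \<tau> = 2 * \<tau>" by (simp add: algebra_simps)
      have "\<bar>g (real (Suc (Suc k)) * \<tau>) - g (real k * \<tau>)\<bar> \<le> C * \<bar>real (Suc (Suc k)) * \<tau> - real k * \<tau>\<bar>"
        using k by (intro g1 in_T) auto
      then have "\<bar>gh (Suc k) - gh k\<bar> \<le> C * \<tau>" unfolding s gh_def using \<tau> by (auto simp: abs_le_iff field_simps)
      also have "\<dots> \<le> C * (1 + T) * \<tau>" using C T0 \<tau> by (intro mult_right_mono) (auto simp: algebra_simps)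
      finally show ?thesis .
    qed
    show "\<bar>gh (Suc (Suc k)) - gh (Suc k) - (gh (Suc k) - gh k)\<bar> \<le> C * \<tau>\<^sup>2" if k: "Suc (Suc k) < N" for k
    proof -
      have s: "real (Suc k) * \<tau> = real k * \<tau> + \<tau>" "real (Suc (Suc k)) * \<tau> = real k * \<tau> + 2 * \<tau>"
        "real (Suc (Suc (Suc k))) * \<tau> = real k * \<tau> + \<tau> + 2 * \<tau>" by (simp_all add: algebra_simps)
      \<comment> \<open>Since \<open>gh\<close> averages neighbours, its second difference is half
        of a single mixed difference of \<open>g\<close>, with increments tau and 2 tau.\<close>
      have "\<bar>g (real k * \<tau> + \<tau> + 2 * \<tau>) - g (real k * \<tau> + \<tau>) - g (real k * \<tau> + 2 * \<tau>) + g (real k * \<tau>)\<bar> \<le> C * \<tau> * (2 * \<tau>)"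
        using le_T[of "Suc (Suc (Suc k))"] k \<tau> unfolding s by (intro g2) auto
      then show ?thesis unfolding gh_def s by (auto simp: abs_le_iff field_simps power2_eq_square)
    qed
    show "1 / 2 \<le> gh 0"
      using g_nn[OF in_T[of 1]] g0 N by (simp add: gh_def)
    fix n assume n: "n < N"
    define Sy where "Sy m = (\<Sum>j<m. gh (m - Suc j) * (y (real (Suc j) * \<tau>) - y (real j * \<tau>)))" for m
    define Sb where "Sb m = (\<Sum>j<m. Gk (m - Suc j) * yb j)" for m
    have Ssum: "(\<Sum>j<m. integral {0..\<tau>} (\<lambda>x. \<gamma> (real (Suc (m - Suc j)) * \<tau> - x)) * yb j) = c * Sb m" for m
      unfolding \<gamma>_int Sb_def sum_distrib_left Gk_def by (simp only: mult.assoc)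
    have ex: "\<Phi> m = (E1 m + Sy m) + \<mu> * (E2 m + c * Sb m)" if "m \<le> N" for m
      unfolding exact[OF that, symmetric] E1_def E2_def Ssum Sy_def by simp
    have dSy: "Sy (Suc n) - Sy n = gh 0 * (y (real (Suc n) * \<tau>) - y (real n * \<tau>))
        + (\<Sum>j<n. (gh (n - j) - gh (n - Suc j)) * (y (real (Suc j) * \<tau>) - y (real j * \<tau>)))"
      unfolding Sy_def by (rule gsum)
    have dSb: "Sb (Suc n) - Sb n = (\<Sum>j\<le>n. pi_weight q (n - j) * yb j)"
      unfolding Sb_def by (rule \<gamma>sum)
    have "gh 0 * (e (Suc n) - e n) + (\<Sum>j<n. (gh (n - j) - gh (n - Suc j)) * (e (Suc j) - e j))
         + \<mu> * (\<Sum>j\<le>n. c * pi_weight q (n - j) * eb j)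
       = (Sy (Suc n) - Sy n) + \<mu> * (c * (Sb (Suc n) - Sb n)) - (\<Phi> (Suc n) - \<Phi> n)"
      unfolding scheme[OF n, symmetric] dSy dSb e_def eb_def c_def[symmetric]
      by (simp add: algebra_simps sum_subtractf sum_distrib_left sum.distrib)
    also have "\<dots> = \<rho> n"
      unfolding \<rho>_def using ex[of n] ex[of "Suc n"] n by (simp add: algebra_simps)
    finally show "gh 0 * (e (Suc n) - e n) + (\<Sum>j<n. (gh (n - j) - gh (n - Suc j)) * (e (Suc j) - e j))
         + \<mu> * (\<Sum>j\<le>n. c * pi_weight q (n - j) * eb j) = \<rho> n" .
  qed
  have "(\<Sum>n<N. \<bar>\<rho> n\<bar>) \<le> (\<Sum>n<N. \<bar>E1 (Suc n) - E1 n\<bar> + \<mu> * \<bar>E2 (Suc n) - E2 n\<bar>)"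
  proof (intro sum_mono)
    fix n
    have "\<bar>\<mu> * (E2 (Suc n) - E2 n)\<bar> = \<mu> * \<bar>E2 (Suc n) - E2 n\<bar>" using \<mu> by (simp add: abs_mult)
    then show "\<bar>\<rho> n\<bar> \<le> \<bar>E1 (Suc n) - E1 n\<bar> + \<mu> * \<bar>E2 (Suc n) - E2 n\<bar>" unfolding \<rho>_def by linarith
  qed
  also have "\<dots> = (\<Sum>n<N. \<bar>E1 (Suc n) - E1 n\<bar>) + \<mu> * (\<Sum>n<N. \<bar>E2 (Suc n) - E2 n\<bar>)"
    by (simp add: sum.distrib sum_distrib_left)
  also have "\<dots> \<le> C * (1 + 2 * T) * \<tau>\<^sup>2 * (\<bar>y1 0\<bar> + V T) + \<mu> * (3 * \<gamma> T * \<tau>\<^sup>2 * (\<bar>y1 0\<bar> + V T))"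
    by (intro add_mono mult_left_mono v1 v2 \<mu>)
  also have "\<dots> = (C * (1 + 2 * T) + 3 * \<mu> * \<gamma> T) * \<tau>\<^sup>2 * (\<bar>y1 0\<bar> + V T)" by (simp add: algebra_simps)
  finally have \<rho>: "(\<Sum>n<N. \<bar>\<rho> n\<bar>) \<le> (C * (1 + 2 * T) + 3 * \<mu> * \<gamma> T) * \<tau>\<^sup>2 * (\<bar>y1 0\<bar> + V T)" .
  have ex: "8 * (C * (1 + T) * \<tau>) * real N = 8 * (C * (1 + T)) * T" unfolding T[symmetric] by (simp add: mult_ac)
  show ?thesis using order_trans[OF bound[unfolded ex] mult_left_mono[OF \<rho>]] by (simp add: e_def)
qed

subsection \<open>The kernel \<open>g\<close>\<close>

text \<open>The mean value theorem, used once and twice. Derivatives are taken only inside the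
  interval, since the formulas to come contain a logarithm. Difference bounds are the form to pass
  on: they survive averaging over a parameter without differentiation under the integral.\<close>

lemma increment_bounds:
  fixes h h1 h2 :: "real \<Rightarrow> real"
  assumes c: "continuous_on {0..T} h"
    and h1: "\<And>x. 0 < x \<Longrightarrow> x < T \<Longrightarrow> (h has_real_derivative h1 x) (at x)"
    and h2: "\<And>x. 0 < x \<Longrightarrow> x < T \<Longrightarrow> (h1 has_real_derivative h2 x) (at x)"
    and M1: "\<And>x. 0 < x \<Longrightarrow> x < T \<Longrightarrow> \<bar>h1 x\<bar> \<le> M" and M2: "\<And>x. 0 < x \<Longrightarrow> x < T \<Longrightarrow> \<bar>h2 x\<bar> \<le> M"
  shows increment_bound1: "\<And>a b. a \<in> {0..T} \<Longrightarrow> b \<in> {0..T} \<Longrightarrow> \<bar>h a - h b\<bar> \<le> M * \<bar>a - b\<bar>"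
    and increment_bound2: "\<And>a b c. 0 \<le> a \<Longrightarrow> 0 \<le> b \<Longrightarrow> 0 \<le> c \<Longrightarrow> a + b + c \<le> T \<Longrightarrow>
      \<bar>h (a + b + c) - h (a + b) - h (a + c) + h a\<bar> \<le> M * b * c"
proof -
  have lt: "\<bar>h b - h a\<bar> \<le> M * \<bar>b - a\<bar>" if ab: "0 \<le> a" "a < b" "b \<le> T" for a b
  proof -
    have "continuous_on {a..b} h" using ab by (intro continuous_on_subset[OF c]) auto
    moreover have "h differentiable (at x)" if "a < x" "x < b" for x
      using h1[of x] that ab by (auto simp: real_differentiable_def)
    ultimately obtain l z where z: "a < z" "z < b" "(h has_real_derivative l) (at z)" "h b - h a = (b - a) * l"
      using MVT[OF ab(2)] by blast
    then have "l = h1 z" using h1[of z] ab by (intro DERIV_unique) auto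
    then have "\<bar>l\<bar> \<le> M" using M1[of z] z ab by simp
    then show ?thesis unfolding z(4) abs_mult using ab by (simp add: mult.commute[of M] mult_left_mono)
  qed
  show "\<bar>h a - h b\<bar> \<le> M * \<bar>a - b\<bar>" if "a \<in> {0..T}" "b \<in> {0..T}" for a b
    using lt[of a b] lt[of b a] that by (cases a b rule: linorder_cases) (auto simp: abs_minus_commute)
  show "\<bar>h (a + b + d) - h (a + b) - h (a + d) + h a\<bar> \<le> M * b * d"
    if abd: "0 \<le> a" "0 \<le> b" "0 \<le> d" "a + b + d \<le> T" for a b d
  proof (cases "b = 0 \<or> d = 0")
    case True
    then show ?thesis by auto
  next
    case False
    then have p: "0 < b" "0 < d" using abd by auto
    define \<phi> where "\<phi> s = h (s + d) - h s" for s
    have d\<phi>: "(\<phi> has_real_derivative h1 (s + d) - h1 s) (at s)" if "a < s" "s < a + b" for s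
      unfolding \<phi>_def
    proof (rule DERIV_diff)
      show "((\<lambda>s. h (s + d)) has_real_derivative h1 (s + d)) (at s)"
        by (intro DERIV_shift[THEN iffD1] h1) (use that abd p in auto)
      show "(h has_real_derivative h1 s) (at s)" using h1[of s] that abd p by auto
    qed
    have "continuous_on {a..a + b} \<phi>" unfolding \<phi>_def
      using abd by (intro continuous_intros continuous_on_compose2[OF c] continuous_on_subset[OF c]) auto
    moreover have "\<phi> differentiable (at x)" if "a < x" "x < a + b" for x
      using d\<phi>[OF that] by (auto simp: real_differentiable_def)
    moreover have "a < a + b" using p by simp
    ultimately obtain l z where z: "a < z" "z < a + b" "(\<phi> has_real_derivative l) (at z)" "\<phi> (a + b) - \<phi> a = (a + b - a) * l"
      using MVT[of a "a + b" \<phi>] by blast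
    have l: "l = h1 (z + d) - h1 z" using d\<phi>[of z] z by (intro DERIV_unique) auto
    have "continuous_on {z..z + d} h1"
    proof (intro continuous_at_imp_continuous_on ballI)
      fix x assume "x \<in> {z..z + d}"
      then show "isCont h1 x" using z abd p by (intro DERIV_isCont[OF h2]) auto
    qed
    moreover have "h1 differentiable (at x)" if "z < x" "x < z + d" for x
      using h2[of x] that z abd p by (auto simp: real_differentiable_def)
    moreover have "z < z + d" using p by simp
    ultimately obtain l' w where w: "z < w" "w < z + d" "(h1 has_real_derivative l') (at w)" "h1 (z + d) - h1 z = (z + d - z) * l'"
      using MVT[of z "z + d" h1] by blast
    have "l' = h2 w" using h2[of w] w z abd p by (intro DERIV_unique) auto
    then have l': "\<bar>l'\<bar> \<le> M" using M2[of w] w z abd p by simp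
    have "h (a + b + d) - h (a + b) - h (a + d) + h a = b * (d * l')"
      using z(4) w(4) l by (simp add: \<phi>_def algebra_simps)
    also have "\<bar>\<dots>\<bar> = b * d * \<bar>l'\<bar>" using p by (simp add: abs_mult)
    also have "\<dots> \<le> b * d * M" using l' p by (intro mult_left_mono) auto
    finally show ?thesis by (simp add: mult_ac)
  qed
qed

text \<open>Crude, but a single power of \<open>x\<close> in front absorbs the singular
  term.\<close>

lemma abs_ln_le:
  fixes x :: real
  assumes "0 < x"
  shows "\<bar>ln x\<bar> \<le> 1 / x + x"
proof -
  have "ln x \<le> x" using ln_le_minus_one[OF assms] by linarith
  moreover have "ln (1 / x) \<le> 1 / x" using ln_le_minus_one[of "1 / x"] assms by simp
  then have "- ln x \<le> 1 / x" using assms by (simp add: ln_div)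
  moreover have "0 < 1 / x" using assms by simp
  ultimately show ?thesis using assms by linarith
qed

section \<open>The smooth part of the kernel k\<close>

locale variable_order =
  fixes T L :: real and \<alpha> \<alpha>1 \<alpha>2 \<alpha>3 :: "real \<Rightarrow> real"
  assumes T: "0 < T" and L: "0 < L"
    and range: "\<And>t. t \<in> {0..T} \<Longrightarrow> 1 < \<alpha> t \<and> \<alpha> t < 2"
    and D1: "\<And>t. t \<in> {0..T} \<Longrightarrow> (\<alpha> has_real_derivative \<alpha>1 t) (at t within {0..T})"
    and D2: "\<And>t. t \<in> {0..T} \<Longrightarrow> (\<alpha>1 has_real_derivative \<alpha>2 t) (at t within {0..T})"
    and D3: "\<And>t. t \<in> {0..T} \<Longrightarrow> (\<alpha>2 has_real_derivative \<alpha>3 t) (at t within {0..T})"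
    and bound: "\<And>t. t \<in> {0..T} \<Longrightarrow> \<bar>\<alpha>1 t\<bar> + \<bar>\<alpha>2 t\<bar> + \<bar>\<alpha>3 t\<bar> \<le> L"
    and z1: "\<alpha>1 0 = 0" and z2: "\<alpha>2 0 = 0"
begin

text \<open>Each integration gains one order of vanishing at 0. Starting from the bounded third
  derivative, \<open>\<alpha>2\<close>, \<open>\<alpha>1\<close> and
  \<open>\<alpha> 0 - \<alpha> x\<close> vanish to first, second and third order, always with the
  constant \<open>L\<close>.\<close>

lemma vanishing_bound:
  fixes u v :: "real \<Rightarrow> real"
  assumes "\<And>t. t \<in> {0..T} \<Longrightarrow> (u has_real_derivative v t) (at t within {0..T})"
    and "\<And>t. t \<in> {0..T} \<Longrightarrow> \<bar>v t\<bar> \<le> L * t ^ n" and x: "x \<in> {0..T}"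
  shows "\<bar>u x - u 0\<bar> \<le> L * x ^ Suc n"
proof -
  have "norm (u x - u 0) \<le> (L * x ^ n) * norm (x - 0)"
  proof (rule field_differentiable_bound[where S = "{0..x}" and f' = v])
    fix t assume t: "t \<in> {0..x}"
    then have t': "t \<in> {0..T}" "{0..x} \<subseteq> {0..T}" using x by auto
    show "(u has_field_derivative v t) (at t within {0..x})"
      by (rule DERIV_subset[OF assms(1)[OF t'(1)] t'(2)])
    have "\<bar>v t\<bar> \<le> L * t ^ n" by (rule assms(2)[OF t'(1)])
    also have "\<dots> \<le> L * x ^ n" using t L by (intro mult_left_mono power_mono) auto
    finally show "norm (v t) \<le> L * x ^ n" by simp
  qed (use x in auto)
  then show ?thesis using x by (simp add: mult_ac)
qed

lemma \<alpha>2_le: "x \<in> {0..T} \<Longrightarrow> \<bar>\<alpha>2 x\<bar> \<le> L * x"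
  using vanishing_bound[of \<alpha>2 \<alpha>3 0 x] D3 bound z2 by fastforce

lemma \<alpha>1_le: "x \<in> {0..T} \<Longrightarrow> \<bar>\<alpha>1 x\<bar> \<le> L * x ^ 2"
  using vanishing_bound[of \<alpha>1 \<alpha>2 1 x] D2 \<alpha>2_le z1 by (simp add: numeral_2_eq_2)

lemma \<alpha>_le: "x \<in> {0..T} \<Longrightarrow> \<bar>\<alpha> 0 - \<alpha> x\<bar> \<le> L * x ^ 3"
  using vanishing_bound[of \<alpha> \<alpha>1 2 x] D1 \<alpha>1_le by (simp add: abs_minus_commute numeral_3_eq_3 numeral_2_eq_2)

lemma \<alpha>_continuous: "continuous_on {0..T} \<alpha>" "continuous_on {0..T} \<alpha>1"
  by (rule DERIV_continuous_on, erule D1) (rule DERIV_continuous_on, erule D2)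

lemma \<alpha>0: "1 < \<alpha> 0" "\<alpha> 0 < 2"
  using range[of 0] T by auto

text \<open>
  \<open>smooth_factor = exp \<circ> log_factor\<close> is the smooth part \<open>x\<^bsup>\<alpha>(0)-\<alpha>(x)\<^esup> / \<Gamma>(2 - \<alpha>(x))\<close> of \<open>k\<close>; as \<open>ln 0 = 0\<close>, the formula also gives the
  right value at \<open>x = 0\<close>. Its second derivative is bounded because \<open>\<alpha>\<^sub>1\<close> and \<open>\<alpha>\<^sub>2\<close> vanish at \<open>0\<close>.
\<close>

definition log_factor :: "real \<Rightarrow> real" where
  "log_factor x = (\<alpha> 0 - \<alpha> x) * ln x - ln_Gamma (2 - \<alpha> x)"

definition log_factor1 :: "real \<Rightarrow> real" where
  "log_factor1 x = - \<alpha>1 x * ln x + (\<alpha> 0 - \<alpha> x) / x + Digamma (2 - \<alpha> x) * \<alpha>1 x"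

definition log_factor2 :: "real \<Rightarrow> real" where
  "log_factor2 x = - \<alpha>2 x * ln x - 2 * \<alpha>1 x / x - (\<alpha> 0 - \<alpha> x) / x\<^sup>2
     - Polygamma 1 (2 - \<alpha> x) * (\<alpha>1 x)\<^sup>2 + Digamma (2 - \<alpha> x) * \<alpha>2 x"

lemma interior_derivs:
  assumes "0 < x" "x < T"
  shows "(\<alpha> has_real_derivative \<alpha>1 x) (at x)" "(\<alpha>1 has_real_derivative \<alpha>2 x) (at x)"
  using D1[of x] D2[of x] assms by (auto simp: at_within_Icc_at)

lemma log_factor_deriv:
  assumes x: "0 < x" "x < T"
  shows "(log_factor has_real_derivative log_factor1 x) (at x)" "(log_factor1 has_real_derivative log_factor2 x) (at x)"
proof -
  have r: "2 - \<alpha> x > 0" using range[of x] x by auto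
  then have nz: "2 - \<alpha> x \<notin> \<int>\<^sub>\<le>\<^sub>0" by (auto elim!: nonpos_Ints_cases)
  note d = interior_derivs[OF x]
  have i: "((\<lambda>x. 2 - \<alpha> x) has_real_derivative 0 - \<alpha>1 x) (at x)"
    by (intro DERIV_diff DERIV_const d)
  have i': "((\<lambda>x. \<alpha> 0 - \<alpha> x) has_real_derivative 0 - \<alpha>1 x) (at x)"
    by (intro DERIV_diff DERIV_const d)
  note l = DERIV_chain2[OF has_field_derivative_ln_Gamma_real[OF r] i]
  have "(log_factor has_real_derivative (0 - \<alpha>1 x) * ln x + 1 / x * (\<alpha> 0 - \<alpha> x) - Digamma (2 - \<alpha> x) * (0 - \<alpha>1 x)) (at x)"
    unfolding log_factor_def by (intro DERIV_diff DERIV_mult l i' DERIV_ln_divide x)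
  then show "(log_factor has_real_derivative log_factor1 x) (at x)" by (simp add: log_factor1_def)
  note p = DERIV_chain2[OF has_field_derivative_Polygamma[OF nz, of 0 UNIV] i]
  have "(log_factor1 has_real_derivative
      (- \<alpha>2 x * ln x + 1 / x * - \<alpha>1 x) + ((0 - \<alpha>1 x) * x - (\<alpha> 0 - \<alpha> x) * 1) / (x * x)
      + (Polygamma (Suc 0) (2 - \<alpha> x) * (0 - \<alpha>1 x) * \<alpha>1 x + \<alpha>2 x * Digamma (2 - \<alpha> x))) (at x)"
    unfolding log_factor1_def using x
    by (intro DERIV_add DERIV_mult DERIV_divide DERIV_minus d p i' DERIV_ln_divide DERIV_ident) auto
  also have "(- \<alpha>2 x * ln x + 1 / x * - \<alpha>1 x) + ((0 - \<alpha>1 x) * x - (\<alpha> 0 - \<alpha> x) * 1) / (x * x)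
      + (Polygamma (Suc 0) (2 - \<alpha> x) * (0 - \<alpha>1 x) * \<alpha>1 x + \<alpha>2 x * Digamma (2 - \<alpha> x)) = log_factor2 x"
    using x by (simp add: log_factor2_def diff_divide_distrib power2_eq_square)
  finally show "(log_factor1 has_real_derivative log_factor2 x) (at x)" .
qed

definition smooth_factor :: "real \<Rightarrow> real" where "smooth_factor x = exp (log_factor x)"

lemma smooth_factor_pos: "0 < smooth_factor x" by (simp add: smooth_factor_def)

lemma smooth_factor_eq:
  assumes "0 < x" "x \<le> T"
  shows "smooth_factor x = x powr (\<alpha> 0 - \<alpha> x) / Gamma (2 - \<alpha> x)"
  using assms range[of x] by (simp add: smooth_factor_def log_factor_def exp_diff powr_def Gamma_real_pos_exp)

lemma smooth_factor_0: "smooth_factor 0 = 1 / Gamma (2 - \<alpha> 0)"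
  using \<alpha>0 by (simp add: smooth_factor_def log_factor_def exp_minus Gamma_real_pos_exp field_simps)

lemma compact_bounds:
  "\<exists>B\<ge>0. \<forall>x\<in>{0..T}. \<bar>Digamma (2 - \<alpha> x)\<bar> \<le> B \<and> \<bar>Polygamma 1 (2 - \<alpha> x)\<bar> \<le> B \<and> \<bar>ln_Gamma (2 - \<alpha> x)\<bar> \<le> B"
proof -
  have pos: "0 < 2 - \<alpha> x" if "x \<in> {0..T}" for x using range[OF that] by simp
  have c: "continuous_on {0..T} (\<lambda>x. 2 - \<alpha> x)" by (intro continuous_intros \<alpha>_continuous)
  have cb: "\<exists>B. \<forall>x\<in>{0..T}. \<bar>f x\<bar> \<le> B" if "continuous_on {0..T} f" for f :: "real \<Rightarrow> real"
    using compact_imp_bounded[OF compact_continuous_image[OF that compact_Icc]] by (auto simp: bounded_iff)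
  have cP: "continuous_on {0..T} (\<lambda>x. Polygamma n (2 - \<alpha> x))" for n
  proof (rule continuous_on_compose2[OF _ c, of "{0<..}"])
    show "continuous_on {0<..} (Polygamma n :: real \<Rightarrow> real)"
      by (rule continuous_on_Polygamma) (auto elim!: nonpos_Ints_cases)
  qed (use pos in auto)
  have cl: "continuous_on {0..T} (\<lambda>x. ln_Gamma (2 - \<alpha> x))"
    using pos by (intro continuous_on_compose2[OF _ c, of "{0<..}" ln_Gamma] continuous_at_imp_continuous_on ballI
       DERIV_isCont[OF has_field_derivative_ln_Gamma_real]) auto
  from cb[OF cP[of 0]] obtain B1 where B1: "\<forall>x\<in>{0..T}. \<bar>Digamma (2 - \<alpha> x)\<bar> \<le> B1" ..
  from cb[OF cP[of 1]] obtain B2 where B2: "\<forall>x\<in>{0..T}. \<bar>Polygamma 1 (2 - \<alpha> x)\<bar> \<le> B2" ..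
  from cb[OF cl] obtain B3 where B3: "\<forall>x\<in>{0..T}. \<bar>ln_Gamma (2 - \<alpha> x)\<bar> \<le> B3" ..
  show ?thesis
  proof (intro exI conjI ballI)
    show "0 \<le> \<bar>B1\<bar> + \<bar>B2\<bar> + \<bar>B3\<bar>" by simp
    fix x assume x: "x \<in> {0..T}"
    show "\<bar>Digamma (2 - \<alpha> x)\<bar> \<le> \<bar>B1\<bar> + \<bar>B2\<bar> + \<bar>B3\<bar>" "\<bar>Polygamma 1 (2 - \<alpha> x)\<bar> \<le> \<bar>B1\<bar> + \<bar>B2\<bar> + \<bar>B3\<bar>"
      "\<bar>ln_Gamma (2 - \<alpha> x)\<bar> \<le> \<bar>B1\<bar> + \<bar>B2\<bar> + \<bar>B3\<bar>"
      using bspec[OF B1 x] bspec[OF B2 x] bspec[OF B3 x] by linarith+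
  qed
qed

text \<open>The critical terms of the second derivative are \<open>\<alpha>2 x * ln x\<close>,
  \<open>\<alpha>1 x / x\<close> and \<open>(\<alpha> 0 - \<alpha> x) / x\<^sup>2\<close>; vanishing
  to orders 1, 2 and 3 keeps each of them bounded. The Gamma terms are bounded because
  \<open>2 - \<alpha> x\<close> stays in a compact set of positive numbers.\<close>

lemma log_factor_bounded: "\<exists>K\<ge>0. \<forall>x. 0 < x \<longrightarrow> x < T \<longrightarrow> \<bar>log_factor x\<bar> \<le> K \<and> \<bar>log_factor1 x\<bar> \<le> K \<and> \<bar>log_factor2 x\<bar> \<le> K"
proof -
  obtain B where B: "0 \<le> B" "\<And>x. x \<in> {0..T} \<Longrightarrow> \<bar>Digamma (2 - \<alpha> x)\<bar> \<le> B"
    "\<And>x. x \<in> {0..T} \<Longrightarrow> \<bar>Polygamma 1 (2 - \<alpha> x)\<bar> \<le> B" "\<And>x. x \<in> {0..T} \<Longrightarrow> \<bar>ln_Gamma (2 - \<alpha> x)\<bar> \<le> B"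
    using compact_bounds by blast
  have lnT: "x ^ Suc n * \<bar>ln x\<bar> \<le> T ^ n * (1 + T\<^sup>2)" if "0 < x" "x < T" for x n
  proof -
    have "x ^ Suc n * \<bar>ln x\<bar> \<le> x ^ Suc n * (1 / x + x)" using that by (intro mult_left_mono abs_ln_le) auto
    also have "\<dots> = x ^ n * (1 + x\<^sup>2)" using that by (simp add: field_simps power2_eq_square)
    also have "\<dots> \<le> T ^ n * (1 + T\<^sup>2)" using that by (intro mult_mono power_mono add_left_mono) auto
    finally show ?thesis .
  qed
  define S where "S = 1 + T\<^sup>2"
  have S: "1 \<le> S" by (simp add: S_def)
  let ?K0 = "L * (T\<^sup>2 * S) + B"
  let ?K1 = "L * (T * S) + L * T\<^sup>2 + B * L"
  let ?K2 = "L * S + 2 * (L * T) + L * T + B * L\<^sup>2 + B * L"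
  have *: "\<bar>log_factor x\<bar> \<le> ?K0 \<and> \<bar>log_factor1 x\<bar> \<le> ?K1 \<and> \<bar>log_factor2 x\<bar> \<le> ?K2" if x: "0 < x" "x < T" for x
  proof -
    have xT: "x \<in> {0..T}" using x by simp
    have a0: "\<bar>\<alpha> 0 - \<alpha> x\<bar> \<le> L * x ^ 3" and a1: "\<bar>\<alpha>1 x\<bar> \<le> L * x ^ 2" and a2: "\<bar>\<alpha>2 x\<bar> \<le> L * x"
      using \<alpha>_le \<alpha>1_le \<alpha>2_le xT by auto
    have a1': "\<bar>\<alpha>1 x\<bar> \<le> L" and a2': "\<bar>\<alpha>2 x\<bar> \<le> L" using bound[OF xT] by linarith+
    have e0: "\<bar>(\<alpha> 0 - \<alpha> x) * ln x\<bar> \<le> L * (T\<^sup>2 * S)"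
    proof -
      have "\<bar>(\<alpha> 0 - \<alpha> x) * ln x\<bar> \<le> L * x ^ 3 * \<bar>ln x\<bar>" unfolding abs_mult by (intro mult_right_mono a0) auto
      also have "\<dots> \<le> L * (T\<^sup>2 * S)" using lnT[OF x, of 2] L unfolding mult.assoc S_def
        by (intro mult_left_mono) (auto simp: numeral_3_eq_3 numeral_2_eq_2)
      finally show ?thesis .
    qed
    have e1: "\<bar>\<alpha>1 x * ln x\<bar> \<le> L * (T * S)"
    proof -
      have "\<bar>\<alpha>1 x * ln x\<bar> \<le> L * x ^ 2 * \<bar>ln x\<bar>" unfolding abs_mult by (intro mult_right_mono a1) auto
      also have "\<dots> \<le> L * (T * S)" using lnT[OF x, of 1] L unfolding mult.assoc S_def
        by (intro mult_left_mono) (auto simp: numeral_2_eq_2)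
      finally show ?thesis .
    qed
    have e2: "\<bar>\<alpha>2 x * ln x\<bar> \<le> L * S"
    proof -
      have "\<bar>\<alpha>2 x * ln x\<bar> \<le> L * x * \<bar>ln x\<bar>" unfolding abs_mult by (intro mult_right_mono a2) auto
      also have "\<dots> \<le> L * S" using lnT[OF x, of 0] L unfolding mult.assoc S_def
        by (intro mult_left_mono) auto
      finally show ?thesis .
    qed
    have d1: "\<bar>(\<alpha> 0 - \<alpha> x) / x\<bar> \<le> L * T\<^sup>2"
    proof -
      have "\<bar>(\<alpha> 0 - \<alpha> x) / x\<bar> \<le> L * x ^ 3 / x" unfolding abs_divide using x a0 by (intro frac_le) auto
      also have "\<dots> = L * x\<^sup>2" using x by (simp add: power3_eq_cube power2_eq_square)
      also have "\<dots> \<le> L * T\<^sup>2" using x L by (intro mult_left_mono power_mono) auto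
      finally show ?thesis .
    qed
    have d2: "\<bar>(\<alpha> 0 - \<alpha> x) / x\<^sup>2\<bar> \<le> L * T"
    proof -
      have "\<bar>(\<alpha> 0 - \<alpha> x) / x\<^sup>2\<bar> \<le> L * x ^ 3 / x\<^sup>2" unfolding abs_divide using x a0 L by (intro frac_le) auto
      also have "\<dots> = L * x" using x by (simp add: power3_eq_cube power2_eq_square)
      also have "\<dots> \<le> L * T" using x L by (intro mult_left_mono) auto
      finally show ?thesis .
    qed
    have d3: "\<bar>\<alpha>1 x / x\<bar> \<le> L * T"
    proof -
      have "\<bar>\<alpha>1 x / x\<bar> \<le> L * x ^ 2 / x" unfolding abs_divide using x a1 by (intro frac_le) auto
      also have "\<dots> = L * x" using x by (simp add: power2_eq_square)
      also have "\<dots> \<le> L * T" using x L by (intro mult_left_mono) auto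
      finally show ?thesis .
    qed
    have g1: "\<bar>Digamma (2 - \<alpha> x) * \<alpha>1 x\<bar> \<le> B * L" "\<bar>Digamma (2 - \<alpha> x) * \<alpha>2 x\<bar> \<le> B * L"
      unfolding abs_mult using B(1) B(2)[OF xT] a1' a2' by (auto intro!: mult_mono)
    have g2: "\<bar>Polygamma 1 (2 - \<alpha> x) * (\<alpha>1 x)\<^sup>2\<bar> \<le> B * L\<^sup>2"
    proof -
      have "(\<alpha>1 x)\<^sup>2 \<le> L\<^sup>2" using a1' L by (simp add: abs_le_square_iff[symmetric])
      then show ?thesis unfolding abs_mult using B(1) B(3)[OF xT] by (auto intro!: mult_mono)
    qed
    have "\<bar>log_factor x\<bar> \<le> ?K0" unfolding log_factor_def using e0 B(4)[OF xT] by linarith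
    moreover have "\<bar>log_factor1 x\<bar> \<le> ?K1" unfolding log_factor1_def using e1 d1 g1 by linarith
    moreover have "\<bar>log_factor2 x\<bar> \<le> ?K2" unfolding log_factor2_def using e2 d2 d3 g1 g2 by linarith
    ultimately show ?thesis by blast
  qed
  show ?thesis
  proof (intro exI conjI allI impI)
    show "0 \<le> max ?K0 (max ?K1 ?K2)" using L T B(1) S by (simp add: le_max_iff_disj)
    fix x assume "0 < x" "x < T"
    from *[OF this] show "\<bar>log_factor x\<bar> \<le> max ?K0 (max ?K1 ?K2)" "\<bar>log_factor1 x\<bar> \<le> max ?K0 (max ?K1 ?K2)" "\<bar>log_factor2 x\<bar> \<le> max ?K0 (max ?K1 ?K2)"
      by (simp_all add: le_max_iff_disj)
  qed
qed

text \<open>Only \<open>x = 0\<close> is delicate. There the logarithm is squeezed by the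
  third-order vanishing of its coefficient.\<close>

lemma smooth_factor_continuous: "continuous_on {0..T} smooth_factor"
proof -
  have lG: "continuous_on {0..T} (\<lambda>x. ln_Gamma (2 - \<alpha> x))"
  proof -
    have c: "continuous_on {0..T} (\<lambda>x. 2 - \<alpha> x)" by (intro continuous_intros \<alpha>_continuous)
    show ?thesis
      using range by (intro continuous_on_compose2[OF _ c, of "{0<..}" ln_Gamma] continuous_at_imp_continuous_on ballI
       DERIV_isCont[OF has_field_derivative_ln_Gamma_real]) auto
  qed
  have "continuous_on {0..T} (\<lambda>x. (\<alpha> 0 - \<alpha> x) * ln x)"
    unfolding continuous_on
  proof
    fix x assume x: "x \<in> {0..T}"
    show "((\<lambda>x. (\<alpha> 0 - \<alpha> x) * ln x) \<longlongrightarrow> (\<alpha> 0 - \<alpha> x) * ln x) (at x within {0..T})"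
    proof (cases "x = 0")
      case False
      then show ?thesis using x \<alpha>_continuous(1) unfolding continuous_on by (intro tendsto_intros) auto
    next
      case True
      have "((\<lambda>x. (\<alpha> 0 - \<alpha> x) * ln x) \<longlongrightarrow> 0) (at 0 within {0..T})"
      proof (rule tendsto_rabs_zero_cancel, rule tendsto_sandwich[OF _ _ tendsto_const])
        show "\<forall>\<^sub>F x in at 0 within {0..T}. \<bar>(\<alpha> 0 - \<alpha> x) * ln x\<bar> \<le> L * (x\<^sup>2 + x ^ 4)"
          unfolding eventually_at_filter
        proof (intro always_eventually allI impI)
          fix x :: real assume "x \<noteq> 0" "x \<in> {0..T}"
          then have "0 < x" "x \<in> {0..T}" by auto
          have "\<bar>(\<alpha> 0 - \<alpha> x) * ln x\<bar> \<le> (L * x ^ 3) * (1 / x + x)"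
            unfolding abs_mult using \<open>0 < x\<close> L by (intro mult_mono \<alpha>_le abs_ln_le \<open>x \<in> {0..T}\<close>) auto
          also have "\<dots> = L * (x\<^sup>2 + x ^ 4)" using \<open>0 < x\<close> by (simp add: power_numeral_reduce field_simps)
          finally show "\<bar>(\<alpha> 0 - \<alpha> x) * ln x\<bar> \<le> L * (x\<^sup>2 + x ^ 4)" .
        qed
        have "((\<lambda>x. L * (x\<^sup>2 + x ^ 4)) \<longlongrightarrow> L * (0\<^sup>2 + 0 ^ 4)) (at 0 within {0..T})" by (intro tendsto_intros)
        then show "((\<lambda>x. L * (x\<^sup>2 + x ^ 4)) \<longlongrightarrow> 0) (at 0 within {0..T})" by simp
      qed simp
      then show ?thesis using True by simp
    qed
  qed
  then show ?thesis unfolding smooth_factor_def log_factor_def by (intro continuous_on_exp continuous_on_diff lG)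
qed

lemma smooth_factor_increments:
  "\<exists>M\<ge>0. (\<forall>a\<in>{0..T}. \<forall>b\<in>{0..T}. \<bar>smooth_factor a - smooth_factor b\<bar> \<le> M * \<bar>a - b\<bar>) \<and>
     (\<forall>a\<ge>0. \<forall>b\<ge>0. \<forall>c\<ge>0. a + b + c \<le> T \<longrightarrow>
       \<bar>smooth_factor (a + b + c) - smooth_factor (a + b) - smooth_factor (a + c) + smooth_factor a\<bar> \<le> M * b * c)"
proof -
  obtain K where K: "0 \<le> K" "\<And>x. 0 < x \<Longrightarrow> x < T \<Longrightarrow> \<bar>log_factor x\<bar> \<le> K \<and> \<bar>log_factor1 x\<bar> \<le> K \<and> \<bar>log_factor2 x\<bar> \<le> K"
    using log_factor_bounded by blast
  \<comment> \<open>The first derivative is the factor times \<open>log_factor1\<close>; the second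
    is the factor times the square of \<open>log_factor1\<close> plus
    \<open>log_factor2\<close>.\<close>
  define M where "M = exp K * (K + K\<^sup>2)"
  have M: "0 \<le> M" using K by (simp add: M_def)
  define h1 where "h1 x = smooth_factor x * log_factor1 x" for x
  define h2 where "h2 x = smooth_factor x * ((log_factor1 x)\<^sup>2 + log_factor2 x)" for x
  have d1: "(smooth_factor has_real_derivative h1 x) (at x)" if "0 < x" "x < T" for x
    unfolding smooth_factor_def h1_def by (rule derivative_eq_intros log_factor_deriv[OF that] refl)+
  have d2: "(h1 has_real_derivative h2 x) (at x)" if "0 < x" "x < T" for x
  proof -
    have "((\<lambda>x. smooth_factor x * log_factor1 x) has_real_derivative (h1 x * log_factor1 x + log_factor2 x * smooth_factor x)) (at x)"
      by (rule DERIV_mult[OF d1[OF that] log_factor_deriv(2)[OF that]])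
    moreover have "h1 x * log_factor1 x + log_factor2 x * smooth_factor x = h2 x"
      by (simp add: h1_def h2_def power2_eq_square algebra_simps)
    ultimately show ?thesis by (simp add: h1_def[abs_def])
  qed
  have hK: "smooth_factor x \<le> exp K" if "0 < x" "x < T" for x using K(2)[OF that] by (auto simp: smooth_factor_def abs_le_iff)
  have b1: "\<bar>h1 x\<bar> \<le> M" if "0 < x" "x < T" for x
  proof -
    have "\<bar>h1 x\<bar> \<le> exp K * K" unfolding h1_def abs_mult
      using hK[OF that] K(2)[OF that] smooth_factor_pos[of x] by (intro mult_mono) auto
    also have "\<dots> \<le> M" unfolding M_def by (intro mult_left_mono) auto
    finally show ?thesis .
  qed
  have b2: "\<bar>h2 x\<bar> \<le> M" if "0 < x" "x < T" for x
  proof -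
    have "(log_factor1 x)\<^sup>2 \<le> K\<^sup>2" using K(2)[OF that] K(1) by (simp add: abs_le_square_iff[symmetric])
    then have "\<bar>(log_factor1 x)\<^sup>2 + log_factor2 x\<bar> \<le> K + K\<^sup>2"
      using K(2)[OF that] zero_le_power2[of "log_factor1 x"] by linarith
    then show ?thesis unfolding h2_def M_def abs_mult
      using hK[OF that] smooth_factor_pos[of x] by (intro mult_mono) auto
  qed
  have "\<bar>smooth_factor a - smooth_factor b\<bar> \<le> M * \<bar>a - b\<bar>" if "a \<in> {0..T}" "b \<in> {0..T}" for a b
    by (rule increment_bound1[OF smooth_factor_continuous d1 d2 b1 b2 that])
  moreover have "\<bar>smooth_factor (a + b + c) - smooth_factor (a + b) - smooth_factor (a + c) + smooth_factor a\<bar> \<le> M * b * c"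
    if "0 \<le> a" "0 \<le> b" "0 \<le> c" "a + b + c \<le> T" for a b c
    by (rule increment_bound2[OF smooth_factor_continuous d1 d2 b1 b2 that])
  ultimately show ?thesis using M by (intro exI[of _ M]) auto
qed

end

lemma lebesgue_on_lborel:
  fixes f :: "real \<Rightarrow> 'b::{banach, second_countable_topology}"
  assumes "S \<in> sets borel" "(\<lambda>x. indicator S x *\<^sub>R f x) \<in> borel_measurable borel"
  shows "integral\<^sup>L (lebesgue_on S) f = (LINT x|lborel. indicator S x *\<^sub>R f x)"
  using assms by (simp add: integral_restrict_space integral_completion)

section \<open>The kernel g as a Beta average of the smooth factor\<close>

context variable_order
begin

text \<open>The Beta integrand with parameters \<open>2 - \<alpha> 0\<close> and
  \<open>\<alpha> 0 - 1\<close>, scaled so that its mass is the reciprocal of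
  \<open>smooth_factor 0\<close>. This is why the formula for \<open>g\<close> gives 1 at 0.\<close>

definition beta_density :: "real \<Rightarrow> real" where
  "beta_density z = (1 - z) powr (\<alpha> 0 - 2) * z powr (1 - \<alpha> 0) / Gamma (\<alpha> 0 - 1)"

lemma beta_density_nonneg: "0 \<le> beta_density z"
  using \<alpha>0 by (simp add: beta_density_def Gamma_real_nonneg)

lemma beta_density_integral: "integrable (lebesgue_on {0..1}) beta_density" "integral\<^sup>L (lebesgue_on {0..1}) beta_density = Gamma (2 - \<alpha> 0)"
proof -
  have "((\<lambda>z. z powr ((2 - \<alpha> 0) - 1) * (1 - z) powr ((\<alpha> 0 - 1) - 1)) has_integral Beta (2 - \<alpha> 0) (\<alpha> 0 - 1)) {0..1}"
    using \<alpha>0 by (intro has_integral_Beta_real) auto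
  then have "((\<lambda>z. (z powr ((2 - \<alpha> 0) - 1) * (1 - z) powr ((\<alpha> 0 - 1) - 1)) / Gamma (\<alpha> 0 - 1)) has_integral
      Beta (2 - \<alpha> 0) (\<alpha> 0 - 1) / Gamma (\<alpha> 0 - 1)) {0..1}"
    by (rule has_integral_divide)
  moreover have "(\<lambda>z. (z powr ((2 - \<alpha> 0) - 1) * (1 - z) powr ((\<alpha> 0 - 1) - 1)) / Gamma (\<alpha> 0 - 1)) = beta_density"
    by (auto simp: beta_density_def fun_eq_iff)
  moreover have "Beta (2 - \<alpha> 0) (\<alpha> 0 - 1) / Gamma (\<alpha> 0 - 1) = Gamma (2 - \<alpha> 0)"
    using \<alpha>0 less_imp_neq[OF Gamma_real_pos[of "\<alpha> 0 - 1"]] by (simp add: Beta_def)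
  ultimately have c: "(beta_density has_integral Gamma (2 - \<alpha> 0)) {0..1}" by simp
  then have "beta_density absolutely_integrable_on {0..1}"
    by (intro nonnegative_absolutely_integrable_1) (auto simp: beta_density_nonneg)
  then show i: "integrable (lebesgue_on {0..1}) beta_density"
    by (simp add: set_integrable_def integrable_restrict_space)
  show "integral\<^sup>L (lebesgue_on {0..1}) beta_density = Gamma (2 - \<alpha> 0)"
    using lebesgue_integral_eq_integral[OF i] integral_unique[OF c] by simp
qed

lemma scaled_mem: "t \<in> {0..T} \<Longrightarrow> z \<in> {0..1} \<Longrightarrow> t * z \<in> {0..T}"
  using mult_mono[of t T z 1] by auto

lemma smooth_factor_cz_integrable:
  assumes t: "t \<in> {0..T}"
  shows "integrable (lebesgue_on {0..1}) (\<lambda>z. smooth_factor (t * z) * beta_density z)"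
proof -
  have "continuous_on {0..1} (\<lambda>z. smooth_factor (t * z))"
    by (intro continuous_on_compose2[OF smooth_factor_continuous] continuous_intros) (use scaled_mem[OF t] in auto)
  then have m: "(\<lambda>z. smooth_factor (t * z)) \<in> borel_measurable (lebesgue_on {0..1})"
    by (rule continuous_imp_measurable_on_sets_lebesgue) auto
  obtain B where B: "\<And>x. x \<in> {0..T} \<Longrightarrow> \<bar>smooth_factor x\<bar> \<le> B"
    using compact_imp_bounded[OF compact_continuous_image[OF smooth_factor_continuous compact_Icc]]
    unfolding bounded_iff by (metis imageI real_norm_def)
  show ?thesis
  proof (rule Bochner_Integration.integrable_bound)
    show "integrable (lebesgue_on {0..1}) (\<lambda>z. B * beta_density z)" by (intro integrable_mult_right beta_density_integral)
    show "(\<lambda>z. smooth_factor (t * z) * beta_density z) \<in> borel_measurable (lebesgue_on {0..1})"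
      using m beta_density_integral(1) by (intro borel_measurable_times) auto
    show "AE z in lebesgue_on {0..1}. norm (smooth_factor (t * z) * beta_density z) \<le> norm (B * beta_density z)"
    proof (rule AE_I2)
      fix z :: real assume "z \<in> space (lebesgue_on {0..1})"
      then have "\<bar>smooth_factor (t * z)\<bar> \<le> B" using B[OF scaled_mem[OF t]] by auto
      then have "\<bar>smooth_factor (t * z)\<bar> * \<bar>beta_density z\<bar> \<le> \<bar>B\<bar> * \<bar>beta_density z\<bar>" by (intro mult_right_mono) auto
      then show "norm (smooth_factor (t * z) * beta_density z) \<le> norm (B * beta_density z)" by (simp add: abs_mult)
    qed
  qed
qed

lemma g_kernel_eq:
  assumes t: "t \<in> {0..T}"
  shows "g_kernel \<alpha> t = (LINT z|lebesgue_on {0..1}. smooth_factor (t * z) * beta_density z)"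
proof (cases "t = 0")
  case True
  have "Gamma (2 - \<alpha> 0) \<noteq> 0" using \<alpha>0 less_imp_neq[OF Gamma_real_pos[of "2 - \<alpha> 0"]] by simp
  then show ?thesis using True by (simp add: g_kernel_def smooth_factor_0 beta_density_integral)
next
  case False
  then have t0: "0 < t" using t by simp
  have "g_kernel \<alpha> t = (LINT z|lebesgue_on {0..1}. (t * z) powr (\<alpha> 0 - \<alpha> (t * z)) / (Gamma (\<alpha> 0 - 1) * Gamma (2 - \<alpha> (t * z)))
       * (1 - z) powr (\<alpha> 0 - 2) * z powr (1 - \<alpha> 0))"
    using False by (simp add: g_kernel_def)
  also have "\<dots> = (LINT z|lebesgue_on {0..1}. smooth_factor (t * z) * beta_density z)"
  proof (rule Bochner_Integration.integral_cong)
    fix z :: real assume "z \<in> space (lebesgue_on {0..1})"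
    then have z: "z \<in> {0..1}" by simp
    show "(t * z) powr (\<alpha> 0 - \<alpha> (t * z)) / (Gamma (\<alpha> 0 - 1) * Gamma (2 - \<alpha> (t * z)))
       * (1 - z) powr (\<alpha> 0 - 2) * z powr (1 - \<alpha> 0) = smooth_factor (t * z) * beta_density z"
    \<comment> \<open>At \<open>z = 0\<close> both sides are 0, since a power with base 0 is 0 by
      convention.\<close>
    proof (cases "z = 0")
      case False
      then have "0 < t * z" "t * z \<le> T" using z t0 scaled_mem[OF t z] by auto
      from smooth_factor_eq[OF this] show ?thesis by (simp add: beta_density_def mult_ac)
    qed (simp add: beta_density_def)
  qed simp
  finally show ?thesis .
qed

text \<open>Passing from t to t z multiplies first differences by z and mixed second differences by
  z^2, both at most 1. The bounds for \<open>smooth_factor\<close> therefore survive integration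
  against the Beta density, up to its mass.\<close>

lemma g_kernel_bounds:
  "\<exists>C\<ge>0. (\<forall>a\<in>{0..T}. \<forall>b\<in>{0..T}. \<bar>g_kernel \<alpha> a - g_kernel \<alpha> b\<bar> \<le> C * \<bar>a - b\<bar>) \<and>
     (\<forall>a\<ge>0. \<forall>b\<ge>0. \<forall>c\<ge>0. a + b + c \<le> T \<longrightarrow>
       \<bar>g_kernel \<alpha> (a + b + c) - g_kernel \<alpha> (a + b) - g_kernel \<alpha> (a + c) + g_kernel \<alpha> a\<bar> \<le> C * b * c)"
proof -
  obtain M where M: "0 \<le> M" "\<And>a b. a \<in> {0..T} \<Longrightarrow> b \<in> {0..T} \<Longrightarrow> \<bar>smooth_factor a - smooth_factor b\<bar> \<le> M * \<bar>a - b\<bar>"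
    "\<And>a b c. 0 \<le> a \<Longrightarrow> 0 \<le> b \<Longrightarrow> 0 \<le> c \<Longrightarrow> a + b + c \<le> T \<Longrightarrow>
       \<bar>smooth_factor (a + b + c) - smooth_factor (a + b) - smooth_factor (a + c) + smooth_factor a\<bar> \<le> M * b * c"
    using smooth_factor_increments by blast
  define C where "C = M * Gamma (2 - \<alpha> 0)"
  have bound: "\<bar>LINT z|lebesgue_on {0..1}. F z * beta_density z\<bar> \<le> B * Gamma (2 - \<alpha> 0)"
    if i: "integrable (lebesgue_on {0..1}) (\<lambda>z. F z * beta_density z)" and F: "\<And>z. z \<in> {0..1} \<Longrightarrow> \<bar>F z\<bar> \<le> B" for F B
  proof -
    have "norm (LINT z|lebesgue_on {0..1}. F z * beta_density z) \<le> (LINT z|lebesgue_on {0..1}. norm (F z * beta_density z))"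
      by (rule integral_norm_bound)
    also have "\<dots> \<le> (LINT z|lebesgue_on {0..1}. B * beta_density z)"
    proof (rule Bochner_Integration.integral_mono)
      show "integrable (lebesgue_on {0..1}) (\<lambda>z. norm (F z * beta_density z))" by (intro integrable_norm i)
      show "integrable (lebesgue_on {0..1}) (\<lambda>z. B * beta_density z)" by (intro integrable_mult_right beta_density_integral)
      show "norm (F z * beta_density z) \<le> B * beta_density z" if "z \<in> space (lebesgue_on {0..1})" for z
        using F[of z] that by (auto simp: abs_mult beta_density_nonneg intro!: mult_right_mono)
    qed
    finally have "norm (LINT z|lebesgue_on {0..1}. F z * beta_density z) \<le> (LINT z|lebesgue_on {0..1}. B * beta_density z)" .
    then show ?thesis by (simp add: beta_density_integral)
  qed
  have "\<bar>g_kernel \<alpha> a - g_kernel \<alpha> b\<bar> \<le> C * \<bar>a - b\<bar>" if ab: "a \<in> {0..T}" "b \<in> {0..T}" for a b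
  proof -
    have "g_kernel \<alpha> a - g_kernel \<alpha> b = (LINT z|lebesgue_on {0..1}. (smooth_factor (a * z) - smooth_factor (b * z)) * beta_density z)"
      unfolding g_kernel_eq[OF ab(1)] g_kernel_eq[OF ab(2)] left_diff_distrib
      by (intro Bochner_Integration.integral_diff[symmetric] smooth_factor_cz_integrable ab)
    also have "\<bar>\<dots>\<bar> \<le> (M * \<bar>a - b\<bar>) * Gamma (2 - \<alpha> 0)"
    proof (rule bound)
      show "integrable (lebesgue_on {0..1}) (\<lambda>z. (smooth_factor (a * z) - smooth_factor (b * z)) * beta_density z)"
        unfolding left_diff_distrib by (intro Bochner_Integration.integrable_diff smooth_factor_cz_integrable ab)
      fix z :: real assume z: "z \<in> {0..1}"
      have "\<bar>smooth_factor (a * z) - smooth_factor (b * z)\<bar> \<le> M * \<bar>a * z - b * z\<bar>" by (intro M scaled_mem ab z)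
      also have "\<bar>a * z - b * z\<bar> = \<bar>a - b\<bar> * z" using z by (simp add: abs_mult left_diff_distrib[symmetric])
      also have "M * (\<bar>a - b\<bar> * z) \<le> M * \<bar>a - b\<bar>" using z M(1) by (intro mult_left_mono mult_right_le_one_le) auto
      finally show "\<bar>smooth_factor (a * z) - smooth_factor (b * z)\<bar> \<le> M * \<bar>a - b\<bar>" .
    qed
    finally show ?thesis by (simp add: C_def mult_ac)
  qed
  moreover have "\<bar>g_kernel \<alpha> (a + b + d) - g_kernel \<alpha> (a + b) - g_kernel \<alpha> (a + d) + g_kernel \<alpha> a\<bar> \<le> C * b * d"
    if abd: "0 \<le> a" "0 \<le> b" "0 \<le> d" "a + b + d \<le> T" for a b d
  proof -
    have mem: "a + b + d \<in> {0..T}" "a + b \<in> {0..T}" "a + d \<in> {0..T}" "a \<in> {0..T}" using abd by auto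
    have "g_kernel \<alpha> (a + b + d) - g_kernel \<alpha> (a + b) - g_kernel \<alpha> (a + d) + g_kernel \<alpha> a
        = (LINT z|lebesgue_on {0..1}. (smooth_factor ((a + b + d) * z) - smooth_factor ((a + b) * z) - smooth_factor ((a + d) * z) + smooth_factor (a * z)) * beta_density z)"
      unfolding ring_distribs(2)[of _ _ "beta_density _"] left_diff_distrib[of _ _ "beta_density _"]
      using smooth_factor_cz_integrable[OF mem(1)] smooth_factor_cz_integrable[OF mem(2)] smooth_factor_cz_integrable[OF mem(3)] smooth_factor_cz_integrable[OF mem(4)]
      by (simp only: g_kernel_eq mem Bochner_Integration.integral_diff Bochner_Integration.integral_add
          Bochner_Integration.integrable_diff Bochner_Integration.integrable_add)
    also have "\<bar>\<dots>\<bar> \<le> (M * b * d) * Gamma (2 - \<alpha> 0)"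
    proof (rule bound)
      show "integrable (lebesgue_on {0..1})
         (\<lambda>z. (smooth_factor ((a + b + d) * z) - smooth_factor ((a + b) * z) - smooth_factor ((a + d) * z) + smooth_factor (a * z)) * beta_density z)"
        unfolding ring_distribs(2)[of _ _ "beta_density _"] left_diff_distrib[of _ _ "beta_density _"]
        by (intro Bochner_Integration.integrable_diff Bochner_Integration.integrable_add smooth_factor_cz_integrable mem)
      fix z :: real assume z: "z \<in> {0..1}"
      have 1: "a * z + b * z + d * z \<le> T"
        using scaled_mem[OF mem(1) z] by (simp add: distrib_right)
      have "\<bar>smooth_factor (a * z + b * z + d * z) - smooth_factor (a * z + b * z) - smooth_factor (a * z + d * z) + smooth_factor (a * z)\<bar> \<le> M * (b * z) * (d * z)"
        using abd z by (intro M(3) 1 mult_nonneg_nonneg) auto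
      also have "\<dots> = (M * b * d) * (z * z)" by (simp add: mult_ac)
      also have "\<dots> \<le> (M * b * d) * 1" using z M(1) abd by (intro mult_left_mono mult_le_one mult_nonneg_nonneg) auto
      finally show "\<bar>smooth_factor ((a + b + d) * z) - smooth_factor ((a + b) * z) - smooth_factor ((a + d) * z) + smooth_factor (a * z)\<bar> \<le> M * b * d"
        by (simp add: distrib_right)
    qed
    finally show ?thesis by (simp add: C_def mult_ac)
  qed
  moreover have "0 \<le> C" using M(1) \<alpha>0 by (simp add: C_def Gamma_real_nonneg)
  ultimately show ?thesis by blast
qed

lemma g_kernel_nonneg: "t \<in> {0..T} \<Longrightarrow> 0 \<le> g_kernel \<alpha> t"
  by (simp add: g_kernel_eq) (intro Bochner_Integration.integral_nonneg mult_nonneg_nonneg beta_density_nonneg less_imp_le smooth_factor_pos)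

lemma g_kernel_continuous: "continuous_on {0..T} (g_kernel \<alpha>)"
proof -
  obtain C where "0 \<le> C" "\<forall>a\<in>{0..T}. \<forall>b\<in>{0..T}. \<bar>g_kernel \<alpha> a - g_kernel \<alpha> b\<bar> \<le> C * \<bar>a - b\<bar>"
    using g_kernel_bounds by blast
  then show ?thesis by (intro lipschitz_on_continuous_on[of C]) (auto simp: lipschitz_on_def dist_real_def)
qed

end

subsection \<open>The integrated equation\<close>

text \<open>
  Convolutions are taken over the whole line, of functions that are extended by zero outside of \<open>[0,T]\<close>.
  Only their values on \<open>[0,T]\<close> are meaningful.
\<close>

definition conv :: "(real \<Rightarrow> real) \<Rightarrow> (real \<Rightarrow> 'b::{banach, second_countable_topology}) \<Rightarrow> real \<Rightarrow> 'b" where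
  "conv a b t = (LINT s|lborel. a (t - s) *\<^sub>R b s)"

section \<open>Calculus of convolutions on the line\<close>

lemma conv_pair_integrable:
  fixes a :: "real \<Rightarrow> real" and b :: "real \<Rightarrow> 'b::{banach, second_countable_topology}"
  assumes a: "integrable lborel a" and b: "integrable lborel b"
  shows "integrable (lborel \<Otimes>\<^sub>M lborel) (\<lambda>(s, r). a (s - r) *\<^sub>R b r)"
proof -
  have [measurable]: "a \<in> borel_measurable borel" "b \<in> borel_measurable borel"
    using borel_measurable_integrable[OF a] borel_measurable_integrable[OF b] by auto
  have sh: "integrable lborel (\<lambda>s. a (s - r))" for r
    using lborel_integrable_real_affine[OF a, of 1 "-r"] by simp
  have "integrable (lborel \<Otimes>\<^sub>M lborel) (\<lambda>(r, s). a (s - r) *\<^sub>R b r)"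
  proof (rule lborel_pair.Fubini_integrable)
    show "(\<lambda>(r, s). a (s - r) *\<^sub>R b r) \<in> borel_measurable (lborel \<Otimes>\<^sub>M lborel)" by measurable
    show "AE r in lborel. integrable lborel (\<lambda>s. case (r, s) of (r, s) \<Rightarrow> a (s - r) *\<^sub>R b r)"
      using sh by simp
    have "(LINT s|lborel. norm (a (s - r) *\<^sub>R b r)) = (LINT s|lborel. \<bar>a s\<bar>) * norm (b r)" for r
      using lborel_integral_real_affine[of 1 "\<lambda>s. \<bar>a s\<bar>" "-r"] by simp
    then show "integrable lborel (\<lambda>r. LINT s|lborel. norm (case (r, s) of (r, s) \<Rightarrow> a (s - r) *\<^sub>R b r))"
      by (simp only: prod.case) (intro integrable_mult_right integrable_norm b)
  qed
  from lborel_pair.integrable_product_swap[OF this] show ?thesis by simp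
qed

lemma conv_integrable:
  fixes a :: "real \<Rightarrow> real" and b :: "real \<Rightarrow> 'b::{banach, second_countable_topology}"
  assumes a: "integrable lborel a" and b: "integrable lborel b"
  shows "integrable lborel (conv a b)" "AE s in lborel. integrable lborel (\<lambda>r. a (s - r) *\<^sub>R b r)"
  using lborel_pair.integrable_fst[OF conv_pair_integrable[OF a b]] lborel_pair.AE_integrable_fst[OF conv_pair_integrable[OF a b]]
  by (simp_all add: conv_def[abs_def])

lemma conv_commute:
  fixes a b :: "real \<Rightarrow> real"
  shows "conv a b t = conv b a t"
  using lborel_integral_real_affine[of "-1" "\<lambda>s. a (t - s) * b s" t] by (simp add: conv_def mult.commute)

text \<open>A bounded outer factor \<open>C\<close> makes the double integrand integrable for every
  \<open>t\<close>. With three merely integrable factors associativity would hold only almost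
  everywhere, too weak for an identity at grid points.\<close>

lemma conv_assoc:
  fixes C a :: "real \<Rightarrow> real" and b :: "real \<Rightarrow> 'b::{banach, second_countable_topology}"
  assumes C[measurable]: "C \<in> borel_measurable borel" and B: "\<And>s. \<bar>C s\<bar> \<le> B"
    and a: "integrable lborel a" and b: "integrable lborel b"
  shows "conv C (conv a b) t = conv (conv C a) b t"
proof -
  have [measurable]: "a \<in> borel_measurable borel" "b \<in> borel_measurable borel"
    using borel_measurable_integrable[OF a] borel_measurable_integrable[OF b] by auto
  have int: "integrable (lborel \<Otimes>\<^sub>M lborel) (\<lambda>(s, r). C (t - s) *\<^sub>R (a (s - r) *\<^sub>R b r))"
  proof (rule Bochner_Integration.integrable_bound)
    show "integrable (lborel \<Otimes>\<^sub>M lborel) (\<lambda>x. B *\<^sub>R (case x of (s, r) \<Rightarrow> a (s - r) *\<^sub>R b r))"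
      by (intro integrable_scaleR_right conv_pair_integrable a b)
    have "\<bar>C s\<bar> \<le> \<bar>B\<bar>" for s using B[of s] by linarith
    then show "AE x in lborel \<Otimes>\<^sub>M lborel. norm (case x of (s, r) \<Rightarrow> C (t - s) *\<^sub>R (a (s - r) *\<^sub>R b r))
        \<le> norm (B *\<^sub>R (case x of (s, r) \<Rightarrow> a (s - r) *\<^sub>R b r))"
      by (intro AE_I2) (auto simp: abs_mult mult.assoc intro!: mult_right_mono)
  qed measurable
  have "conv C (conv a b) t = (LINT s|lborel. LINT r|lborel. C (t - s) *\<^sub>R (a (s - r) *\<^sub>R b r))"
    unfolding conv_def by (simp only: integral_scaleR_right)
  also have "\<dots> = (LINT r|lborel. LINT s|lborel. C (t - s) *\<^sub>R (a (s - r) *\<^sub>R b r))"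
    using lborel_pair.Fubini_integral[OF int] by simp
  also have "\<dots> = (LINT r|lborel. conv C a (t - r) *\<^sub>R b r)"
  proof (rule Bochner_Integration.integral_cong[OF refl])
    fix r
    have "(LINT s|lborel. C (t - s) *\<^sub>R (a (s - r) *\<^sub>R b r)) = (LINT s|lborel. (C (t - s) * a (s - r)) *\<^sub>R b r)"
      by simp
    also have "\<dots> = (LINT s|lborel. C (t - s) * a (s - r)) *\<^sub>R b r"
    proof (rule integral_scaleR_left)
      assume "b r \<noteq> 0"
      have sh: "integrable lborel (\<lambda>s. a (s - r))"
        using lborel_integrable_real_affine[OF a, of 1 "-r"] by simp
      show "integrable lborel (\<lambda>s. C (t - s) * a (s - r))"
      proof (rule Bochner_Integration.integrable_bound)
        show "integrable lborel (\<lambda>s. B * a (s - r))" by (intro integrable_mult_right sh)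
        have "\<bar>C s\<bar> \<le> \<bar>B\<bar>" for s using B[of s] by linarith
        then show "AE s in lborel. norm (C (t - s) * a (s - r)) \<le> norm (B * a (s - r))"
          by (intro AE_I2) (auto simp: abs_mult intro!: mult_right_mono)
      qed measurable
    qed
    also have "(LINT s|lborel. C (t - s) * a (s - r)) = conv C a (t - r)"
      using lborel_integral_real_affine[of 1 "\<lambda>s. C (t - s) * a (s - r)" r]
      by (simp add: conv_def algebra_simps)
    finally show "(LINT s|lborel. C (t - s) *\<^sub>R (a (s - r) *\<^sub>R b r)) = conv C a (t - r) *\<^sub>R b r" .
  qed
  finally show ?thesis by (simp add: conv_def)
qed

text \<open>The kernels may differ at 0: this value is met only at \<open>s = t\<close>, a null set.
  Cut-offs of singular kernels are compared in this way.\<close>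

lemma conv_cong_left:
  fixes a a' :: "real \<Rightarrow> real" and b :: "real \<Rightarrow> 'b::{banach, second_countable_topology}"
  assumes "\<And>s. 0 < s \<Longrightarrow> s \<le> t \<Longrightarrow> a s = a' s" "\<And>s. s < 0 \<Longrightarrow> a s = a' s" "\<And>s. s < 0 \<Longrightarrow> b s = 0"
    "a \<in> borel_measurable borel" "a' \<in> borel_measurable borel" "b \<in> borel_measurable borel"
  shows "conv a b t = conv a' b t"
  unfolding conv_def
proof (rule integral_cong_AE)
  have "AE s in lborel. s \<noteq> t" by (rule AE_lborel_singleton)
  then show "AE s in lborel. a (t - s) *\<^sub>R b s = a' (t - s) *\<^sub>R b s"
  proof eventually_elim
    case (elim s)
    then consider "s < 0" | "t < s" | "0 \<le> s" "s < t" by linarith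
    then show ?case using assms(1)[of "t - s"] assms(2)[of "t - s"] assms(3)[of s] by cases auto
  qed
qed (use assms(4-6) in measurable)

lemma conv_cong_right:
  fixes a :: "real \<Rightarrow> real" and b b' :: "real \<Rightarrow> 'b::{banach, second_countable_topology}"
  assumes "AE s in lborel. s \<le> t \<longrightarrow> b s = b' s" "\<And>s. s < 0 \<Longrightarrow> a s = 0"
    "a \<in> borel_measurable borel" "b \<in> borel_measurable borel" "b' \<in> borel_measurable borel"
  shows "conv a b t = conv a b' t"
  unfolding conv_def
proof (rule integral_cong_AE)
  show "AE s in lborel. a (t - s) *\<^sub>R b s = a (t - s) *\<^sub>R b' s"
    using assms(1)
  proof eventually_elim
    case (elim s)
    then show ?case using assms(2)[of "t - s"] by (cases "s \<le> t") auto
  qed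
qed (use assms(3-5) in measurable)

lemma conv_eq_0:
  fixes a :: "real \<Rightarrow> real" and b :: "real \<Rightarrow> 'b::{banach, second_countable_topology}"
  assumes "\<And>s. s < 0 \<Longrightarrow> a s = 0" "\<And>s. s < 0 \<Longrightarrow> b s = 0" "t < 0"
  shows "conv a b t = 0"
proof -
  have "a (t - s) *\<^sub>R b s = 0" for s
    using assms(1)[of "t - s"] assms(2)[of s] assms(3) by (cases "s < 0") auto
  then show ?thesis unfolding conv_def by (simp only: integral_zero)
qed

lemma conv_inner:
  fixes b :: "real \<Rightarrow> 'b::{real_inner, banach, second_countable_topology}"
  assumes "integrable lborel (\<lambda>r. a (t - r) *\<^sub>R b r)"
  shows "conv a b t \<bullet> x = conv a (\<lambda>r. b r \<bullet> x) t"
  unfolding conv_def using integral_inner_left[OF assms, of x] by simp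

lemma conv_bounded_integrable:
  fixes C :: "real \<Rightarrow> real" and b :: "real \<Rightarrow> 'b::{banach, second_countable_topology}"
  assumes C[measurable]: "C \<in> borel_measurable borel" and B: "\<And>s. \<bar>C s\<bar> \<le> B" and b: "integrable lborel b"
  shows "integrable lborel (\<lambda>s. C (t - s) *\<^sub>R b s)"
proof (rule Bochner_Integration.integrable_bound)
  have [measurable]: "b \<in> borel_measurable borel" using borel_measurable_integrable[OF b] by simp
  show "integrable lborel (\<lambda>s. B *\<^sub>R b s)" by (intro integrable_scaleR_right b)
  show "(\<lambda>s. C (t - s) *\<^sub>R b s) \<in> borel_measurable lborel" by measurable
  have "\<bar>C s\<bar> \<le> \<bar>B\<bar>" for s using B[of s] by linarith
  then show "AE s in lborel. norm (C (t - s) *\<^sub>R b s) \<le> norm (B *\<^sub>R b s)"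
    by (intro AE_I2) (auto intro!: mult_right_mono)
qed

lemma conv_HK:
  fixes a b :: "real \<Rightarrow> real"
  assumes a: "continuous_on {0..T} a" and b: "continuous_on {0..T} b" and t: "0 \<le> t" "t \<le> T"
  shows "conv (\<lambda>s. indicator {0..T} s * a s) (\<lambda>s. indicator {0..T} s * b s) t = integral {0..t} (\<lambda>s. a (t - s) * b s)"
proof -
  have c: "continuous_on {0..t} (\<lambda>s. a (t - s) * b s)"
    using t by (intro continuous_intros continuous_on_compose2[OF a] continuous_on_subset[OF b]) auto
  have "conv (\<lambda>s. indicator {0..T} s * a s) (\<lambda>s. indicator {0..T} s * b s) t
      = (LINT s:{0..t}|lborel. a (t - s) * b s)"
    unfolding conv_def set_lebesgue_integral_def using t
    by (intro Bochner_Integration.integral_cong refl) (auto simp: indicator_def)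
  also have "\<dots> = integral {0..t} (\<lambda>s. a (t - s) * b s)"
    by (rule set_borel_integral_eq_integral(2)[OF borel_integrable_atLeastAtMost'[OF c]])
  finally show ?thesis .
qed

lemma powr_lborel:
  fixes p c :: real
  assumes p: "- 1 < p" and c: "0 \<le> c"
  shows "integrable lborel (\<lambda>x. indicator {0..c} x * x powr p)"
    and "(LINT x|lborel. indicator {0..c} x * x powr p) = c powr (p + 1) / (p + 1)"
proof -
  have h: "((\<lambda>x. x powr p) has_integral (c powr (p + 1) / (p + 1))) {0..c}"
    using p c by (intro has_integral_powr_from_0) auto
  then have "(\<lambda>x. x powr p) absolutely_integrable_on {0..c}"
    by (intro nonnegative_absolutely_integrable_1) auto
  then have "integrable lebesgue (\<lambda>x. indicator {0..c} x * x powr p)"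
    by (simp add: set_integrable_def)
  moreover have "(\<lambda>x. indicator {0..c} x * x powr p) \<in> borel_measurable lborel" by measurable
  ultimately show i: "integrable lborel (\<lambda>x. indicator {0..c} x * x powr p)"
    by (simp add: integrable_completion)
  then have "set_integrable lborel {0..c} (\<lambda>x. x powr p)" by (simp add: set_integrable_def)
  from set_borel_integral_eq_integral(2)[OF this]
  show "(LINT x|lborel. indicator {0..c} x * x powr p) = c powr (p + 1) / (p + 1)"
    using integral_unique[OF h] by (simp add: set_lebesgue_integral_def)
qed

lemma indicator_continuous_bounded:
  fixes a :: "real \<Rightarrow> real"
  assumes a: "continuous_on {0..T} a"
  shows "(\<lambda>s. indicator {0..T} s * a s) \<in> borel_measurable borel"
    and "\<exists>B. \<forall>s. \<bar>indicator {0..T} s * a s\<bar> \<le> B"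
    and "integrable lborel (\<lambda>s. indicator {0..T} s * a s)"
proof -
  show "(\<lambda>s. indicator {0..T} s * a s) \<in> borel_measurable borel"
    using borel_measurable_continuous_on_indicator[OF _ a] by simp
  obtain B where "\<forall>x\<in>a ` {0..T}. norm x \<le> B"
    using compact_imp_bounded[OF compact_continuous_image[OF a compact_Icc]] unfolding bounded_iff by blast
  then have "\<bar>indicator {0..T} s * a s\<bar> \<le> max B 0" for s
    by (cases "s \<in> {0..T}") (auto simp: le_max_iff_disj)
  then show "\<exists>B. \<forall>s. \<bar>indicator {0..T} s * a s\<bar> \<le> B" by blast
  show "integrable lborel (\<lambda>s. indicator {0..T} s * a s)"
    using borel_integrable_atLeastAtMost'[OF a] by (simp add: set_integrable_def)
qed

section \<open>Cut-off kernels and the identities between them\<close>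

context variable_order
begin

definition beta_cut :: "real \<Rightarrow> real" where
  "beta_cut s = indicator {0..T} s * s powr (\<alpha> 0 - 2) / Gamma (\<alpha> 0 - 1)"

text \<open>The doubled indicator exhibits a bounded measurable factor times an integrable
  power.\<close>

definition k_cut :: "real \<Rightarrow> real" where
  "k_cut s = (indicator {0..T} s * smooth_factor s) * (indicator {0..T} s * s powr (1 - \<alpha> 0))"

definition g_cut :: "real \<Rightarrow> real" where "g_cut s = indicator {0..T} s * g_kernel \<alpha> s"

definition gamma_kernel :: "real \<Rightarrow> real" where "gamma_kernel s = s powr (\<alpha> 0 - 1) / Gamma (\<alpha> 0)"

definition gamma_cut :: "real \<Rightarrow> real" where "gamma_cut s = indicator {0..T} s * gamma_kernel s"

text \<open>For times up to \<open>T\<close>, convolution with it is integration from 0. The factor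
  1 gives it the same shape as the other cut-offs of continuous functions.\<close>

definition one_cut :: "real \<Rightarrow> real" where "one_cut s = indicator {0..T} s * 1"

lemma beta_cut_eq: "0 < s \<Longrightarrow> s \<le> T \<Longrightarrow> beta_cut s = beta_kernel (\<alpha> 0 - 1) s"
  by (simp add: beta_cut_def beta_kernel_def)

lemma k_cut_eq: "0 < s \<Longrightarrow> s \<le> T \<Longrightarrow> k_cut s = k_kernel \<alpha> s"
  by (simp add: k_cut_def k_kernel_def smooth_factor_eq powr_add[symmetric])

lemma beta_cut_integrable: "integrable lborel beta_cut"
  unfolding beta_cut_def using \<alpha>0 T by (intro integrable_divide powr_lborel) auto

lemma kernel_vanishes: "s < 0 \<Longrightarrow> beta_cut s = 0" "s < 0 \<Longrightarrow> k_cut s = 0" "s < 0 \<Longrightarrow> g_cut s = 0" "s < 0 \<Longrightarrow> gamma_cut s = 0" "s < 0 \<Longrightarrow> one_cut s = 0"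
  by (simp_all add: beta_cut_def k_cut_def g_cut_def gamma_cut_def one_cut_def)

lemma k_cut_integrable: "integrable lborel k_cut"
proof -
  note c = indicator_continuous_bounded[OF smooth_factor_continuous]
  obtain B where B: "\<And>s. \<bar>indicator {0..T} s * smooth_factor s\<bar> \<le> B" using c(2) by blast
  have i: "integrable lborel (\<lambda>s. indicator {0..T} s * s powr (1 - \<alpha> 0))"
    using \<alpha>0 T by (intro powr_lborel) auto
  show ?thesis
  proof (rule Bochner_Integration.integrable_bound)
    show "integrable lborel (\<lambda>s. B * (indicator {0..T} s * s powr (1 - \<alpha> 0)))"
      by (intro integrable_mult_right i)
    show "k_cut \<in> borel_measurable lborel" unfolding k_cut_def[abs_def]
      using c(1) by (intro borel_measurable_times[OF _ borel_measurable_integrable[OF i]]) simp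
    have "\<bar>indicator {0..T} s * smooth_factor s\<bar> \<le> \<bar>B\<bar>" for s using B[of s] by linarith
    then show "AE s in lborel. norm (k_cut s) \<le> norm (B * (indicator {0..T} s * s powr (1 - \<alpha> 0)))"
      unfolding k_cut_def real_norm_def abs_mult[of "indicator _ _ * smooth_factor _"] abs_mult[of B] by (intro AE_I2 mult_right_mono) auto
  qed
qed

lemma gamma_kernel_continuous: "continuous_on {0..T} gamma_kernel"
proof -
  have "Gamma (\<alpha> 0) \<noteq> 0" using less_imp_neq[OF Gamma_real_pos[of "\<alpha> 0"]] \<alpha>0 by simp
  then show ?thesis unfolding gamma_kernel_def using \<alpha>0
    by (intro continuous_on_divide continuous_on_powr' continuous_on_const continuous_on_id) auto
qed

lemma conv_oneK:
  fixes q :: "real \<Rightarrow> 'b::{banach, second_countable_topology}"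
  assumes "t \<le> T" "\<And>s. s < 0 \<Longrightarrow> q s = 0"
  shows "conv one_cut q t = (LINT s|lborel. indicator {0..t} s *\<^sub>R q s)"
  unfolding conv_def
proof (rule Bochner_Integration.integral_cong[OF refl])
  show "one_cut (t - s) *\<^sub>R q s = indicator {0..t} s *\<^sub>R q s" for s
    using assms by (cases "s < 0") (auto simp: one_cut_def indicator_def)
qed

lemma conv_one_beta:
  assumes t: "0 < t" "t \<le> T"
  shows "conv one_cut beta_cut t = gamma_kernel t"
proof -
  have "conv one_cut beta_cut t = (LINT s|lborel. indicator {0..t} s *\<^sub>R beta_cut s)"
    by (rule conv_oneK[OF t(2) kernel_vanishes(1)])
  also have "\<dots> = (LINT s|lborel. (indicator {0..t} s * s powr (\<alpha> 0 - 2)) / Gamma (\<alpha> 0 - 1))"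
    using t by (intro Bochner_Integration.integral_cong refl) (auto simp: beta_cut_def indicator_def)
  also have "\<dots> = t powr (\<alpha> 0 - 1) / (\<alpha> 0 - 1) / Gamma (\<alpha> 0 - 1)"
    using powr_lborel(2)[of "\<alpha> 0 - 2" t] \<alpha>0 t by simp
  also have "\<dots> = gamma_kernel t"
  proof -
    have "Gamma ((\<alpha> 0 - 1) + 1) = (\<alpha> 0 - 1) * Gamma (\<alpha> 0 - 1)"
      using \<alpha>0 by (intro Gamma_plus1) (auto elim!: nonpos_Ints_cases)
    then show ?thesis by (simp add: gamma_kernel_def)
  qed
  finally show ?thesis .
qed

lemma kernels_measurable [measurable]:
  "beta_cut \<in> borel_measurable borel" "k_cut \<in> borel_measurable borel" "g_cut \<in> borel_measurable borel"
  "gamma_cut \<in> borel_measurable borel" "one_cut \<in> borel_measurable borel"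
  using borel_measurable_integrable[OF beta_cut_integrable] borel_measurable_integrable[OF k_cut_integrable]
    indicator_continuous_bounded(1)[OF g_kernel_continuous] indicator_continuous_bounded(1)[OF gamma_kernel_continuous]
  by (simp_all add: g_cut_def[abs_def] gamma_cut_def[abs_def] one_cut_def[abs_def])

text \<open>The substitution s = t z makes the powers of t cancel, as their exponents 1, alpha(0) -
  2 and 1 - alpha(0) add up to 0. Two singular kernels thus combine into a regular one.\<close>

lemma conv_beta_k:
  assumes t: "0 < t" "t \<le> T"
  shows "conv beta_cut k_cut t = g_kernel \<alpha> t"
proof -
  have eq: "t * (beta_cut (t - (0 + t * z)) * k_cut (0 + t * z)) = indicator {0..1} z *\<^sub>R (smooth_factor (t * z) * beta_density z)" for z
  proof (cases "z \<in> {0..1}")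
    case True
    have m: "t * z \<in> {0..T}" "t - t * z \<in> {0..T}"
      using scaled_mem[of t z] scaled_mem[of t "1 - z"] t True by (auto simp: algebra_simps)
    have 1: "t - t * z = t * (1 - z)" by (simp add: algebra_simps)
    have "t * (t powr (\<alpha> 0 - 2) * t powr (1 - \<alpha> 0)) = 1"
      using t by (simp add: powr_add[symmetric] powr_minus_divide)
    then have "t * (t powr (\<alpha> 0 - 2) * t powr (1 - \<alpha> 0)) * ((1 - z) powr (\<alpha> 0 - 2) * z powr (1 - \<alpha> 0) * smooth_factor (t * z) / Gamma (\<alpha> 0 - 1))
       = ((1 - z) powr (\<alpha> 0 - 2) * z powr (1 - \<alpha> 0) * smooth_factor (t * z) / Gamma (\<alpha> 0 - 1))" by simp
    then show ?thesis using True m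
      by (simp add: beta_cut_def k_cut_def beta_density_def 1 powr_mult mult_ac)
  next
    case False
    then consider "t * z < 0" | "t - t * z < 0" using t by (auto simp: mult_less_0_iff)
    then show ?thesis using False by cases (auto simp: kernel_vanishes)
  qed
  have m: "(\<lambda>z. indicator {0..1} z *\<^sub>R (smooth_factor (t * z) * beta_density z)) \<in> borel_measurable borel"
    unfolding eq[symmetric] by measurable
  have "conv beta_cut k_cut t = t * (LINT z|lborel. beta_cut (t - (0 + t * z)) * k_cut (0 + t * z))"
    unfolding conv_def using t lborel_integral_real_affine[of t "\<lambda>s. beta_cut (t - s) * k_cut s" 0] by simp
  also have "\<dots> = (LINT z|lborel. indicator {0..1} z *\<^sub>R (smooth_factor (t * z) * beta_density z))"
    unfolding eq[symmetric] by (rule integral_mult_right_zero[symmetric])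
  also have "\<dots> = g_kernel \<alpha> t"
    using g_kernel_eq[of t] lebesgue_on_lborel[OF _ m] t by simp
  finally show ?thesis .
qed

text \<open>Since gamma * k = 1 * beta * k = 1 * g, convolving with gamma turns k * z into g * (1 *
  z), where 1 * z is \<open>y1\<close> minus \<open>y1 0\<close>; the part with \<open>y1 0\<close>
  joins the right-hand side. Using the bounded gamma instead of beta makes the identity hold at
  every \<open>t\<close>, so it can be evaluated on the grid.\<close>

lemma integrated_equation:
  fixes z f' y y1 :: "real \<Rightarrow> real"
  assumes z: "integrable lborel z" and z0: "\<And>s. s < 0 \<Longrightarrow> z s = 0"
    and f: "integrable lborel f'" and f0: "\<And>s. s < 0 \<Longrightarrow> f' s = 0"
    and y: "continuous_on {0..T} y" and y1: "continuous_on {0..T} y1"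
    and zy: "\<And>s. s \<in> {0..T} \<Longrightarrow> conv one_cut z s = y1 s - y1 0"
    and eq: "AE s in lborel. 0 < s \<and> s < T \<longrightarrow> conv k_cut z s + \<mu> * y s = f' s"
    and t: "0 \<le> t" "t \<le> T"
  shows "integral {0..t} (\<lambda>s. g_kernel \<alpha> (t - s) * y1 s) + \<mu> * integral {0..t} (\<lambda>s. gamma_kernel (t - s) * y s)
     = (LINT s|lborel. indicator {0..t} s * (conv beta_cut f' s + g_cut s * y1 0))"
proof -
  note gc = g_kernel_continuous and \<gamma>c = gamma_kernel_continuous
  note gI = indicator_continuous_bounded(3)[OF gc, folded g_cut_def]
  note \<gamma>I = indicator_continuous_bounded(3)[OF \<gamma>c, folded gamma_cut_def]
  have oneI: "integrable lborel one_cut"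
    using indicator_continuous_bounded(3)[OF continuous_on_const[of "{0..T}" 1]] by (simp add: one_cut_def[abs_def])
  obtain Bg where Bg: "\<And>s. \<bar>g_cut s\<bar> \<le> Bg" using indicator_continuous_bounded(2)[OF gc] by (auto simp: g_cut_def)
  obtain B\<gamma> where B\<gamma>: "\<And>s. \<bar>gamma_cut s\<bar> \<le> B\<gamma>" using indicator_continuous_bounded(2)[OF \<gamma>c] by (auto simp: gamma_cut_def)
  have Bo: "\<bar>one_cut s\<bar> \<le> 1" for s by (simp add: one_cut_def indicator_def)
  define yK where "yK s = indicator {0..T} s * y s" for s
  define y1K where "y1K s = indicator {0..T} s * y1 s" for s
  note yI = indicator_continuous_bounded(3)[OF y, folded yK_def]
  note y1I = indicator_continuous_bounded(3)[OF y1, folded y1K_def]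
  note [measurable] = borel_measurable_integrable[OF z, simplified] borel_measurable_integrable[OF f, simplified]
    borel_measurable_integrable[OF yI, simplified] borel_measurable_integrable[OF y1I, simplified]
  note mI = borel_measurable_integrable[OF conv_integrable(1), simplified]
  have kz: "integrable lborel (conv k_cut z)" by (rule conv_integrable(1)[OF k_cut_integrable z])
  have [measurable]: "conv k_cut z \<in> borel_measurable borel" by (rule mI[OF k_cut_integrable z])
  have [measurable]: "conv one_cut beta_cut \<in> borel_measurable borel" by (rule mI[OF oneI beta_cut_integrable])
  have [measurable]: "conv beta_cut k_cut \<in> borel_measurable borel" by (rule mI[OF beta_cut_integrable k_cut_integrable])
  have [measurable]: "conv gamma_cut k_cut \<in> borel_measurable borel" by (rule mI[OF \<gamma>I k_cut_integrable])
  have [measurable]: "conv g_cut one_cut \<in> borel_measurable borel" by (rule mI[OF gI oneI])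
  have [measurable]: "conv one_cut z \<in> borel_measurable borel" by (rule mI[OF oneI z])
  have bf: "integrable lborel (conv beta_cut f')" by (rule conv_integrable(1)[OF beta_cut_integrable f])
  \<comment> \<open>The equation holds almost everywhere; the convolution absorbs the exceptional
    null set.\<close>
  have A1: "conv gamma_cut (\<lambda>s. conv k_cut z s + \<mu> * yK s) t = conv gamma_cut f' t"
  proof (rule conv_cong_right)
    have "AE s in lborel. s \<noteq> 0" "AE s in lborel. s \<noteq> T" by (rule AE_lborel_singleton)+
    with eq show "AE s in lborel. s \<le> t \<longrightarrow> conv k_cut z s + \<mu> * yK s = f' s"
    proof eventually_elim
      case (elim s)
      have "conv k_cut z s + \<mu> * yK s = f' s" if "s < 0"
        using that conv_eq_0[OF kernel_vanishes(2) z0 that] f0[OF that] by (simp add: yK_def)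
      then show ?case using elim t by (cases "s < 0") (auto simp: yK_def)
    qed
  qed (auto simp: kernel_vanishes)
  have A2: "conv gamma_cut (\<lambda>s. conv k_cut z s + \<mu> * yK s) t = conv gamma_cut (conv k_cut z) t + \<mu> * conv gamma_cut yK t"
  proof -
    have "integrable lborel (\<lambda>s. gamma_cut (t - s) *\<^sub>R conv k_cut z s)" "integrable lborel (\<lambda>s. gamma_cut (t - s) *\<^sub>R yK s)"
      by (intro conv_bounded_integrable[OF _ B\<gamma>] kz yI; simp)+
    then show ?thesis unfolding conv_def[of gamma_cut] by (simp add: distrib_left mult.left_commute)
  qed
  have \<gamma>k: "conv gamma_cut k_cut x = conv g_cut one_cut x" if x: "x \<le> T" for x
  proof -
    have "conv gamma_cut k_cut x = conv (conv one_cut beta_cut) k_cut x"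
    proof (rule conv_cong_left)
      show "gamma_cut s = conv one_cut beta_cut s" if "0 < s" "s \<le> x" for s
        using conv_one_beta[of s] that x by (simp add: gamma_cut_def)
      show "gamma_cut s = conv one_cut beta_cut s" if "s < 0" for s
        using conv_eq_0[OF kernel_vanishes(5) kernel_vanishes(1) that] that by (simp add: kernel_vanishes)
    qed (auto simp: kernel_vanishes)
    also have "\<dots> = conv one_cut (conv beta_cut k_cut) x"
      by (rule conv_assoc[symmetric, OF _ Bo beta_cut_integrable k_cut_integrable]) simp
    also have "\<dots> = conv one_cut g_cut x"
    proof (rule conv_cong_right)
      have "AE s in lborel. s \<noteq> (0::real)" by (rule AE_lborel_singleton)
      then show "AE s in lborel. s \<le> x \<longrightarrow> conv beta_cut k_cut s = g_cut s"
      proof eventually_elim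
        case (elim s)
        show ?case
        proof (cases "s < 0")
          case True
          then show ?thesis using conv_eq_0[OF kernel_vanishes(1) kernel_vanishes(2) True] by (simp add: kernel_vanishes)
        next
          case False
          then show ?thesis using elim conv_beta_k[of s] x by (auto simp: g_cut_def)
        qed
      qed
    qed (auto simp: kernel_vanishes)
    \<comment> \<open>Commuted so that the bounded \<open>g_cut\<close> stands outside in the next
      use of associativity.\<close>
    also have "\<dots> = conv g_cut one_cut x" by (rule conv_commute)
    finally show ?thesis .
  qed
  have A3: "conv gamma_cut (conv k_cut z) t = conv g_cut (conv one_cut z) t"
  proof -
    have "conv gamma_cut (conv k_cut z) t = conv (conv gamma_cut k_cut) z t"
      by (rule conv_assoc[OF _ B\<gamma> k_cut_integrable z]) simp
    also have "\<dots> = conv (conv g_cut one_cut) z t"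
    proof (rule conv_cong_left)
      show "conv gamma_cut k_cut s = conv g_cut one_cut s" if "s \<le> t" for s using \<gamma>k[of s] that t by simp
      show "conv gamma_cut k_cut s = conv g_cut one_cut s" if "s < 0" for s using \<gamma>k[of s] that T by simp
    qed (auto simp: z0)
    also have "\<dots> = conv g_cut (conv one_cut z) t"
      by (rule conv_assoc[symmetric, OF _ Bg oneI z]) simp
    finally show ?thesis .
  qed
  have A4: "conv g_cut (conv one_cut z) t = conv g_cut y1K t - y1 0 * conv g_cut one_cut t"
  proof -
    have "conv g_cut (conv one_cut z) t = conv g_cut (\<lambda>s. y1K s - y1 0 * one_cut s) t"
    proof (rule conv_cong_right)
      show "AE s in lborel. s \<le> t \<longrightarrow> conv one_cut z s = y1K s - y1 0 * one_cut s"
      proof (intro AE_I2 impI)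
        fix s assume "s \<le> t"
        then show "conv one_cut z s = y1K s - y1 0 * one_cut s"
          using zy[of s] conv_eq_0[where a = one_cut and b = z and t = s, OF kernel_vanishes(5) z0] t
          by (cases "s < 0") (auto simp: y1K_def one_cut_def)
      qed
    qed (auto simp: kernel_vanishes)
    also have "\<dots> = conv g_cut y1K t - y1 0 * conv g_cut one_cut t"
    proof -
      have "integrable lborel (\<lambda>s. g_cut (t - s) *\<^sub>R y1K s)" "integrable lborel (\<lambda>s. g_cut (t - s) *\<^sub>R one_cut s)"
        by (intro conv_bounded_integrable[OF _ Bg] y1I oneI; simp)+
      then show ?thesis unfolding conv_def[of g_cut] by (simp add: right_diff_distrib mult.left_commute)
    qed
    finally show ?thesis .
  qed
  have A5: "conv gamma_cut f' t = conv one_cut (conv beta_cut f') t"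
  proof -
    have "conv gamma_cut f' t = conv (conv one_cut beta_cut) f' t"
    proof (rule conv_cong_left)
      show "gamma_cut s = conv one_cut beta_cut s" if "0 < s" "s \<le> t" for s
        using conv_one_beta[of s] that t by (simp add: gamma_cut_def)
      show "gamma_cut s = conv one_cut beta_cut s" if "s < 0" for s
        using conv_eq_0[OF kernel_vanishes(5) kernel_vanishes(1) that] that by (simp add: kernel_vanishes)
    qed (auto simp: f0)
    also have "\<dots> = conv one_cut (conv beta_cut f') t"
      by (rule conv_assoc[symmetric, OF _ Bo beta_cut_integrable f]) simp
    finally show ?thesis .
  qed
  have "conv g_cut y1K t + \<mu> * conv gamma_cut yK t = conv one_cut (conv beta_cut f') t + y1 0 * conv one_cut g_cut t"
    using A1 A2 A3 A4[unfolded conv_commute[of g_cut one_cut t]] A5 by linarith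
  also have "\<dots> = conv one_cut (\<lambda>s. conv beta_cut f' s + g_cut s * y1 0) t"
  proof -
    have "integrable lborel (\<lambda>s. one_cut (t - s) *\<^sub>R conv beta_cut f' s)" "integrable lborel (\<lambda>s. one_cut (t - s) *\<^sub>R g_cut s)"
      by (intro conv_bounded_integrable[OF _ Bo] bf gI; simp)+
    then show ?thesis unfolding conv_def[of one_cut] by (simp add: distrib_left mult.assoc[symmetric] mult.commute[of "y1 0"])
  qed
  also have "\<dots> = (LINT s|lborel. indicator {0..t} s *\<^sub>R (conv beta_cut f' s + g_cut s * y1 0))"
  proof (rule conv_oneK[OF t(2)])
    show "conv beta_cut f' s + g_cut s * y1 0 = 0" if "s < 0" for s
      using conv_eq_0[OF kernel_vanishes(1) f0 that] that by (simp add: kernel_vanishes)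
  qed
  finally show ?thesis
    using conv_HK[OF gc y1 t] conv_HK[OF \<gamma>c y t] by (simp add: g_cut_def[abs_def] gamma_cut_def[abs_def] yK_def[abs_def] y1K_def[abs_def])
qed

end

subsection \<open>The Dirichlet eigenbasis\<close>

lemma orthogonal_closure_span:
  fixes x :: "'b::real_inner"
  assumes "\<And>s. s \<in> S \<Longrightarrow> x \<bullet> s = 0" "y \<in> closure (span S)"
  shows "x \<bullet> y = 0"
proof -
  have "x \<bullet> s = 0" if "s \<in> span S" for s
    using that
  proof (induction rule: span_induct_alt)
    case (step c x' y)
    then show ?case by (simp add: inner_right_distrib assms(1))
  qed simp
  moreover have "closed {y. x \<bullet> y = 0}" by (intro closed_Collect_eq continuous_intros)
  ultimately have "closure (span S) \<subseteq> {y. x \<bullet> y = 0}" by (intro closure_minimal) auto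
  then show ?thesis using assms(2) by auto
qed

lemma Cauchy_of_square_increments:
  fixes X :: "nat \<Rightarrow> 'b::real_normed_vector"
  assumes s: "summable d" and X: "\<And>m n. m \<le> n \<Longrightarrow> (norm (X n - X m))\<^sup>2 \<le> sum d {m..<n}"
  shows "Cauchy X"
proof (rule CauchyI')
  fix e :: real assume e: "0 < e"
  obtain N where N: "\<And>m n. m \<ge> N \<Longrightarrow> norm (sum d {m..<n}) < e\<^sup>2"
    using s e unfolding summable_Cauchy by (meson zero_less_power)
  have "norm (X m - X n) < e" if "m \<ge> N" "n > m" for m n
  proof -
    have "(norm (X n - X m))\<^sup>2 < e\<^sup>2" using X[of m n] N[of m n] that by auto
    then show ?thesis using e by (simp add: norm_minus_commute power2_less_imp_less)
  qed
  then show "\<exists>M. \<forall>m\<ge>M. \<forall>n>m. dist (X m) (X n) < e" unfolding dist_norm by blast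
qed

locale eigensystem =
  fixes \<Omega> :: "'a::euclidean_space set" and lam :: "nat \<Rightarrow> real" and \<phi> :: "nat \<Rightarrow> 'a L2"
  assumes eig: "dirichlet_eigensystem \<Omega> lam \<phi>"
begin

lemma lam_pos: "0 < lam i" and \<phi>_dom: "\<phi> i \<in> dirichlet_dom \<Omega>"
  and \<phi>_eig: "dirichlet_laplacian \<Omega> (\<phi> i) = - (lam i *\<^sub>R \<phi> i)"
  and \<phi>_orth: "\<phi> i \<bullet> \<phi> j = (if i = j then 1 else 0)"
  and L2_on_eq: "L2_on \<Omega> = closure (span (range \<phi>))"
proof -
  have "- dirichlet_laplacian \<Omega> (\<phi> i) = lam i *\<^sub>R \<phi> i" using eig by (auto simp: dirichlet_eigensystem_def)
  then show "dirichlet_laplacian \<Omega> (\<phi> i) = - (lam i *\<^sub>R \<phi> i)" by (metis minus_minus)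
qed (use eig in \<open>auto simp: dirichlet_eigensystem_def\<close>)

lemma L2_on_subspace: "subspace (L2_on \<Omega>)" and L2_on_closed: "closed (L2_on \<Omega>)"
  unfolding L2_on_eq by (rule subspace_closure_span, rule closed_closure)

lemma dirichlet_dom_L2_on: "q \<in> dirichlet_dom \<Omega> \<Longrightarrow> q \<in> L2_on \<Omega>"
  by (auto simp: dirichlet_dom_def H1_zero_def has_weak_gradient_def)

text \<open>The test functions are dense because the eigenfunctions are limits of test functions.\<close>

lemma test_functions_separate:
  assumes x: "x \<in> L2_on \<Omega>" and orth: "\<And>v. v \<in> test_functions \<Omega> \<Longrightarrow> x \<bullet> to_L2 v = 0"
  shows "x = 0"
proof -
  have "x \<bullet> \<phi> i = 0" for i
  proof -
    have "\<phi> i \<in> H1_zero \<Omega>" using \<phi>_dom[of i] by (simp add: dirichlet_dom_def)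
    then obtain D and v :: "nat \<Rightarrow> 'a \<Rightarrow> real" where "has_weak_gradient \<Omega> (\<phi> i) D"
      and v: "\<And>n. v n \<in> test_functions \<Omega>" "(\<lambda>n. to_L2 (v n)) \<longlonglongrightarrow> \<phi> i"
      and "\<And>b. b \<in> Basis \<Longrightarrow> (\<lambda>n. to_L2 (partial_deriv b (v n))) \<longlonglongrightarrow> D b"
      unfolding H1_zero_def by blast
    have "(\<lambda>n. x \<bullet> to_L2 (v n)) \<longlonglongrightarrow> x \<bullet> \<phi> i" by (intro tendsto_inner tendsto_const v)
    then show ?thesis unfolding orth[OF v(1)] by (simp only: LIMSEQ_const_iff)
  qed
  then have "x \<bullet> s = 0" if "s \<in> range \<phi>" for s using that by blast
  then have "x \<bullet> x = 0" by (rule orthogonal_closure_span[OF _ x[unfolded L2_on_eq]])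
  then show ?thesis by simp
qed

lemma separate_eq:
  assumes "x \<in> L2_on \<Omega>" "y \<in> L2_on \<Omega>" "\<And>v. v \<in> test_functions \<Omega> \<Longrightarrow> x \<bullet> to_L2 v = y \<bullet> to_L2 v"
  shows "x = y"
  using test_functions_separate[of "x - y"] subspace_diff[OF L2_on_subspace assms(1,2)] assms(3)
  by (simp add: inner_diff_left)

lemma weak_gradient_unique:
  assumes "has_weak_gradient \<Omega> q D" "has_weak_gradient \<Omega> q D'" "b \<in> Basis"
  shows "D b = D' b"
proof (rule separate_eq)
  show "D b \<in> L2_on \<Omega>" "D' b \<in> L2_on \<Omega>" using assms by (auto simp: has_weak_gradient_def)
  show "D b \<bullet> to_L2 v = D' b \<bullet> to_L2 v" if "v \<in> test_functions \<Omega>" for v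
    using assms that unfolding has_weak_gradient_def by (metis neg_equal_iff_equal)
qed

lemma weak_laplacian_unique:
  assumes "has_weak_laplacian \<Omega> q w" "has_weak_laplacian \<Omega> q w'"
  shows "w = w'"
proof (rule separate_eq)
  obtain D where D: "w \<in> L2_on \<Omega>" "has_weak_gradient \<Omega> q D"
    "\<And>v. v \<in> test_functions \<Omega> \<Longrightarrow> (\<Sum>b\<in>Basis. D b \<bullet> to_L2 (partial_deriv b v)) = - (w \<bullet> to_L2 v)"
    using assms(1) unfolding has_weak_laplacian_def by blast
  obtain D' where D': "w' \<in> L2_on \<Omega>" "has_weak_gradient \<Omega> q D'"
    "\<And>v. v \<in> test_functions \<Omega> \<Longrightarrow> (\<Sum>b\<in>Basis. D' b \<bullet> to_L2 (partial_deriv b v)) = - (w' \<bullet> to_L2 v)"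
    using assms(2) unfolding has_weak_laplacian_def by blast
  show "w \<in> L2_on \<Omega>" "w' \<in> L2_on \<Omega>" by (fact D D')+
  fix v assume v: "v \<in> test_functions \<Omega>"
  have "(\<Sum>b\<in>Basis. D b \<bullet> to_L2 (partial_deriv b v)) = (\<Sum>b\<in>Basis. D' b \<bullet> to_L2 (partial_deriv b v))"
    using weak_gradient_unique[OF D(2) D'(2)] by (intro sum.cong) auto
  then show "w \<bullet> to_L2 v = w' \<bullet> to_L2 v" using D(3)[OF v] D'(3)[OF v] by simp
qed

lemma dirichlet_laplacian_eq: "has_weak_laplacian \<Omega> q w \<Longrightarrow> dirichlet_laplacian \<Omega> q = w"
  unfolding dirichlet_laplacian_def by (rule the_equality) (auto intro: weak_laplacian_unique)

lemma has_weak_laplacian_dirichlet: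
  assumes "q \<in> dirichlet_dom \<Omega>"
  shows "has_weak_laplacian \<Omega> q (dirichlet_laplacian \<Omega> q)"
  using assms dirichlet_laplacian_eq unfolding dirichlet_dom_def by force

text \<open>The weak Laplacian is tested with the functions that approximate \<open>q\<close>
  together with their gradients. Uniqueness of weak gradients then replaces the gradients obtained
  in this way by the given ones.\<close>

lemma Green_formula:
  assumes p: "has_weak_laplacian \<Omega> p w" "has_weak_gradient \<Omega> p Dp"
    and q: "q \<in> H1_zero \<Omega>" "has_weak_gradient \<Omega> q Dq"
  shows "w \<bullet> q = - (\<Sum>b\<in>Basis. Dp b \<bullet> Dq b)"
proof -
  obtain D where D: "has_weak_gradient \<Omega> p D"
    "\<And>v. v \<in> test_functions \<Omega> \<Longrightarrow> (\<Sum>b\<in>Basis. D b \<bullet> to_L2 (partial_deriv b v)) = - (w \<bullet> to_L2 v)"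
    using p(1) unfolding has_weak_laplacian_def by blast
  obtain D' and v :: "nat \<Rightarrow> 'a \<Rightarrow> real" where D': "has_weak_gradient \<Omega> q D'" and v: "\<And>n. v n \<in> test_functions \<Omega>"
    "(\<lambda>n. to_L2 (v n)) \<longlonglongrightarrow> q" "\<And>b. b \<in> Basis \<Longrightarrow> (\<lambda>n. to_L2 (partial_deriv b (v n))) \<longlonglongrightarrow> D' b"
    using q(1) unfolding H1_zero_def by blast
  have "(\<lambda>n. w \<bullet> to_L2 (v n)) \<longlonglongrightarrow> w \<bullet> q" by (intro tendsto_intros v)
  moreover have "(\<lambda>n. - (\<Sum>b\<in>Basis. D b \<bullet> to_L2 (partial_deriv b (v n)))) \<longlonglongrightarrow> - (\<Sum>b\<in>Basis. D b \<bullet> D' b)"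
    by (intro tendsto_intros v)
  moreover have "- (\<Sum>b\<in>Basis. D b \<bullet> to_L2 (partial_deriv b (v n))) = w \<bullet> to_L2 (v n)" for n
    using D(2)[OF v(1)] by simp
  ultimately have "w \<bullet> q = - (\<Sum>b\<in>Basis. D b \<bullet> D' b)" by (simp add: LIMSEQ_unique)
  also have "(\<Sum>b\<in>Basis. D b \<bullet> D' b) = (\<Sum>b\<in>Basis. Dp b \<bullet> Dq b)"
    using weak_gradient_unique[OF D(1) p(2)] weak_gradient_unique[OF D' q(2)] by (intro sum.cong) auto
  finally show ?thesis .
qed

lemma dirichlet_laplacian_symmetric:
  assumes p: "p \<in> dirichlet_dom \<Omega>" and q: "q \<in> dirichlet_dom \<Omega>"
  shows "dirichlet_laplacian \<Omega> p \<bullet> q = p \<bullet> dirichlet_laplacian \<Omega> q"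
proof -
  obtain Dp Dq where D: "has_weak_gradient \<Omega> p Dp" "has_weak_gradient \<Omega> q Dq" "p \<in> H1_zero \<Omega>" "q \<in> H1_zero \<Omega>"
    using p q unfolding dirichlet_dom_def has_weak_laplacian_def by blast
  show ?thesis
    using Green_formula[OF has_weak_laplacian_dirichlet[OF p] D(1) D(4) D(2)]
      Green_formula[OF has_weak_laplacian_dirichlet[OF q] D(2) D(3) D(1)]
    by (simp add: inner_commute)
qed

lemma dirichlet_laplacian_coefficient:
  assumes "q \<in> dirichlet_dom \<Omega>"
  shows "dirichlet_laplacian \<Omega> q \<bullet> \<phi> i = - (lam i * (q \<bullet> \<phi> i))"
  using dirichlet_laplacian_symmetric[OF assms \<phi>_dom] by (simp add: \<phi>_eig)

definition eigen_sum :: "(nat \<Rightarrow> real) \<Rightarrow> nat \<Rightarrow> 'a L2" where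
  "eigen_sum c M = (\<Sum>i<M. c i *\<^sub>R \<phi> i)"

lemma eigen_sum_inner: "eigen_sum c M \<bullet> \<phi> j = (if j < M then c j else 0)"
proof -
  have "eigen_sum c M \<bullet> \<phi> j = (\<Sum>i<M. if i = j then c i else 0)"
    unfolding eigen_sum_def inner_sum_left by (intro sum.cong) (auto simp: \<phi>_orth)
  then show ?thesis by simp
qed

lemma norm_Pr: "(norm (eigen_sum c M))\<^sup>2 = (\<Sum>i<M. (c i)\<^sup>2)"
proof -
  have "(norm (eigen_sum c M))\<^sup>2 = eigen_sum c M \<bullet> (\<Sum>i<M. c i *\<^sub>R \<phi> i)" by (simp add: power2_norm_eq_inner eigen_sum_def)
  also have "\<dots> = (\<Sum>i<M. (c i)\<^sup>2)" by (simp add: inner_sum_right eigen_sum_inner power2_eq_square)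
  finally show ?thesis .
qed

lemma Bessel: "(\<Sum>i<M. (q \<bullet> \<phi> i)\<^sup>2) \<le> (norm q)\<^sup>2"
proof -
  let ?P = "eigen_sum (\<lambda>i. q \<bullet> \<phi> i) M"
  have "q \<bullet> ?P = (\<Sum>i<M. (q \<bullet> \<phi> i)\<^sup>2)" by (simp add: eigen_sum_def inner_sum_right power2_eq_square)
  then have "(norm (q - ?P))\<^sup>2 = (norm q)\<^sup>2 - (\<Sum>i<M. (q \<bullet> \<phi> i)\<^sup>2)"
    using norm_Pr[of "\<lambda>i. q \<bullet> \<phi> i" M] by (simp add: power2_norm_eq_inner inner_diff_left inner_diff_right inner_commute)
  then show ?thesis using zero_le_power2[of "norm (q - ?P)"] by linarith
qed

text \<open>Convergence is plain on the span; the partial sums are contractions by Bessel's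
  inequality, so it extends to the closure.\<close>

lemma eigen_sum_tendsto:
  assumes "q \<in> L2_on \<Omega>"
  shows "eigen_sum (\<lambda>i. q \<bullet> \<phi> i) \<longlonglongrightarrow> q"
proof -
  define P where "P q M = eigen_sum (\<lambda>i. q \<bullet> \<phi> i) M" for q M
  have lin: "P (c *\<^sub>R p + q) M = c *\<^sub>R P p M + P q M" for c p q M
    by (simp add: P_def eigen_sum_def inner_left_distrib scaleR_left_distrib sum.distrib scaleR_sum_right)
  have contr: "norm (P q M) \<le> norm q" for q M
  proof (rule power2_le_imp_le)
    show "(norm (P q M))\<^sup>2 \<le> (norm q)\<^sup>2" unfolding P_def norm_Pr by (rule Bessel)
  qed simp
  have span: "P y \<longlonglongrightarrow> y" if "y \<in> span (range \<phi>)" for y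
    using that
  proof (induction rule: span_induct_alt)
    case base
    then show ?case by (simp add: P_def eigen_sum_def)
  next
    case (step c x y)
    obtain j where j: "x = \<phi> j" using step(1) by auto
    have Px: "P x M = x" if "M > j" for M
    proof -
      have "P x M = (\<Sum>i<M. if i = j then \<phi> i else 0)"
        unfolding P_def eigen_sum_def j by (intro sum.cong) (auto simp: \<phi>_orth)
      then show ?thesis using that by (simp add: j)
    qed
    have "\<forall>\<^sub>F M in sequentially. P x M = x" using eventually_gt_at_top[of j] by eventually_elim (rule Px)
    then have "P x \<longlonglongrightarrow> x" by (rule tendsto_eventually)
    then have "(\<lambda>M. c *\<^sub>R P x M + P y M) \<longlonglongrightarrow> c *\<^sub>R x + y" by (intro tendsto_intros step)
    then show ?case by (simp add: lin)
  qed
  have "P q \<longlonglongrightarrow> q"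
  proof (rule LIMSEQ_I)
    fix r :: real assume r: "0 < r"
    obtain y where y: "y \<in> span (range \<phi>)" "dist y q < r / 3"
      using assms r unfolding L2_on_eq closure_approachable by (meson divide_pos_pos zero_less_numeral)
    obtain M0 where M0: "\<And>M. M \<ge> M0 \<Longrightarrow> norm (P y M - y) < r / 3"
      using LIMSEQ_D[OF span[OF y(1)], of "r / 3"] r by auto
    have "norm (P q M - q) < r" if "M \<ge> M0" for M
    proof -
      have "P q M = P (q - y) M + P y M" using lin[of 1 "q - y" y M] by simp
      then have "P q M - q = P (q - y) M + (P y M - y) + (y - q)" by simp
      then have "norm (P q M - q) \<le> norm (P (q - y) M) + norm (P y M - y) + norm (y - q)"
        using norm_triangle_ineq[of "P (q - y) M + (P y M - y)" "y - q"] norm_triangle_ineq[of "P (q - y) M" "P y M - y"]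
        by (simp only:)
      also have "norm (P (q - y) M) \<le> norm (y - q)" using contr[of "q - y" M] by (simp add: norm_minus_commute)
      finally show ?thesis using y(2) M0[OF that] by (simp add: dist_norm)
    qed
    then show "\<exists>M0. \<forall>M\<ge>M0. norm (P q M - q) < r" by blast
  qed
  then show ?thesis by (simp add: P_def[abs_def])
qed

text \<open>The form in which estimates for the modes are put together to an estimate of the
  norm.\<close>

lemma norm_le_partial_sums:
  assumes q: "q \<in> L2_on \<Omega>" and B: "0 \<le> B" "\<And>M. (\<Sum>i<M. (q \<bullet> \<phi> i)\<^sup>2) \<le> B\<^sup>2"
  shows "norm q \<le> B"
proof (rule LIMSEQ_le_const2[OF tendsto_norm[OF eigen_sum_tendsto[OF q]]])
  have "norm (eigen_sum (\<lambda>i. q \<bullet> \<phi> i) M) \<le> B" for M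
    by (rule power2_le_imp_le[OF _ B(1)]) (simp only: norm_Pr B(2))
  then show "\<exists>N. \<forall>n\<ge>N. norm (eigen_sum (\<lambda>i. q \<bullet> \<phi> i) n) \<le> B" by blast
qed

lemma eigen_sum_diff: "m \<le> n \<Longrightarrow> (norm (eigen_sum c n - eigen_sum c m))\<^sup>2 = (\<Sum>i\<in>{m..<n}. (c i)\<^sup>2)"
proof -
  assume mn: "m \<le> n"
  have "eigen_sum c n - eigen_sum c m = eigen_sum (\<lambda>i. if m \<le> i then c i else 0) n"
  proof -
    have "eigen_sum c n = eigen_sum c m + (\<Sum>i\<in>{m..<n}. c i *\<^sub>R \<phi> i)"
      unfolding eigen_sum_def lessThan_atLeast0 using mn by (intro sum.atLeastLessThan_concat[symmetric]) auto
    moreover have "eigen_sum (\<lambda>i. if m \<le> i then c i else 0) n = (\<Sum>i\<in>{m..<n}. c i *\<^sub>R \<phi> i)"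
      unfolding eigen_sum_def by (intro sum.mono_neutral_cong_right) auto
    ultimately show ?thesis by simp
  qed
  then show ?thesis using norm_Pr[of "\<lambda>i. if m \<le> i then c i else 0" n]
    by (simp, intro sum.mono_neutral_cong_right) auto
qed

text \<open>\<open>dirichlet_laplacian\<close> is a definite description, so a weak Laplacian of
  \<open>q\<close> has to be constructed. Gradient and Laplacian are obtained as limits over the
  partial sums of the expansion. The gradients of the eigenfunctions are orthogonal with squared
  norm \<open>lam i\<close>, and the resulting series is dominated by those for the exponents 0 and
  2.\<close>

lemma Hcheck2_coefficient:
  assumes q: "q \<in> Hcheck \<Omega> lam \<phi> 2"
  shows "dirichlet_laplacian \<Omega> q \<bullet> \<phi> i = - (lam i * (q \<bullet> \<phi> i))"
proof -
  define c where "c i = q \<bullet> \<phi> i" for i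
  have qL: "q \<in> L2_on \<Omega>" and s2: "summable (\<lambda>i. (lam i * c i)\<^sup>2)"
    using q lam_pos by (auto simp: Hcheck_def c_def power_mult_distrib powr_numeral less_imp_le)
  have s0: "summable (\<lambda>i. (c i)\<^sup>2)"
    unfolding c_def by (rule summableI_nonneg_bounded[of _ "(norm q)\<^sup>2"]) (auto intro: Bessel)
  have s1: "summable (\<lambda>i. lam i * (c i)\<^sup>2)"
  proof (rule summable_comparison_test'[OF summable_add[OF s0 s2]])
    fix n :: nat
    have "2 * (1 * lam n) \<le> 1\<^sup>2 + (lam n)\<^sup>2" using sum_squares_bound[of 1 "lam n"] by simp
    then have "lam n \<le> 1 + (lam n)\<^sup>2" using lam_pos[of n] by simp
    then have "lam n * (c n)\<^sup>2 \<le> (1 + (lam n)\<^sup>2) * (c n)\<^sup>2" by (intro mult_right_mono) auto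
    then show "norm (lam n * (c n)\<^sup>2) \<le> (c n)\<^sup>2 + (lam n * c n)\<^sup>2"
      using lam_pos[of n] by (simp add: power_mult_distrib distrib_right abs_mult)
  qed
  have "\<exists>D. has_weak_gradient \<Omega> (\<phi> i) D" for i
    using \<phi>_dom[of i] unfolding dirichlet_dom_def has_weak_laplacian_def by blast
  then obtain G where G: "\<And>i. has_weak_gradient \<Omega> (\<phi> i) (G i)" by metis
  have wl: "has_weak_laplacian \<Omega> (\<phi> i) (- (lam i *\<^sub>R \<phi> i))" for i
    using has_weak_laplacian_dirichlet[OF \<phi>_dom[of i]] by (simp add: \<phi>_eig)
  have GG: "(\<Sum>b\<in>Basis. G i b \<bullet> G j b) = (if i = j then lam i else 0)" for i j
    using Green_formula[OF wl[of i] G[of i] _ G[of j]] \<phi>_dom[of j] by (simp add: dirichlet_dom_def \<phi>_orth split: if_splits)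
  define X where "X b M = (\<Sum>i<M. c i *\<^sub>R G i b)" for b M
  have X_diff: "(norm (X b n - X b m))\<^sup>2 \<le> (\<Sum>i\<in>{m..<n}. lam i * (c i)\<^sup>2)" if mn: "m \<le> n" and b: "b \<in> Basis" for b m n
  proof -
    have d: "X b n - X b m = (\<Sum>i\<in>{m..<n}. c i *\<^sub>R G i b)" for b
      using sum.atLeastLessThan_concat[of 0 m n "\<lambda>i. c i *\<^sub>R G i b"] mn
      by (simp add: X_def lessThan_atLeast0 algebra_simps)
    \<comment> \<open>One component is enlarged to all of them, because the orthogonality of the
      gradients concerns the sum over all directions.\<close>
    have "(norm (X b n - X b m))\<^sup>2 \<le> (\<Sum>b\<in>Basis. (norm (X b n - X b m))\<^sup>2)"
      using b by (intro member_le_sum) auto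
    also have "\<dots> = (\<Sum>b\<in>Basis. \<Sum>i\<in>{m..<n}. \<Sum>j\<in>{m..<n}. c i * c j * (G i b \<bullet> G j b))"
      unfolding d power2_norm_eq_inner inner_sum_left inner_sum_right by (simp add: mult_ac inner_commute)
    also have "\<dots> = (\<Sum>i\<in>{m..<n}. \<Sum>b\<in>Basis. \<Sum>j\<in>{m..<n}. c i * c j * (G i b \<bullet> G j b))" by (rule sum.swap)
    also have "\<dots> = (\<Sum>i\<in>{m..<n}. \<Sum>j\<in>{m..<n}. \<Sum>b\<in>Basis. c i * c j * (G i b \<bullet> G j b))"
      by (intro sum.cong refl sum.swap)
    also have "\<dots> = (\<Sum>i\<in>{m..<n}. \<Sum>j\<in>{m..<n}. c i * c j * (if i = j then lam i else 0))"
      by (simp add: sum_distrib_left[symmetric] GG)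
    also have "\<dots> = (\<Sum>i\<in>{m..<n}. lam i * (c i)\<^sup>2)"
      by (intro sum.cong refl) (simp add: if_distrib[of "\<lambda>r. _ * r"] sum.delta power2_eq_square mult_ac cong: if_cong)
    finally show ?thesis .
  qed
  have "\<exists>D. X b \<longlonglongrightarrow> D" if "b \<in> Basis" for b
  proof -
    have "Cauchy (X b)" using X_diff that by (intro Cauchy_of_square_increments[OF s1]) auto
    then show ?thesis using Cauchy_convergent convergent_def by blast
  qed
  then obtain D where D: "\<And>b. b \<in> Basis \<Longrightarrow> X b \<longlonglongrightarrow> D b" by metis
  have "Cauchy (eigen_sum (\<lambda>i. - (lam i * c i)))"
    by (rule Cauchy_of_square_increments[OF s2]) (simp add: eigen_sum_diff)
  then obtain w where w: "eigen_sum (\<lambda>i. - (lam i * c i)) \<longlonglongrightarrow> w" using Cauchy_convergent convergent_def by blast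
  have qc: "eigen_sum c \<longlonglongrightarrow> q" using eigen_sum_tendsto[OF qL] by (simp add: c_def[abs_def])
  have PrL: "eigen_sum c' M \<in> L2_on \<Omega>" for c' M
    unfolding eigen_sum_def by (intro subspace_sum[OF L2_on_subspace] subspace_scale[OF L2_on_subspace] dirichlet_dom_L2_on \<phi>_dom)
  have GL: "G i b \<in> L2_on \<Omega>" if "b \<in> Basis" for i b using G[of i] that by (auto simp: has_weak_gradient_def)
  have wg: "has_weak_gradient \<Omega> q D"
    unfolding has_weak_gradient_def
  proof (intro conjI ballI qL)
    fix b :: 'a assume b: "b \<in> Basis"
    have "X b M \<in> L2_on \<Omega>" for M
      unfolding X_def by (intro subspace_sum[OF L2_on_subspace] subspace_scale[OF L2_on_subspace] GL b)
    then show "D b \<in> L2_on \<Omega>" using closed_sequentially[OF L2_on_closed _ D[OF b]] by blast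
    fix v assume v: "v \<in> test_functions \<Omega>"
    have "(\<lambda>M. eigen_sum c M \<bullet> to_L2 (partial_deriv b v)) \<longlonglongrightarrow> q \<bullet> to_L2 (partial_deriv b v)"
      by (intro tendsto_intros qc)
    moreover have "(\<lambda>M. - (X b M \<bullet> to_L2 v)) \<longlonglongrightarrow> - (D b \<bullet> to_L2 v)"
      by (intro tendsto_intros D b)
    moreover have "eigen_sum c M \<bullet> to_L2 (partial_deriv b v) = - (X b M \<bullet> to_L2 v)" for M
    proof -
      have "\<phi> i \<bullet> to_L2 (partial_deriv b v) = - (G i b \<bullet> to_L2 v)" for i
        using G[of i] b v by (auto simp: has_weak_gradient_def)
      then show ?thesis by (simp add: eigen_sum_def X_def inner_sum_left sum_negf)
    qed
    ultimately show "q \<bullet> to_L2 (partial_deriv b v) = - (D b \<bullet> to_L2 v)" by (simp add: LIMSEQ_unique)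
  qed
  have "has_weak_laplacian \<Omega> q w"
    unfolding has_weak_laplacian_def
  proof (intro conjI exI[of _ D] ballI wg)
    show "w \<in> L2_on \<Omega>" using closed_sequentially[OF L2_on_closed _ w] PrL by blast
    fix v assume v: "v \<in> test_functions \<Omega>"
    have "(\<lambda>M. \<Sum>b\<in>Basis. X b M \<bullet> to_L2 (partial_deriv b v)) \<longlonglongrightarrow> (\<Sum>b\<in>Basis. D b \<bullet> to_L2 (partial_deriv b v))"
      by (intro tendsto_intros D)
    moreover have "(\<lambda>M. - (eigen_sum (\<lambda>i. - (lam i * c i)) M \<bullet> to_L2 v)) \<longlonglongrightarrow> - (w \<bullet> to_L2 v)"
      by (intro tendsto_intros w)
    moreover have "(\<Sum>b\<in>Basis. X b M \<bullet> to_L2 (partial_deriv b v)) = - (eigen_sum (\<lambda>i. - (lam i * c i)) M \<bullet> to_L2 v)" for M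
    proof -
      have Gv: "(\<Sum>b\<in>Basis. G i b \<bullet> to_L2 (partial_deriv b v)) = lam i * (\<phi> i \<bullet> to_L2 v)" for i
      proof -
        obtain D' where D': "has_weak_gradient \<Omega> (\<phi> i) D'"
          "(\<Sum>b\<in>Basis. D' b \<bullet> to_L2 (partial_deriv b v)) = - (- (lam i *\<^sub>R \<phi> i) \<bullet> to_L2 v)"
          using wl[of i] v unfolding has_weak_laplacian_def by blast
        have "(\<Sum>b\<in>Basis. G i b \<bullet> to_L2 (partial_deriv b v)) = (\<Sum>b\<in>Basis. D' b \<bullet> to_L2 (partial_deriv b v))"
          using weak_gradient_unique[OF G[of i] D'(1)] by (intro sum.cong) auto
        then show ?thesis using D'(2) by simp
      qed
      have "(\<Sum>b\<in>Basis. X b M \<bullet> to_L2 (partial_deriv b v)) = (\<Sum>b\<in>Basis. \<Sum>i<M. c i * (G i b \<bullet> to_L2 (partial_deriv b v)))"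
        by (simp add: X_def inner_sum_left)
      also have "\<dots> = (\<Sum>i<M. \<Sum>b\<in>Basis. c i * (G i b \<bullet> to_L2 (partial_deriv b v)))" by (rule sum.swap)
      also have "\<dots> = (\<Sum>i<M. c i * (lam i * (\<phi> i \<bullet> to_L2 v)))" by (simp add: sum_distrib_left[symmetric] Gv)
      finally show ?thesis by (simp add: eigen_sum_def inner_sum_left sum_negf mult_ac)
    qed
    ultimately show "(\<Sum>b\<in>Basis. D b \<bullet> to_L2 (partial_deriv b v)) = - (w \<bullet> to_L2 v)" by (simp add: LIMSEQ_unique)
  qed
  then have "dirichlet_laplacian \<Omega> q = w" by (rule dirichlet_laplacian_eq)
  moreover have "w \<bullet> \<phi> i = - (lam i * c i)"
  proof -
    have "(\<lambda>M. eigen_sum (\<lambda>i. - (lam i * c i)) M \<bullet> \<phi> i) \<longlonglongrightarrow> w \<bullet> \<phi> i" by (intro tendsto_intros w)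
    moreover have "\<forall>\<^sub>F M in sequentially. eigen_sum (\<lambda>i. - (lam i * c i)) M \<bullet> \<phi> i = - (lam i * c i)"
      using eventually_gt_at_top[of i] by eventually_elim (simp add: eigen_sum_inner)
    then have "(\<lambda>M. eigen_sum (\<lambda>i. - (lam i * c i)) M \<bullet> \<phi> i) \<longlonglongrightarrow> - (lam i * c i)" by (rule tendsto_eventually)
    ultimately show ?thesis by (rule LIMSEQ_unique)
  qed
  ultimately show ?thesis by (simp add: c_def)
qed

lemma Hcheck_norm_partial_sum:
  assumes "q \<in> Hcheck \<Omega> lam \<phi> s" "Hcheck_norm lam \<phi> s q \<le> B"
  shows "(\<Sum>i<M. lam i powr s * (q \<bullet> \<phi> i)\<^sup>2) \<le> B\<^sup>2"
proof -
  have s: "summable (\<lambda>i. lam i powr s * (q \<bullet> \<phi> i)\<^sup>2)" using assms(1) by (simp add: Hcheck_def)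
  have "(\<Sum>i<M. lam i powr s * (q \<bullet> \<phi> i)\<^sup>2) \<le> (\<Sum>i. lam i powr s * (q \<bullet> \<phi> i)\<^sup>2)"
    by (rule sum_le_suminf[OF s]) auto
  also have "\<dots> = (Hcheck_norm lam \<phi> s q)\<^sup>2"
    unfolding Hcheck_norm_def by (rule real_sqrt_pow2[symmetric]) (intro suminf_nonneg s mult_nonneg_nonneg; simp)
  also have "\<dots> \<le> B\<^sup>2" using assms(2) unfolding Hcheck_norm_def
    by (intro power_mono) (auto intro!: real_sqrt_ge_zero suminf_nonneg s)
  finally show ?thesis .
qed

end

subsection \<open>Weights of the scheme\<close>

lemma lebesgue_on_nonneg_integral:
  fixes f :: "real \<Rightarrow> real"
  assumes "(f has_integral I) S" "\<And>x. x \<in> S \<Longrightarrow> 0 \<le> f x" "S \<in> sets lebesgue"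
  shows "integral\<^sup>L (lebesgue_on S) f = I"
proof -
  have "f absolutely_integrable_on S"
    using assms by (intro nonnegative_absolutely_integrable_1) auto
  then have "integrable (lebesgue_on S) f"
    using assms(3) by (simp add: set_integrable_def integrable_restrict_space)
  then show ?thesis
    using lebesgue_integral_eq_integral[of S f] assms by (simp add: integral_unique)
qed

lemma has_integral_beta_kernel:
  fixes q :: real
  assumes q: "1 < q" and ab: "a \<le> b" "b \<le> t"
  shows "((\<lambda>s. beta_kernel (q - 1) (t - s)) has_integral ((t - a) powr (q - 1) - (t - b) powr (q - 1)) / Gamma q) {a..b}"
proof -
  have \<Gamma>: "Gamma q \<noteq> 0" using q by (intro less_imp_neq[THEN not_sym] Gamma_real_pos) auto
  have "Gamma ((q - 1) + 1) = (q - 1) * Gamma (q - 1)"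
    using q by (intro Gamma_plus1) (auto elim!: nonpos_Ints_cases)
  then have Gq: "Gamma q = (q - 1) * Gamma (q - 1)" by simp
  define F where "F s = - ((t - s) powr (q - 1) / Gamma q)" for s
  have "((\<lambda>s. beta_kernel (q - 1) (t - s)) has_integral (F b - F a)) {a..b}"
  proof (rule fundamental_theorem_of_calculus_interior[OF ab(1)])
    show "continuous_on {a..b} F" unfolding F_def
      using q ab \<Gamma> by (intro continuous_on_minus continuous_on_divide continuous_on_powr' continuous_on_diff continuous_on_const continuous_on_id) auto
    fix s assume "s \<in> {a<..<b}"
    then have p: "0 < t - s" using ab by simp
    have "(F has_real_derivative (q - 1) * (t - s) powr (q - 1 - 1) / Gamma q) (at s)"
      unfolding F_def using p \<Gamma> by (auto intro!: derivative_eq_intros)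
    moreover have "(q - 1) * (t - s) powr (q - 1 - 1) / Gamma q = beta_kernel (q - 1) (t - s)"
      using q by (simp add: Gq beta_kernel_def)
    ultimately show "(F has_vector_derivative beta_kernel (q - 1) (t - s)) (at s)"
      by (simp add: has_real_derivative_iff_has_vector_derivative[symmetric])
  qed
  then show ?thesis by (simp add: F_def diff_divide_distrib)
qed

lemma has_integral_gamma_cell:
  fixes q :: real
  assumes q: "1 < q" and ab: "a \<le> u" "u \<le> v"
  shows "((\<lambda>t. (t - a) powr (q - 1) / Gamma q) has_integral ((v - a) powr q - (u - a) powr q) / Gamma (q + 1)) {u..v}"
proof -
  have \<Gamma>: "Gamma (q + 1) \<noteq> 0" using q by (intro less_imp_neq[THEN not_sym] Gamma_real_pos) auto
  have Gq: "Gamma (q + 1) = q * Gamma q" using q by (intro Gamma_plus1) (auto elim!: nonpos_Ints_cases)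
  define F where "F t = (t - a) powr q / Gamma (q + 1)" for t
  have "((\<lambda>t. (t - a) powr (q - 1) / Gamma q) has_integral (F v - F u)) {u..v}"
  proof (rule fundamental_theorem_of_calculus_interior[OF ab(2)])
    show "continuous_on {u..v} F" unfolding F_def
      using q ab \<Gamma> by (intro continuous_on_divide continuous_on_powr' continuous_on_diff continuous_on_const continuous_on_id) auto
    fix s assume "s \<in> {u<..<v}"
    then have p: "0 < s - a" using ab by simp
    have "(F has_real_derivative q * (s - a) powr (q - 1) / Gamma (q + 1)) (at s)"
      unfolding F_def using p \<Gamma> by (auto intro!: derivative_eq_intros)
    moreover have "q * (s - a) powr (q - 1) / Gamma (q + 1) = (s - a) powr (q - 1) / Gamma q"
      using q by (simp add: Gq)
    ultimately show "(F has_vector_derivative (s - a) powr (q - 1) / Gamma q) (at s)"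
      by (simp add: has_real_derivative_iff_has_vector_derivative[symmetric])
  qed
  then show ?thesis by (simp add: F_def diff_divide_distrib)
qed

text \<open>The inner integral is a difference of powers of order q - 1, and the outer one raises
  the order to q, which gives a second difference. On the diagonal \<open>min\<close> stops the
  inner integral at \<open>t\<close>, so a single power is left and the weight is 1. The
  \<open>Suc\<close> translates the indices of the scheme, which start at 1.\<close>

lemma omega_weight_eq:
  fixes q \<tau> :: real
  assumes q: "1 < q" and \<tau>: "0 < \<tau>" and j: "j \<le> m"
  shows "\<tau> * omega_weight (q - 1) \<tau> (Suc m) (Suc j) = \<tau> powr q / Gamma (q + 1) * pi_weight q (m - j)"
proof -
  define a where "a = real j * \<tau>"
  define u where "u = real m * \<tau>"
  have au: "a \<le> u" unfolding a_def u_def using j \<tau> by (intro mult_right_mono) auto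
  have Sj: "real (Suc j) * \<tau> = a + \<tau>" "real (Suc m) * \<tau> = u + \<tau>" by (simp_all add: a_def u_def distrib_right)
  have \<Gamma>: "0 < Gamma q" using q by (intro Gamma_real_pos) auto
  have pm: "(real n * \<tau>) powr q = real n powr q * \<tau> powr q" for n by (rule powr_mult)
  have inner: "(LINT s|lebesgue_on {a..min t (a + \<tau>)}. beta_kernel (q - 1) (t - s))
      = ((t - a) powr (q - 1) - (t - min t (a + \<tau>)) powr (q - 1)) / Gamma q" if "u \<le> t" for t
  proof (rule lebesgue_on_nonneg_integral)
    show "((\<lambda>s. beta_kernel (q - 1) (t - s)) has_integral ((t - a) powr (q - 1) - (t - min t (a + \<tau>)) powr (q - 1)) / Gamma q) {a..min t (a + \<tau>)}"
      using au that \<tau> by (intro has_integral_beta_kernel[OF q]) auto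
    show "0 \<le> beta_kernel (q - 1) (t - s)" for s
      using q by (simp add: beta_kernel_def Gamma_real_nonneg)
  qed auto
  have "\<tau> * omega_weight (q - 1) \<tau> (Suc m) (Suc j)
      = (LINT t|lebesgue_on {u..u + \<tau>}. LINT s|lebesgue_on {a..min t (a + \<tau>)}. beta_kernel (q - 1) (t - s))"
    unfolding omega_weight_def Sj diff_Suc_1 a_def[symmetric] u_def[symmetric] using \<tau> by simp
  also have "\<dots> = (LINT t|lebesgue_on {u..u + \<tau>}. ((t - a) powr (q - 1) - (t - min t (a + \<tau>)) powr (q - 1)) / Gamma q)"
    by (intro Bochner_Integration.integral_cong refl inner) auto
  also have "\<dots> = \<tau> powr q / Gamma (q + 1) * pi_weight q (m - j)"
  proof (rule lebesgue_on_nonneg_integral)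
    show "0 \<le> ((t - a) powr (q - 1) - (t - min t (a + \<tau>)) powr (q - 1)) / Gamma q" if "t \<in> {u..u + \<tau>}" for t
    proof -
      have "(t - min t (a + \<tau>)) powr (q - 1) \<le> (t - a) powr (q - 1)"
        using q that au \<tau> by (intro powr_mono2) auto
      then show ?thesis using \<Gamma> by simp
    qed
    show "((\<lambda>t. ((t - a) powr (q - 1) - (t - min t (a + \<tau>)) powr (q - 1)) / Gamma q) has_integral
        \<tau> powr q / Gamma (q + 1) * pi_weight q (m - j)) {u..u + \<tau>}"
    proof (cases "j = m")
      case True
      then have au': "a = u" by (simp add: a_def u_def)
      have "((\<lambda>t. (t - a) powr (q - 1) / Gamma q) has_integral ((u + \<tau> - a) powr q - (u - a) powr q) / Gamma (q + 1)) {u..u + \<tau>}"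
        using au \<tau> by (intro has_integral_gamma_cell[OF q]) auto
      moreover have "((u + \<tau> - a) powr q - (u - a) powr q) / Gamma (q + 1) = \<tau> powr q / Gamma (q + 1) * pi_weight q (m - j)"
        using True by (simp add: au' pi_weight_def)
      ultimately have h: "((\<lambda>t. (t - a) powr (q - 1) / Gamma q) has_integral \<tau> powr q / Gamma (q + 1) * pi_weight q (m - j)) {u..u + \<tau>}"
        by simp
      show ?thesis by (rule has_integral_eq[OF _ h]) (simp add: au' min_def)
    next
      case False
      with j obtain k where k: "m = j + Suc k" using less_imp_Suc_add[of j m] by auto
      have ua: "u - a = real (Suc k) * \<tau>" by (simp add: u_def a_def k algebra_simps)
      then have a1: "a + \<tau> \<le> u" using \<tau> by (simp add: algebra_simps)
      have "((\<lambda>t. (t - a) powr (q - 1) / Gamma q) has_integral ((u + \<tau> - a) powr q - (u - a) powr q) / Gamma (q + 1)) {u..u + \<tau>}"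
        using au \<tau> by (intro has_integral_gamma_cell[OF q]) auto
      moreover have "((\<lambda>t. (t - (a + \<tau>)) powr (q - 1) / Gamma q) has_integral ((u + \<tau> - (a + \<tau>)) powr q - (u - (a + \<tau>)) powr q) / Gamma (q + 1)) {u..u + \<tau>}"
        using a1 \<tau> by (intro has_integral_gamma_cell[OF q]) auto
      ultimately have h: "((\<lambda>t. (t - a) powr (q - 1) / Gamma q - (t - (a + \<tau>)) powr (q - 1) / Gamma q) has_integral
          ((u + \<tau> - a) powr q - (u - a) powr q) / Gamma (q + 1) - ((u + \<tau> - (a + \<tau>)) powr q - (u - (a + \<tau>)) powr q) / Gamma (q + 1)) {u..u + \<tau>}"
        by (rule has_integral_diff)
      have e: "u + \<tau> - a = real (Suc (Suc k)) * \<tau>" "u - (a + \<tau>) = real k * \<tau>" "u + \<tau> - (a + \<tau>) = real (Suc k) * \<tau>"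
        using ua by (simp_all add: algebra_simps)
      have pw: "pi_weight q (m - j) = real (Suc (Suc k)) powr q - 2 * real (Suc k) powr q + real k powr q"
        by (simp add: k pi_weight_def add.commute)
      have "((u + \<tau> - a) powr q - (u - a) powr q) / Gamma (q + 1) - ((u + \<tau> - (a + \<tau>)) powr q - (u - (a + \<tau>)) powr q) / Gamma (q + 1)
          = \<tau> powr q / Gamma (q + 1) * pi_weight q (m - j)"
        unfolding e ua pm pw by (simp add: diff_divide_distrib algebra_simps add_divide_distrib)
      with h have h': "((\<lambda>t. (t - a) powr (q - 1) / Gamma q - (t - (a + \<tau>)) powr (q - 1) / Gamma q) has_integral
          \<tau> powr q / Gamma (q + 1) * pi_weight q (m - j)) {u..u + \<tau>}" by (simp only:)
      show ?thesis
        by (rule has_integral_eq[OF _ h']) (use a1 in \<open>auto simp: min_def diff_divide_distrib\<close>)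
    qed
  qed auto
  finally show ?thesis .
qed

text \<open>With \<open>k = m - Suc j\<close> the summands of the two sums differ by
  \<open>g k * Y (Suc j) - g (Suc k) * Y j\<close>, which telescopes. Jumps of \<open>g\<close>
  against averages of \<open>Y\<close> become averages of \<open>g\<close> against jumps of
  \<open>Y\<close>; the trapezoidal weights arise here.\<close>

lemma scheme_summation_by_parts:
  fixes g Y :: "nat \<Rightarrow> real"
  shows "(\<Sum>j<m. (g (m - Suc j) + g (Suc (m - Suc j))) / 2 * (Y (Suc j) - Y j))
    = g 0 * Y m - g m * Y 0 + (\<Sum>j<m. (g (Suc (m - Suc j)) - g (m - Suc j)) * ((Y (Suc j) + Y j) / 2))"
proof -
  have "(\<Sum>j<m. (g (m - Suc j) + g (Suc (m - Suc j))) / 2 * (Y (Suc j) - Y j))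
      - (\<Sum>j<m. (g (Suc (m - Suc j)) - g (m - Suc j)) * ((Y (Suc j) + Y j) / 2))
      = (\<Sum>j<m. g (m - Suc j) * Y (Suc j) - g (m - j) * Y j)"
    unfolding sum_subtractf[symmetric] by (intro sum.cong refl) (simp add: Suc_diff_Suc field_simps)
  also have "\<dots> = g 0 * Y m - g m * Y 0"
    using sum_lessThan_telescope[of "\<lambda>j. g (m - j) * Y j" m] by simp
  finally show ?thesis by simp
qed

text \<open>The scheme is the increment in \<open>m\<close> of the previous identity;
  \<open>g 0 = 1\<close> supplies the plain difference of \<open>Y\<close>.\<close>

lemma scheme_difference_form:
  fixes g Y :: "nat \<Rightarrow> real"
  defines "gh \<equiv> \<lambda>k. (g k + g (Suc k)) / 2" and "w \<equiv> \<lambda>k. g (Suc k) - g k"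
  assumes g0: "g 0 = 1"
  shows "(Y (Suc m) - Y m) + w 0 * ((Y (Suc m) + Y m) / 2)
      - (\<Sum>k = 1..m. (w (k - 1) - w k) * ((Y (Suc m - k) + Y (Suc m - k - 1)) / 2)) - w m * Y 0
    = gh 0 * (Y (Suc m) - Y m) + (\<Sum>j<m. (gh (m - j) - gh (m - Suc j)) * (Y (Suc j) - Y j))"
proof -
  define S where "S n = (\<Sum>j<n. gh (n - Suc j) * (Y (Suc j) - Y j))" for n
  have S: "S n = g 0 * Y n - g n * Y 0 + (\<Sum>j<n. w (n - Suc j) * ((Y (Suc j) + Y j) / 2))" for n
    unfolding S_def gh_def w_def by (rule scheme_summation_by_parts)
  have "S (Suc m) - S m = gh 0 * (Y (Suc m) - Y m) + (\<Sum>j<m. (gh (m - j) - gh (m - Suc j)) * (Y (Suc j) - Y j))"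
    unfolding S_def by (simp add: left_diff_distrib sum_subtractf)
  moreover have "S (Suc m) - S m = (Y (Suc m) - Y m) + w 0 * ((Y (Suc m) + Y m) / 2)
      + (\<Sum>j<m. (w (m - j) - w (m - Suc j)) * ((Y (Suc j) + Y j) / 2)) - w m * Y 0"
  proof -
    have "w m * Y 0 = g (Suc m) * Y 0 - g m * Y 0" by (simp add: w_def left_diff_distrib)
    then show ?thesis unfolding S g0 by (simp add: left_diff_distrib sum_subtractf diff_divide_distrib)
  qed
  moreover have "(\<Sum>k = 1..m. (w (k - 1) - w k) * ((Y (Suc m - k) + Y (Suc m - k - 1)) / 2))
      = - (\<Sum>j<m. (w (m - j) - w (m - Suc j)) * ((Y (Suc j) + Y j) / 2))"
  proof -
    have "(\<Sum>k = 1..m. (w (k - 1) - w k) * ((Y (Suc m - k) + Y (Suc m - k - 1)) / 2))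
        = (\<Sum>j<m. - ((w (m - j) - w (m - Suc j)) * ((Y (Suc j) + Y j) / 2)))"
      by (rule sum.reindex_bij_witness[of _ "\<lambda>j. m - j" "\<lambda>k. m - k"]) (auto simp: Suc_diff_le field_simps)
    then show ?thesis by (simp add: sum_negf)
  qed
  ultimately show ?thesis by simp
qed

section \<open>Null sets and weighted integrals\<close>

lemma AE_interval_ex:
  assumes AE: "AE t in lebesgue_on {0<..<T}. P t" and ab: "0 \<le> a" "a < b" "b \<le> (T::real)"
  shows "\<exists>t\<in>{a<..<b}. P t"
proof (rule ccontr)
  assume "\<not> ?thesis"
  moreover have "AE t in lebesgue. t \<in> {0<..<T} \<longrightarrow> P t"
    using AE by (simp add: AE_restrict_space_iff)
  ultimately have "AE t in lebesgue. t \<notin> {a<..<b}" using ab by (auto elim!: eventually_mono)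
  then have "{a<..<b} \<in> null_sets lebesgue" by (subst AE_iff_null_sets) auto
  then have "emeasure lebesgue {a<..<b} = 0" by blast
  then show False using ab by simp
qed

text \<open>The integral of the square of |z| - c w, divided by w, is nonnegative, and
  \<open>c\<close> is the value that minimises it. Where \<open>w\<close> vanishes so does
  \<open>z\<close>, and the quotient is 0 by convention.\<close>

lemma weighted_Cauchy_Schwarz:
  fixes w z :: "real \<Rightarrow> real"
  assumes w: "integrable M w" and wpos: "0 < (LINT s|M. w s)"
    and z: "integrable M (\<lambda>s. \<bar>z s\<bar>)" and zz: "integrable M (\<lambda>s. z s ^ 2 / w s)"
    and nn: "\<And>s. 0 \<le> w s" and van: "\<And>s. w s = 0 \<Longrightarrow> z s = 0"
  shows "(LINT s|M. \<bar>z s\<bar>)\<^sup>2 \<le> (LINT s|M. w s) * (LINT s|M. z s ^ 2 / w s)"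
proof -
  let ?A = "LINT s|M. w s" and ?V = "LINT s|M. \<bar>z s\<bar>" and ?B = "LINT s|M. z s ^ 2 / w s"
  define c where "c = ?V / ?A"
  have "0 \<le> (LINT s|M. z s ^ 2 / w s - 2 * c * \<bar>z s\<bar> + c\<^sup>2 * w s)"
  proof (rule Bochner_Integration.integral_nonneg)
    fix s
    show "0 \<le> z s ^ 2 / w s - 2 * c * \<bar>z s\<bar> + c\<^sup>2 * w s"
    proof (cases "w s = 0")
      case True
      then show ?thesis using van by simp
    next
      case False
      then have "0 < w s" using nn[of s] by simp
      then have "z s ^ 2 / w s - 2 * c * \<bar>z s\<bar> + c\<^sup>2 * w s = (\<bar>z s\<bar> - c * w s)\<^sup>2 / w s"
        by (simp add: field_simps power2_eq_square)
      then show ?thesis using \<open>0 < w s\<close> by simp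
    qed
  qed
  also have "\<dots> = ?B - 2 * c * ?V + c\<^sup>2 * ?A" using w z zz by simp
  finally have "0 \<le> ?B - 2 * c * ?V + c\<^sup>2 * ?A" .
  then have "0 \<le> ?A * (?B - 2 * c * ?V + c\<^sup>2 * ?A)" using wpos by simp
  also have "\<dots> = ?A * ?B - ?V\<^sup>2" using wpos by (simp add: c_def field_simps power2_eq_square)
  finally show ?thesis by simp
qed

lemma sum_reindex_from_2: "(\<Sum>j = 2..Suc m. F j) = (\<Sum>j<m. F (Suc (Suc j)) :: real)"
  by (rule sum.reindex_bij_witness[of _ "\<lambda>j. Suc (Suc j)" "\<lambda>j. j - 2"]) (auto intro!: arg_cong[of _ _ F])

subsection \<open>Reduction to the modes\<close>

text \<open>Membership of the solution in a closed subspace is given for almost every time, whereas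
  the error lives at grid points. Continuity closes the gap.\<close>

lemma closed_AE_continuous:
  fixes v :: "real \<Rightarrow> 'b::metric_space"
  assumes v: "continuous_on {0..T} v" and X: "closed X" and AE: "AE t in lebesgue_on {0<..<T}. v t \<in> X"
    and t: "t \<in> {0..T}" and T: "0 < T"
  shows "v t \<in> X"
proof -
  have "v t \<in> closure X" unfolding closure_approachable
  proof (intro allI impI)
    fix e :: real assume "0 < e"
    then obtain d where d: "0 < d" "\<And>s. s \<in> {0..T} \<Longrightarrow> dist s t < d \<Longrightarrow> dist (v s) (v t) < e"
      using v t unfolding continuous_on_iff by blast
    define a where "a = max 0 (t - d)"
    define b where "b = min T (t + d)"
    have "0 \<le> a" "a < b" "b \<le> T" using t d(1) T by (auto simp: a_def b_def)
    from AE_interval_ex[OF AE this] obtain s where s: "s \<in> {a<..<b}" "v s \<in> X" by blast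
    then have "dist (v s) (v t) < e" by (intro d(2)) (auto simp: a_def b_def dist_real_def)
    then show "\<exists>y\<in>X. dist y (v t) < e" using s by blast
  qed
  then show ?thesis using X by simp
qed

section \<open>The solution and its data as Borel functions\<close>

locale diffusion_wave = variable_order T L \<alpha> \<alpha>1 \<alpha>2 \<alpha>3 + eigensystem \<Omega> lam \<phi>
  for T L :: real and \<alpha> \<alpha>1 \<alpha>2 \<alpha>3 :: "real \<Rightarrow> real"
    and \<Omega> :: "'a::euclidean_space set" and lam :: "nat \<Rightarrow> real" and \<phi> :: "nat \<Rightarrow> 'a L2" +
  fixes \<kappa> p Q0 :: real and f :: "real \<Rightarrow> 'a L2" and u0 ubar0 :: "'a L2" and du :: "nat \<Rightarrow> real \<Rightarrow> 'a L2"
  assumes \<kappa>: "0 < \<kappa>" and ubar0: "ubar0 \<in> Hcheck \<Omega> lam \<phi> 2"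
    and fW: "\<exists>df. df 0 = f \<and> bochner_sobolev 1 1 T \<Omega> df"
    and sol: "diffusion_wave_solution \<Omega> lam \<phi> T \<kappa> \<alpha> p f u0 ubar0 du"
    and der: "\<forall>j<3. \<forall>t\<in>{0<..T}. (du j has_vector_derivative du (Suc j) t) (at t within {0..T})"
    and reg: "\<forall>n\<in>{1, 2::nat}. \<forall>m\<in>{0, 1::nat}. \<forall>t\<in>{0<..T}.
           du (n + 1) t \<in> Hcheck \<Omega> lam \<phi> (2 * real m) \<and>
           Hcheck_norm lam \<phi> (2 * real m) (du (n + 1) t) \<le> Q0 * t powr (\<alpha> 0 - real (n + 1))"
begin

lemma du_continuous: "continuous_on {0..T} (du 0)" "continuous_on {0..T} (du 1)"
  and du_initial: "du 0 0 = u0" "du 1 0 = ubar0"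
  using sol by (auto simp: diffusion_wave_solution_def)

text \<open>The bound with the factor \<open>lam i\<close> comes from the stronger norm and will
  absorb the linear growth of the truncation error in \<mu>.\<close>

lemma du2_regularity:
  assumes t: "0 < t" "t \<le> T"
  shows "du 2 t \<in> L2_on \<Omega>" "(\<Sum>i<M. (du 2 t \<bullet> \<phi> i)\<^sup>2) \<le> (Q0 * t powr (\<alpha> 0 - 2))\<^sup>2"
    "(\<Sum>i<M. (lam i * (du 2 t \<bullet> \<phi> i))\<^sup>2) \<le> (Q0 * t powr (\<alpha> 0 - 2))\<^sup>2"
proof -
  have r0: "du 2 t \<in> Hcheck \<Omega> lam \<phi> 0" "Hcheck_norm lam \<phi> 0 (du 2 t) \<le> Q0 * t powr (\<alpha> 0 - 2)"
    using reg[THEN bspec, of 1, THEN bspec, of 0, THEN bspec, of t] t by (simp_all add: numeral_2_eq_2)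
  have r1: "du 2 t \<in> Hcheck \<Omega> lam \<phi> 2" "Hcheck_norm lam \<phi> 2 (du 2 t) \<le> Q0 * t powr (\<alpha> 0 - 2)"
    using reg[THEN bspec, of 1, THEN bspec, of 1, THEN bspec, of t] t by (simp_all add: numeral_2_eq_2)
  show "du 2 t \<in> L2_on \<Omega>" using r0(1) by (simp add: Hcheck_def)
  have "lam i \<noteq> 0" for i using lam_pos[of i] by simp
  then show "(\<Sum>i<M. (du 2 t \<bullet> \<phi> i)\<^sup>2) \<le> (Q0 * t powr (\<alpha> 0 - 2))\<^sup>2"
    using Hcheck_norm_partial_sum[OF r0, of M] by simp
  have "lam i powr 2 = (lam i)\<^sup>2" for i using lam_pos[of i] by (simp add: powr_numeral)
  then show "(\<Sum>i<M. (lam i * (du 2 t \<bullet> \<phi> i))\<^sup>2) \<le> (Q0 * t powr (\<alpha> 0 - 2))\<^sup>2"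
    using Hcheck_norm_partial_sum[OF r1, of M] by (simp add: power_mult_distrib)
qed

lemma Q0_nonneg: "0 \<le> Q0"
proof -
  have "Hcheck_norm lam \<phi> 0 (du 2 T) \<le> Q0 * T powr (\<alpha> 0 - 2)"
    using reg[THEN bspec, of 1, THEN bspec, of 0, THEN bspec, of T] T by (simp add: numeral_2_eq_2)
  moreover have "0 \<le> Hcheck_norm lam \<phi> 0 (du 2 T)"
  proof -
    have "du 2 T \<in> Hcheck \<Omega> lam \<phi> 0"
      using reg[THEN bspec, of 1, THEN bspec, of 0, THEN bspec, of T] T by (simp add: numeral_2_eq_2)
    then show ?thesis by (auto simp: Hcheck_norm_def Hcheck_def intro!: real_sqrt_ge_zero suminf_nonneg)
  qed
  ultimately have "0 \<le> Q0 * T powr (\<alpha> 0 - 2)" by linarith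
  then show ?thesis using T by (simp add: zero_le_mult_iff)
qed

lemma du2_norm:
  assumes t: "0 < t" "t \<le> T"
  shows "norm (du 2 t) \<le> Q0 * t powr (\<alpha> 0 - 2)"
  by (rule norm_le_partial_sums[OF du2_regularity(1)[OF t] _ du2_regularity(2)[OF t]]) (simp add: Q0_nonneg)

text \<open>On the open interval \<open>du 2\<close> is differentiable, hence continuous, so the
  cut-off is Borel measurable; the uncontrolled value at 0 is discarded.\<close>

definition d2u_cut :: "real \<Rightarrow> 'a L2" where "d2u_cut s = indicator {0<..<T} s *\<^sub>R du 2 s"

lemma d2u_cut_measurable [measurable]: "d2u_cut \<in> borel_measurable borel"
proof -
  have "continuous (at t within {0<..<T}) (du 2)" if "t \<in> {0<..<T}" for t
  proof -
    have "(du 2 has_vector_derivative du (Suc 2) t) (at t within {0..T})" using der[rule_format, of 2 t] that by simp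
    then have "continuous (at t within {0..T}) (du 2)" by (rule has_vector_derivative_continuous)
    then show ?thesis by (rule continuous_within_subset) auto
  qed
  then have "continuous_on {0<..<T} (du 2)" by (simp add: continuous_on_eq_continuous_within)
  then show ?thesis unfolding d2u_cut_def[abs_def] by (intro borel_measurable_continuous_on_indicator) auto
qed

lemma d2u_cut_norm: "norm (d2u_cut s) \<le> Q0 * (indicator {0..T} s * s powr (\<alpha> 0 - 2))"
  using du2_norm[of s] Q0_nonneg by (auto simp: d2u_cut_def indicator_def)

lemma weight_integrable: "integrable lborel (\<lambda>s. indicator {0..T} s * s powr (\<alpha> 0 - 2))"
  using \<alpha>0 T by (intro powr_lborel) auto

lemma d2u_cut_integrable: "integrable lborel d2u_cut"
proof (rule Bochner_Integration.integrable_bound)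
  show "integrable lborel (\<lambda>s. Q0 * (indicator {0..T} s * s powr (\<alpha> 0 - 2)))"
    by (intro integrable_mult_right weight_integrable)
  show "AE s in lborel. norm (d2u_cut s) \<le> norm (Q0 * (indicator {0..T} s * s powr (\<alpha> 0 - 2)))"
    unfolding real_norm_def by (intro AE_I2 order_trans[OF d2u_cut_norm abs_ge_self])
qed simp

text \<open>A Borel measurable representative of \<open>f\<close>, built from representatives of its coefficients.\<close>

lemma f_representative:
  "\<exists>f_borel. integrable lborel f_borel \<and> (\<forall>s. s \<notin> {0<..<T} \<longrightarrow> f_borel s = 0) \<and> (AE s in lebesgue. s \<in> {0<..<T} \<longrightarrow> f_borel s = f s)
     \<and> (\<lambda>s. indicator {0<..<T} s *\<^sub>R f s) \<in> borel_measurable lebesgue"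
proof -
  obtain df where df: "df 0 = f" "bochner_sobolev 1 1 T \<Omega> df" using fW by blast
  then have fLp: "f \<in> bochner_Lp 1 T (L2_on \<Omega>) norm" by (auto simp: bochner_sobolev_def)
  define F where "F s = indicator {0<..<T} s *\<^sub>R f s" for s
  have Fm: "F \<in> borel_measurable lebesgue"
    using fLp unfolding bochner_Lp_def F_def[abs_def] by (auto simp: borel_measurable_restrict_space_iff mult.commute)
  have "AE s in lebesgue. s \<in> {0<..<T} \<longrightarrow> f s \<in> L2_on \<Omega>"
    using fLp unfolding bochner_Lp_def by (auto simp: AE_restrict_space_iff)
  then have FL: "AE s in lebesgue. F s \<in> L2_on \<Omega>"
    by eventually_elim (auto simp: F_def indicator_def subspace_0[OF L2_on_subspace])
  have Fn: "integrable lebesgue (\<lambda>s. norm (F s))"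
  proof -
    have "integrable (lebesgue_on {0<..<T}) (\<lambda>s. norm (f s))"
      using fLp unfolding bochner_Lp_def by simp
    then have "integrable lebesgue (\<lambda>s. indicator {0<..<T} s *\<^sub>R norm (f s))" by (simp add: integrable_restrict_space)
    moreover have "(\<lambda>s. indicator {0<..<T} s *\<^sub>R norm (f s)) = (\<lambda>s. norm (F s))"
      by (auto simp: F_def fun_eq_iff)
    ultimately show ?thesis by simp
  qed
  have "\<exists>c. c \<in> borel_measurable lborel \<and> (AE s in lborel. F s \<bullet> \<phi> i = c s)" for i
  proof -
    have "(\<lambda>s. F s \<bullet> \<phi> i) \<in> borel_measurable (completion lborel)" using Fm by (intro borel_measurable_inner) auto
    then show ?thesis using completion_ex_borel_measurable_real by blast
  qed
  then obtain c where c: "\<And>i. c i \<in> borel_measurable lborel" "\<And>i. AE s in lborel. F s \<bullet> \<phi> i = c i s" by metis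
  define f_borel where "f_borel s = indicator {0<..<T} s *\<^sub>R lim (\<lambda>M. \<Sum>i<M. c i s *\<^sub>R \<phi> i)" for s
  have [measurable]: "c i \<in> borel_measurable borel" for i using c(1)[of i] by simp
  have fBm: "f_borel \<in> borel_measurable borel"
    unfolding f_borel_def[abs_def] by (intro borel_measurable_scaleR borel_measurable_lim_metric) measurable
  have "AE s in lebesgue. \<forall>i. F s \<bullet> \<phi> i = c i s"
    using c(2) by (intro AE_all_countable[THEN iffD2] allI AE_completion) auto
  with FL have eq: "AE s in lebesgue. f_borel s = F s"
  proof eventually_elim
    case (elim s)
    have "(\<lambda>M. \<Sum>i<M. c i s *\<^sub>R \<phi> i) \<longlonglongrightarrow> F s"
      using eigen_sum_tendsto[OF elim(1)] elim(2) by (simp add: eigen_sum_def[abs_def])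
    then have "lim (\<lambda>M. \<Sum>i<M. c i s *\<^sub>R \<phi> i) = F s" by (rule limI)
    then show ?case by (cases "s \<in> {0<..<T}") (simp_all add: f_borel_def F_def)
  qed
  have "integrable lebesgue f_borel"
  proof (rule Bochner_Integration.integrable_bound[OF Fn])
    show "f_borel \<in> borel_measurable lebesgue" using fBm by (simp add: measurable_completion)
    show "AE s in lebesgue. norm (f_borel s) \<le> norm (norm (F s))" using eq by eventually_elim simp
  qed
  then have "integrable lborel f_borel" using fBm by (simp add: integrable_completion)
  moreover have "AE s in lebesgue. s \<in> {0<..<T} \<longrightarrow> f_borel s = f s" using eq by eventually_elim (simp add: F_def)
  ultimately show ?thesis using Fm unfolding F_def[abs_def] by (intro exI[of _ f_borel]) (auto simp: f_borel_def)
qed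

definition f_borel :: "real \<Rightarrow> 'a L2" where
  "f_borel = (SOME f_borel. integrable lborel f_borel \<and> (\<forall>s. s \<notin> {0<..<T} \<longrightarrow> f_borel s = 0) \<and> (AE s in lebesgue. s \<in> {0<..<T} \<longrightarrow> f_borel s = f s)
     \<and> (\<lambda>s. indicator {0<..<T} s *\<^sub>R f s) \<in> borel_measurable lebesgue)"

lemma f_borel: "integrable lborel f_borel" "s \<notin> {0<..<T} \<Longrightarrow> f_borel s = 0" "AE s in lebesgue. s \<in> {0<..<T} \<longrightarrow> f_borel s = f s"
  "(\<lambda>s. indicator {0<..<T} s *\<^sub>R f s) \<in> borel_measurable lebesgue"
  using someI_ex[OF f_representative, folded f_borel_def] by blast+

lemma f_borel_measurable [measurable]: "f_borel \<in> borel_measurable borel"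
  using borel_measurable_integrable[OF f_borel(1)] by simp

text \<open>Passes from the integrals of the problem, with Lebesgue measurable representatives, to
  convolutions of Borel functions. The points 0 and \<open>t\<close>, where the integrands may
  differ, form a null set.\<close>

lemma lebesgue_on_convolution:
  fixes v V :: "real \<Rightarrow> 'a L2" and a A :: "real \<Rightarrow> real"
  assumes t: "0 \<le> t" "t \<le> T"
    and a: "\<And>s. 0 < s \<Longrightarrow> s \<le> T \<Longrightarrow> A s = a s" "\<And>s. s < 0 \<Longrightarrow> A s = 0" "A \<in> borel_measurable borel"
    and V: "V \<in> borel_measurable borel" "\<And>s. s \<notin> {0<..<T} \<Longrightarrow> V s = 0" "AE s in lebesgue. s \<in> {0<..<T} \<longrightarrow> V s = v s"
    and v: "(\<lambda>s. indicator {0<..<T} s *\<^sub>R v s) \<in> borel_measurable lebesgue"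
  shows "(LINT s|lebesgue_on {0..t}. a (t - s) *\<^sub>R v s) = conv A V t"
proof -
  note [measurable] = a(3) V(1)
  have m: "A \<in> borel_measurable lebesgue" "(\<lambda>s. A (t - s)) \<in> borel_measurable lebesgue" "V \<in> borel_measurable lebesgue"
  proof -
    have "(\<lambda>s. A (t - s)) \<in> borel_measurable borel" using a(3) by measurable
    then show "A \<in> borel_measurable lebesgue" "(\<lambda>s. A (t - s)) \<in> borel_measurable lebesgue" "V \<in> borel_measurable lebesgue"
      using a(3) V(1) by (simp_all add: measurable_completion)
  qed
  have "(LINT s|lebesgue_on {0..t}. a (t - s) *\<^sub>R v s) = (LINT s|lebesgue. indicator {0..t} s *\<^sub>R (a (t - s) *\<^sub>R v s))"
    by (simp add: integral_restrict_space)
  also have "\<dots> = (LINT s|lebesgue. A (t - s) *\<^sub>R (indicator {0<..<T} s *\<^sub>R v s))"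
  proof (rule integral_discrete_difference[where X = "{0, t}"])
    fix s assume s: "s \<notin> {0, t}"
    show "indicator {0..t} s *\<^sub>R (a (t - s) *\<^sub>R v s) = A (t - s) *\<^sub>R (indicator {0<..<T} s *\<^sub>R v s)"
    proof (cases "0 < s \<and> s < t")
      case True
      then show ?thesis using a(1)[of "t - s"] t by (simp add: indicator_def)
    next
      case False
      then have "s < 0 \<or> t < s" using s by auto
      then show ?thesis using a(2)[of "t - s"] by (auto simp: indicator_def)
    qed
  qed auto
  also have "\<dots> = (LINT s|lebesgue. A (t - s) *\<^sub>R V s)"
  proof (rule integral_cong_AE)
    show "AE s in lebesgue. A (t - s) *\<^sub>R (indicator {0<..<T} s *\<^sub>R v s) = A (t - s) *\<^sub>R V s"
      using V(3) by eventually_elim (use V(2) in \<open>auto simp: indicator_def\<close>)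
  qed (intro borel_measurable_scaleR m v)+
  also have "\<dots> = conv A V t"
    unfolding conv_def by (intro integral_completion) measurable
  finally show ?thesis .
qed

lemma fbar_eq:
  assumes t: "0 \<le> t" "t \<le> T"
  shows "fbar \<alpha> f ubar0 t = conv beta_cut f_borel t + g_cut t *\<^sub>R ubar0"
proof -
  have "(LINT s|lebesgue_on {0..t}. beta_kernel (\<alpha> 0 - 1) (t - s) *\<^sub>R f s) = conv beta_cut f_borel t"
    by (rule lebesgue_on_convolution[OF t beta_cut_eq kernel_vanishes(1) _ _ f_borel(2) f_borel(3) f_borel(4)]) auto
  then show ?thesis using t by (simp add: fbar_def g_cut_def)
qed

lemma k_convolution:
  assumes t: "0 \<le> t" "t \<le> T"
  shows "(LINT s|lebesgue_on {0..t}. k_kernel \<alpha> (t - s) *\<^sub>R du 2 s) = conv k_cut d2u_cut t"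
proof (rule lebesgue_on_convolution[OF t k_cut_eq kernel_vanishes(2) kernels_measurable(2) d2u_cut_measurable])
  have "d2u_cut \<in> borel_measurable lebesgue" by (simp add: measurable_completion)
  then show "(\<lambda>s. indicator {0<..<T} s *\<^sub>R du 2 s) \<in> borel_measurable lebesgue" unfolding d2u_cut_def[abs_def] .
qed (auto simp: d2u_cut_def)

end

section \<open>The scalar problem of one mode\<close>

context diffusion_wave
begin

definition comp_d2u :: "nat \<Rightarrow> real \<Rightarrow> real" where "comp_d2u i s = d2u_cut s \<bullet> \<phi> i"
definition comp_u :: "nat \<Rightarrow> real \<Rightarrow> real" where "comp_u i s = du 0 s \<bullet> \<phi> i"
definition comp_du :: "nat \<Rightarrow> real \<Rightarrow> real" where "comp_du i s = du 1 s \<bullet> \<phi> i"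
definition comp_f :: "nat \<Rightarrow> real \<Rightarrow> real" where "comp_f i s = f_borel s \<bullet> \<phi> i"

lemma comp_d2u_integrable: "integrable lborel (comp_d2u i)" and comp_d2u_0: "s \<notin> {0<..<T} \<Longrightarrow> comp_d2u i s = 0"
  and comp_f_integrable: "integrable lborel (comp_f i)" and comp_f_0: "s \<notin> {0<..<T} \<Longrightarrow> comp_f i s = 0"
proof -
  show "integrable lborel (comp_d2u i)" unfolding comp_d2u_def[abs_def] by (intro integrable_inner_left d2u_cut_integrable)
  show "integrable lborel (comp_f i)" unfolding comp_f_def[abs_def] by (intro integrable_inner_left f_borel)
qed (auto simp: comp_d2u_def d2u_cut_def comp_f_def f_borel)

lemma comp_u_continuous: "continuous_on {0..T} (comp_u i)" "continuous_on {0..T} (comp_du i)"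
  unfolding comp_u_def comp_du_def by (intro continuous_intros du_continuous)+

lemma component_derivs:
  assumes t: "0 < t" "t < T"
  shows "(comp_u i has_real_derivative comp_du i t) (at t)" "(comp_du i has_real_derivative comp_d2u i t) (at t)"
proof -
  have d: "((\<lambda>t. du j t \<bullet> \<phi> i) has_real_derivative du (Suc j) t \<bullet> \<phi> i) (at t)" if "j < 3" for j
  proof -
    have "(du j has_vector_derivative du (Suc j) t) (at t within {0..T})" using der that t by auto
    then have "(du j has_vector_derivative du (Suc j) t) (at t)" using t by (simp add: at_within_Icc_at)
    then have "((\<lambda>t. du j t \<bullet> \<phi> i) has_vector_derivative du (Suc j) t \<bullet> \<phi> i) (at t)"
      by (rule bounded_linear.has_vector_derivative[OF bounded_linear_inner_left])
    then show ?thesis by (simp add: has_real_derivative_iff_has_vector_derivative)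
  qed
  show "(comp_u i has_real_derivative comp_du i t) (at t)" using d[of 0] by (simp add: comp_u_def[abs_def] comp_du_def)
  have "comp_d2u i t = du (Suc 1) t \<bullet> \<phi> i" using t by (simp add: comp_d2u_def d2u_cut_def numeral_2_eq_2)
  then show "(comp_du i has_real_derivative comp_d2u i t) (at t)" using d[of 1] by (simp add: comp_du_def[abs_def])
qed

lemma comp_d2u_antiderivative:
  assumes s: "s \<in> {0..T}"
  shows "conv one_cut (comp_d2u i) s = comp_du i s - comp_du i 0"
proof -
  have "(comp_d2u i has_integral (comp_du i s - comp_du i 0)) {0..s}"
  proof (rule fundamental_theorem_of_calculus_interior)
    show "continuous_on {0..s} (comp_du i)" using s by (intro continuous_on_subset[OF comp_u_continuous(2)]) auto
    show "(comp_du i has_vector_derivative comp_d2u i x) (at x)" if "x \<in> {0<..<s}" for x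
      using component_derivs(2)[of x i] that s by (simp add: has_real_derivative_iff_has_vector_derivative)
  qed (use s in simp)
  then have "integral {0..s} (comp_d2u i) = comp_du i s - comp_du i 0" by (rule integral_unique)
  moreover have "set_integrable lborel {0..s} (comp_d2u i)"
    unfolding set_integrable_def by (intro integrable_mult_indicator comp_d2u_integrable) auto
  then have "(LINT x:{0..s}|lborel. comp_d2u i x) = integral {0..s} (comp_d2u i)" by (rule set_borel_integral_eq_integral(2))
  moreover have "conv one_cut (comp_d2u i) s = (LINT x:{0..s}|lborel. comp_d2u i x)"
    unfolding set_lebesgue_integral_def using s by (intro conv_oneK) (auto simp: comp_d2u_0)
  ultimately show ?thesis by simp
qed

text \<open>Differentiability is assumed only for positive times. At 0 it is recovered by writing
  the component as the integral of its continuous derivative.\<close>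

lemma comp_u_derivative:
  assumes s: "s \<in> {0..T}"
  shows "(comp_u i has_real_derivative comp_du i s) (at s within {0..T})"
proof -
  have eq: "comp_u i t = comp_u i 0 + integral {0..t} (comp_du i)" if t: "t \<in> {0..T}" for t
  proof -
    have "(comp_du i has_integral (comp_u i t - comp_u i 0)) {0..t}"
    proof (rule fundamental_theorem_of_calculus_interior)
      show "continuous_on {0..t} (comp_u i)" using t by (intro continuous_on_subset[OF comp_u_continuous(1)]) auto
      show "(comp_u i has_vector_derivative comp_du i x) (at x)" if "x \<in> {0<..<t}" for x
        using component_derivs(1)[of x i] that t by (simp add: has_real_derivative_iff_has_vector_derivative)
    qed (use t in simp)
    then show ?thesis by (simp add: integral_unique)
  qed
  have "((\<lambda>t. integral {0..t} (comp_du i)) has_real_derivative comp_du i s) (at s within {0..T})"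
    by (rule integral_has_real_derivative[OF comp_u_continuous(2) s])
  then have "((\<lambda>t. comp_u i 0 + integral {0..t} (comp_du i)) has_real_derivative comp_du i s) (at s within {0..T})"
    by (auto intro!: derivative_eq_intros)
  then show ?thesis
    by (rule has_field_derivative_transform_within[OF _ zero_less_one s]) (rule eq[symmetric])
qed

text \<open>The variation of \<open>comp_du i\<close> on the interval from 0 to \<open>s\<close>, to
  be used as \<open>V\<close> in the truncation estimates.\<close>

definition comp_variation :: "nat \<Rightarrow> real \<Rightarrow> real" where
  "comp_variation i s = (LINT x|lborel. indicator {0..s} x * \<bar>comp_d2u i x\<bar>)"

lemma comp_variation_bound:
  assumes rs: "0 \<le> r" "r \<le> s" "s \<le> T"
  shows "\<bar>comp_du i s - comp_du i r\<bar> \<le> comp_variation i s - comp_variation i r"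
proof -
  have i1: "integrable lborel (\<lambda>x. indicator {0..u} x * comp_d2u i x)" for u
    using integrable_mult_indicator[of "{0..u}" lborel "comp_d2u i"] comp_d2u_integrable by simp
  have i2: "integrable lborel (\<lambda>x. indicator {0..u} x * \<bar>comp_d2u i x\<bar>)" for u
    using integrable_mult_indicator[of "{0..u}" lborel "\<lambda>x. \<bar>comp_d2u i x\<bar>"] integrable_abs[OF comp_d2u_integrable] by simp
  have y: "comp_du i u - comp_du i 0 = (LINT x|lborel. indicator {0..u} x * comp_d2u i x)" if "u \<in> {0..T}" for u
  proof -
    have "conv one_cut (comp_d2u i) u = (LINT x|lborel. indicator {0..u} x *\<^sub>R comp_d2u i x)"
      using that by (intro conv_oneK) (auto simp: comp_d2u_0)
    then show ?thesis unfolding comp_d2u_antiderivative[OF that] real_scaleR_def .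
  qed
  have e: "comp_du i s - comp_du i r = (LINT x|lborel. indicator {0..s} x * comp_d2u i x - indicator {0..r} x * comp_d2u i x)"
  proof -
    have m: "s \<in> {0..T}" "r \<in> {0..T}" using rs by auto
    show ?thesis unfolding Bochner_Integration.integral_diff[OF i1 i1] y[OF m(1), symmetric] y[OF m(2), symmetric] by simp
  qed
  have "\<bar>comp_du i s - comp_du i r\<bar> \<le> (LINT x|lborel. \<bar>indicator {0..s} x * comp_d2u i x - indicator {0..r} x * comp_d2u i x\<bar>)"
    unfolding e by (rule integral_abs_bound)
  also have "\<dots> = (LINT x|lborel. indicator {0..s} x * \<bar>comp_d2u i x\<bar> - indicator {0..r} x * \<bar>comp_d2u i x\<bar>)"
  proof (rule Bochner_Integration.integral_cong[OF refl])
    fix x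
    have "x \<in> {0..r} \<Longrightarrow> x \<in> {0..s}" using rs by simp
    then show "\<bar>indicator {0..s} x * comp_d2u i x - indicator {0..r} x * comp_d2u i x\<bar> = indicator {0..s} x * \<bar>comp_d2u i x\<bar> - indicator {0..r} x * \<bar>comp_d2u i x\<bar>"
      by (cases "x \<in> {0..r}"; cases "x \<in> {0..s}") (simp_all only: indicator_simps, simp_all)
  qed
  also have "\<dots> = comp_variation i s - comp_variation i r" unfolding comp_variation_def by (rule Bochner_Integration.integral_diff[OF i2 i2])
  finally show ?thesis .
qed

lemma comp_variation_0: "comp_variation i 0 = 0"
proof -
  have "comp_variation i 0 = (LINT (x::real)|lborel. 0 :: real)"
    unfolding comp_variation_def
  proof (rule Bochner_Integration.integral_cong[OF refl])
    show "indicator {0..0} x * \<bar>comp_d2u i x\<bar> = 0" for x :: real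
      by (cases "x = 0") (simp_all add: comp_d2u_0)
  qed
  then show ?thesis by simp
qed

lemma comp_variation_T: "comp_variation i T = (LINT x|lborel. \<bar>comp_d2u i x\<bar>)"
  unfolding comp_variation_def
proof (rule Bochner_Integration.integral_cong[OF refl])
  show "indicator {0..T} x * \<bar>comp_d2u i x\<bar> = \<bar>comp_d2u i x\<bar>" for x
    by (cases "x \<in> {0<..<T}") (auto simp: comp_d2u_0)
qed

lemma component_equation:
  "AE s in lborel. 0 < s \<and> s < T \<longrightarrow> conv k_cut (comp_d2u i) s + (\<kappa> * lam i) * comp_u i s = comp_f i s"
proof -
  have "AE t in lebesgue_on {0<..<T}. du 0 t \<in> Hcheck \<Omega> lam \<phi> 2"
    using sol by (auto simp: diffusion_wave_solution_def bochner_Lp_def)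
  moreover have "AE t in lebesgue_on {0<..<T}.
        (LINT s|lebesgue_on {0..t}. k_kernel \<alpha> (t - s) *\<^sub>R du 2 s) - \<kappa> *\<^sub>R dirichlet_laplacian \<Omega> (du 0 t) = f t"
    using sol by (auto simp: diffusion_wave_solution_def)
  ultimately have "AE t in lebesgue. t \<in> {0<..<T} \<longrightarrow> du 0 t \<in> Hcheck \<Omega> lam \<phi> 2"
    "AE t in lebesgue. t \<in> {0<..<T} \<longrightarrow>
        (LINT s|lebesgue_on {0..t}. k_kernel \<alpha> (t - s) *\<^sub>R du 2 s) - \<kappa> *\<^sub>R dirichlet_laplacian \<Omega> (du 0 t) = f t"
    by (simp_all add: AE_restrict_space_iff)
  moreover have "AE t in lebesgue. integrable lborel (\<lambda>r. k_cut (t - r) *\<^sub>R d2u_cut r)"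
    using conv_integrable(2)[OF k_cut_integrable d2u_cut_integrable] by (rule AE_completion)
  ultimately have "AE s in lebesgue. 0 < s \<and> s < T \<longrightarrow> conv k_cut (comp_d2u i) s + (\<kappa> * lam i) * comp_u i s = comp_f i s"
    using f_borel(3)
  proof eventually_elim
    case (elim s)
    show ?case
    proof
      assume s: "0 < s \<and> s < T"
      have "(conv k_cut d2u_cut s - \<kappa> *\<^sub>R dirichlet_laplacian \<Omega> (du 0 s)) \<bullet> \<phi> i = f_borel s \<bullet> \<phi> i"
        using elim s k_convolution[of s] by simp
      moreover have "conv k_cut d2u_cut s \<bullet> \<phi> i = conv k_cut (comp_d2u i) s"
        using conv_inner[OF elim(3)] by (simp add: comp_d2u_def[abs_def])
      moreover have "dirichlet_laplacian \<Omega> (du 0 s) \<bullet> \<phi> i = - (lam i * comp_u i s)"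
        using elim s Hcheck2_coefficient by (simp add: comp_u_def)
      ultimately show "conv k_cut (comp_d2u i) s + (\<kappa> * lam i) * comp_u i s = comp_f i s"
        by (simp add: inner_diff_left comp_f_def)
    qed
  qed
  then show ?thesis by (simp add: AE_completion_iff)
qed

text \<open>The time integral of a coefficient of \<open>fbar\<close>; the averages in the scheme
  are its increments divided by the step.\<close>

definition comp_rhs :: "nat \<Rightarrow> real \<Rightarrow> real" where
  "comp_rhs i t = (LINT s|lborel. indicator {0..t} s * (conv beta_cut (comp_f i) s + g_cut s * comp_du i 0))"

lemma component_exact:
  assumes t: "0 \<le> t" "t \<le> T"
  shows "integral {0..t} (\<lambda>s. g_kernel \<alpha> (t - s) * comp_du i s) + (\<kappa> * lam i) * integral {0..t} (\<lambda>s. gamma_kernel (t - s) * comp_u i s) = comp_rhs i t"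
  unfolding comp_rhs_def
  by (rule integrated_equation[OF comp_d2u_integrable comp_d2u_0 comp_f_integrable comp_f_0 comp_u_continuous comp_d2u_antiderivative component_equation t]) auto

lemma g_cut_integrable: "integrable lborel g_cut"
  using indicator_continuous_bounded(3)[OF g_kernel_continuous] by (simp add: g_cut_def[abs_def])

lemma Fbar_component:
  assumes \<tau>: "0 < \<tau>" and n: "real (Suc n) * \<tau> \<le> T"
  shows "\<tau> * (Fbar \<alpha> f ubar0 \<tau> (Suc n) \<bullet> \<phi> i) = comp_rhs i (real (Suc n) * \<tau>) - comp_rhs i (real n * \<tau>)"
proof -
  let ?a = "real n * \<tau>" and ?b = "real (Suc n) * \<tau>"
  have ab: "0 \<le> ?a" "?a \<le> ?b" using \<tau> by (auto intro!: mult_right_mono)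
  define H where "H t = conv beta_cut f_borel t + g_cut t *\<^sub>R ubar0" for t
  have HI: "integrable lborel H" unfolding H_def[abs_def]
    by (intro Bochner_Integration.integrable_add conv_integrable(1)[OF beta_cut_integrable f_borel(1)] integrable_scaleR_left g_cut_integrable)
  have [measurable]: "H \<in> borel_measurable borel" using borel_measurable_integrable[OF HI] by simp
  define h where "h s = conv beta_cut (comp_f i) s + g_cut s * comp_du i 0" for s
  have hI: "integrable lborel h" unfolding h_def[abs_def]
    by (intro Bochner_Integration.integrable_add conv_integrable(1)[OF beta_cut_integrable comp_f_integrable] integrable_mult_left g_cut_integrable)
  have [measurable]: "h \<in> borel_measurable borel" using borel_measurable_integrable[OF hI] by simp
  have iI: "integrable lborel (\<lambda>s. indicator {0..u} s * h s)" for u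
    using integrable_mult_indicator[of "{0..u}" lborel h] hI by simp
  have "(LINT t|lebesgue_on {?a..?b}. fbar \<alpha> f ubar0 t) = (LINT t|lebesgue_on {?a..?b}. H t)"
    using ab n by (intro Bochner_Integration.integral_cong refl) (auto simp: H_def intro!: fbar_eq)
  also have "\<dots> = (LINT t|lborel. indicator {?a..?b} t *\<^sub>R H t)"
    by (rule lebesgue_on_lborel) auto
  finally have e: "(LINT t|lebesgue_on {?a..?b}. fbar \<alpha> f ubar0 t) = (LINT t|lborel. indicator {?a..?b} t *\<^sub>R H t)" .
  have "integrable lborel (\<lambda>t. indicator {?a..?b} t *\<^sub>R H t)" by (rule integrable_mult_indicator[OF _ HI]) simp
  then have "(LINT t|lebesgue_on {?a..?b}. fbar \<alpha> f ubar0 t) \<bullet> \<phi> i = (LINT t|lborel. (indicator {?a..?b} t *\<^sub>R H t) \<bullet> \<phi> i)"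
    unfolding e by (intro integral_inner_left[symmetric])
  also have "\<dots> = (LINT t|lborel. indicator {0..?b} t * h t - indicator {0..?a} t * h t)"
  proof (rule integral_cong_AE)
    \<comment> \<open>At \<open>?a\<close> the closed intervals overlap: the indicator on the left
      is 1, but the two on the right cancel.\<close>
    have "AE t in lborel. t \<noteq> ?a" by (rule AE_lborel_singleton)
    with conv_integrable(2)[OF beta_cut_integrable f_borel(1)]
    show "AE t in lborel. (indicator {?a..?b} t *\<^sub>R H t) \<bullet> \<phi> i = indicator {0..?b} t * h t - indicator {0..?a} t * h t"
    proof eventually_elim
      case (elim t)
      have "H t \<bullet> \<phi> i = h t"
        using conv_inner[OF elim(1), of "\<phi> i"] du_initial(2)
        by (simp add: H_def h_def inner_add_left comp_f_def[abs_def] comp_du_def)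
      then show ?case using elim(2) ab by (auto simp: indicator_def)
    qed
  qed measurable
  also have "\<dots> = comp_rhs i ?b - comp_rhs i ?a" unfolding comp_rhs_def h_def[symmetric] using iI by simp
  finally show ?thesis using \<tau> by (simp add: Fbar_def)
qed

text \<open>Equation \<open>Suc n\<close> of the scheme, tested with one eigenfunction and
  multiplied by the step, becomes increment \<open>n\<close> of the summed form.
  \<open>Yb 0 = Y 1\<close> reflects the first cell of the product rule.\<close>

lemma scheme_component:
  fixes N n i :: nat and U :: "nat \<Rightarrow> 'a L2"
  assumes N: "1 \<le> N" and U: "numerical_solution \<Omega> \<kappa> \<alpha> f u0 ubar0 (T / real N) N U" and n: "n < N"
  defines "\<tau> \<equiv> T / real N"
    and "Y \<equiv> \<lambda>j. U j \<bullet> \<phi> i"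
    and "gh \<equiv> \<lambda>k. (g_kernel \<alpha> (real k * (T / real N)) + g_kernel \<alpha> (real (Suc k) * (T / real N))) / 2"
  defines "Yb \<equiv> \<lambda>j. case j of 0 \<Rightarrow> Y 1 | Suc k \<Rightarrow> (Y (Suc (Suc k)) + Y (Suc k)) / 2"
  shows "gh 0 * (Y (Suc n) - Y n) + (\<Sum>j<n. (gh (n - j) - gh (n - Suc j)) * (Y (Suc j) - Y j))
        + (\<kappa> * lam i) * (\<tau> powr \<alpha> 0 / Gamma (\<alpha> 0 + 1)) * (\<Sum>j\<le>n. pi_weight (\<alpha> 0) (n - j) * Yb j)
     = comp_rhs i (real (Suc n) * \<tau>) - comp_rhs i (real n * \<tau>)"
proof -
  have \<tau>: "0 < \<tau>" using T N by (simp add: \<tau>_def)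
  have nT: "real (Suc n) * \<tau> \<le> T"
  proof -
    have "real (Suc n) * \<tau> \<le> real N * \<tau>" using n \<tau> by (intro mult_right_mono) auto
    also have "\<dots> = T" using N by (simp add: \<tau>_def)
    finally show ?thesis .
  qed
  define g where "g k = g_kernel \<alpha> (real k * \<tau>)" for k
  define w where "w k = g (Suc k) - g k" for k
  have w: "w_weight \<alpha> \<tau> k = w k" for k by (simp add: w_weight_def w_def g_def)
  have dom: "U j \<in> dirichlet_dom \<Omega>" if "1 \<le> j" "j \<le> N" for j using U that by (auto simp: numerical_solution_def)
  \<comment> \<open>The product rule begins with index 1 and averages from index 2 on, so all
    Laplacians that occur belong to \<open>U j\<close> with \<open>1 \<le> j\<close>.\<close>
  have Lap: "dirichlet_laplacian \<Omega> (U j) \<bullet> \<phi> i = - (lam i * Y j)" if "1 \<le> j" "j \<le> N" for j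
    unfolding Y_def by (rule dirichlet_laplacian_coefficient[OF dom[OF that]])
  have half: "half_avg v j \<bullet> \<phi> i = (v j \<bullet> \<phi> i + v (j - 1) \<bullet> \<phi> i) / 2" for v j
    by (simp add: half_avg_def inner_add_left)
  have eq: "delta_t \<tau> U (Suc n)
          + (1 / \<tau>) *\<^sub>R (w_weight \<alpha> \<tau> 0 *\<^sub>R half_avg U (Suc n)
              - (\<Sum>k = 1..n. (w_weight \<alpha> \<tau> (k - 1) - w_weight \<alpha> \<tau> k) *\<^sub>R half_avg U (Suc n - k))
              - w_weight \<alpha> \<tau> n *\<^sub>R U 0)
          - \<kappa> *\<^sub>R PI_rule (\<alpha> 0 - 1) \<tau> (Suc n) (\<lambda>j. dirichlet_laplacian \<Omega> (U j))
        = Fbar \<alpha> f ubar0 \<tau> (Suc n)"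
    using U n unfolding numerical_solution_def \<tau>_def[symmetric] by force
  define PI where "PI = omega_weight (\<alpha> 0 - 1) \<tau> (Suc n) 1 * Y 1
     + (\<Sum>j = 2..Suc n. omega_weight (\<alpha> 0 - 1) \<tau> (Suc n) j * ((Y j + Y (j - 1)) / 2))"
  have PI: "PI_rule (\<alpha> 0 - 1) \<tau> (Suc n) (\<lambda>j. dirichlet_laplacian \<Omega> (U j)) \<bullet> \<phi> i = - (lam i * PI)"
  proof -
    have "(\<Sum>j = 2..Suc n. omega_weight (\<alpha> 0 - 1) \<tau> (Suc n) j * (half_avg (\<lambda>j. dirichlet_laplacian \<Omega> (U j)) j \<bullet> \<phi> i))
        = (\<Sum>j = 2..Suc n. - lam i * (omega_weight (\<alpha> 0 - 1) \<tau> (Suc n) j * ((Y j + Y (j - 1)) / 2)))"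
    proof (intro sum.cong refl)
      fix j assume "j \<in> {2..Suc n}"
      then have "dirichlet_laplacian \<Omega> (U j) \<bullet> \<phi> i = - (lam i * Y j)" "dirichlet_laplacian \<Omega> (U (j - 1)) \<bullet> \<phi> i = - (lam i * Y (j - 1))"
        using n by (auto intro!: Lap)
      then show "omega_weight (\<alpha> 0 - 1) \<tau> (Suc n) j * (half_avg (\<lambda>j. dirichlet_laplacian \<Omega> (U j)) j \<bullet> \<phi> i)
         = - lam i * (omega_weight (\<alpha> 0 - 1) \<tau> (Suc n) j * ((Y j + Y (j - 1)) / 2))"
        unfolding half by (simp add: field_simps)
    qed
    then have hs: "(\<Sum>j = 2..Suc n. omega_weight (\<alpha> 0 - 1) \<tau> (Suc n) j * (half_avg (\<lambda>j. dirichlet_laplacian \<Omega> (U j)) j \<bullet> \<phi> i))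
        = - lam i * (\<Sum>j = 2..Suc n. omega_weight (\<alpha> 0 - 1) \<tau> (Suc n) j * ((Y j + Y (j - 1)) / 2))"
      by (simp only: sum_distrib_left)
    have L1: "dirichlet_laplacian \<Omega> (U 1) \<bullet> \<phi> i = - (lam i * Y 1)" using n by (intro Lap) auto
    have "o' * - (l * y) + - l * S = - (l * (o' * y + S))" for o' l y S :: real by (simp add: algebra_simps)
    then show ?thesis
      unfolding PI_rule_def PI_def inner_add_left inner_sum_left inner_scaleR_left hs L1 by (simp only:)
  qed
  have PIc: "\<tau> * PI = \<tau> powr \<alpha> 0 / Gamma (\<alpha> 0 + 1) * (\<Sum>j\<le>n. pi_weight (\<alpha> 0) (n - j) * Yb j)"
  proof -
    have om: "\<tau> * omega_weight (\<alpha> 0 - 1) \<tau> (Suc n) (Suc j) = \<tau> powr \<alpha> 0 / Gamma (\<alpha> 0 + 1) * pi_weight (\<alpha> 0) (n - j)" if "j \<le> n" for j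
      by (rule omega_weight_eq[OF \<alpha>0(1) \<tau> that])
    have "\<tau> * PI = (\<tau> * omega_weight (\<alpha> 0 - 1) \<tau> (Suc n) (Suc 0)) * Yb 0
        + (\<Sum>j<n. (\<tau> * omega_weight (\<alpha> 0 - 1) \<tau> (Suc n) (Suc (Suc j))) * Yb (Suc j))"
      unfolding PI_def sum_reindex_from_2 by (simp add: Yb_def distrib_left sum_distrib_left mult_ac)
    also have "\<dots> = (\<tau> powr \<alpha> 0 / Gamma (\<alpha> 0 + 1) * pi_weight (\<alpha> 0) (n - 0)) * Yb 0
        + (\<Sum>j<n. (\<tau> powr \<alpha> 0 / Gamma (\<alpha> 0 + 1) * pi_weight (\<alpha> 0) (n - Suc j)) * Yb (Suc j))"
      using om by (intro arg_cong2[where f = "(+)"] sum.cong refl) auto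
    also have "\<dots> = \<tau> powr \<alpha> 0 / Gamma (\<alpha> 0 + 1) * (\<Sum>j\<le>n. pi_weight (\<alpha> 0) (n - j) * Yb j)"
      by (simp add: sum.atMost_shift distrib_left sum_distrib_left mult_ac)
    finally show ?thesis .
  qed
  define b where "b = w 0 * ((Y (Suc n) + Y n) / 2)
      - (\<Sum>k = 1..n. (w (k - 1) - w k) * ((Y (Suc n - k) + Y (Suc n - k - 1)) / 2)) - w n * Y 0"
  have "Fbar \<alpha> f ubar0 \<tau> (Suc n) \<bullet> \<phi> i = 1 / \<tau> * (Y (Suc n) - Y n) + 1 / \<tau> * b - \<kappa> * - (lam i * PI)"
    unfolding eq[symmetric] w b_def delta_t_def inner_add_left inner_diff_left inner_sum_left inner_scaleR_left PI half Y_def diff_Suc_1 ..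
  moreover have "\<tau> * (1 / \<tau> * a' + 1 / \<tau> * b' - \<kappa> * - (l * P)) = a' + b' + (\<kappa> * l) * (\<tau> * P)" for a' b' l P
    using \<tau> by (simp add: field_simps)
  ultimately have e: "\<tau> * (Fbar \<alpha> f ubar0 \<tau> (Suc n) \<bullet> \<phi> i) = (Y (Suc n) - Y n) + b + (\<kappa> * lam i) * (\<tau> * PI)"
    by (simp only:)
  have ghg: "gh k = (g k + g (Suc k)) / 2" for k by (simp only: gh_def g_def \<tau>_def)
  have "g 0 = 1" by (simp add: g_def g_kernel_def)
  from scheme_difference_form[of g, OF this, of Y n, folded w_def ghg]
  have sd: "(Y (Suc n) - Y n) + b = gh 0 * (Y (Suc n) - Y n) + (\<Sum>j<n. (gh (n - j) - gh (n - Suc j)) * (Y (Suc j) - Y j))"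
    unfolding b_def by linarith
  show ?thesis
    unfolding Fbar_component[OF \<tau> nT, symmetric] e sd PIc by (simp only: mult.assoc)
qed

end

subsection \<open>Summation over the modes\<close>

context diffusion_wave
begin

definition weight_mass :: real where "weight_mass = (LINT s|lborel. indicator {0..T} s * s powr (\<alpha> 0 - 2))"

lemma weight_mass_pos: "0 < weight_mass"
  unfolding weight_mass_def using \<alpha>0 T powr_lborel(2)[of "\<alpha> 0 - 2" T] by simp

text \<open>Where the weight vanishes the quotient is \<open>0 / 0 = 0\<close>.\<close>

definition weighted_square :: "nat \<Rightarrow> real" where
  "weighted_square i = (LINT s|lborel. (comp_d2u i s)\<^sup>2 / (indicator {0..T} s * s powr (\<alpha> 0 - 2)))"

text \<open>The squared regularity bound contains the weight twice; the division leaves one copy,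
  which is integrable because alpha(0) > 1. The coefficients \<open>c\<close> are free so that a
  single mode and the factor \<open>1 + (lam i)\<^sup>2\<close> are both covered.\<close>

lemma weighted_square_le:
  assumes c: "\<And>i. 0 \<le> c i" and B: "\<And>s. 0 < s \<Longrightarrow> s \<le> T \<Longrightarrow> (\<Sum>i<M. c i * (du 2 s \<bullet> \<phi> i)\<^sup>2) \<le> K * (Q0 * s powr (\<alpha> 0 - 2))\<^sup>2"
    and K: "0 \<le> K"
  shows "(\<Sum>i<M. c i * ((comp_d2u i s)\<^sup>2 / (indicator {0..T} s * s powr (\<alpha> 0 - 2)))) \<le> K * Q0\<^sup>2 * (indicator {0..T} s * s powr (\<alpha> 0 - 2))"
proof (cases "s \<in> {0<..<T}")
  case True
  define p where "p = s powr (\<alpha> 0 - 2)"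
  have p: "0 < p" using True by (simp add: p_def)
  have "(\<Sum>i<M. c i * ((comp_d2u i s)\<^sup>2 / (indicator {0..T} s * s powr (\<alpha> 0 - 2)))) = (\<Sum>i<M. c i * (du 2 s \<bullet> \<phi> i)\<^sup>2) / p"
    using True by (simp add: comp_d2u_def d2u_cut_def sum_divide_distrib p_def)
  also have "\<dots> \<le> K * (Q0 * p)\<^sup>2 / p" using B[of s] True p by (intro divide_right_mono) (auto simp: p_def)
  also have "\<dots> = K * Q0\<^sup>2 * p" using p by (simp add: power2_eq_square)
  finally show ?thesis using True by (simp add: p_def)
next
  case False
  then have "comp_d2u i s = 0" for i by (rule comp_d2u_0)
  then show ?thesis using K by simp
qed

lemma comp_d2u_square_integrable: "integrable lborel (\<lambda>s. (comp_d2u i s)\<^sup>2 / (indicator {0..T} s * s powr (\<alpha> 0 - 2)))"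
proof (rule Bochner_Integration.integrable_bound)
  have [measurable]: "comp_d2u i \<in> borel_measurable borel" using borel_measurable_integrable[OF comp_d2u_integrable] by simp
  show "integrable lborel (\<lambda>s. Q0\<^sup>2 * (indicator {0..T} s * s powr (\<alpha> 0 - 2)))"
    by (intro integrable_mult_right weight_integrable)
  show "(\<lambda>s. (comp_d2u i s)\<^sup>2 / (indicator {0..T} s * s powr (\<alpha> 0 - 2))) \<in> borel_measurable lborel" by measurable
  show "AE s in lborel. norm ((comp_d2u i s)\<^sup>2 / (indicator {0..T} s * s powr (\<alpha> 0 - 2))) \<le> norm (Q0\<^sup>2 * (indicator {0..T} s * s powr (\<alpha> 0 - 2)))"
  proof (rule AE_I2)
    fix s
    \<comment> \<open>The coefficients \<open>of_bool\<close> single out one mode from the bound for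
      sums.\<close>
    have "(\<Sum>j<Suc i. of_bool (j = i) * ((comp_d2u j s)\<^sup>2 / (indicator {0..T} s * s powr (\<alpha> 0 - 2)))) \<le> 1 * Q0\<^sup>2 * (indicator {0..T} s * s powr (\<alpha> 0 - 2))"
    proof (rule weighted_square_le)
      fix s :: real assume s: "0 < s" "s \<le> T"
      have "(\<Sum>j<Suc i. of_bool (j = i) * (du 2 s \<bullet> \<phi> j)\<^sup>2) \<le> (\<Sum>j<Suc i. (du 2 s \<bullet> \<phi> j)\<^sup>2)"
        by (intro sum_mono) auto
      also have "\<dots> \<le> (Q0 * s powr (\<alpha> 0 - 2))\<^sup>2" by (rule du2_regularity(2)[OF s])
      finally show "(\<Sum>j<Suc i. of_bool (j = i) * (du 2 s \<bullet> \<phi> j)\<^sup>2) \<le> 1 * (Q0 * s powr (\<alpha> 0 - 2))\<^sup>2" by simp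
    qed auto
    moreover have "(\<Sum>j<Suc i. of_bool (j = i) * ((comp_d2u j s)\<^sup>2 / (indicator {0..T} s * s powr (\<alpha> 0 - 2)))) = (comp_d2u i s)\<^sup>2 / (indicator {0..T} s * s powr (\<alpha> 0 - 2))"
      by simp
    moreover have "0 \<le> (comp_d2u i s)\<^sup>2 / (indicator {0..T} s * s powr (\<alpha> 0 - 2))" by (intro divide_nonneg_nonneg mult_nonneg_nonneg) auto
    ultimately show "norm ((comp_d2u i s)\<^sup>2 / (indicator {0..T} s * s powr (\<alpha> 0 - 2))) \<le> norm (Q0\<^sup>2 * (indicator {0..T} s * s powr (\<alpha> 0 - 2)))"
      by (simp only: real_norm_def)
  qed
qed

lemma comp_variation_T_le: "(comp_variation i T)\<^sup>2 \<le> weight_mass * weighted_square i"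
  unfolding comp_variation_T weight_mass_def weighted_square_def
proof (rule weighted_Cauchy_Schwarz)
  show "integrable lborel (\<lambda>s. indicator {0..T} s * s powr (\<alpha> 0 - 2))" by (rule weight_integrable)
  show "0 < (LINT s|lborel. indicator {0..T} s * s powr (\<alpha> 0 - 2))" using weight_mass_pos by (simp add: weight_mass_def)
  show "integrable lborel (\<lambda>s. \<bar>comp_d2u i s\<bar>)" by (intro integrable_abs comp_d2u_integrable)
  show "integrable lborel (\<lambda>s. (comp_d2u i s)\<^sup>2 / (indicator {0..T} s * s powr (\<alpha> 0 - 2)))" by (rule comp_d2u_square_integrable)
  show "comp_d2u i s = 0" if "indicator {0..T} s * s powr (\<alpha> 0 - 2) = 0" for s
    using that by (intro comp_d2u_0) (auto simp: indicator_def split: if_splits)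
qed auto

text \<open>The sum over the modes is taken under the integral, where the regularity assumption
  bounds it pointwise; a bound for each mode separately would not be summable. The 2 counts the two
  norms in that assumption.\<close>

lemma sum_Bw_le: "(\<Sum>i<M. (1 + (lam i)\<^sup>2) * weighted_square i) \<le> 2 * Q0\<^sup>2 * weight_mass"
proof -
  let ?w = "\<lambda>s. indicator {0..T} s * s powr (\<alpha> 0 - 2) :: real"
  have i: "integrable lborel (\<lambda>s. (1 + (lam i)\<^sup>2) * ((comp_d2u i s)\<^sup>2 / ?w s))" for i
    by (intro integrable_mult_right comp_d2u_square_integrable)
  have "(\<Sum>i<M. (1 + (lam i)\<^sup>2) * weighted_square i) = (LINT s|lborel. (\<Sum>i<M. (1 + (lam i)\<^sup>2) * ((comp_d2u i s)\<^sup>2 / ?w s)))"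
    unfolding weighted_square_def by (subst Bochner_Integration.integral_sum[OF i]) (simp only: integral_mult_right_zero)
  also have "\<dots> \<le> (LINT s|lborel. 2 * Q0\<^sup>2 * ?w s)"
  proof (rule Bochner_Integration.integral_mono)
    show "integrable lborel (\<lambda>s. (\<Sum>i<M. (1 + (lam i)\<^sup>2) * ((comp_d2u i s)\<^sup>2 / ?w s)))"
      by (intro Bochner_Integration.integrable_sum i)
    show "integrable lborel (\<lambda>s. 2 * Q0\<^sup>2 * ?w s)" by (intro integrable_mult_right weight_integrable)
    show "(\<Sum>i<M. (1 + (lam i)\<^sup>2) * ((comp_d2u i s)\<^sup>2 / ?w s)) \<le> 2 * Q0\<^sup>2 * ?w s" for s
    proof (rule weighted_square_le)
      fix s :: real assume s: "0 < s" "s \<le> T"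
      have "(\<Sum>i<M. (1 + (lam i)\<^sup>2) * (du 2 s \<bullet> \<phi> i)\<^sup>2) = (\<Sum>i<M. (du 2 s \<bullet> \<phi> i)\<^sup>2) + (\<Sum>i<M. (lam i * (du 2 s \<bullet> \<phi> i))\<^sup>2)"
        by (simp add: distrib_right sum.distrib power_mult_distrib)
      also have "\<dots> \<le> 2 * (Q0 * s powr (\<alpha> 0 - 2))\<^sup>2"
        using du2_regularity(2,3)[OF s, of M] by linarith
      finally show "(\<Sum>i<M. (1 + (lam i)\<^sup>2) * (du 2 s \<bullet> \<phi> i)\<^sup>2) \<le> 2 * (Q0 * s powr (\<alpha> 0 - 2))\<^sup>2" .
    qed auto
  qed
  also have "\<dots> = 2 * Q0\<^sup>2 * weight_mass" by (simp add: weight_mass_def)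
  finally show ?thesis .
qed

definition ubar_bound :: real where
  "ubar_bound = (norm ubar0)\<^sup>2 + (Hcheck_norm lam \<phi> 2 ubar0)\<^sup>2"

lemma sum_ubar_le: "(\<Sum>i<M. (1 + (lam i)\<^sup>2) * (comp_du i 0)\<^sup>2) \<le> ubar_bound"
proof -
  have "lam i powr 2 = (lam i)\<^sup>2" for i using lam_pos[of i] by (simp add: powr_numeral)
  then have "(\<Sum>i<M. (lam i)\<^sup>2 * (ubar0 \<bullet> \<phi> i)\<^sup>2) \<le> (Hcheck_norm lam \<phi> 2 ubar0)\<^sup>2"
    using Hcheck_norm_partial_sum[OF ubar0 order_refl, of M] by simp
  moreover have "comp_du i 0 = ubar0 \<bullet> \<phi> i" for i by (simp only: comp_du_def du_initial)
  ultimately show ?thesis using Bessel[where q = ubar0 and M = M]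
    by (simp add: ubar_bound_def distrib_right sum.distrib)
qed

text \<open>The 4 stems from bounding the square of a sum by twice the sum of squares, in both
  factors. The weight mass appears once through the Cauchy-Schwarz inequality and once through the
  sum over the modes.\<close>

lemma mode_data_square_sum:
  "(\<Sum>i<M. ((1 + lam i) * (\<bar>comp_du i 0\<bar> + comp_variation i T))\<^sup>2) \<le> 4 * (ubar_bound + 2 * Q0\<^sup>2 * weight_mass\<^sup>2)"
proof -
  have two: "(a + b)\<^sup>2 \<le> 2 * (a\<^sup>2 + b\<^sup>2)" for a b :: real
    using sum_squares_bound[of a b] by (simp add: power2_sum)
  have "((1 + lam i) * (\<bar>comp_du i 0\<bar> + comp_variation i T))\<^sup>2 \<le> 4 * ((1 + (lam i)\<^sup>2) * (comp_du i 0)\<^sup>2 + weight_mass * ((1 + (lam i)\<^sup>2) * weighted_square i))" for i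
  proof -
    have "((1 + lam i) * (\<bar>comp_du i 0\<bar> + comp_variation i T))\<^sup>2 = (1 + lam i)\<^sup>2 * (\<bar>comp_du i 0\<bar> + comp_variation i T)\<^sup>2" by (rule power_mult_distrib)
    also have "\<dots> \<le> (2 * (1 + (lam i)\<^sup>2)) * (2 * ((comp_du i 0)\<^sup>2 + (comp_variation i T)\<^sup>2))"
      using two[of 1 "lam i"] two[of "\<bar>comp_du i 0\<bar>" "comp_variation i T"] by (intro mult_mono) auto
    also have "\<dots> \<le> (2 * (1 + (lam i)\<^sup>2)) * (2 * ((comp_du i 0)\<^sup>2 + weight_mass * weighted_square i))"
      using comp_variation_T_le[of i] by (intro mult_left_mono) auto
    also have "\<dots> = 4 * ((1 + (lam i)\<^sup>2) * (comp_du i 0)\<^sup>2 + weight_mass * ((1 + (lam i)\<^sup>2) * weighted_square i))" by (simp add: algebra_simps)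
    finally show ?thesis .
  qed
  then have "(\<Sum>i<M. ((1 + lam i) * (\<bar>comp_du i 0\<bar> + comp_variation i T))\<^sup>2) \<le> (\<Sum>i<M. 4 * ((1 + (lam i)\<^sup>2) * (comp_du i 0)\<^sup>2 + weight_mass * ((1 + (lam i)\<^sup>2) * weighted_square i)))"
    by (rule sum_mono)
  also have "\<dots> = 4 * ((\<Sum>i<M. (1 + (lam i)\<^sup>2) * (comp_du i 0)\<^sup>2) + weight_mass * (\<Sum>i<M. (1 + (lam i)\<^sup>2) * weighted_square i))"
    by (simp only: sum.distrib sum_distrib_left[symmetric])
  also have "\<dots> \<le> 4 * (ubar_bound + weight_mass * (2 * Q0\<^sup>2 * weight_mass))"
    using weight_mass_pos by (intro mult_left_mono add_mono sum_ubar_le sum_Bw_le) auto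
  finally show ?thesis by (simp add: power2_eq_square mult_ac)
qed

lemma du0_L2_on:
  assumes t: "t \<in> {0..T}"
  shows "du 0 t \<in> L2_on \<Omega>"
proof (rule closed_AE_continuous[OF du_continuous(1) L2_on_closed _ t T])
  show "AE t in lebesgue_on {0<..<T}. du 0 t \<in> L2_on \<Omega>"
    using sol by (auto simp: diffusion_wave_solution_def bochner_sobolev_def bochner_Lp_def)
qed

theorem convergence:
  "\<exists>Q>0. \<forall>N\<ge>1. \<forall>U. numerical_solution \<Omega> \<kappa> \<alpha> f u0 ubar0 (T / real N) N U \<longrightarrow>
           (\<forall>m\<in>{1..N}. norm (du 0 (real m * (T / real N)) - U m) \<le> Q * (T / real N)\<^sup>2)"
proof -
  obtain C where C: "0 \<le> C" "\<And>a b. a \<in> {0..T} \<Longrightarrow> b \<in> {0..T} \<Longrightarrow> \<bar>g_kernel \<alpha> a - g_kernel \<alpha> b\<bar> \<le> C * \<bar>a - b\<bar>"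
    "\<And>a b c. 0 \<le> a \<Longrightarrow> 0 \<le> b \<Longrightarrow> 0 \<le> c \<Longrightarrow> a + b + c \<le> T \<Longrightarrow>
       \<bar>g_kernel \<alpha> (a + b + c) - g_kernel \<alpha> (a + b) - g_kernel \<alpha> (a + c) + g_kernel \<alpha> a\<bar> \<le> C * b * c"
    using g_kernel_bounds by blast
  \<comment> \<open>The product \<open>\<kappa> * lam i\<close> is split so that all modes share
    \<open>K\<close> and differ only by the factor \<open>1 + lam i\<close>.\<close>
  define K where "K = 4 * exp (8 * (C * (1 + T)) * T) * (C * (1 + 2 * T) + 3 * \<kappa> * gamma_kernel T)"
  define S where "S = 4 * (ubar_bound + 2 * Q0\<^sup>2 * weight_mass\<^sup>2)"
  have \<gamma>T: "0 \<le> gamma_kernel T" using \<alpha>0 by (simp add: gamma_kernel_def Gamma_real_nonneg)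
  have K: "0 \<le> K" using C(1) T \<kappa> \<gamma>T by (simp add: K_def)
  have S: "0 \<le> S" by (simp add: S_def ubar_bound_def)
  \<comment> \<open>The summand 1 makes the constant positive even when \<open>K * sqrt S\<close>
    vanishes.\<close>
  have main: "norm (du 0 (real m * (T / real N)) - U m) \<le> (K * sqrt S + 1) * (T / real N)\<^sup>2"
    if N: "1 \<le> N" and U: "numerical_solution \<Omega> \<kappa> \<alpha> f u0 ubar0 (T / real N) N U" and m: "m \<in> {1..N}" for N U m
  proof -
    define \<tau> where "\<tau> = T / real N"
    have \<tau>: "0 < \<tau>" and N\<tau>: "real N * \<tau> = T" using T N by (simp_all add: \<tau>_def)
    have mT: "real k * \<tau> \<in> {0..T}" if "k \<le> N" for k
      using mult_right_mono[of "real k" "real N" \<tau>] \<tau> N\<tau> that by auto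
    have mode: "\<bar>comp_u i (real m * \<tau>) - U m \<bullet> \<phi> i\<bar> \<le> K * \<tau>\<^sup>2 * ((1 + lam i) * (\<bar>comp_du i 0\<bar> + comp_variation i T))" for i
    proof -
      have nn: "0 \<le> \<bar>comp_du i 0\<bar> + comp_variation i T" using comp_variation_bound[of 0 T i] T comp_variation_0[of i] by simp
      have "\<bar>comp_u i (real m * \<tau>) - U m \<bullet> \<phi> i\<bar> \<le> 4 * exp (8 * (C * (1 + T)) * T)
         * ((C * (1 + 2 * T) + 3 * (\<kappa> * lam i) * (T powr (\<alpha> 0 - 1) / Gamma (\<alpha> 0))) * \<tau>\<^sup>2 * (\<bar>comp_du i 0\<bar> + comp_variation i T))"
      proof (rule averaged_scheme_error[where \<Phi> = "\<lambda>n. comp_rhs i (real n * \<tau>)" and Y = "\<lambda>j. U j \<bullet> \<phi> i"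
            and Yb = "\<lambda>j. case j of 0 \<Rightarrow> U 1 \<bullet> \<phi> i | Suc k \<Rightarrow> (U (Suc (Suc k)) \<bullet> \<phi> i + U (Suc k) \<bullet> \<phi> i) / 2",
            OF \<tau> N\<tau> _ comp_u_derivative comp_u_continuous(2) comp_variation_bound comp_variation_0 C _ g_kernel_nonneg \<alpha>0])
        show "0 < N" "m \<le> N" using N m by auto
        show "g_kernel \<alpha> 0 = 1" by (simp add: g_kernel_def)
        show "0 \<le> \<kappa> * lam i" using \<kappa> lam_pos[of i] by simp
        show "U 0 \<bullet> \<phi> i = comp_u i 0" using U by (simp add: numerical_solution_def comp_u_def du_initial)
        show "integral {0..real n * \<tau>} (\<lambda>s. g_kernel \<alpha> (real n * \<tau> - s) * comp_du i s)
            + \<kappa> * lam i * integral {0..real n * \<tau>} (\<lambda>s. (real n * \<tau> - s) powr (\<alpha> 0 - 1) / Gamma (\<alpha> 0) * comp_u i s) = comp_rhs i (real n * \<tau>)"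
          if "n \<le> N" for n using component_exact[of "real n * \<tau>" i] mT[OF that] by (simp add: gamma_kernel_def)
        show "(g_kernel \<alpha> (real 0 * \<tau>) + g_kernel \<alpha> (real (Suc 0) * \<tau>)) / 2 * (U (Suc n) \<bullet> \<phi> i - U n \<bullet> \<phi> i)
          + (\<Sum>j<n. ((g_kernel \<alpha> (real (n - j) * \<tau>) + g_kernel \<alpha> (real (Suc (n - j)) * \<tau>)) / 2
              - (g_kernel \<alpha> (real (n - Suc j) * \<tau>) + g_kernel \<alpha> (real (Suc (n - Suc j)) * \<tau>)) / 2) * (U (Suc j) \<bullet> \<phi> i - U j \<bullet> \<phi> i))
          + \<kappa> * lam i * (\<tau> powr \<alpha> 0 / Gamma (\<alpha> 0 + 1))
            * (\<Sum>j\<le>n. pi_weight (\<alpha> 0) (n - j) * (case j of 0 \<Rightarrow> U 1 \<bullet> \<phi> i | Suc k \<Rightarrow> (U (Suc (Suc k)) \<bullet> \<phi> i + U (Suc k) \<bullet> \<phi> i) / 2))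
          = comp_rhs i (real (Suc n) * \<tau>) - comp_rhs i (real n * \<tau>)" if n: "n < N" for n
          using scheme_component[OF N U n, of i] unfolding \<tau>_def .
      qed auto
      also have "\<dots> \<le> K * \<tau>\<^sup>2 * ((1 + lam i) * (\<bar>comp_du i 0\<bar> + comp_variation i T))"
      proof -
        have "C * (1 + 2 * T) + 3 * (\<kappa> * lam i) * gamma_kernel T \<le> (C * (1 + 2 * T) + 3 * \<kappa> * gamma_kernel T) * (1 + lam i)"
        proof -
          have "0 \<le> C * (1 + 2 * T) * lam i" "0 \<le> 3 * \<kappa> * gamma_kernel T" using C(1) T lam_pos[of i] \<kappa> \<gamma>T by simp_all
          then show ?thesis by (simp add: algebra_simps)
        qed
        then have "4 * exp (8 * (C * (1 + T)) * T) * ((C * (1 + 2 * T) + 3 * (\<kappa> * lam i) * gamma_kernel T) * \<tau>\<^sup>2 * (\<bar>comp_du i 0\<bar> + comp_variation i T))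
           \<le> 4 * exp (8 * (C * (1 + T)) * T) * (((C * (1 + 2 * T) + 3 * \<kappa> * gamma_kernel T) * (1 + lam i)) * \<tau>\<^sup>2 * (\<bar>comp_du i 0\<bar> + comp_variation i T))"
          using nn by (intro mult_left_mono mult_right_mono) auto
        also have "\<dots> = K * \<tau>\<^sup>2 * ((1 + lam i) * (\<bar>comp_du i 0\<bar> + comp_variation i T))" by (simp only: K_def mult_ac)
        finally show ?thesis by (simp only: gamma_kernel_def)
      qed
      finally show ?thesis .
    qed
    define e where "e = du 0 (real m * \<tau>) - U m"
    have "norm e \<le> K * \<tau>\<^sup>2 * sqrt S"
    proof (rule norm_le_partial_sums)
      have "U m \<in> L2_on \<Omega>" using U m by (intro dirichlet_dom_L2_on) (auto simp: numerical_solution_def)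
      then show "e \<in> L2_on \<Omega>" unfolding e_def
        using m by (intro subspace_diff[OF L2_on_subspace] du0_L2_on mT) auto
      show "0 \<le> K * \<tau>\<^sup>2 * sqrt S" using K S by simp
      fix M
      have "(e \<bullet> \<phi> i)\<^sup>2 \<le> (K * \<tau>\<^sup>2)\<^sup>2 * ((1 + lam i) * (\<bar>comp_du i 0\<bar> + comp_variation i T))\<^sup>2" for i
      proof -
        have "\<bar>e \<bullet> \<phi> i\<bar> \<le> K * \<tau>\<^sup>2 * ((1 + lam i) * (\<bar>comp_du i 0\<bar> + comp_variation i T))"
          using mode[of i] by (simp add: e_def inner_diff_left comp_u_def)
        then have "\<bar>e \<bullet> \<phi> i\<bar>\<^sup>2 \<le> (K * \<tau>\<^sup>2 * ((1 + lam i) * (\<bar>comp_du i 0\<bar> + comp_variation i T)))\<^sup>2" by (intro power_mono) auto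
        then show ?thesis by (simp only: power2_abs power_mult_distrib)
      qed
      then have "(\<Sum>i<M. (e \<bullet> \<phi> i)\<^sup>2) \<le> (K * \<tau>\<^sup>2)\<^sup>2 * (\<Sum>i<M. ((1 + lam i) * (\<bar>comp_du i 0\<bar> + comp_variation i T))\<^sup>2)"
        unfolding sum_distrib_left by (intro sum_mono)
      also have "\<dots> \<le> (K * \<tau>\<^sup>2)\<^sup>2 * S"
        unfolding S_def by (intro mult_left_mono mode_data_square_sum) auto
      also have "\<dots> = (K * \<tau>\<^sup>2 * sqrt S)\<^sup>2" using S by (simp add: power_mult_distrib)
      finally show "(\<Sum>i<M. (e \<bullet> \<phi> i)\<^sup>2) \<le> (K * \<tau>\<^sup>2 * sqrt S)\<^sup>2" .
    qed
    also have "\<dots> \<le> (K * sqrt S + 1) * \<tau>\<^sup>2" by (simp add: algebra_simps)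
    finally show ?thesis by (simp add: e_def \<tau>_def)
  qed
  have "0 < K * sqrt S + 1" using K S by (simp add: add_nonneg_pos)
  then show ?thesis using main by blast
qed

end

theorem theorem7:
  fixes \<Omega> :: "'a::euclidean_space set"
    and lam :: "nat \<Rightarrow> real" and \<phi> :: "nat \<Rightarrow> 'a L2"
    and T \<kappa> L p Q0 :: real
    and \<alpha> \<alpha>1 \<alpha>2 \<alpha>3 :: "real \<Rightarrow> real"
    and f :: "real \<Rightarrow> 'a L2" and u0 ubar0 :: "'a L2"
    and du :: "nat \<Rightarrow> real \<Rightarrow> 'a L2"
  assumes "0 < T" and "0 < \<kappa>"
    and "DIM('a) \<le> 3" and "admissible_domain \<Omega>"
    and "dirichlet_eigensystem \<Omega> lam \<phi>"
    and "\<forall>t\<in>{0..T}. 1 < \<alpha> t \<and> \<alpha> t < 2"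
    and "\<forall>t\<in>{0..T}. (\<alpha> has_real_derivative \<alpha>1 t) (at t within {0..T})"
    and "\<forall>t\<in>{0..T}. (\<alpha>1 has_real_derivative \<alpha>2 t) (at t within {0..T})"
    and "\<forall>t\<in>{0..T}. (\<alpha>2 has_real_derivative \<alpha>3 t) (at t within {0..T})"
    and "0 < L" and "\<forall>t\<in>{0..T}. \<bar>\<alpha>1 t\<bar> + \<bar>\<alpha>2 t\<bar> + \<bar>\<alpha>3 t\<bar> \<le> L"
    and "\<alpha>1 0 = 0" and "\<alpha>2 0 = 0"
    and "u0 \<in> Hcheck \<Omega> lam \<phi> 2" and "ubar0 \<in> Hcheck \<Omega> lam \<phi> 2"
    and "\<exists>df. df 0 = f \<and> bochner_sobolev 1 1 T \<Omega> df"
    and "1 < p" and "p < 1 / (2 - \<alpha> 0)"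
    and "diffusion_wave_solution \<Omega> lam \<phi> T \<kappa> \<alpha> p f u0 ubar0 du"
    and "\<forall>j<3. \<forall>t\<in>{0<..T}. (du j has_vector_derivative du (Suc j) t) (at t within {0..T})"
    and "\<forall>n\<in>{1, 2::nat}. \<forall>m\<in>{0, 1::nat}. \<forall>t\<in>{0<..T}.
           du (n + 1) t \<in> Hcheck \<Omega> lam \<phi> (2 * real m) \<and>
           Hcheck_norm lam \<phi> (2 * real m) (du (n + 1) t) \<le> Q0 * t powr (\<alpha> 0 - real (n + 1))"
  shows "\<exists>Q>0. \<forall>N\<ge>1. \<forall>U. numerical_solution \<Omega> \<kappa> \<alpha> f u0 ubar0 (T / real N) N U \<longrightarrow>
           (\<forall>m\<in>{1..N}. norm (du 0 (real m * (T / real N)) - U m) \<le> Q * (T / real N)\<^sup>2)"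
proof -
  interpret diffusion_wave T L \<alpha> \<alpha>1 \<alpha>2 \<alpha>3 \<Omega> lam \<phi> \<kappa> p Q0 f u0 ubar0 du
    by unfold_locales (use assms in blast)+
  show ?thesis by (rule convergence)
qed

end
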